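(* Let $\beta\in(0,1]$ and consider the scale $a(n,t)=n(\log n)^t$. Then for every $\alpha\in\mathcal D\cap\mathcal E$ and every corresponding Arnol'd flow $(T^f_t)_{t\in\mathbb R}$ (the special flow over the rotation by $\alpha$ under a roof function $f$ with an asymmetric logarithmic singularity), the $\beta$-slow entropy with respect to this scale satisfies $h_s^\beta(T^f_t)=1$.
   Context: **Slow entropy.** Let $(T_t)_{t\in\mathbb R}$ be a measure-preserving flow on a probability Borel space $(X,\mathcal B,\mu)$ and $\mathcal P=\{P_1,\dots,P_k\}$ a finite measurable partition of $X$. For $r>0$ let $\Omega_{k,r}$ be the set of (measurable) $w=(w_t)_{t\in[0,r]}$ with $w_t\in\{1,\dots,k\}$, with the Hamming distance $d_r(w,w')=\frac1r\left(r-\lambda\{s\in[0,r]: w_s=w'_s\}\right)$, $\lambda$ being Lebesgue measure. The $\mathcal P,r$-name of $x\in X$ is $\phi_{\mathcal P,r}(x)=(N_t(x))_{t\in[0,r]}$ where $N_t(x)=i$ iff $T_tx\in P_i$. Put $\nu=(\phi_{\mathcal P,r})_*\mu$. For $\epsilon>0$, $\beta\in(0,1]$, let $S^r_{\mathcal P}(\epsilon,\beta)$ be the minimal number of $d_r$-balls of radius $\epsilon$ whose union has $\nu$-measure greater than $\beta-\epsilon$. Given a scale $a(n,t)$ ($n\in\mathbb N$, $t>0$), with $a(n,t)\to\infty$ as $n\to\infty$ for each fixed $t$, let $$A(\mathcal P,\epsilon,\beta)=\sup\Big\{t>0:\ \liminf_{r\to+\infty}\frac{S^r_{\mathcal P}(\epsilon,\beta)}{a([r],t)}>0\Big\}$$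 (supremum of the empty set being $0$), $A^\beta(\mathcal P)=\lim_{\epsilon\to0}A(\mathcal P,\epsilon,\beta)$, and $h^\beta_s(T_t)=\sup_{\mathcal P}A^\beta(\mathcal P)$, the supremum over all finite measurable partitions. **Arnol'd flows.** Let $\mathbb T=\mathbb R/\mathbb Z$ with Lebesgue measure $\lambda$, $\alpha\in\mathbb R\setminus\mathbb Q$, $Tx=x+\alpha$ mod $1$. Let $h(x)=-\log x$ on $(0,1)$ and let $f\in C^2(\mathbb T\setminus\{0\})$, $f>0$, satisfy, for some constants $A_i,B_i>0$ with $A_i\neq B_i$ ($i=1,2,3$), identifying $\mathbb T\setminus\{0\}$ with $(0,1)$ (so $x\to0^-$ means $x\to1^-$ in $(0,1)$): $$\lim_{x\to0^+}\frac{f(x)}{h(x)}=A_1,\quad \lim_{x\to0^-}\frac{f(x)}{h(1-x)}=B_1,$$ $$\lim_{x\to0^+}\frac{f'(x)}{h'(x)}=A_2,\quad \lim_{x\to0^-}\frac{f'(x)}{h'(1-x)}=-B_2,$$ $$\lim_{x\to0^+}\frac{f''(x)}{h''(x)}=A_3,\quad \lim_{x\to0^-}\frac{f''(x)}{h''(1-x)}=B_3.$$ The special flow $(T^f_t)$ acts on $\mathbb T^f=\{(x,s):x\in\mathbb T,\ 0\le s<f(x)\}$, equipped with the measure $\mu^f$ equal to the product of Lebesgue measures restricted to $\mathbb T^f$, normalized to be a probability measure; points move vertically with unit speed and $(x,f(x))$ is identified with $(Tx,0)$: $T^f_t(x,s)=(T^{N}x,\ s+t-f^{(N)}(x))$ with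 $N\in\mathbb Z$ the unique integer such that $f^{(N)}(x)\le s+t<f^{(N+1)}(x)$, where $f^{(n)}(x)=\sum_{i=0}^{n-1}f(T^ix)$ for $n\ge1$, $f^{(0)}=0$, $f^{(-n)}(x)=-\sum_{i=1}^nf(T^{-i}x)$. (The null set of points whose orbit meets the singularity is discarded.) This flow is called an Arnol'd flow with frequency $\alpha$. **Diophantine sets.** Let $(q_n)$ be the sequence of denominators of the continued fraction convergents of $\alpha$. $\mathcal D$ is the set of $\alpha\in\mathbb R\setminus\mathbb Q$ for which there is a constant $C(\alpha)$ with $q_{n+1}\le C(\alpha)\,q_n\log q_n(\log n)^2$ for all $n\ge2$. With $K_\alpha=\{n: q_{n+1}\le q_n\log^{7/8}q_n\}$, $\mathcal E$ is the set of $\alpha\in\mathbb R\setminus\mathbb Q$ with $\sum_{i\ge2,\ i\notin K_\alpha}\log^{-7/8}q_i<+\infty$. *)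

theory Defs
  imports "HOL-Analysis.Analysis"
begin

section \<open>Slow entropy of a flow\<close>

text \<open>Words over \<open>{1..k}\<close> are extensional functions on \<open>[0,r]\<close>, so that two words are equal iff they
  agree on \<open>[0,r]\<close>.  ``Measurable'' is read as Borel measurable throughout.\<close>

definition words :: "nat \<Rightarrow> real \<Rightarrow> (real \<Rightarrow> nat) set" where
  "words k r = {w \<in> {0..r} \<rightarrow>\<^sub>E {1..k}. w \<in> restrict_space borel {0..r} \<rightarrow>\<^sub>M count_space UNIV}"

definition hamming :: "real \<Rightarrow> (real \<Rightarrow> nat) \<Rightarrow> (real \<Rightarrow> nat) \<Rightarrow> real" where
  "hamming r w w' = 1 / r * (r - measure lborel {s \<in> {0..r}. w s = w' s})"

definition hamming_ball :: "nat \<Rightarrow> real \<Rightarrow> (real \<Rightarrow> nat) \<Rightarrow> real \<Rightarrow> (real \<Rightarrow> nat) set" where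
  "hamming_ball k r w \<epsilon> = {w' \<in> words k r. hamming r w w' < \<epsilon>}"

definition word_space :: "nat \<Rightarrow> real \<Rightarrow> (real \<Rightarrow> nat) measure" where
  "word_space k r = sigma (words k r) {hamming_ball k r w \<epsilon> | w \<epsilon>. w \<in> words k r \<and> \<epsilon> > 0}"

definition finite_partition :: "'a measure \<Rightarrow> nat \<Rightarrow> (nat \<Rightarrow> 'a set) \<Rightarrow> bool" where
  "finite_partition M k P \<longleftrightarrow>
     P ` {1..k} \<subseteq> sets M \<and> disjoint_family_on P {1..k} \<and> (\<Union>i\<in>{1..k}. P i) = space M"

definition name :: "(real \<Rightarrow> 'a \<Rightarrow> 'a) \<Rightarrow> nat \<Rightarrow> (nat \<Rightarrow> 'a set) \<Rightarrow> real \<Rightarrow> 'a \<Rightarrow> (real \<Rightarrow> nat)" where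
  "name T k P r x = (\<lambda>t\<in>{0..r}. THE i. i \<in> {1..k} \<and> T t x \<in> P i)"

definition name_measure ::
  "'a measure \<Rightarrow> (real \<Rightarrow> 'a \<Rightarrow> 'a) \<Rightarrow> nat \<Rightarrow> (nat \<Rightarrow> 'a set) \<Rightarrow> real \<Rightarrow> (real \<Rightarrow> nat) measure" where
  "name_measure M T k P r = distr M (word_space k r) (name T k P r)"

text \<open>The minimal number of balls is taken in \<open>[0,\<infinity>]\<close>, so it would be \<open>\<infinity>\<close> if no finite family of
  balls were large enough.\<close>

definition covering_number ::
  "'a measure \<Rightarrow> (real \<Rightarrow> 'a \<Rightarrow> 'a) \<Rightarrow> nat \<Rightarrow> (nat \<Rightarrow> 'a set) \<Rightarrow> real \<Rightarrow> real \<Rightarrow> real \<Rightarrow> ennreal" where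
  "covering_number M T k P \<epsilon> \<beta> r =
     (INF C \<in> {C. finite C \<and> C \<subseteq> words k r \<and>
                  measure (name_measure M T k P r) (\<Union>w\<in>C. hamming_ball k r w \<epsilon>) > \<beta> - \<epsilon>}.
        of_nat (card C))"

text \<open>In \<open>ennreal\<close> the supremum of the empty set is \<open>0\<close>.\<close>

definition partition_entropy_eps ::
  "(nat \<Rightarrow> real \<Rightarrow> real) \<Rightarrow> 'a measure \<Rightarrow> (real \<Rightarrow> 'a \<Rightarrow> 'a) \<Rightarrow> nat \<Rightarrow> (nat \<Rightarrow> 'a set) \<Rightarrow>
   real \<Rightarrow> real \<Rightarrow> ennreal" where
  "partition_entropy_eps a M T k P \<epsilon> \<beta> =
     Sup (ennreal ` {t. t > 0 \<and>
       Liminf at_top (\<lambda>r. covering_number M T k P \<epsilon> \<beta> r / ennreal (a (nat \<lfloor>r\<rfloor>) t)) > 0})"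

definition partition_entropy ::
  "(nat \<Rightarrow> real \<Rightarrow> real) \<Rightarrow> real \<Rightarrow> 'a measure \<Rightarrow> (real \<Rightarrow> 'a \<Rightarrow> 'a) \<Rightarrow> nat \<Rightarrow> (nat \<Rightarrow> 'a set) \<Rightarrow> ennreal" where
  "partition_entropy a \<beta> M T k P = Lim (at_right 0) (\<lambda>\<epsilon>. partition_entropy_eps a M T k P \<epsilon> \<beta>)"

definition slow_entropy ::
  "(nat \<Rightarrow> real \<Rightarrow> real) \<Rightarrow> real \<Rightarrow> 'a measure \<Rightarrow> (real \<Rightarrow> 'a \<Rightarrow> 'a) \<Rightarrow> ennreal" where
  "slow_entropy a \<beta> M T = (SUP (k, P) \<in> {(k, P). finite_partition M k P}. partition_entropy a \<beta> M T k P)"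


section \<open>Special flows over rotations\<close>

text \<open>The circle is \<open>[0,1)\<close>; a roof function is a function on \<open>\<real>\<close> of which only the values on
  \<open>(0,1)\<close> are used.\<close>

definition rot :: "real \<Rightarrow> int \<Rightarrow> real \<Rightarrow> real" where
  "rot \<alpha> n x = frac (x + of_int n * \<alpha>)"

definition birkhoff :: "real \<Rightarrow> (real \<Rightarrow> real) \<Rightarrow> int \<Rightarrow> real \<Rightarrow> real" where
  "birkhoff \<alpha> f n x =
     (if n \<ge> 0 then \<Sum>i\<in>{0..<n}. f (rot \<alpha> i x) else - (\<Sum>i\<in>{1..-n}. f (rot \<alpha> (- i) x)))"

text \<open>The points whose orbit meets the singularity, i.e. those over the two-sided orbit of \<open>0\<close>, are
  removed from the phase space.\<close>

definition flow_space :: "real \<Rightarrow> (real \<Rightarrow> real) \<Rightarrow> (real \<times> real) set" where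
  "flow_space \<alpha> f = {(x, s). x \<in> {0..<1} \<and> (\<forall>n. rot \<alpha> n x \<noteq> 0) \<and> 0 \<le> s \<and> s < f x}"

definition flow_measure :: "real \<Rightarrow> (real \<Rightarrow> real) \<Rightarrow> (real \<times> real) measure" where
  "flow_measure \<alpha> f =
     scale_measure (inverse (emeasure (lborel \<Otimes>\<^sub>M lborel) (flow_space \<alpha> f)))
       (restrict_space (lborel \<Otimes>\<^sub>M lborel) (flow_space \<alpha> f))"

definition special_flow :: "real \<Rightarrow> (real \<Rightarrow> real) \<Rightarrow> real \<Rightarrow> real \<times> real \<Rightarrow> real \<times> real" where
  "special_flow \<alpha> f t = (\<lambda>(x, s).
     let N = (THE N. birkhoff \<alpha> f N x \<le> s + t \<and> s + t < birkhoff \<alpha> f (N + 1) x)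
     in (rot \<alpha> N x, s + t - birkhoff \<alpha> f N x))"

definition neg_log :: "real \<Rightarrow> real" where
  "neg_log x = - ln x"

definition C2_on :: "(real \<Rightarrow> real) \<Rightarrow> real set \<Rightarrow> bool" where
  "C2_on f S \<longleftrightarrow> (\<forall>x\<in>S. f differentiable at x \<and> deriv f differentiable at x) \<and>
     continuous_on S (deriv (deriv f))"

definition arnold_roof :: "(real \<Rightarrow> real) \<Rightarrow> bool" where
  "arnold_roof f \<longleftrightarrow> C2_on f {0<..<1} \<and> (\<forall>x\<in>{0<..<1}. f x > 0) \<and>
     (\<exists>A B :: nat \<Rightarrow> real.
        (\<forall>i\<in>{1, 2, 3}. A i > 0 \<and> B i > 0 \<and> A i \<noteq> B i) \<and>
        ((\<lambda>x. f x / neg_log x) \<longlongrightarrow> A 1) (at_right 0) \<and>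
        ((\<lambda>x. f x / neg_log (1 - x)) \<longlongrightarrow> B 1) (at_left 1) \<and>
        ((\<lambda>x. deriv f x / deriv neg_log x) \<longlongrightarrow> A 2) (at_right 0) \<and>
        ((\<lambda>x. deriv f x / deriv neg_log (1 - x)) \<longlongrightarrow> - B 2) (at_left 1) \<and>
        ((\<lambda>x. deriv (deriv f) x / deriv (deriv neg_log) x) \<longlongrightarrow> A 3) (at_right 0) \<and>
        ((\<lambda>x. deriv (deriv f) x / deriv (deriv neg_log) (1 - x)) \<longlongrightarrow> B 3) (at_left 1))"


section \<open>Diophantine conditions\<close>

text \<open>Complete and partial quotients of the continued fraction of an irrational \<open>\<alpha>\<close>, and the
  denominators of its convergents, indexed by \<open>q\<^sub>0 = 1\<close>, \<open>q\<^sub>1 = a\<^sub>1\<close>.\<close>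

primrec complete_quotient :: "real \<Rightarrow> nat \<Rightarrow> real" where
  "complete_quotient \<alpha> 0 = \<alpha>"
| "complete_quotient \<alpha> (Suc n) = 1 / frac (complete_quotient \<alpha> n)"

definition partial_quotient :: "real \<Rightarrow> nat \<Rightarrow> int" where
  "partial_quotient \<alpha> n = \<lfloor>complete_quotient \<alpha> n\<rfloor>"

fun conv_denom :: "real \<Rightarrow> nat \<Rightarrow> int" where
  "conv_denom \<alpha> 0 = 1"
| "conv_denom \<alpha> (Suc 0) = partial_quotient \<alpha> 1"
| "conv_denom \<alpha> (Suc (Suc n)) =
     partial_quotient \<alpha> (Suc (Suc n)) * conv_denom \<alpha> (Suc n) + conv_denom \<alpha> n"

definition dioph_D :: "real set" where
  "dioph_D = {\<alpha>. \<alpha> \<notin> \<rat> \<and> (\<exists>C::real. \<forall>n\<ge>2.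
     real_of_int (conv_denom \<alpha> (n + 1)) \<le>
       C * real_of_int (conv_denom \<alpha> n) * ln (real_of_int (conv_denom \<alpha> n)) * (ln (real n))\<^sup>2)}"

definition K_set :: "real \<Rightarrow> nat set" where
  "K_set \<alpha> = {n. real_of_int (conv_denom \<alpha> (n + 1)) \<le>
     real_of_int (conv_denom \<alpha> n) * ln (real_of_int (conv_denom \<alpha> n)) powr (7 / 8)}"

definition dioph_E :: "real set" where
  "dioph_E = {\<alpha>. \<alpha> \<notin> \<rat> \<and>
     (\<lambda>i. ln (real_of_int (conv_denom \<alpha> i)) powr (- 7 / 8)) summable_on {i. i \<ge> 2 \<and> i \<notin> K_set \<alpha>}}"

end

theory Submission
  imports Defs "HOL-Real_Asymp.Real_Asymp"
begin

text \<open>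
  The slow entropy counts how many names of length \<open>r\<close> are needed to describe most of the phase space.
  For an Arnol'd flow the answer is governed by the shear of nearby orbits.  Two points of the base at
  distance \<open>e\<close> acquire after \<open>n\<close> crossings of the roof a time difference of about
  \<open>e (\<Sum>i<n. f' (x + i \<alpha>))\<close>.  As \<open>f'\<close> behaves like \<open>- A / x\<close> at \<open>0\<close> and like
  \<open>B / (1 - x)\<close> at \<open>1\<close>, and as the orbit sums of \<open>1 / x\<close> and of \<open>1 / (1 - x)\<close> are both asymptotic
  to \<open>n log n\<close>, the two sides do not cancel when \<open>A \<noteq> B\<close>, and the sum of the derivatives is of exact
  order \<open>n log n\<close> (\<open>sum_inverse_orb_asymp\<close>, \<open>birkhoff_estimates\<close>).  This holds for all orbits that
  keep a distance of about \<open>1 / (n log n)\<close>, up to a small power of \<open>log n\<close>, from the singularity;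
  these are most orbits.  The first Diophantine condition makes the gaps between the denominators
  short enough to control the few visits closest to the singularity.

  Upper bound (\<open>covering_number_upper\<close>): up to time \<open>r\<close> an orbit crosses the roof \<open>O(r)\<close> times, so
  the points of a box of width of order \<open>1 / (r log r)\<close> and small height stay together, except while
  they are near the floor, the roof or the boundary of an atom.  For most points these exceptional times
  are a small fraction of \<open>r\<close>.  Hence \<open>O(r log r)\<close> names suffice, and no exponent \<open>t > 1\<close>
  contributes to the entropy.

  Lower bound (\<open>covering_number_lower\<close>): use a partition into small boxes and fix \<open>t < 1\<close> close to \<open>1\<close>.
  Suppose that the orbits of two typical points are in the same atom most of the time.  At such a time
  their offset \<open>e\<close> in the base is small.  If \<open>\<bar>e\<bar>\<close> exceeds \<open>1 / (r (log r) powr t)\<close>, then for \<open>n\<close> with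
  \<open>\<bar>e\<bar> n log n\<close> of order one the shear over \<open>n / 2\<close> to \<open>n\<close> crossings is large enough to separate
  the heights and too small for the second orbit to gain a full crossing
  (\<open>separation_window\<close>).  A Vitali covering argument would then turn the many times of coincidence into
  many times of difference (\<open>vitali_fraction\<close>).  So the offset is below \<open>1 / (r (log r) powr t)\<close> at some time,
  and then the second point lies in the union of \<open>O((log r) powr (1 - t))\<close> rotated intervals of that size
  (\<open>tiny_offset_location\<close>).  Thus a ball of names has measure \<open>O(1 / (r (log r) powr (2 t - 1)))\<close>, and
  the exponent \<open>2 t - 1\<close> is as close to \<open>1\<close> as desired.

  The shear estimate is required along \<open>n\<close> crossings after or before the time of coincidence, for every
  scale \<open>n\<close>.  It fails in both directions only if the orbit visits the singularity closely in
  the past and in the future.  The difference of the two visiting times is then an exceptionally good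
  return time of the rotation, so that \<open>n\<close> belongs to one of the long gaps between denominators, those with
  index outside \<open>K_set\<close>.  The second Diophantine condition makes the set of base points with
  such visits small (\<open>two_sided_visit\<close>, \<open>bad_base_set\<close>), and a typical orbit spends little time over it.
\<close>

section \<open>Convergents and the Diophantine conditions\<close>

lemma frac_irrational:
  fixes x :: real assumes "x \<notin> \<rat>" shows "0 < frac x" "frac x < 1" "frac x \<notin> \<rat>"
proof -
  show irr: "frac x \<notin> \<rat>"
  proof
    assume "frac x \<in> \<rat>"
    then have "frac x + of_int \<lfloor>x\<rfloor> \<in> \<rat>" by (rule Rats_add) auto
    then show False using assms by (simp add: frac_def)
  qed
  show "frac x < 1" by (rule frac_lt_1)
  have "frac x \<noteq> 0" using irr by (metis Rats_0)
  then show "0 < frac x" using frac_ge_0[of x] by linarith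
qed

lemma complete_quotient_irrational:
  assumes "\<alpha> \<notin> \<rat>" shows "complete_quotient \<alpha> n \<notin> \<rat>"
proof (induction n)
  case (Suc n)
  show ?case
  proof
    assume "complete_quotient \<alpha> (Suc n) \<in> \<rat>"
    then have "inverse (complete_quotient \<alpha> (Suc n)) \<in> \<rat>" by (rule Rats_inverse)
    then show False using frac_irrational(3)[OF Suc] by (simp add: inverse_eq_divide)
  qed
qed (use assms in simp)

lemma complete_quotient_Suc:
  "complete_quotient \<alpha> n = of_int (partial_quotient \<alpha> n) + 1 / complete_quotient \<alpha> (Suc n)"
  by (simp add: partial_quotient_def frac_def)

lemma complete_quotient_gt_1:
  assumes "\<alpha> \<notin> \<rat>" shows "complete_quotient \<alpha> (Suc n) > 1"
  using frac_irrational(1,2)[OF complete_quotient_irrational[OF assms, of n]] by simp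

lemma partial_quotient_ge_1:
  assumes "\<alpha> \<notin> \<rat>" shows "partial_quotient \<alpha> (Suc n) \<ge> 1"
  using complete_quotient_gt_1[OF assms, of n]
  by (simp add: partial_quotient_def less_imp_le del: complete_quotient.simps)

lemma conv_denom_step:
  assumes "\<alpha> \<notin> \<rat>" "conv_denom \<alpha> (Suc n) \<ge> 0"
  shows "conv_denom \<alpha> (Suc (Suc n)) \<ge> conv_denom \<alpha> (Suc n) + conv_denom \<alpha> n"
  using mult_right_mono[OF partial_quotient_ge_1[OF assms(1), of "Suc n"] assms(2)] by simp

lemma conv_denom_ge_1:
  assumes "\<alpha> \<notin> \<rat>" shows "conv_denom \<alpha> n \<ge> 1"
proof -
  have "conv_denom \<alpha> n \<ge> 1 \<and> conv_denom \<alpha> (Suc n) \<ge> 1"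
  proof (induction n)
    case 0
    then show ?case using partial_quotient_ge_1[OF assms, of 0] by simp
  next
    case (Suc n)
    then show ?case using conv_denom_step[OF assms, of n] by linarith
  qed
  then show ?thesis ..
qed

lemma conv_denom_mono_Suc:
  assumes "\<alpha> \<notin> \<rat>" shows "conv_denom \<alpha> n \<le> conv_denom \<alpha> (Suc n)"
proof (cases n)
  case 0
  then show ?thesis using partial_quotient_ge_1[OF assms, of 0] by simp
next
  case (Suc m)
  show ?thesis
    unfolding Suc
    using conv_denom_step[OF assms, of m] conv_denom_ge_1[OF assms, of m] conv_denom_ge_1[OF assms, of "Suc m"]
    by linarith
qed

lemma conv_denom_mono:
  assumes "\<alpha> \<notin> \<rat>" "m \<le> n" shows "conv_denom \<alpha> m \<le> conv_denom \<alpha> n"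
  using lift_Suc_mono_le[of "conv_denom \<alpha>", OF conv_denom_mono_Suc[OF assms(1)] assms(2)] .

text \<open>Two steps of the recursion at least double the denominator.\<close>

lemma conv_denom_growth:
  assumes "\<alpha> \<notin> \<rat>" shows "2 * (conv_denom \<alpha> n)\<^sup>2 \<ge> 2 ^ n"
proof -
  have "2 * (conv_denom \<alpha> n)\<^sup>2 \<ge> 2 ^ n \<and> 2 * (conv_denom \<alpha> (Suc n))\<^sup>2 \<ge> 2 ^ (Suc n)"
  proof (induction n)
    case 0
    have "(conv_denom \<alpha> (Suc 0))\<^sup>2 \<ge> 1\<^sup>2"
      by (rule power_mono) (use conv_denom_ge_1[OF assms, of "Suc 0"] in auto)
    then show ?case by simp
  next
    case (Suc n)
    have "conv_denom \<alpha> (Suc (Suc n)) \<ge> 2 * conv_denom \<alpha> n"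
      using conv_denom_step[OF assms, of n] conv_denom_ge_1[OF assms, of "Suc n"]
        conv_denom_mono_Suc[OF assms, of n] by linarith
    then have "(conv_denom \<alpha> (Suc (Suc n)))\<^sup>2 \<ge> (2 * conv_denom \<alpha> n)\<^sup>2"
      by (rule power_mono) (use conv_denom_ge_1[OF assms, of n] in auto)
    then show ?case using Suc by (simp add: power_mult_distrib)
  qed
  then show ?thesis ..
qed

fun conv_num :: "real \<Rightarrow> nat \<Rightarrow> int" where
  "conv_num \<alpha> 0 = partial_quotient \<alpha> 0"
| "conv_num \<alpha> (Suc 0) = partial_quotient \<alpha> 1 * partial_quotient \<alpha> 0 + 1"
| "conv_num \<alpha> (Suc (Suc n)) =
     partial_quotient \<alpha> (Suc (Suc n)) * conv_num \<alpha> (Suc n) + conv_num \<alpha> n"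

lemma conv_det:
  "conv_num \<alpha> (Suc n) * conv_denom \<alpha> n - conv_num \<alpha> n * conv_denom \<alpha> (Suc n) = (-1) ^ n"
  by (induction n) (simp_all add: algebra_simps)

lemma conv_complete:
  assumes "\<alpha> \<notin> \<rat>"
  defines "x \<equiv> complete_quotient \<alpha>"
  shows "\<alpha> * (x (Suc (Suc n)) * conv_denom \<alpha> (Suc n) + conv_denom \<alpha> n)
       = x (Suc (Suc n)) * conv_num \<alpha> (Suc n) + conv_num \<alpha> n"
proof (induction n)
  case 0
  define a0 a1 x1 x2 where "a0 = real_of_int (partial_quotient \<alpha> 0)"
    and "a1 = real_of_int (partial_quotient \<alpha> (Suc 0))" and "x1 = x (Suc 0)" and "x2 = x (Suc (Suc 0))"
  have pos: "x1 > 1" "x2 > 1"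
    unfolding x1_def x2_def x_def by (rule complete_quotient_gt_1[OF assms(1)])+
  have 1: "\<alpha> = a0 + 1 / x1"
    unfolding a0_def x1_def x_def using complete_quotient_Suc[of \<alpha> 0] by simp
  have 2: "x1 = a1 + 1 / x2"
    unfolding a1_def x1_def x2_def x_def by (rule complete_quotient_Suc)
  have 3: "x1 * x2 = a1 * x2 + 1" using 2 pos by (simp add: field_simps)
  have "\<alpha> * (x2 * a1 + 1) = \<alpha> * x1 * x2" using 3 by (simp add: algebra_simps)
  also have "\<alpha> * x1 = a0 * x1 + 1" using 1 pos by (simp add: field_simps)
  also have "(a0 * x1 + 1) * x2 = a0 * (x1 * x2) + x2" by (simp add: algebra_simps)
  finally have "\<alpha> * (x2 * a1 + 1) = x2 * (a1 * a0 + 1) + a0"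
    unfolding 3 by (simp add: algebra_simps)
  then show ?case by (simp add: a0_def a1_def x2_def)
next
  case (Suc n)
  define a y y' where "a = real_of_int (partial_quotient \<alpha> (Suc (Suc n)))"
    and "y = x (Suc (Suc n))" and "y' = x (Suc (Suc (Suc n)))"
  have pos: "y' > 1" unfolding y'_def x_def by (rule complete_quotient_gt_1[OF assms(1)])
  have "y = a + 1 / y'" unfolding a_def y_def y'_def x_def by (rule complete_quotient_Suc)
  then have 3: "y * y' = a * y' + 1" using pos by (simp add: field_simps)
  have IH: "\<alpha> * (y * conv_denom \<alpha> (Suc n) + conv_denom \<alpha> n) = y * conv_num \<alpha> (Suc n) + conv_num \<alpha> n"
    using Suc unfolding y_def .
  have e: "y' * (a * u + v) + u = y' * (y * u + v)" for u v :: real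
  proof -
    have "y' * (a * u + v) + u = (a * y' + 1) * u + y' * v" by (simp add: algebra_simps)
    then show ?thesis unfolding 3[symmetric] by (simp add: algebra_simps)
  qed
  have "\<alpha> * (y' * (a * conv_denom \<alpha> (Suc n) + conv_denom \<alpha> n) + conv_denom \<alpha> (Suc n))
      = y' * (\<alpha> * (y * conv_denom \<alpha> (Suc n) + conv_denom \<alpha> n))"
    unfolding e by (simp add: algebra_simps)
  also have "\<dots> = y' * (a * conv_num \<alpha> (Suc n) + conv_num \<alpha> n) + conv_num \<alpha> (Suc n)"
    unfolding e IH ..
  finally show ?case by (simp add: a_def y'_def)
qed

text \<open>The denominators of approximations \<open>p / q\<close> in lowest terms with error below \<open>1 / q\<^sup>2\<close>.  Unlike the
  recursion for the convergents, this property is visibly invariant under \<open>\<alpha> \<mapsto> -\<alpha>\<close>, so that estimates near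
  the right end of the circle follow from those near the left end.\<close>

definition good_denom :: "real \<Rightarrow> nat \<Rightarrow> bool" where
  "good_denom \<alpha> q \<longleftrightarrow> q \<ge> 1 \<and> (\<exists>p::int. coprime p (int q) \<and> \<bar>real q * \<alpha> - of_int p\<bar> < 1 / real q)"

lemma good_denom_uminus:
  assumes "good_denom \<alpha> q" shows "good_denom (- \<alpha>) q"
proof -
  obtain p :: int where p: "coprime p (int q)" "\<bar>real q * \<alpha> - of_int p\<bar> < 1 / real q"
    using assms by (auto simp: good_denom_def)
  have "\<bar>real q * - \<alpha> - of_int (- p)\<bar> = \<bar>real q * \<alpha> - of_int p\<bar>" by simp
  then show ?thesis using assms p by (auto simp: good_denom_def intro!: exI[of _ "-p"])
qed

definition cden :: "real \<Rightarrow> nat \<Rightarrow> nat" where "cden \<alpha> n = nat (conv_denom \<alpha> n)"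

lemma of_cden:
  assumes "\<alpha> \<notin> \<rat>"
  shows "int (cden \<alpha> n) = conv_denom \<alpha> n" "real (cden \<alpha> n) = real_of_int (conv_denom \<alpha> n)"
  using conv_denom_ge_1[OF assms, of n] by (auto simp: cden_def)

lemma cden_ge_1: "\<alpha> \<notin> \<rat> \<Longrightarrow> cden \<alpha> n \<ge> 1"
  using conv_denom_ge_1[of \<alpha> n] by (simp add: cden_def)

lemma cden_mono: "\<alpha> \<notin> \<rat> \<Longrightarrow> m \<le> n \<Longrightarrow> cden \<alpha> m \<le> cden \<alpha> n"
  using conv_denom_mono[of \<alpha> m n] by (simp add: cden_def)

text \<open>The determinant identity gives the distance \<open>1 / (x q\<^sub>1 + q\<^sub>0)\<close> of \<open>q\<^sub>1 \<alpha>\<close> to the numerator, where \<open>x\<close> is the next complete quotient and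
  \<open>q\<^sub>0\<close>, \<open>q\<^sub>1\<close> are consecutive denominators, and it forces numerator and denominator to be coprime.\<close>

lemma good_denom_cden:
  assumes "\<alpha> \<notin> \<rat>" shows "good_denom \<alpha> (cden \<alpha> (Suc n))"
proof -
  define x q0 q1 p0 p1 where "x = complete_quotient \<alpha> (Suc (Suc n))"
    and "q0 = conv_denom \<alpha> n" and "q1 = conv_denom \<alpha> (Suc n)"
    and "p0 = conv_num \<alpha> n" and "p1 = conv_num \<alpha> (Suc n)"
  note defs = x_def q0_def q1_def p0_def p1_def
  have q: "q0 \<ge> 1" "q1 \<ge> 1" unfolding defs by (rule conv_denom_ge_1[OF assms])+
  have x: "x > 1" unfolding defs by (rule complete_quotient_gt_1[OF assms])
  define D where "D = x * q1 + q0"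
  have "1 * real_of_int q1 < x * q1"
    by (rule mult_strict_right_mono) (use q x in auto)
  moreover have "real_of_int q0 \<ge> 1" using q by simp
  ultimately have D: "D > q1" unfolding D_def by linarith
  have det: "p1 * q0 - p0 * q1 = (-1) ^ n" unfolding defs by (rule conv_det)
  have det': "real_of_int p1 * q0 - real_of_int p0 * q1 = (-1) ^ n"
    using arg_cong[OF det, of real_of_int] by simp
  have "(q1 * \<alpha> - p1) * D = q1 * (\<alpha> * D) - p1 * D" by (simp add: algebra_simps)
  also have "\<alpha> * D = x * p1 + p0"
    unfolding D_def defs by (rule conv_complete[OF assms])
  also have "q1 * (x * p1 + p0) - p1 * D = - (real_of_int p1 * q0 - real_of_int p0 * q1)"
    unfolding D_def by (simp add: algebra_simps)
  finally have "\<bar>q1 * \<alpha> - p1\<bar> * D = 1"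
    using D q unfolding det' by (metis abs_minus_cancel abs_mult abs_of_pos abs_power_minus abs_one
        of_int_0_less_iff order_less_trans power_one zero_less_one_class.zero_less_one int_one_le_iff_zero_less)
  then have "\<bar>q1 * \<alpha> - p1\<bar> = 1 / D" using D q by (simp add: field_simps)
  also have "\<dots> < 1 / q1" using D q by (simp add: frac_less2)
  finally have b: "\<bar>q1 * \<alpha> - p1\<bar> < 1 / q1" .
  have "coprime p1 q1"
  proof (rule coprimeI)
    fix c assume "c dvd p1" "c dvd q1"
    then have "c dvd p1 * q0 - p0 * q1" by simp
    then have "c dvd (-1) ^ n" unfolding det .
    then show "is_unit c" using dvd_trans
      by (metis dvd_minus_iff minus_one_power_iff)
  qed
  then show ?thesis
    using b q unfolding good_denom_def
    by (intro conjI exI[of _ p1]) (use cden_ge_1[OF assms, of "Suc n"] in \<open>auto simp: of_cden[OF assms] q1_def\<close>)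
qed

lemma index_le_ln_cden:
  assumes "\<alpha> \<notin> \<rat>" shows "real n \<le> 1 + 3 * ln (real (cden \<alpha> n))"
proof -
  define L where "L = ln (real (cden \<alpha> n))"
  have q1: "real (cden \<alpha> n) \<ge> 1" using cden_ge_1[OF assms, of n] by simp
  have L0: "L \<ge> 0" using q1 by (simp add: L_def)
  have "real_of_int (2 ^ n) \<le> real_of_int (2 * (conv_denom \<alpha> n)\<^sup>2)"
    using conv_denom_growth[OF assms, of n] by (simp only: of_int_le_iff)
  then have "2 ^ n \<le> 2 * (real (cden \<alpha> n))\<^sup>2" by (simp add: of_cden[OF assms])
  then have "ln (2 ^ n) \<le> ln (2 * (real (cden \<alpha> n))\<^sup>2)" using q1 by (subst ln_le_cancel_iff) auto
  then have "real n * ln 2 \<le> ln 2 + 2 * L" using q1 by (simp add: ln_mult ln_realpow L_def)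
  then have "(real n - 1) * ln 2 \<le> 2 * L" by (simp add: algebra_simps)
  also have "2 * L \<le> (3 * L) * ln 2" using L0 ln2_ge_two_thirds mult_left_mono[of "2/3" "ln 2" "3 * L"] by simp
  finally show ?thesis unfolding L_def[symmetric] by (simp add: mult_le_cancel_right)
qed

lemma ln_cden_at_top:
  assumes "\<alpha> \<notin> \<rat>" shows "filterlim (\<lambda>n. ln (real (cden \<alpha> n))) at_top sequentially"
proof (rule filterlim_at_top_mono)
  show "filterlim (\<lambda>n. (real n - 1) / 3) at_top sequentially" by real_asymp
  show "\<forall>\<^sub>F n in sequentially. (real n - 1) / 3 \<le> ln (real (cden \<alpha> n))"
    using index_le_ln_cden[OF assms] by (intro always_eventually allI) (simp add: field_simps)
qed

lemma cden_at_top: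
  assumes "\<alpha> \<notin> \<rat>" shows "filterlim (\<lambda>n. cden \<alpha> n) at_top sequentially"
proof -
  have "filterlim (\<lambda>n. real (cden \<alpha> n)) at_top sequentially"
  proof (rule filterlim_at_top_mono[OF ln_cden_at_top[OF assms]])
    show "\<forall>\<^sub>F n in sequentially. ln (real (cden \<alpha> n)) \<le> real (cden \<alpha> n)"
      using cden_ge_1[OF assms] by (intro always_eventually allI) (simp add: ln_bound Suc_le_lessD)
  qed
  then show ?thesis by (simp add: filterlim_sequentially_iff_filterlim_real)
qed

text \<open>The factor \<open>(log n)\<^sup>2\<close> in the first condition is at most of order \<open>(log log q\<^sub>n)\<^sup>2\<close>, since
  denominators grow at least exponentially; hence it is below every power of \<open>log q\<^sub>n\<close>.\<close>

lemma cden_ratio_bound: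
  assumes "\<alpha> \<in> dioph_D"
  shows "\<forall>\<^sub>F k in sequentially.
    real (cden \<alpha> (Suc k)) \<le> real (cden \<alpha> k) * ln (real (cden \<alpha> k)) powr (201 / 200)"
proof -
  have irr: "\<alpha> \<notin> \<rat>" using assms by (simp add: dioph_D_def)
  obtain C where C: "\<And>n. n \<ge> 2 \<Longrightarrow> real (cden \<alpha> (n + 1)) \<le>
       C * real (cden \<alpha> n) * ln (real (cden \<alpha> n)) * (ln (real n))\<^sup>2"
    using assms by (auto simp: dioph_D_def of_cden[OF irr])
  define C' where "C' = max C 1"
  have "\<forall>\<^sub>F L in at_top. C' * (ln (1 + 3 * L))\<^sup>2 \<le> L powr (1 / 200)" "\<forall>\<^sub>F L in at_top. L \<ge> (1::real)"
    unfolding C'_def by real_asymp+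
  then have "\<forall>\<^sub>F k in sequentially. C' * (ln (1 + 3 * ln (real (cden \<alpha> k))))\<^sup>2 \<le> ln (real (cden \<alpha> k)) powr (1 / 200)"
    "\<forall>\<^sub>F k in sequentially. ln (real (cden \<alpha> k)) \<ge> 1"
    using ln_cden_at_top[OF irr] by (auto simp: filterlim_iff)
  then show ?thesis using eventually_ge_at_top[of 2]
  proof eventually_elim
    case (elim k)
    define q L where "q = real (cden \<alpha> k)" and "L = ln q"
    have q0: "q \<ge> 1" using cden_ge_1[OF irr, of k] by (simp add: q_def)
    have L1: "L \<ge> 1" using elim by (simp add: L_def q_def)
    have "ln (real k) \<le> ln (1 + 3 * L)"
      using index_le_ln_cden[OF irr, of k] elim(3) by (subst ln_le_cancel_iff) (auto simp: L_def q_def)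
    then have lnk: "(ln (real k))\<^sup>2 \<le> (ln (1 + 3 * L))\<^sup>2"
      using elim(3) by (intro power_mono) auto
    have "real (cden \<alpha> (Suc k)) \<le> C * (q * L * (ln (real k))\<^sup>2)"
      using C[OF elim(3)] by (simp add: q_def L_def mult_ac)
    also have "\<dots> \<le> C' * (q * L * (ln (1 + 3 * L))\<^sup>2)"
      using q0 L1 lnk by (intro mult_mono) (auto simp: C'_def)
    also have "\<dots> = q * L * (C' * (ln (1 + 3 * L))\<^sup>2)" by (simp add: mult_ac)
    also have "\<dots> \<le> q * L * L powr (1 / 200)"
      using elim(1) q0 L1 by (intro mult_left_mono) (auto simp: L_def q_def)
    also have "\<dots> = q * L powr (201 / 200)" using L1 powr_add[of L 1 "1/200"] by simp
    finally show ?case by (simp add: q_def L_def)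
  qed
qed

text \<open>Since the denominators tend to infinity, some gap between consecutive ones contains \<open>n\<close>; in the bound for
  its length, \<open>log q\<^sub>k\<close> may be replaced by \<open>log n\<close>.\<close>

lemma cden_gap:
  assumes "\<alpha> \<in> dioph_D"
  shows "\<forall>\<^sub>F n in sequentially. \<exists>k\<ge>K. cden \<alpha> k \<le> n \<and> n < cden \<alpha> (Suc k) \<and>
    real (cden \<alpha> (Suc k)) \<le> real (cden \<alpha> k) * ln (real n) powr (201 / 200)"
proof -
  have irr: "\<alpha> \<notin> \<rat>" using assms by (simp add: dioph_D_def)
  obtain k0 where k0: "\<And>k. k \<ge> k0 \<Longrightarrow>
      real (cden \<alpha> (Suc k)) \<le> real (cden \<alpha> k) * ln (real (cden \<alpha> k)) powr (201 / 200)"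
    using cden_ratio_bound[OF assms] by (auto simp: eventually_sequentially)
  define k1 where "k1 = max k0 K"
  show ?thesis
  proof (intro eventually_sequentiallyI[of "cden \<alpha> k1"])
    fix n assume n: "n \<ge> cden \<alpha> k1"
    have "\<exists>m. cden \<alpha> m > n"
    proof -
      have "\<forall>\<^sub>F m in sequentially. Suc n \<le> cden \<alpha> m"
        using cden_at_top[OF irr] unfolding filterlim_at_top by blast
      then obtain m where "Suc n \<le> cden \<alpha> m" by (auto simp: eventually_sequentially)
      then show ?thesis by (intro exI[of _ m]) simp
    qed
    then have ex: "\<exists>m. cden \<alpha> m > n \<and> (\<forall>i<m. \<not> cden \<alpha> i > n)"
      using exists_least_iff[of "\<lambda>m. cden \<alpha> m > n"] by blast
    then obtain m where m: "cden \<alpha> m > n" "\<And>i. i < m \<Longrightarrow> cden \<alpha> i \<le> n" by (auto simp: not_less)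
    have "m > k1" using m(1) n cden_mono[OF irr, of m k1] by (meson leD le_less_trans not_le_imp_less)
    then obtain k where k: "m = Suc k" "k \<ge> k1" by (cases m) auto
    have qk: "cden \<alpha> k \<le> n" using m(2) k by simp
    have "ln (real (cden \<alpha> k)) powr (201/200) \<le> ln (real n) powr (201/200)"
      using qk cden_ge_1[OF irr, of k] by (intro powr_mono2) auto
    then have "real (cden \<alpha> (Suc k)) \<le> real (cden \<alpha> k) * ln (real n) powr (201 / 200)"
      using k0[of k] k(2) by (simp add: k1_def) (meson mult_left_mono of_nat_0_le_iff order_trans)
    then show "\<exists>k\<ge>K. cden \<alpha> k \<le> n \<and> n < cden \<alpha> (Suc k) \<and>
      real (cden \<alpha> (Suc k)) \<le> real (cden \<alpha> k) * ln (real n) powr (201 / 200)"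
      using k qk m(1) by (intro exI[of _ k]) (auto simp: k1_def)
  qed
qed

section \<open>Sums over orbits of the rotation\<close>

definition orb :: "real \<Rightarrow> real \<Rightarrow> nat \<Rightarrow> real" where
  "orb \<alpha> x i = frac (x + real i * \<alpha>)"

lemma orb_bounds: "0 \<le> orb \<alpha> x i" "orb \<alpha> x i < 1"
  by (auto simp: orb_def frac_lt_1)

lemma orb_add: "orb \<alpha> x (m + i) = orb \<alpha> (x + real m * \<alpha>) i"
  by (simp add: orb_def algebra_simps)

lemma frac_frac_add: "frac (frac x + y) = frac (x + y :: real)"
proof -
  have "frac x + y = (x + y) - of_int \<lfloor>x\<rfloor>" by (simp add: frac_def)
  then show ?thesis by (simp only: frac_def floor_diff_of_int of_int_diff)
qed

text \<open>Among \<open>q\<close> consecutive points of an orbit, the \<open>i\<close>-th lies within one cell of the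
  \<open>i\<close>-th point of a permutation of the grid of mesh \<open>1 / q\<close>.\<close>

definition grid_index :: "int \<Rightarrow> nat \<Rightarrow> real \<Rightarrow> nat \<Rightarrow> int" where
  "grid_index p q y i = (\<lfloor>real q * y\<rfloor> + int i * p) mod int q"

lemma grid_index_bij:
  assumes "coprime p (int q)" "q \<ge> 1"
  shows "bij_betw (grid_index p q y) {..<q} {0..<int q}"
proof -
  have "inj_on (grid_index p q y) {..<q}"
  proof (rule inj_onI)
    fix i j assume ij: "i \<in> {..<q}" "j \<in> {..<q}" "grid_index p q y i = grid_index p q y j"
    then have "int q dvd (\<lfloor>real q * y\<rfloor> + int i * p) - (\<lfloor>real q * y\<rfloor> + int j * p)"
      unfolding grid_index_def by (simp only: mod_eq_dvd_iff)
    then have "int q dvd (int i - int j) * p" by (simp add: algebra_simps)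
    then have "int q dvd int i - int j"
      using assms(1) by (simp add: coprime_dvd_mult_left_iff coprime_commute)
    then show "i = j" using ij zdvd_not_zless[of "int i - int j" "int q"] zdvd_not_zless[of "int j - int i" "int q"]
      by (smt (verit) dvd_minus_iff lessThan_iff minus_diff_eq of_nat_0_le_iff of_nat_eq_iff of_nat_less_iff)
  qed
  moreover have "grid_index p q y ` {..<q} \<subseteq> {0..<int q}"
    using assms(2) by (auto simp: grid_index_def)
  ultimately have "grid_index p q y ` {..<q} = {0..<int q}"
    by (intro card_subset_eq) (auto simp: card_image)
  then show ?thesis
    using \<open>inj_on (grid_index p q y) {..<q}\<close> unfolding bij_betw_def by blast
qed

lemma block_cell:
  assumes "q \<ge> 1" "\<bar>real q * \<alpha> - of_int p\<bar> < 1 / real q" "i < q"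
  obtains s :: int where "s \<in> {-1, 0, 1}"
    "\<lfloor>real q * orb \<alpha> y i\<rfloor> = (grid_index p q y i + s) mod int q"
proof -
  define t where "t = y + real i * \<alpha>"
  define e where "e = real i * (real q * \<alpha> - of_int p)"
  have "\<bar>e\<bar> = real i * \<bar>real q * \<alpha> - of_int p\<bar>" by (simp add: e_def abs_mult)
  also have "\<dots> \<le> real i * (1 / real q)" using assms(2) by (intro mult_left_mono) auto
  also have "\<dots> < 1" using assms by simp
  finally have e: "\<bar>e\<bar> < 1" .
  define s where "s = \<lfloor>real q * y + e\<rfloor> - \<lfloor>real q * y\<rfloor>"
  have s: "s \<in> {-1, 0, 1}"
  proof -
    have "s \<le> 1" "s \<ge> -1" using e unfolding s_def by linarith+
    then show ?thesis by auto
  qed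
  have "real q * t = (real q * y + e) + of_int (int i * p)"
    by (simp add: t_def e_def algebra_simps)
  then have "\<lfloor>real q * t\<rfloor> = \<lfloor>real q * y + e\<rfloor> + int i * p" by (simp only: floor_add_int)
  then have qt: "\<lfloor>real q * t\<rfloor> = \<lfloor>real q * y\<rfloor> + int i * p + s"
    by (simp add: s_def)
  have "real q * frac t = real q * t - of_int (int q * \<lfloor>t\<rfloor>)" by (simp add: frac_def algebra_simps)
  then have "\<lfloor>real q * frac t\<rfloor> = \<lfloor>real q * t\<rfloor> - int q * \<lfloor>t\<rfloor>" by (simp only: floor_diff_of_int)
  then have "\<lfloor>real q * frac t\<rfloor> mod int q = \<lfloor>real q * t\<rfloor> mod int q"
    by (simp add: mod_diff_right_eq[symmetric])
  moreover have "0 \<le> \<lfloor>real q * frac t\<rfloor>" "\<lfloor>real q * frac t\<rfloor> < int q"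
    using assms(1) frac_lt_1[of t] by (auto simp: floor_less_iff)
  ultimately have "\<lfloor>real q * frac t\<rfloor> = \<lfloor>real q * t\<rfloor> mod int q" by simp
  then have "\<lfloor>real q * orb \<alpha> y i\<rfloor> = (grid_index p q y i + s) mod int q"
    unfolding orb_def t_def[symmetric] grid_index_def qt by (simp add: mod_add_left_eq)
  then show ?thesis using that s by blast
qed

lemma cell_bounds:
  assumes "q \<ge> 1"
  shows "real_of_int \<lfloor>real q * u\<rfloor> / q \<le> u" "u < (real_of_int \<lfloor>real q * u\<rfloor> + 1) / q"
proof -
  have "real_of_int \<lfloor>real q * u\<rfloor> \<le> real q * u" "real q * u < real_of_int \<lfloor>real q * u\<rfloor> + 1" by linarith+
  then show "real_of_int \<lfloor>real q * u\<rfloor> / q \<le> u" "u < (real_of_int \<lfloor>real q * u\<rfloor> + 1) / q"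
    using assms by (simp_all add: divide_le_eq less_divide_eq mult.commute)
qed

text \<open>Comparison with the harmonic sum over the grid.  The orbit points of the two grid points
  next to the seam of the circle may lie on its other side, so these are left out.  The remaining sum lacks the first
  two terms \<open>1 + 1 / 2 = 3 / 2\<close> of the harmonic sum.\<close>

lemma sum_inverse_orb_block_ge:
  assumes "good_denom \<alpha> q" "\<And>i. i < q \<Longrightarrow> orb \<alpha> y i > 0"
  shows "(\<Sum>i<q. 1 / orb \<alpha> y i) \<ge> real q * (ln (real q) - 3 / 2)"
proof (cases "q \<ge> 3")
  case True
  obtain p where p: "coprime p (int q)" "\<bar>real q * \<alpha> - of_int p\<bar> < 1 / real q"
    using assms by (auto simp: good_denom_def)
  \<comment> \<open>The orbit point belonging to the grid point \<open>j / q\<close> lies below \<open>(j + 2) / q\<close>.\<close>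
  define G where "G j = (if 1 \<le> j \<and> j \<le> int q - 2 then real q / (real_of_int j + 2) else 0)" for j
  have "real q * (ln (real q) - 3 / 2) \<le> real q * (harm q - 3 / 2)"
  proof -
    have "ln (real q) \<le> ln (real (Suc q))" using True by (subst ln_le_cancel_iff) auto
    also have "\<dots> \<le> harm q" using ln_le_harm[of q] by (simp add: add.commute)
    finally show ?thesis by (intro mult_left_mono) auto
  qed
  also have "real q * (harm q - 3 / 2) = (\<Sum>m\<in>{3..q}. real q / real m)"
  proof -
    have "harm q = (\<Sum>m\<in>{1..q}. 1 / real m)" by (simp add: harm_def inverse_eq_divide)
    also have "{1..q} = {1, 2} \<union> {3..q}" using True by auto
    also have "(\<Sum>m\<in>{1, 2} \<union> {3..q}. 1 / real m) = 3 / 2 + (\<Sum>m\<in>{3..q}. 1 / real m)"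
      by (subst sum.union_disjoint) auto
    finally show ?thesis by (simp add: sum_distrib_left)
  qed
  also have "\<dots> = (\<Sum>j\<in>{1..int q - 2}. real q / (real_of_int j + 2))"
    by (rule sum.reindex_bij_witness[of _ "\<lambda>j. nat (j + 2)" "\<lambda>m. int m - 2"]) auto
  also have "\<dots> = (\<Sum>j\<in>{0..<int q}. G j)"
    unfolding G_def by (rule sum.mono_neutral_cong_left) auto
  also have "\<dots> = (\<Sum>i<q. G (grid_index p q y i))"
    using True p(1) by (intro sum.reindex_bij_betw[symmetric] grid_index_bij) auto
  also have "\<dots> \<le> (\<Sum>i<q. 1 / orb \<alpha> y i)"
  proof (rule sum_mono)
    fix i assume "i \<in> {..<q}"
    then have i: "i < q" by simp
    define j where "j = grid_index p q y i"
    obtain s where s: "s \<in> {-1, 0, 1}" "\<lfloor>real q * orb \<alpha> y i\<rfloor> = (j + s) mod int q"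
      using block_cell[of q \<alpha> p i y] p True i unfolding j_def by auto
    show "G (grid_index p q y i) \<le> 1 / orb \<alpha> y i"
    proof (cases "1 \<le> j \<and> j \<le> int q - 2")
      case jc: True
      then have "(j + s) mod int q = j + s" using s(1) by auto
      then have "\<lfloor>real q * orb \<alpha> y i\<rfloor> \<le> j + 1" using s by auto
      then have "real_of_int \<lfloor>real q * orb \<alpha> y i\<rfloor> + 1 \<le> real_of_int j + 2" by linarith
      then have "(real_of_int \<lfloor>real q * orb \<alpha> y i\<rfloor> + 1) / q \<le> (real_of_int j + 2) / q"
        by (intro divide_right_mono) auto
      then have "orb \<alpha> y i \<le> (real_of_int j + 2) / q"
        using cell_bounds(2)[of q "orb \<alpha> y i"] True by linarith
      then have "1 / ((real_of_int j + 2) / q) \<le> 1 / orb \<alpha> y i"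
        using assms(2)[OF i] jc by (intro divide_left_mono) auto
      then show ?thesis using jc by (simp add: G_def j_def)
    next
      case False
      then show ?thesis using orb_bounds(1)[of \<alpha> y i] by (auto simp: G_def j_def)
    qed
  qed
  finally show ?thesis .
next
  case False
  have "q \<ge> 1" using assms(1) by (simp add: good_denom_def)
  then have "ln (real q) \<le> ln 2" using False by (subst ln_le_cancel_iff) auto
  then have "ln (real q) - 3 / 2 \<le> 0" using ln_2_less_1 by linarith
  then have "real q * (ln (real q) - 3 / 2) \<le> 0" by (simp add: mult_nonneg_nonpos)
  also have "0 \<le> (\<Sum>i<q. 1 / orb \<alpha> y i)" by (intro sum_nonneg) (simp add: orb_bounds)
  finally show ?thesis .
qed

text \<open>The orbit point belonging to the grid point \<open>j / q\<close> lies above \<open>(j - 1) / q\<close>, unless it crosses the seam of the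
  circle.  Orbit points in the first three cells are left out, so that only the grid point
  \<open>0\<close> can cross the seam, and it moves to the last cell.\<close>

lemma sum_orb_block_le:
  fixes g :: "real \<Rightarrow> real"
  assumes "good_denom \<alpha> q" "q \<ge> 4"
    and g: "\<And>u v. 0 < u \<Longrightarrow> u \<le> v \<Longrightarrow> v < 1 \<Longrightarrow> g v \<le> g u" "\<And>u. 0 < u \<Longrightarrow> u < 1 \<Longrightarrow> 0 \<le> g u"
  shows "(\<Sum>i<q. if orb \<alpha> y i \<ge> 3 / q then g (orb \<alpha> y i) else 0) \<le> (\<Sum>j\<in>{1..<q}. g (real j / q))"
proof -
  obtain p where p: "coprime p (int q)" "\<bar>real q * \<alpha> - of_int p\<bar> < 1 / real q"
    using assms by (auto simp: good_denom_def)
  define G where "G j = (if j \<ge> 2 then g (real_of_int (j - 1) / q)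
      else if j = 0 then g (real (q - 1) / q) else 0)" for j :: int
  have "(\<Sum>i<q. if orb \<alpha> y i \<ge> 3 / q then g (orb \<alpha> y i) else 0) \<le> (\<Sum>i<q. G (grid_index p q y i))"
  proof (rule sum_mono)
    fix i assume "i \<in> {..<q}"
    then have i: "i < q" by simp
    define j where "j = grid_index p q y i"
    define J where "J = \<lfloor>real q * orb \<alpha> y i\<rfloor>"
    have jr: "0 \<le> j" "j < int q" using assms(2) by (auto simp: j_def grid_index_def)
    obtain s where s: "s \<in> {-1, 0, 1}" "J = (j + s) mod int q"
      using block_cell[of q \<alpha> p i y] p assms(2) i unfolding j_def J_def by auto
    have Gnn: "G j \<ge> 0" using assms(2) jr unfolding G_def by (auto intro!: g(2) simp: divide_less_eq)
    show "(if orb \<alpha> y i \<ge> 3 / q then g (orb \<alpha> y i) else 0) \<le> G (grid_index p q y i)"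
    proof (cases "orb \<alpha> y i \<ge> 3 / q")
      case big: True
      have "real q * orb \<alpha> y i \<ge> 3" using big assms(2) by (simp add: field_simps)
      then have J3: "J \<ge> 3" unfolding J_def by linarith
      have low: "real_of_int J / q \<le> orb \<alpha> y i" unfolding J_def using assms(2) by (intro cell_bounds) auto
      consider "2 \<le> j" "J \<ge> j - 1" | "j = 0" "J = int q - 1"
      proof -
        consider "j + s = - 1" | "j + s = int q" | "0 \<le> j + s" "j + s < int q" using s(1) jr by force
        then show ?thesis
        proof cases
          case 1
          then have "J = int q - 1" using s(2) assms(2) by (simp add: zmod_minus1)
          then show ?thesis using 1 s(1) jr that by auto
        next
          case 2
          then show ?thesis using s(2) J3 by simp
        next
          case 3
          then have "J = j + s" using s(2) by simp
          then show ?thesis using J3 s(1) jr that by auto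
        qed
      qed
      then show ?thesis
      proof cases
        case 1
        then have "real_of_int (j - 1) / q \<le> real_of_int J / q" by (intro divide_right_mono) auto
        then have "g (orb \<alpha> y i) \<le> g (real_of_int (j - 1) / q)"
          using 1 low assms(2) orb_bounds(2)[of \<alpha> y i] by (intro g(1)) (auto intro: order_trans)
        then show ?thesis using 1 big by (simp add: G_def j_def)
      next
        case 2
        then have "real (q - 1) / q \<le> real_of_int J / q" using assms(2) by (simp add: of_nat_diff)
        then have "g (orb \<alpha> y i) \<le> g (real (q - 1) / q)"
          using 2 low assms(2) orb_bounds(2)[of \<alpha> y i] by (intro g(1)) (auto intro: order_trans)
        then show ?thesis using 2 big by (simp add: G_def j_def)
      qed
    qed (use Gnn in \<open>simp add: j_def\<close>)
  qed
  also have "\<dots> = (\<Sum>j\<in>{0..<int q}. G j)"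
    using assms(2) p(1) by (intro sum.reindex_bij_betw grid_index_bij) auto
  also have "{0..<int q} = {0, 1} \<union> {2..<int q}" using assms(2) by auto
  also have "(\<Sum>j\<in>{0, 1} \<union> {2..<int q}. G j) = g (real (q - 1) / q) + (\<Sum>j\<in>{2..<int q}. G j)"
    by (subst sum.union_disjoint) (auto simp: G_def)
  also have "(\<Sum>j\<in>{2..<int q}. G j) = (\<Sum>j\<in>{1..<q - 1}. g (real j / q))"
    by (rule sum.reindex_bij_witness[of _ "\<lambda>j. int j + 1" "\<lambda>m. nat (m - 1)"]) (auto simp: G_def)
  also have "g (real (q - 1) / q) + \<dots> = (\<Sum>j\<in>{1..<q}. g (real j / q))"
  proof -
    have "{1..<q} = insert (q - 1) {1..<q - 1}" using assms(2) by auto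
    then show ?thesis by simp
  qed
  finally show ?thesis .
qed

text \<open>A cell can only receive the grid points of this cell and of its two neighbours.\<close>

lemma card_cell_block:
  assumes "good_denom \<alpha> q"
  shows "card {i. i < q \<and> \<lfloor>real q * orb \<alpha> y i\<rfloor> = J} \<le> 3"
proof -
  obtain p where p: "coprime p (int q)" "\<bar>real q * \<alpha> - of_int p\<bar> < 1 / real q" and q: "q \<ge> 1"
    using assms by (auto simp: good_denom_def)
  have inj: "inj_on (grid_index p q y) {..<q}"
    using grid_index_bij[OF p(1) q] by (rule bij_betw_imp_inj_on)
  let ?A = "{i. i < q \<and> \<lfloor>real q * orb \<alpha> y i\<rfloor> = J}"
  have "grid_index p q y ` ?A \<subseteq> (\<lambda>s. (J - s) mod int q) ` {-1, 0, 1}"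
  proof safe
    fix i assume i: "i < q"
    define j where "j = grid_index p q y i"
    have jr: "0 \<le> j" "j < int q" using q by (auto simp: j_def grid_index_def)
    obtain s where s: "s \<in> {-1, 0, 1}" "\<lfloor>real q * orb \<alpha> y i\<rfloor> = (j + s) mod int q"
      using block_cell[of q \<alpha> p i y] p q i unfolding j_def by auto
    have "(\<lfloor>real q * orb \<alpha> y i\<rfloor> - s) mod int q = j"
      unfolding s(2) using jr by (simp add: mod_diff_left_eq)
    then show "grid_index p q y i \<in> (\<lambda>s. (\<lfloor>real q * orb \<alpha> y i\<rfloor> - s) mod int q) ` {-1, 0, 1}"
      using s(1) unfolding j_def by (metis imageI)
  qed
  then have "card (grid_index p q y ` ?A) \<le> card ((\<lambda>s. (J - s) mod int q) ` {-1, 0, 1 :: int})"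
    by (intro card_mono) auto
  also have "\<dots> \<le> card {-1, 0, 1 :: int}" by (intro card_image_le) auto
  also have "\<dots> = 3" by simp
  finally show ?thesis
    using inj by (subst (asm) card_image) (auto intro: inj_on_subset)
qed

lemma sum_orb_blocks:
  fixes h :: "real \<Rightarrow> real"
  shows "(\<Sum>i<m * q. h (orb \<alpha> x i)) = (\<Sum>l<m. \<Sum>i<q. h (orb \<alpha> (x + real (l * q) * \<alpha>) i))"
proof -
  have "(\<Sum>i<m * q. h (orb \<alpha> x i)) = (\<Sum>l<m. \<Sum>i\<in>{l * q..<l * q + q}. h (orb \<alpha> x i))"
    by (rule sum.nat_group[symmetric])
  also have "\<dots> = (\<Sum>l<m. \<Sum>i<q. h (orb \<alpha> x (l * q + i)))"
  proof (rule sum.cong[OF refl])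
    fix l
    show "(\<Sum>i\<in>{l * q..<l * q + q}. h (orb \<alpha> x i)) = (\<Sum>i<q. h (orb \<alpha> x (l * q + i)))"
      by (rule sum.reindex_bij_witness[of _ "\<lambda>i. l * q + i" "\<lambda>i. i - l * q"]) auto
  qed
  finally show ?thesis by (simp add: orb_add)
qed

lemma sum_orb_le_blocks:
  fixes h :: "real \<Rightarrow> real"
  assumes "q \<ge> 1" "\<And>u. 0 \<le> h u" "\<And>y. (\<Sum>i<q. h (orb \<alpha> y i)) \<le> B"
  shows "(\<Sum>i<n. h (orb \<alpha> x i)) \<le> (real n / real q + 1) * B"
proof -
  have "B \<ge> 0" using assms(3)[of 0] sum_nonneg[of "{..<q}" "\<lambda>i. h (orb \<alpha> 0 i)"] assms(2) by force
  have "n \<le> (n div q + 1) * q"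
  proof -
    have "n = n div q * q + n mod q" by simp
    moreover have "n mod q < q" using assms(1) by simp
    ultimately show ?thesis unfolding add_mult_distrib by linarith
  qed
  then have "(\<Sum>i<n. h (orb \<alpha> x i)) \<le> (\<Sum>i<(n div q + 1) * q. h (orb \<alpha> x i))"
    using assms(2) by (intro sum_mono2) auto
  also have "\<dots> \<le> (\<Sum>l<n div q + 1. B)"
    unfolding sum_orb_blocks by (intro sum_mono assms)
  also have "\<dots> = (real (n div q) + 1) * B" by simp
  also have "\<dots> \<le> (real n / real q + 1) * B"
    using \<open>B \<ge> 0\<close> by (intro mult_right_mono add_mono) (auto intro: of_nat_div_le_of_nat)
  finally show ?thesis .
qed

lemma sum_inverse_orb_ge:
  assumes "good_denom \<alpha> q" "\<And>i. i < n \<Longrightarrow> orb \<alpha> x i > 0"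
  shows "(\<Sum>i<n. 1 / orb \<alpha> x i) \<ge> real (n div q) * (real q * (ln (real q) - 3 / 2))"
proof -
  have le: "n div q * q \<le> n" by (simp add: div_times_less_eq_dividend)
  have "real (n div q) * (real q * (ln (real q) - 3 / 2)) = (\<Sum>l<n div q. real q * (ln (real q) - 3 / 2))"
    by simp
  also have "\<dots> \<le> (\<Sum>l<n div q. \<Sum>i<q. 1 / orb \<alpha> (x + real (l * q) * \<alpha>) i)"
  proof (intro sum_mono sum_inverse_orb_block_ge[OF assms(1)])
    fix l i assume "l \<in> {..<n div q}" "i < q"
    then have "(l + 1) * q \<le> n div q * q" by (intro mult_le_mono1) auto
    then have "l * q + q \<le> n div q * q" by (simp add: add_mult_distrib)
    with \<open>i < q\<close> have "l * q + i < n div q * q" by linarith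
    then have "l * q + i < n" using le by linarith
    then show "0 < orb \<alpha> (x + real (l * q) * \<alpha>) i"
      using assms(2)[of "l * q + i"] by (simp only: orb_add)
  qed
  also have "\<dots> = (\<Sum>i<n div q * q. 1 / orb \<alpha> x i)"
    by (rule sum_orb_blocks[where h = "\<lambda>u. 1 / u", symmetric])
  also have "\<dots> \<le> (\<Sum>i<n. 1 / orb \<alpha> x i)"
    using le by (intro sum_mono2) (auto simp: orb_bounds)
  finally show ?thesis .
qed

lemma sum_orb_away_le:
  fixes g :: "real \<Rightarrow> real"
  assumes "good_denom \<alpha> q" "q \<ge> 4"
    and g: "\<And>u v. 0 < u \<Longrightarrow> u \<le> v \<Longrightarrow> v < 1 \<Longrightarrow> g v \<le> g u" "\<And>u. 0 < u \<Longrightarrow> u < 1 \<Longrightarrow> 0 \<le> g u"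
  shows "(\<Sum>i | i < n \<and> orb \<alpha> x i \<ge> 3 / q. g (orb \<alpha> x i))
       \<le> (real n / real q + 1) * (\<Sum>j\<in>{1..<q}. g (real j / q))"
proof -
  define h where "h u = (if 3 / real q \<le> u \<and> u < 1 then g u else 0)" for u
  have "(\<Sum>i<n. h (orb \<alpha> x i)) \<le> (real n / real q + 1) * (\<Sum>j\<in>{1..<q}. g (real j / q))"
  proof (rule sum_orb_le_blocks)
    show "0 \<le> h u" for u using assms(2) unfolding h_def by (auto intro!: g(2) less_le_trans[of 0 "3 / real q" u])
    show "(\<Sum>i<q. h (orb \<alpha> y i)) \<le> (\<Sum>j\<in>{1..<q}. g (real j / q))" for y
      using sum_orb_block_le[of \<alpha> q g y] assms by (simp add: h_def orb_bounds)
  qed (use assms in auto)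
  also have "(\<Sum>i<n. h (orb \<alpha> x i)) = (\<Sum>i | i < n \<and> orb \<alpha> x i \<ge> 3 / q. g (orb \<alpha> x i))"
    by (rule sum.mono_neutral_cong_right) (auto simp: h_def orb_bounds)
  finally show ?thesis .
qed

lemma card_cell:
  assumes "good_denom \<alpha> q"
  shows "real (card {i. i < n \<and> \<lfloor>real q * orb \<alpha> x i\<rfloor> = J}) \<le> 3 * (real n / real q + 1)"
proof -
  define h where "h u = (if \<lfloor>real q * u\<rfloor> = J then 1 else 0 :: real)" for u
  have c: "(\<Sum>i<n. h (orb \<alpha> x i)) = real (card {i. i < n \<and> \<lfloor>real q * orb \<alpha> x i\<rfloor> = J})" for n x
  proof -
    have "(\<Sum>i<n. h (orb \<alpha> x i)) = (\<Sum>i\<in>{i. i < n \<and> \<lfloor>real q * orb \<alpha> x i\<rfloor> = J}. 1)"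
      by (rule sum.mono_neutral_cong_right) (auto simp: h_def)
    then show ?thesis by simp
  qed
  have "(\<Sum>i<n. h (orb \<alpha> x i)) \<le> (real n / real q + 1) * 3"
  proof (rule sum_orb_le_blocks)
    show "(\<Sum>i<q. h (orb \<alpha> y i)) \<le> 3" for y
      unfolding c using card_cell_block[OF assms, of y J] by simp
  qed (use assms in \<open>auto simp: h_def good_denom_def\<close>)
  then show ?thesis unfolding c by (simp add: mult.commute)
qed

text \<open>For \<open>i \<le> q / 2\<close> the distance of \<open>i \<alpha>\<close> to the nearest integer exceeds half of that of
  \<open>i p / q\<close>, which is at least \<open>1 / q\<close>.\<close>

lemma good_denom_separation:
  assumes "good_denom \<alpha> q" "0 < i" "2 * i \<le> q"
  shows "\<bar>real i * \<alpha> - of_int m\<bar> \<ge> 1 / (2 * real q)"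
proof -
  obtain p where p: "coprime p (int q)" "\<bar>real q * \<alpha> - of_int p\<bar> < 1 / real q" and q: "q \<ge> 1"
    using assms by (auto simp: good_denom_def)
  have "int i * p - m * int q \<noteq> 0"
  proof
    assume "int i * p - m * int q = 0"
    then have "int q dvd int i * p" by simp
    then have "int q dvd int i" using p(1) by (simp add: coprime_dvd_mult_left_iff coprime_commute)
    then show False using assms(2,3) by (auto dest: dvd_imp_le)
  qed
  then have "\<bar>real_of_int (int i * p - m * int q)\<bar> \<ge> 1" by linarith
  moreover have "real i * of_int p - of_int m * real q
      = real q * (real i * \<alpha> - of_int m) - real i * (real q * \<alpha> - of_int p)"
    by (simp add: algebra_simps)
  ultimately have "1 \<le> \<bar>real q * (real i * \<alpha> - of_int m) - real i * (real q * \<alpha> - of_int p)\<bar>" by simp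
  also have "\<dots> \<le> real q * \<bar>real i * \<alpha> - of_int m\<bar> + real i * \<bar>real q * \<alpha> - of_int p\<bar>"
    by (rule order_trans[OF abs_triangle_ineq4]) (simp add: abs_mult)
  also have "real i * \<bar>real q * \<alpha> - of_int p\<bar> \<le> (real q / 2) * (1 / real q)"
    using p(2) assms(3) by (intro mult_mono) auto
  also have "\<dots> = 1 / 2" using q by simp
  finally have "1 / 2 \<le> real q * \<bar>real i * \<alpha> - of_int m\<bar>" by simp
  then show ?thesis using q by (simp add: field_simps)
qed

lemma orb_separation:
  assumes "good_denom \<alpha> q" "i \<noteq> j" "2 * i \<le> q" "2 * j \<le> q"
  shows "\<bar>orb \<alpha> x i - orb \<alpha> x j\<bar> \<ge> 1 / (2 * real q)"
proof -
  have *: "\<bar>orb \<alpha> x i - orb \<alpha> x j\<bar> \<ge> 1 / (2 * real q)" if "j < i" "2 * i \<le> q" for i j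
  proof -
    have "orb \<alpha> x i - orb \<alpha> x j
        = real (i - j) * \<alpha> - of_int (\<lfloor>x + real i * \<alpha>\<rfloor> - \<lfloor>x + real j * \<alpha>\<rfloor>)"
      using that by (simp add: orb_def frac_def of_nat_diff algebra_simps)
    moreover have "0 < i - j" "2 * (i - j) \<le> q" using that by auto
    ultimately show ?thesis by (metis good_denom_separation[OF assms(1)])
  qed
  show ?thesis using *[of j i] *[of i j] assms by (cases "j < i") (auto simp: abs_minus_commute)
qed

text \<open>Of \<open>k\<close> separated points, the largest is at least \<open>\<rho> + (k - 1) h\<close>; removing one point after the other
  leads to a harmonic sum.\<close>

lemma sum_inverse_separated:
  fixes A :: "real set"
  assumes "finite A" "h > 0" "\<rho> > 0" "\<And>u. u \<in> A \<Longrightarrow> u \<ge> \<rho>"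
    and "\<And>u v. u \<in> A \<Longrightarrow> v \<in> A \<Longrightarrow> u \<noteq> v \<Longrightarrow> \<bar>u - v\<bar> \<ge> h"
  shows "(\<Sum>u\<in>A. 1 / u) \<le> 1 / \<rho> + harm (card A - 1) / h"
  using assms(1,4,5)
proof (induction "card A" arbitrary: A)
  case 0
  then show ?case using assms(3) by (simp add: harm_def)
next
  case (Suc n)
  then have ne: "A \<noteq> {}" by auto
  define M where "M = Max A"
  have M: "M \<in> A" using Suc.prems(1) ne by (simp add: M_def)
  have Mr: "M \<ge> real n * h + \<rho>"
  proof -
    have sep: "\<lfloor>(u - \<rho>) / h\<rfloor> \<noteq> \<lfloor>(v - \<rho>) / h\<rfloor>" if "u \<in> A" "v \<in> A" "u < v" for u v
    proof -
      have "(v - \<rho>) / h - (u - \<rho>) / h = (v - u) / h" by (simp add: diff_divide_distrib)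
      also have "(v - u) / h \<ge> 1" using Suc.prems(3)[OF that(1,2)] that(3) assms(2) by simp
      finally show ?thesis by linarith
    qed
    have "inj_on (\<lambda>u. \<lfloor>(u - \<rho>) / h\<rfloor>) A"
      by (rule inj_onI) (use sep in \<open>metis linorder_neqE_linordered_idom\<close>)
    then have "card A = card ((\<lambda>u. \<lfloor>(u - \<rho>) / h\<rfloor>) ` A)" by (simp add: card_image)
    also have "\<dots> \<le> card {0..\<lfloor>(M - \<rho>) / h\<rfloor>}"
    proof (intro card_mono)
      show "(\<lambda>u. \<lfloor>(u - \<rho>) / h\<rfloor>) ` A \<subseteq> {0..\<lfloor>(M - \<rho>) / h\<rfloor>}"
        using Suc.prems(1,2) assms(2) by (auto simp: M_def intro!: floor_mono divide_right_mono)
    qed simp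
    also have "\<dots> = nat (\<lfloor>(M - \<rho>) / h\<rfloor> + 1)" by simp
    finally have "int n \<le> \<lfloor>(M - \<rho>) / h\<rfloor>" using Suc(2) by linarith
    then have "real n \<le> (M - \<rho>) / h" by linarith
    then show ?thesis using assms(2) by (simp add: field_simps)
  qed
  have card: "card (A - {M}) = n" using Suc(2) M Suc.prems(1) by simp
  have "(\<Sum>u\<in>A. 1 / u) = 1 / M + (\<Sum>u\<in>A - {M}. 1 / u)"
    using M Suc.prems(1) by (simp add: sum.remove)
  also have "\<dots> \<le> 1 / \<rho> + harm (card A - 1) / h"
  proof (cases "n = 0")
    case True
    then have "A - {M} = {}" using card Suc.prems(1) by simp
    then have "(\<Sum>u\<in>A - {M}. 1 / u) = 0" by (metis sum.empty)
    moreover have "1 / M \<le> 1 / \<rho>" using assms(3) Mr True by (intro divide_left_mono) auto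
    moreover have "harm (card A - 1) / h \<ge> 0" using assms(2) by (simp add: harm_nonneg)
    ultimately show ?thesis by linarith
  next
    case False
    have "(\<Sum>u\<in>A - {M}. 1 / u) \<le> 1 / \<rho> + harm (n - 1) / h"
      using Suc(1)[of "A - {M}"] card Suc.prems by simp
    moreover have "1 / M \<le> 1 / (real n * h)"
      using Mr assms(2,3) False add_pos_pos[of "real n * h" \<rho>]
      by (intro divide_left_mono mult_pos_pos) auto
    moreover have "harm (card A - 1) / h = harm (n - 1) / h + 1 / (real n * h)"
      using False harm_Suc[of "n - 1", where 'a = real]
      unfolding Suc(2)[symmetric] by (simp add: add_divide_distrib inverse_eq_divide)
    ultimately show ?thesis by linarith
  qed
  finally show ?case .
qed

text \<open>The form in which the first Diophantine condition enters the estimates of orbit sums.  An exponent above \<open>1\<close>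
  absorbs the factor \<open>(log log n)\<^sup>2\<close>; it is so close to \<open>1\<close> that a factor \<open>(log n) powr (1 / 100)\<close>
  gained elsewhere compensates for the excess.\<close>

definition short_gaps :: "real \<Rightarrow> bool" where
  "short_gaps \<alpha> \<longleftrightarrow> (\<forall>\<^sub>F n in sequentially. \<exists>q q'. good_denom \<alpha> q \<and> good_denom \<alpha> q' \<and> q \<le> n \<and> n < q' \<and>
     real q' \<le> real q * ln (real n) powr (201 / 200))"

lemma short_gaps_dioph:
  assumes "\<alpha> \<in> dioph_D" shows "short_gaps \<alpha>"
proof -
  have irr: "\<alpha> \<notin> \<rat>" using assms by (simp add: dioph_D_def)
  show ?thesis unfolding short_gaps_def
    using cden_gap[OF assms, of 1]
  proof eventually_elim
    case (elim n)
    then obtain k where k: "k \<ge> 1" "cden \<alpha> k \<le> n" "n < cden \<alpha> (Suc k)"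
      "real (cden \<alpha> (Suc k)) \<le> real (cden \<alpha> k) * ln (real n) powr (201 / 200)" by auto
    have "good_denom \<alpha> (cden \<alpha> k)" using good_denom_cden[OF irr, of "k - 1"] k(1) by simp
    then show ?case using k good_denom_cden[OF irr, of k] by blast
  qed
qed

lemma short_gaps_uminus: "short_gaps \<alpha> \<Longrightarrow> short_gaps (- \<alpha>)"
  unfolding short_gaps_def by (elim eventually_mono) (blast intro: good_denom_uminus)

text \<open>The denominator just below \<open>n / log n\<close>, since the gap above it is short.\<close>

lemma short_gaps_medium_denom:
  assumes "short_gaps \<alpha>"
  shows "\<forall>\<^sub>F n in sequentially. \<exists>q. good_denom \<alpha> q \<and>
    real n / ln (real n) ^ 3 \<le> real q \<and> real q \<le> real n / ln (real n)"
proof -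
  have "filterlim (\<lambda>n. nat \<lfloor>real n / ln (real n)\<rfloor>) at_top sequentially"
  proof -
    have "filterlim (\<lambda>n. real n / ln (real n)) at_top sequentially" by real_asymp
    then show ?thesis
      by (intro filterlim_compose[OF filterlim_nat_sequentially] filterlim_compose[OF filterlim_floor_sequentially])
  qed
  then have 1: "\<forall>\<^sub>F n in sequentially. \<exists>q q'. good_denom \<alpha> q \<and> good_denom \<alpha> q' \<and>
     q \<le> nat \<lfloor>real n / ln (real n)\<rfloor> \<and> nat \<lfloor>real n / ln (real n)\<rfloor> < q' \<and>
     real q' \<le> real q * ln (real (nat \<lfloor>real n / ln (real n)\<rfloor>)) powr (201 / 200)"
    using assms unfolding short_gaps_def filterlim_iff by blast
  have 2: "\<forall>\<^sub>F n in sequentially. ln (real n) ^ 3 \<ge> ln (real n) powr (401 / 200)" by real_asymp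
  have 3: "\<forall>\<^sub>F n in sequentially. ln (real n) \<ge> 1" by real_asymp
  have 4: "\<forall>\<^sub>F n in sequentially. real n / ln (real n) \<ge> 1" by real_asymp
  show ?thesis using 1 2 3 4
  proof eventually_elim
    case (elim n)
    define L where "L = ln (real n)"
    define m where "m = nat \<lfloor>real n / L\<rfloor>"
    obtain q q' where q: "good_denom \<alpha> q" "q \<le> m" "m < q'" "real q' \<le> real q * ln (real m) powr (201 / 200)"
      using elim(1) unfolding m_def L_def by blast
    have L1: "L \<ge> 1" using elim(3) by (simp add: L_def)
    have q1: "q \<ge> 1" using q(1) by (simp add: good_denom_def)
    have n0: "n > 0" using elim(3) by (cases n) auto
    have m: "real m \<le> real n / L" "real n / L < real m + 1"
      using elim(4) unfolding m_def L_def by linarith+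
    have "real n / L \<le> real n / 1" using L1 by (intro divide_left_mono) auto
    then have mn: "real m \<le> real n" using m(1) by simp
    have "real n / L \<le> real q'" using m(2) q(3) by linarith
    also have "\<dots> \<le> real q * ln (real m) powr (201 / 200)" by (rule q(4))
    also have "\<dots> \<le> real q * L powr (201 / 200)"
      using mn q1 q(2) unfolding L_def by (intro mult_left_mono powr_mono2) auto
    finally have "real n \<le> real q * L powr (201 / 200) * L" using L1 by (simp add: field_simps)
    also have "\<dots> = real q * L powr (401 / 200)" using L1 powr_add[of L "201/200" 1] by simp
    also have "\<dots> \<le> real q * L ^ 3" using elim(2) by (intro mult_left_mono) (auto simp: L_def)
    finally have "real n / L ^ 3 \<le> real q" using L1 by (simp add: field_simps)
    moreover have "real q \<le> real n / L" using q(2) m(1) by linarith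
    ultimately show ?case using q(1) unfolding L_def by blast
  qed
qed

lemma harm_le_ln:
  assumes "real m \<le> y" "y \<ge> 1" shows "harm m \<le> 1 + ln y"
proof (cases "m = 0")
  case True
  then show ?thesis using assms by (simp add: harm_def)
next
  case False
  have "harm m \<le> ln (real m) + 1" using False euler_mascheroni_sequence_decreasing[of 1 m] by (simp add: harm_expand)
  also have "ln (real m) \<le> ln y" using False assms by (subst ln_le_cancel_iff) auto
  finally show ?thesis by simp
qed

lemma card_near_zero:
  assumes "good_denom \<alpha> Q" "Q \<le> 2 * n"
  shows "real (card {i. i < n \<and> \<lfloor>real Q * orb \<alpha> x i\<rfloor> = J}) * real Q \<le> 9 * real n"
proof -
  have Q1: "Q \<ge> 1" using assms by (simp add: good_denom_def)
  have "real (card {i. i < n \<and> \<lfloor>real Q * orb \<alpha> x i\<rfloor> = J}) * real Q \<le> 3 * (real n / real Q + 1) * real Q"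
    by (intro mult_right_mono card_cell assms) auto
  also have "\<dots> = 3 * (real n + real Q)" using Q1 by (simp add: field_simps)
  also have "\<dots> \<le> 9 * real n" using assms(2) by simp
  finally show ?thesis .
qed

text \<open>A cell of width \<open>1 / Q\<close> contains \<open>O(n / Q)\<close> orbit points, so the cells next to zero, without the first one,
  contribute a harmonic sum.\<close>

lemma sum_inverse_cells:
  assumes "good_denom \<alpha> Q" "Q \<le> 2 * n" "y \<ge> 1"
  shows "(\<Sum>i | i < n \<and> \<lfloor>real Q * orb \<alpha> x i\<rfloor> \<ge> 1 \<and> real Q * orb \<alpha> x i < y. 1 / orb \<alpha> x i)
    \<le> 9 * real n * (1 + ln y)"
proof -
  have Q1: "Q \<ge> 1" using assms by (simp add: good_denom_def)
  define m where "m = nat \<lfloor>y\<rfloor>"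
  let ?A = "{i. i < n \<and> \<lfloor>real Q * orb \<alpha> x i\<rfloor> \<ge> 1 \<and> real Q * orb \<alpha> x i < y}"
  let ?C = "\<lambda>J. {i. i < n \<and> \<lfloor>real Q * orb \<alpha> x i\<rfloor> = int J}"
  have "?A \<subseteq> (\<Union>J\<in>{1..m}. ?C J)"
  proof
    fix i assume i: "i \<in> ?A"
    then have "\<lfloor>real Q * orb \<alpha> x i\<rfloor> \<le> \<lfloor>y\<rfloor>" by (intro floor_mono) auto
    then show "i \<in> (\<Union>J\<in>{1..m}. ?C J)"
      using i unfolding m_def by (intro UN_I[of "nat \<lfloor>real Q * orb \<alpha> x i\<rfloor>"]) (auto simp: le_nat_iff)
  qed
  then have "(\<Sum>i\<in>?A. 1 / orb \<alpha> x i) \<le> (\<Sum>i\<in>(\<Union>J\<in>{1..m}. ?C J). 1 / orb \<alpha> x i)"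
    by (intro sum_mono2) (auto simp: orb_bounds)
  also have "\<dots> = (\<Sum>J\<in>{1..m}. \<Sum>i\<in>?C J. 1 / orb \<alpha> x i)"
    by (subst sum.UNION_disjoint) auto
  also have "\<dots> \<le> (\<Sum>J\<in>{1..m}. 9 * real n * (1 / real J))"
  proof (rule sum_mono)
    fix J assume J: "J \<in> {1..m}"
    have "(\<Sum>i\<in>?C J. 1 / orb \<alpha> x i) \<le> (\<Sum>i\<in>?C J. real Q / real J)"
    proof (rule sum_mono)
      fix i assume i: "i \<in> ?C J"
      have "real J / real Q \<le> orb \<alpha> x i" using cell_bounds(1)[OF Q1, of "orb \<alpha> x i"] i by simp
      moreover have "real J / real Q > 0" using J Q1 by simp
      ultimately have "1 / orb \<alpha> x i \<le> 1 / (real J / real Q)"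
        by (intro divide_left_mono mult_pos_pos less_le_trans[of 0 "real J / real Q" "orb \<alpha> x i"]) simp_all
      then show "1 / orb \<alpha> x i \<le> real Q / real J" by simp
    qed
    also have "\<dots> = real (card (?C J)) * real Q * (1 / real J)" by simp
    also have "\<dots> \<le> 9 * real n * (1 / real J)"
      by (intro mult_right_mono card_near_zero assms) auto
    finally show "(\<Sum>i\<in>?C J. 1 / orb \<alpha> x i) \<le> 9 * real n * (1 / real J)" .
  qed
  also have "\<dots> = 9 * real n * harm m"
    by (simp add: harm_def sum_distrib_left inverse_eq_divide)
  also have "\<dots> \<le> 9 * real n * (1 + ln y)"
    using assms(3) by (intro mult_left_mono harm_le_ln) (auto simp: m_def)
  finally show ?thesis .
qed

lemma sum_inverse_first_cell:
  assumes "good_denom \<alpha> Q" "good_denom \<alpha> Q'" "Q \<le> 2 * n" "2 * n < Q'" "\<rho> > 0"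
    and "\<And>i. i < n \<Longrightarrow> orb \<alpha> x i \<ge> \<rho>"
  defines "A \<equiv> {i. i < n \<and> \<lfloor>real Q * orb \<alpha> x i\<rfloor> = 0}"
  shows "(\<Sum>i\<in>A. 1 / orb \<alpha> x i) \<le> real (card A) / \<rho>"
    "(\<Sum>i\<in>A. 1 / orb \<alpha> x i) \<le> 1 / \<rho> + 2 * real Q' * harm (card A - 1)"
proof -
  have "(\<Sum>i\<in>A. 1 / orb \<alpha> x i) \<le> (\<Sum>i\<in>A. 1 / \<rho>)"
  proof (rule sum_mono)
    fix i assume "i \<in> A"
    then have "orb \<alpha> x i \<ge> \<rho>" using assms by auto
    then show "1 / orb \<alpha> x i \<le> 1 / \<rho>" using assms(5) by (intro divide_left_mono) auto
  qed
  then show "(\<Sum>i\<in>A. 1 / orb \<alpha> x i) \<le> real (card A) / \<rho>" by simp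
next
  have Q1: "Q' \<ge> 1" using assms by (simp add: good_denom_def)
  have sep: "\<bar>orb \<alpha> x i - orb \<alpha> x j\<bar> \<ge> 1 / (2 * real Q')" if "i \<in> A" "j \<in> A" "i \<noteq> j" for i j
    using that assms(4) unfolding A_def by (intro orb_separation assms) auto
  have inj: "inj_on (orb \<alpha> x) A"
  proof (rule inj_onI, rule ccontr)
    fix i j assume "i \<in> A" "j \<in> A" "orb \<alpha> x i = orb \<alpha> x j" "i \<noteq> j"
    then show False using sep[of i j] Q1 by (auto simp: field_simps)
  qed
  have "(\<Sum>i\<in>A. 1 / orb \<alpha> x i) = (\<Sum>u\<in>orb \<alpha> x ` A. 1 / u)"
    by (simp add: sum.reindex[OF inj])
  also have "\<dots> \<le> 1 / \<rho> + harm (card (orb \<alpha> x ` A) - 1) / (1 / (2 * real Q'))"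
  proof (rule sum_inverse_separated)
    show "finite (orb \<alpha> x ` A)" by (simp add: A_def)
    show "u \<ge> \<rho>" if "u \<in> orb \<alpha> x ` A" for u using that assms(6) by (auto simp: A_def)
    show "\<bar>u - v\<bar> \<ge> 1 / (2 * real Q')" if "u \<in> orb \<alpha> x ` A" "v \<in> orb \<alpha> x ` A" "u \<noteq> v" for u v
      using that sep by auto
  qed (use Q1 assms(5) in auto)
  also have "card (orb \<alpha> x ` A) = card A" using inj by (rule card_image)
  finally show "(\<Sum>i\<in>A. 1 / orb \<alpha> x i) \<le> 1 / \<rho> + 2 * real Q' * harm (card A - 1)"
    by (simp add: mult_ac)
qed

text \<open>The exponent leaves room for a factor \<open>(log n) powr (1 / 100)\<close>: that many visits at the minimal distance
  still contribute only \<open>o(n log n)\<close> to the orbit sum of \<open>1 / x\<close>.\<close>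

definition avoid_radius :: "nat \<Rightarrow> real" where
  "avoid_radius n = 1 / (real n * ln (real n) powr (97 / 100))"

lemma avoid_radius_pos: "ln (real n) \<ge> 1 \<Longrightarrow> avoid_radius n > 0"
  unfolding avoid_radius_def by (intro divide_pos_pos mult_pos_pos) (auto intro: Nat.gr0I)

text \<open>The first cell contributes \<open>o(n log n)\<close>, although the ratio of the two denominators may exceed
  \<open>log n\<close>.  If the lower denominator \<open>Q\<close> is comparable to \<open>n\<close>, the cell has few points, each at distance at
  least \<open>avoid_radius n\<close> from zero.  If \<open>Q\<close> is much smaller than \<open>n\<close>, then the upper denominator
  \<open>Q'\<close> is below \<open>n log n\<close> by a small power of \<open>log n\<close>, and the points of the cell are separated by
  \<open>1 / (2 Q')\<close>.\<close>

lemma sum_inverse_first_cell_le: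
  assumes "good_denom \<alpha> Q" "good_denom \<alpha> Q'" "Q \<le> 2 * n" "2 * n < Q'"
    and "real Q' \<le> real Q * ln (real (2 * n)) powr (201 / 200)"
    and avoid: "\<And>i. i < n \<Longrightarrow> orb \<alpha> x i \<ge> avoid_radius n"
    and n: "ln (real n) \<ge> 1"
  defines "L \<equiv> ln (real n)" and "L2 \<equiv> ln (real (2 * n)) powr (201 / 200)"
  shows "(\<Sum>i | i < n \<and> \<lfloor>real Q * orb \<alpha> x i\<rfloor> = 0. 1 / orb \<alpha> x i)
    \<le> 3 * (L powr (1 / 100) + 1) * (real n * L powr (97 / 100))
      + 2 * (real n * L2 / L powr (1 / 100)) * (1 + ln (3 * (L2 + 1)))"
proof -
  define A where "A = {i. i < n \<and> \<lfloor>real Q * orb \<alpha> x i\<rfloor> = 0}"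
  define \<rho> where "\<rho> = avoid_radius n"
  have Q1: "Q \<ge> 1" using assms by (simp add: good_denom_def)
  have n0: "n \<ge> 1" using n by (cases n) auto
  have L1: "L \<ge> 1" using n by (simp add: L_def)
  have L2: "L2 \<ge> 1"
  proof -
    have "ln (real (2 * n)) \<ge> ln (real n)" using n0 by (subst ln_le_cancel_iff) auto
    then show ?thesis unfolding L2_def using n by (intro ge_one_powr_ge_zero) auto
  qed
  have ip: "1 / \<rho> = real n * L powr (97 / 100)" by (simp add: \<rho>_def avoid_radius_def L_def)
  have ip0: "1 / \<rho> \<ge> 0" unfolding ip by simp
  have \<rho>0: "\<rho> > 0" unfolding \<rho>_def by (rule avoid_radius_pos[OF n])
  have avoid': "\<And>i. i < n \<Longrightarrow> orb \<alpha> x i \<ge> \<rho>" using avoid by (simp add: \<rho>_def)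
  have cA: "real (card A) \<le> 3 * (real n / real Q + 1)" unfolding A_def by (rule card_cell[OF assms(1)])
  have second0: "2 * (real n * L2 / L powr (1 / 100)) * (1 + ln (3 * (L2 + 1))) \<ge> 0"
    using L2 by (intro mult_nonneg_nonneg divide_nonneg_nonneg) auto
  have "(\<Sum>i\<in>A. 1 / orb \<alpha> x i) \<le> 3 * (L powr (1 / 100) + 1) * (1 / \<rho>)
      + 2 * (real n * L2 / L powr (1 / 100)) * (1 + ln (3 * (L2 + 1)))"
  proof (cases "real n / real Q \<le> L powr (1 / 100)")
    case True
    have "(\<Sum>i\<in>A. 1 / orb \<alpha> x i) \<le> real (card A) * (1 / \<rho>)"
      using sum_inverse_first_cell(1)[OF assms(1-4) \<rho>0 avoid'] unfolding A_def by simp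
    also have "\<dots> \<le> 3 * (L powr (1 / 100) + 1) * (1 / \<rho>)"
      using True by (intro mult_right_mono ip0 order_trans[OF cA] mult_left_mono add_right_mono) auto
    finally show ?thesis using second0 by linarith
  next
    case False
    have "real Q * L powr (1 / 100) \<le> real n" using False Q1 by (simp add: field_simps)
    then have "real Q \<le> real n / L powr (1 / 100)" using L1 by (simp add: field_simps)
    then have "real Q * L2 \<le> real n / L powr (1 / 100) * L2"
      by (intro mult_right_mono) (auto simp: L2_def)
    then have Q'le: "real Q' \<le> real n * L2 / L powr (1 / 100)" using assms(5) unfolding L2_def by simp
    have "2 * real n \<le> real Q * L2" using assms(4,5) unfolding L2_def by linarith
    then have "real n / real Q \<le> L2" using Q1 L2 by (simp add: field_simps)
    then have "3 * (real n / real Q + 1) \<le> 3 * (L2 + 1)" by (intro mult_left_mono add_right_mono) auto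
    then have "real (card A) \<le> 3 * (L2 + 1)" by (rule order_trans[OF cA])
    then have "real (card A - 1) \<le> 3 * (L2 + 1)" by simp
    then have h: "harm (card A - 1) \<le> 1 + ln (3 * (L2 + 1))" using L2 by (intro harm_le_ln) auto
    have "(\<Sum>i\<in>A. 1 / orb \<alpha> x i) \<le> 1 / \<rho> + 2 * real Q' * harm (card A - 1)"
      using sum_inverse_first_cell(2)[OF assms(1-4) \<rho>0 avoid'] unfolding A_def by simp
    also have "2 * real Q' * harm (card A - 1)
        \<le> 2 * (real n * L2 / L powr (1 / 100)) * (1 + ln (3 * (L2 + 1)))"
      using Q'le h L2 by (intro mult_mono) (auto intro: harm_nonneg)
    also have "1 / \<rho> \<le> 3 * (L powr (1 / 100) + 1) * (1 / \<rho>)"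
      using mult_right_mono[OF _ ip0, of 1 "3 * (L powr (1 / 100) + 1)"] by (simp add: add_increasing)
    finally show ?thesis by linarith
  qed
  then show ?thesis unfolding ip A_def .
qed

text \<open>The separation of the first \<open>n\<close> points of an orbit requires a denominator of at least \<open>2 n\<close>.\<close>

lemma short_gaps_double:
  assumes "short_gaps \<alpha>"
  shows "\<forall>\<^sub>F n in sequentially. \<exists>q q'. good_denom \<alpha> q \<and> good_denom \<alpha> q' \<and> q \<le> 2 * n \<and> 2 * n < q' \<and>
     real q' \<le> real q * ln (real (2 * n)) powr (201 / 200)"
proof -
  have "filterlim (\<lambda>n::nat. 2 * n) at_top sequentially"
    by (rule filterlim_subseq) (auto simp: strict_mono_def)
  then show ?thesis using assms unfolding short_gaps_def filterlim_iff by blast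
qed

definition orb_avoids :: "real \<Rightarrow> nat \<Rightarrow> real \<Rightarrow> bool" where
  "orb_avoids \<alpha> n x \<longleftrightarrow> (\<forall>i<n. orb \<alpha> x i \<ge> avoid_radius n)"

text \<open>The orbit is cut into blocks of a length \<open>q\<close> slightly below \<open>n / log n\<close>, each contributing
  \<open>q log q + O(q)\<close>, where \<open>log q\<close> is asymptotic to \<open>log n\<close>.  For the upper bound the points below
  \<open>3 / q\<close> are treated on the finer scale of the denominators around \<open>2 n\<close>.\<close>

theorem sum_inverse_orb_asymp:
  assumes "short_gaps \<alpha>" "\<eta> > 0"
  shows "\<forall>\<^sub>F n in sequentially. \<forall>x. orb_avoids \<alpha> n x \<longrightarrow>
    \<bar>(\<Sum>i<n. 1 / orb \<alpha> x i) - real n * ln (real n)\<bar> \<le> \<eta> * (real n * ln (real n))"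
proof -
  define low where "low n = (real n - real n / ln (real n)) * (ln (real n / ln (real n) ^ 3) - 3 / 2)" for n
  define cells where "cells n = 9 * real n * (1 + ln (6 * ln (real n) ^ 3))" for n
  define first where "first n = 3 * (ln (real n) powr (1 / 100) + 1) * (real n * ln (real n) powr (97 / 100))
      + 2 * (real n * ln (real (2 * n)) powr (201 / 200) / ln (real n) powr (1 / 100))
        * (1 + ln (3 * (ln (real (2 * n)) powr (201 / 200) + 1)))" for n
  define up where "up n = (real n + real n / ln (real n)) * (1 + ln (real n)) + cells n + first n" for n
  have "(\<lambda>n. low n / (real n * ln (real n))) \<longlonglongrightarrow> 1" unfolding low_def by real_asymp
  then have low: "\<forall>\<^sub>F n in sequentially. low n / (real n * ln (real n)) > 1 - \<eta>"
    by (rule order_tendstoD) (use assms in auto)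
  have "(\<lambda>n. up n / (real n * ln (real n))) \<longlonglongrightarrow> 1" unfolding up_def cells_def first_def by real_asymp
  then have up: "\<forall>\<^sub>F n in sequentially. up n / (real n * ln (real n)) < 1 + \<eta>"
    by (rule order_tendstoD) (use assms in auto)
  have l1: "\<forall>\<^sub>F n in sequentially. ln (real n) \<ge> 1" by real_asymp
  have l2: "\<forall>\<^sub>F n in sequentially. ln (real n / ln (real n) ^ 3) \<ge> 3 / 2" by real_asymp
  have l3: "\<forall>\<^sub>F n in sequentially. real n / ln (real n) ^ 3 \<ge> 4" by real_asymp
  show ?thesis
    using short_gaps_medium_denom[OF assms(1)] short_gaps_double[OF assms(1)] low up l1 l2 l3
  proof eventually_elim
    case (elim n)
    obtain q where q: "good_denom \<alpha> q" "real n / ln (real n) ^ 3 \<le> real q" "real q \<le> real n / ln (real n)"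
      using elim(1) by blast
    obtain Q Q' where Q: "good_denom \<alpha> Q" "good_denom \<alpha> Q'" "Q \<le> 2 * n" "2 * n < Q'"
      "real Q' \<le> real Q * ln (real (2 * n)) powr (201 / 200)" using elim(2) by blast
    define L where "L = ln (real n)"
    have L1: "L \<ge> 1" using elim(5) by (simp add: L_def)
    have n0: "n \<ge> 1" using elim(5) by (cases n) auto
    have q4: "real q \<ge> 4" using q(2) elim(7) by linarith
    have "real n / L \<le> real n / 1" using L1 by (intro divide_left_mono) auto
    then have qn: "real q \<le> real n" using q(3) unfolding L_def[symmetric] by simp
    have nL0: "real n * ln (real n) > 0" using n0 L1 unfolding L_def by (intro mult_pos_pos) linarith+
    show ?case
    proof (intro allI impI)
      fix x assume "orb_avoids \<alpha> n x"
      then have av: "\<And>i. i < n \<Longrightarrow> orb \<alpha> x i \<ge> avoid_radius n" by (simp add: orb_avoids_def)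
      have r0: "avoid_radius n > 0" using L1 unfolding L_def by (rule avoid_radius_pos)
      have pos: "\<And>i. i < n \<Longrightarrow> orb \<alpha> x i > 0" using av r0 by (meson less_le_trans)
      have "low n \<le> (real n - real q) * (ln (real q) - 3 / 2)"
        unfolding low_def using q elim(6,7) q4 n0 L1 qn
        by (intro mult_mono diff_mono) (auto simp: L_def[symmetric] intro: order_trans)
      also have "\<dots> \<le> real (n div q) * (real q * (ln (real q) - 3 / 2))"
      proof -
        have "real n = real (n div q) * real q + real (n mod q)" by (metis div_mult_mod_eq of_nat_add of_nat_mult)
        moreover have "real (n mod q) \<le> real q" using q4 by (simp add: less_imp_le)
        ultimately have "real n - real q \<le> real (n div q) * real q" by linarith
        moreover have "ln (real q) \<ge> 3 / 2"
          using elim(6) q(2) elim(7) by (smt (verit) ln_le_cancel_iff)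
        ultimately show ?thesis by (simp only: mult.assoc[symmetric]) (intro mult_right_mono, auto)
      qed
      also have "\<dots> \<le> (\<Sum>i<n. 1 / orb \<alpha> x i)" by (rule sum_inverse_orb_ge[OF q(1) pos])
      finally have lo: "low n \<le> (\<Sum>i<n. 1 / orb \<alpha> x i)" .
      have main: "(\<Sum>i | i < n \<and> orb \<alpha> x i \<ge> 3 / q. 1 / orb \<alpha> x i) \<le> (real n + real n / L) * (1 + L)"
      proof -
        have "(\<Sum>i | i < n \<and> orb \<alpha> x i \<ge> 3 / q. 1 / orb \<alpha> x i)
            \<le> (real n / real q + 1) * (\<Sum>j\<in>{1..<q}. 1 / (real j / real q))"
          using q4 by (intro sum_orb_away_le[OF q(1)]) (auto intro: divide_left_mono)
        also have "(\<Sum>j\<in>{1..<q}. 1 / (real j / real q)) = real q * (\<Sum>j\<in>{1..<q}. inverse (real j))"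
          by (simp add: sum_distrib_left inverse_eq_divide)
        also have "{1..<q} = {1..q - 1}" using q4 by auto
        also have "(\<Sum>j\<in>{1..q - 1}. inverse (real j)) = harm (q - 1)" by (simp add: harm_def)
        also have "(real n / real q + 1) * (real q * harm (q - 1)) = (real n + real q) * harm (q - 1)"
          using q4 by (simp add: field_simps)
        also have "\<dots> \<le> (real n + real n / L) * (1 + L)"
        proof (rule mult_mono)
          show "harm (q - 1) \<le> 1 + L" unfolding L_def using n0 qn by (intro harm_le_ln) auto
        qed (use q(3) L1 in \<open>auto simp: L_def harm_nonneg\<close>)
        finally show ?thesis .
      qed
      have cell: "(\<Sum>i | i < n \<and> \<lfloor>real Q * orb \<alpha> x i\<rfloor> \<ge> 1 \<and> real Q * orb \<alpha> x i < 6 * L ^ 3. 1 / orb \<alpha> x i)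
          \<le> cells n"
      proof -
        have "6 * L ^ 3 \<ge> 1" using one_le_power[OF L1, of 3] by linarith
        then show ?thesis
          unfolding cells_def L_def[symmetric] by (rule sum_inverse_cells[OF Q(1,3)])
      qed
      have fst: "(\<Sum>i | i < n \<and> \<lfloor>real Q * orb \<alpha> x i\<rfloor> = 0. 1 / orb \<alpha> x i) \<le> first n"
        unfolding first_def by (rule sum_inverse_first_cell_le[OF Q av elim(5)])
      have cover: "{..<n} \<subseteq> {i. i < n \<and> orb \<alpha> x i \<ge> 3 / q} \<union>
          {i. i < n \<and> \<lfloor>real Q * orb \<alpha> x i\<rfloor> \<ge> 1 \<and> real Q * orb \<alpha> x i < 6 * L ^ 3} \<union>
          {i. i < n \<and> \<lfloor>real Q * orb \<alpha> x i\<rfloor> = 0}"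
      proof
        fix i assume "i \<in> {..<n}"
        then have i: "i < n" by simp
        have "real Q * orb \<alpha> x i < 6 * L ^ 3" if "orb \<alpha> x i < 3 / q"
        proof -
          have "real Q * orb \<alpha> x i < real Q * (3 / q)"
            using that Q(1) by (intro mult_strict_left_mono) (auto simp: good_denom_def)
          also have "\<dots> \<le> 2 * real n * (3 / q)" using Q(3) by (intro mult_right_mono) auto
          also have "\<dots> = 6 * (real n / real q)" by simp
          also have "real n / real q \<le> L ^ 3"
            using q(2) q4 L1 unfolding L_def[symmetric] by (simp add: field_simps)
          finally show ?thesis by simp
        qed
        moreover have "\<lfloor>real Q * orb \<alpha> x i\<rfloor> \<ge> 0" by (simp add: orb_bounds)
        then have "\<lfloor>real Q * orb \<alpha> x i\<rfloor> = 0 \<or> \<lfloor>real Q * orb \<alpha> x i\<rfloor> \<ge> 1" by linarith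
        ultimately show "i \<in> {i. i < n \<and> orb \<alpha> x i \<ge> 3 / q} \<union>
          {i. i < n \<and> \<lfloor>real Q * orb \<alpha> x i\<rfloor> \<ge> 1 \<and> real Q * orb \<alpha> x i < 6 * L ^ 3} \<union>
          {i. i < n \<and> \<lfloor>real Q * orb \<alpha> x i\<rfloor> = 0}"
          using i unfolding Un_iff mem_Collect_eq by (meson not_le)
      qed
      have un: "sum g (A \<union> B) \<le> sum g A + sum g B" if "finite A" "finite B" "\<And>i. g i \<ge> 0"
        for g :: "nat \<Rightarrow> real" and A B
        using sum.union_inter[OF that(1,2), of g] sum_nonneg[of "A \<inter> B" g] that(3) by (simp add: algebra_simps)
      have "(\<Sum>i<n. 1 / orb \<alpha> x i) \<le> (\<Sum>i\<in>{i. i < n \<and> orb \<alpha> x i \<ge> 3 / q} \<union>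
          {i. i < n \<and> \<lfloor>real Q * orb \<alpha> x i\<rfloor> \<ge> 1 \<and> real Q * orb \<alpha> x i < 6 * L ^ 3} \<union>
          {i. i < n \<and> \<lfloor>real Q * orb \<alpha> x i\<rfloor> = 0}. 1 / orb \<alpha> x i)"
        by (intro sum_mono2 cover) (auto simp: orb_bounds)
      also have "\<dots> \<le> (real n + real n / L) * (1 + L) + cells n + first n"
        by (intro order_trans[OF un] add_mono main cell fst) (auto simp: orb_bounds)
      finally have hi: "(\<Sum>i<n. 1 / orb \<alpha> x i) \<le> up n" by (simp add: up_def L_def)
      have "low n \<ge> (1 - \<eta>) * (real n * ln (real n))" "up n \<le> (1 + \<eta>) * (real n * ln (real n))"
        using elim(3,4) nL0 by (simp_all add: less_divide_eq divide_less_eq)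
      then show "\<bar>(\<Sum>i<n. 1 / orb \<alpha> x i) - real n * ln (real n)\<bar> \<le> \<eta> * (real n * ln (real n))"
        using lo hi by (simp add: algebra_simps abs_le_iff)
    qed
  qed
qed

lemma sum_powr_half_le: "(\<Sum>j\<in>{1..<Suc m}. real j powr (- 1 / 2)) \<le> 2 * real m powr (1 / 2)"
proof (induction m)
  case (Suc m)
  define a b where "a = sqrt (real m)" and "b = sqrt (real (Suc m))"
  have ab: "a \<ge> 0" "b > 0" "b \<ge> a" "b * b - a * a = 1" by (auto simp: a_def b_def)
  have "(b - a) * (a + b) = 1" using ab(4) by (simp add: algebra_simps)
  moreover have "(b - a) * (a + b) \<le> (b - a) * (2 * b)" using ab by (intro mult_left_mono) auto
  ultimately have *: "1 / b \<le> 2 * (b - a)" using ab(2) by (simp add: field_simps)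
  have "(\<Sum>j\<in>{1..<Suc (Suc m)}. real j powr (- 1 / 2))
      = real (Suc m) powr (- 1 / 2) + (\<Sum>j\<in>{1..<Suc m}. real j powr (- 1 / 2))"
    by (simp del: of_nat_Suc)
  also have "real (Suc m) powr (- 1 / 2) = 1 / b"
    by (simp add: b_def powr_minus powr_half_sqrt inverse_eq_divide del: of_nat_Suc)
  also have "1 / b + (\<Sum>j\<in>{1..<Suc m}. real j powr (- 1 / 2)) \<le> 2 * b"
    using Suc * by (simp add: a_def powr_half_sqrt)
  finally show ?case by (simp add: b_def powr_half_sqrt del: of_nat_Suc)
qed simp

text \<open>The roof function itself is dominated by \<open>x powr (-1/2)\<close>, whose orbit sums grow linearly; the few
  points of the cells next to zero contribute at most the square root of \<open>1 / \<rho>\<close> each.\<close>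

theorem sum_powr_orb_le:
  assumes "short_gaps \<alpha>"
  shows "\<forall>\<^sub>F n in sequentially. \<forall>x. orb_avoids \<alpha> n x \<longrightarrow>
    (\<Sum>i<n. orb \<alpha> x i powr (- 1 / 2)) \<le> 5 * real n"
proof -
  have l1: "\<forall>\<^sub>F n in sequentially. ln (real n) \<ge> 1" by real_asymp
  have l2: "\<forall>\<^sub>F n in sequentially.
      9 * (ln (real n) ^ 3 + 1) * (real n * ln (real n) powr (97 / 100)) powr (1 / 2) \<le> real n" by real_asymp
  have l3: "\<forall>\<^sub>F n in sequentially. real n / ln (real n) ^ 3 \<ge> 4" by real_asymp
  show ?thesis
    using short_gaps_medium_denom[OF assms] l1 l2 l3
  proof eventually_elim
    case (elim n)
    obtain q where q: "good_denom \<alpha> q" "real n / ln (real n) ^ 3 \<le> real q" "real q \<le> real n / ln (real n)"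
      using elim(1) by blast
    define L where "L = ln (real n)"
    have L1: "L \<ge> 1" using elim(2) by (simp add: L_def)
    have n0: "n \<ge> 1" using elim(2) by (cases n) auto
    have q4: "real q \<ge> 4" using q(2) elim(4) by linarith
    have "real n / L \<le> real n / 1" using L1 by (intro divide_left_mono) auto
    then have qn: "real q \<le> real n" using q(3) unfolding L_def[symmetric] by simp
    have nq: "real n / real q \<le> L ^ 3"
      using q(2) q4 L1 unfolding L_def[symmetric] by (simp add: field_simps)
    show ?case
    proof (intro allI impI)
      fix x assume "orb_avoids \<alpha> n x"
      then have av: "\<And>i. i < n \<Longrightarrow> orb \<alpha> x i \<ge> avoid_radius n" by (simp add: orb_avoids_def)
      have r0: "avoid_radius n > 0" using L1 unfolding L_def by (rule avoid_radius_pos)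
      let ?g = "\<lambda>u::real. u powr (- 1 / 2)"
      have anti: "?g v \<le> ?g u" if "0 < u" "u \<le> v" for u v :: real
        using that by (intro powr_mono2') auto
      have main: "(\<Sum>i | i < n \<and> orb \<alpha> x i \<ge> 3 / q. ?g (orb \<alpha> x i)) \<le> 4 * real n"
      proof -
        have "(\<Sum>i | i < n \<and> orb \<alpha> x i \<ge> 3 / q. ?g (orb \<alpha> x i))
            \<le> (real n / real q + 1) * (\<Sum>j\<in>{1..<q}. ?g (real j / real q))"
          using q4 by (intro sum_orb_away_le[OF q(1)] anti) auto
        also have "(\<Sum>j\<in>{1..<q}. ?g (real j / real q)) = real q powr (1/2) * (\<Sum>j\<in>{1..<q}. real j powr (-1/2))"
          using q4 by (simp add: sum_distrib_left powr_divide powr_minus field_simps)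
        also have "\<dots> \<le> real q powr (1/2) * (2 * real (q - 1) powr (1/2))"
          using sum_powr_half_le[of "q - 1"] q4 by (intro mult_left_mono) auto
        also have "\<dots> \<le> real q powr (1/2) * (2 * real q powr (1/2))"
          by (intro mult_left_mono powr_mono2) auto
        also have "\<dots> = 2 * real q" using q4 by (simp add: powr_half_sqrt)
        also have "(real n / real q + 1) * (2 * real q) = 2 * (real n + real q)" using q4 by (simp add: field_simps)
        finally show ?thesis using qn q4 by (simp add: mult_left_mono)
      qed
      have near: "(\<Sum>i | i < n \<and> orb \<alpha> x i < 3 / q. ?g (orb \<alpha> x i)) \<le> real n"
      proof -
        let ?N = "{i. i < n \<and> orb \<alpha> x i < 3 / q}"
        let ?C = "\<lambda>J. {i. i < n \<and> \<lfloor>real q * orb \<alpha> x i\<rfloor> = J}"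
        have "?N \<subseteq> ?C 0 \<union> (?C 1 \<union> ?C 2)"
        proof
          fix i assume i: "i \<in> ?N"
          then have "real q * orb \<alpha> x i < 3" using q4 by (simp add: field_simps)
          moreover have "real q * orb \<alpha> x i \<ge> 0" by (simp add: orb_bounds)
          ultimately have "\<lfloor>real q * orb \<alpha> x i\<rfloor> \<in> {0, 1, 2}" by simp linarith
          then show "i \<in> ?C 0 \<union> (?C 1 \<union> ?C 2)" using i by auto
        qed
        then have "card ?N \<le> card (?C 0 \<union> (?C 1 \<union> ?C 2))" by (intro card_mono) auto
        also have "\<dots> \<le> card (?C 0) + (card (?C 1) + card (?C 2))"
          by (intro order_trans[OF card_Un_le] add_mono order_refl)
        finally have "real (card ?N) \<le> real (card (?C 0)) + real (card (?C 1)) + real (card (?C 2))" by linarith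
        also have "\<dots> \<le> 9 * (real n / real q + 1)"
          using card_cell[OF q(1), of n x 0] card_cell[OF q(1), of n x 1] card_cell[OF q(1), of n x 2] by linarith
        also have "\<dots> \<le> 9 * (L ^ 3 + 1)" using nq by (intro mult_left_mono add_right_mono) auto
        finally have cN: "real (card ?N) \<le> 9 * (L ^ 3 + 1)" .
        have "(\<Sum>i\<in>?N. ?g (orb \<alpha> x i)) \<le> (\<Sum>i\<in>?N. ?g (avoid_radius n))"
          by (intro sum_mono anti r0) (use av in auto)
        also have "\<dots> = real (card ?N) * (real n * L powr (97 / 100)) powr (1 / 2)"
          using n0 L1 by (simp add: avoid_radius_def L_def powr_minus powr_divide)
        also have "\<dots> \<le> 9 * (L ^ 3 + 1) * (real n * L powr (97 / 100)) powr (1 / 2)"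
          by (intro mult_right_mono cN) auto
        finally show ?thesis using elim(3) unfolding L_def by linarith
      qed
      have "(\<Sum>i<n. ?g (orb \<alpha> x i)) = (\<Sum>i | i < n \<and> orb \<alpha> x i \<ge> 3 / q. ?g (orb \<alpha> x i))
          + (\<Sum>i | i < n \<and> orb \<alpha> x i < 3 / q. ?g (orb \<alpha> x i))"
        by (subst sum.union_disjoint[symmetric]) (auto intro!: sum.cong)
      then show "(\<Sum>i<n. ?g (orb \<alpha> x i)) \<le> 5 * real n" using main near by linarith
    qed
  qed
qed

section \<open>The roof function\<close>

lemma bounded_by_ends:
  fixes h g :: "real \<Rightarrow> real"
  assumes "continuous_on {0<..<1} h" "\<And>x. x \<in> {0<..<1} \<Longrightarrow> g x \<ge> 0"
    and "\<forall>\<^sub>F x in at_right 0. h x \<le> g x" "\<forall>\<^sub>F x in at_left 1. h x \<le> g x"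
  obtains K where "K \<ge> 0" "\<And>x. x \<in> {0<..<1} \<Longrightarrow> h x \<le> g x + K"
proof -
  obtain a where a: "a > 0" "\<And>x. 0 < x \<Longrightarrow> x < a \<Longrightarrow> h x \<le> g x"
    using assms(3) by (auto simp: eventually_at_right_field)
  obtain b where b: "b < 1" "\<And>x. b < x \<Longrightarrow> x < 1 \<Longrightarrow> h x \<le> g x"
    using assms(4) by (auto simp: eventually_at_left_field)
  define a' b' where "a' = min a (1/2)" and "b' = max b (1/2)"
  have ab: "0 < a'" "a' \<le> b'" "b' < 1" using a b by (auto simp: a'_def b'_def)
  have "continuous_on {a'..b'} h" using ab by (intro continuous_on_subset[OF assms(1)]) auto
  then have "compact (h ` {a'..b'})" by (intro compact_continuous_image) auto
  then obtain K0 where K0: "\<And>x. x \<in> {a'..b'} \<Longrightarrow> \<bar>h x\<bar> \<le> K0"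
    using compact_imp_bounded by (fastforce simp: bounded_iff)
  show ?thesis
  proof (rule that[of "max K0 0"])
    fix x :: real assume x: "x \<in> {0<..<1}"
    consider "x < a" | "x > b" | "x \<in> {a'..b'}" by (fastforce simp: a'_def b'_def)
    then show "h x \<le> g x + max K0 0"
    proof cases
      case 3 then show ?thesis using K0[OF 3] assms(2)[OF x] by linarith
    qed (use a b x in \<open>force+\<close>)
  qed simp
qed

lemma deriv_neg_log: "x > 0 \<Longrightarrow> deriv neg_log x = - 1 / x"
  unfolding neg_log_def [abs_def]
  by (rule DERIV_imp_deriv) (auto intro!: derivative_eq_intros)

text \<open>A roof with a logarithmic singularity, described by a positive lower bound \<open>c\<close>, a crude bound by a power that is
  convenient for integrals and orbit sums, and the principal part of its derivative.  The
  asymmetry \<open>A \<noteq> B\<close> is what prevents the two ends from cancelling.\<close>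

locale log_roof =
  fixes f :: "real \<Rightarrow> real" and c K A B :: real
  assumes c_pos: "c > 0" and f_ge: "\<And>x. x \<in> {0<..<1} \<Longrightarrow> f x \<ge> c"
    and f_le: "\<And>x. x \<in> {0<..<1} \<Longrightarrow> f x \<le> K * (x powr (- 1 / 2) + (1 - x) powr (- 1 / 2))"
    and f_deriv: "\<And>x. x \<in> {0<..<1} \<Longrightarrow> (f has_real_derivative deriv f x) (at x)"
    and AB: "A > 0" "B > 0" "A \<noteq> B"
    and deriv_close: "\<And>\<eta>. \<eta> > 0 \<Longrightarrow> \<exists>C\<ge>0. \<forall>x\<in>{0<..<1}.
      \<bar>deriv f x - (B / (1 - x) - A / x)\<bar> \<le> \<eta> * (1 / x + 1 / (1 - x)) + C"

text \<open>Near the two ends each property follows from the given limits; in between it holds by compactness.\<close>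

lemma arnold_roof_log_roof:
  assumes "arnold_roof f" obtains c K A B where "log_roof f c K A B"
proof -
  obtain A B :: "nat \<Rightarrow> real" where AB0: "\<forall>i\<in>{1, 2, 3}. A i > 0 \<and> B i > 0 \<and> A i \<noteq> B i"
    and f0: "((\<lambda>x. f x / neg_log x) \<longlongrightarrow> A 1) (at_right 0)"
    and f1: "((\<lambda>x. f x / neg_log (1 - x)) \<longlongrightarrow> B 1) (at_left 1)"
    and d0: "((\<lambda>x. deriv f x / deriv neg_log x) \<longlongrightarrow> A 2) (at_right 0)"
    and d1: "((\<lambda>x. deriv f x / deriv neg_log (1 - x)) \<longlongrightarrow> - B 2) (at_left 1)"
    and C2: "C2_on f {0<..<1}" and fpos0: "\<forall>x\<in>{0<..<1}. f x > 0"
    using assms unfolding arnold_roof_def by (elim conjE exE) (rule that; assumption)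
  have AB: "A i > 0 \<and> B i > 0 \<and> A i \<noteq> B i" if "i \<in> {1, 2, 3}" for i using AB0 that by blast
  have fpos: "f x > 0" if "x \<in> {0<..<1}" for x using fpos0 that by blast
  have nbhd: "\<forall>\<^sub>F x in at_right 0. x \<in> {0<..<1::real}" "\<forall>\<^sub>F x in at_left 1. x \<in> {0<..<1::real}"
    using eventually_at_right_real[of 0 "1::real"] eventually_at_left_real[of "0::real" 1] by simp_all
  have small: "\<forall>\<^sub>F x in at_right 0. x < (1 / 2 :: real)" "\<forall>\<^sub>F x in at_left 1. x > (1 / 2 :: real)"
    by (auto simp: eventually_at_right_field eventually_at_left_field intro!: exI[of _ "1/2::real"])
  have fd: "(f has_real_derivative deriv f x) (at x)" if "x \<in> {0<..<1}" for x
    using C2 that unfolding C2_on_def by (simp add: DERIV_deriv_iff_real_differentiable)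
  have fc: "continuous_on {0<..<1} f"
    using fd by (intro DERIV_continuous_on[where D = "deriv f"]) (blast intro: DERIV_subset)
  have dc: "continuous_on {0<..<1} (deriv f)"
  proof (rule continuous_at_imp_continuous_on, rule ballI)
    fix x :: real assume "x \<in> {0<..<1}"
    then have "deriv f differentiable at x" using C2 unfolding C2_on_def by simp
    then show "isCont (deriv f) x" by (rule differentiable_imp_continuous_within)
  qed
  have F0: "filterlim f at_top (at_right 0)"
  proof -
    have "filterlim neg_log at_top (at_right 0)" unfolding neg_log_def [abs_def] by real_asymp
    then have "filterlim (\<lambda>x. f x / neg_log x * neg_log x) at_top (at_right 0)"
      using AB[of 1] by (intro filterlim_tendsto_pos_mult_at_top[OF f0]) auto
    then show ?thesis
    proof (rule filterlim_mono_eventually[OF _ order_refl order_refl])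
      show "\<forall>\<^sub>F x in at_right 0. f x / neg_log x * neg_log x = f x"
        using nbhd(1) by eventually_elim (auto simp: neg_log_def)
    qed
  qed
  have F1: "filterlim f at_top (at_left 1)"
  proof -
    have "filterlim (\<lambda>x. neg_log (1 - x)) at_top (at_left 1)" unfolding neg_log_def [abs_def] by real_asymp
    then have "filterlim (\<lambda>x. f x / neg_log (1 - x) * neg_log (1 - x)) at_top (at_left 1)"
      using AB[of 1] by (intro filterlim_tendsto_pos_mult_at_top[OF f1]) auto
    then show ?thesis
    proof (rule filterlim_mono_eventually[OF _ order_refl order_refl])
      show "\<forall>\<^sub>F x in at_left 1. f x / neg_log (1 - x) * neg_log (1 - x) = f x"
        using nbhd(2) by eventually_elim (auto simp: neg_log_def)
    qed
  qed
  obtain c where c: "c > 0" "\<And>x. x \<in> {0<..<1} \<Longrightarrow> f x \<ge> c"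
  proof -
    have "\<forall>\<^sub>F x in at_right 0. 1 / f x \<le> 1" "\<forall>\<^sub>F x in at_left 1. 1 / f x \<le> 1"
      using F0 F1 unfolding filterlim_at_top by (auto elim!: allE[of _ 1] eventually_mono simp: divide_le_eq_1)
    moreover have "continuous_on {0<..<1} (\<lambda>x. 1 / f x)"
      using fpos by (intro continuous_intros fc) (metis less_irrefl)
    ultimately obtain M where M: "M \<ge> 0" "\<And>x. x \<in> {0<..<1} \<Longrightarrow> 1 / f x \<le> 1 + M"
      using bounded_by_ends[of "\<lambda>x. 1 / f x" "\<lambda>_. 1"] by auto
    show ?thesis
    proof (rule that[of "1 / (1 + M)"])
      fix x :: real assume x: "x \<in> {0<..<1}"
      show "1 / (1 + M) \<le> f x" using M(1) M(2)[OF x] fpos[OF x] by (simp add: field_simps)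
    qed (use M in auto)
  qed
  obtain K where K: "\<And>x. x \<in> {0<..<1} \<Longrightarrow> f x \<le> K * (x powr (- 1 / 2) + (1 - x) powr (- 1 / 2))"
  proof -
    have "((\<lambda>x. f x / neg_log x * (neg_log x / x powr (- 1 / 2))) \<longlongrightarrow> A 1 * 0) (at_right 0)"
      unfolding neg_log_def by (intro tendsto_mult f0[unfolded neg_log_def]) real_asymp
    then have "\<forall>\<^sub>F x in at_right 0. f x / neg_log x * (neg_log x / x powr (- 1 / 2)) < 1"
      by (rule order_tendstoD) simp
    then have 1: "\<forall>\<^sub>F x in at_right 0. f x \<le> x powr (- 1 / 2) + (1 - x) powr (- 1 / 2)"
      using nbhd(1)
    proof eventually_elim
      case (elim x)
      have "f x / x powr (- 1 / 2) < 1" using elim by (auto simp: neg_log_def)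
      then have "f x < x powr (- 1 / 2)" using elim by (simp add: divide_less_eq)
      then show ?case using powr_ge_zero[of "1 - x" "- 1 / 2"] by linarith
    qed
    have "((\<lambda>x. f x / neg_log (1 - x) * (neg_log (1 - x) / (1 - x) powr (- 1 / 2))) \<longlongrightarrow> B 1 * 0) (at_left 1)"
      unfolding neg_log_def by (intro tendsto_mult f1[unfolded neg_log_def]) real_asymp
    then have "\<forall>\<^sub>F x in at_left 1. f x / neg_log (1 - x) * (neg_log (1 - x) / (1 - x) powr (- 1 / 2)) < 1"
      by (rule order_tendstoD) simp
    then have 2: "\<forall>\<^sub>F x in at_left 1. f x \<le> x powr (- 1 / 2) + (1 - x) powr (- 1 / 2)"
      using nbhd(2)
    proof eventually_elim
      case (elim x)
      have "f x / (1 - x) powr (- 1 / 2) < 1" using elim by (auto simp: neg_log_def)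
      then have "f x < (1 - x) powr (- 1 / 2)" using elim by (simp add: divide_less_eq)
      then show ?case using powr_ge_zero[of x "- 1 / 2"] by linarith
    qed
    obtain M where M: "M \<ge> 0" "\<And>x. x \<in> {0<..<1} \<Longrightarrow> f x \<le> x powr (- 1 / 2) + (1 - x) powr (- 1 / 2) + M"
      using bounded_by_ends[OF fc _ 1 2] by auto
    show ?thesis
    proof (rule that[of "1 + M"])
      fix x :: real assume x: "x \<in> {0<..<1}"
      have "x powr (- 1 / 2) \<ge> 1 powr (- 1 / 2)" using x by (intro powr_mono2') auto
      then have "x powr (- 1 / 2) \<ge> 1" by simp
      then have "x powr (- 1 / 2) + (1 - x) powr (- 1 / 2) \<ge> 1"
        using powr_ge_zero[of "1 - x" "- 1 / 2"] by linarith
      then have "M * 1 \<le> M * (x powr (- 1 / 2) + (1 - x) powr (- 1 / 2))"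
        using M(1) by (intro mult_left_mono) auto
      then show "f x \<le> (1 + M) * (x powr (- 1 / 2) + (1 - x) powr (- 1 / 2))"
        using M(2)[OF x] by (simp add: algebra_simps)
    qed
  qed
  have D: "\<exists>C\<ge>0. \<forall>x\<in>{0<..<1}. \<bar>deriv f x - (B 2 / (1 - x) - A 2 / x)\<bar> \<le> \<eta> * (1 / x + 1 / (1 - x)) + C"
    if \<eta>: "\<eta> > 0" for \<eta>
  proof -
    define g where "g x = \<eta> * (1 / x + 1 / (1 - x)) + 2 * (A 2 + B 2)" for x :: real
    have "\<forall>\<^sub>F x in at_right 0. dist (deriv f x / deriv neg_log x) (A 2) < \<eta>"
      by (rule tendstoD[OF d0 \<eta>])
    then have 1: "\<forall>\<^sub>F x in at_right 0. \<bar>deriv f x - (B 2 / (1 - x) - A 2 / x)\<bar> \<le> g x"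
      using nbhd(1) small(1)
    proof eventually_elim
      case (elim x)
      have "\<bar>- (x * deriv f x) - A 2\<bar> < \<eta>" using elim by (simp add: deriv_neg_log dist_real_def mult.commute)
      then have "\<bar>x * deriv f x + A 2\<bar> / x \<le> \<eta> / x" using elim by (intro divide_right_mono) auto
      moreover have "x * deriv f x + A 2 = x * (deriv f x + A 2 / x)"
        using elim by (simp add: distrib_left)
      then have "\<bar>x * deriv f x + A 2\<bar> / x = \<bar>deriv f x + A 2 / x\<bar>"
        using elim by (simp only: abs_mult) simp
      ultimately have h1: "\<bar>deriv f x + A 2 / x\<bar> \<le> \<eta> / x" by simp
      have h2: "B 2 / (1 - x) \<le> 2 * B 2" using elim AB[of 2] divide_left_mono[of "1 / 2" "1 - x" "B 2"] by simp
      have h3: "B 2 / (1 - x) \<ge> 0" "\<eta> / (1 - x) \<ge> 0" using elim AB[of 2] \<eta> by auto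
      have aux: "\<bar>p - (v - u)\<bar> \<le> e + e' + 2 * a + 2 * b"
        if "\<bar>p + u\<bar> \<le> e" "v \<le> 2 * b" "0 \<le> v" "0 \<le> e'" "0 < a" for p u v e e' a b :: real
        using that by linarith
      have "g x = \<eta> / x + \<eta> / (1 - x) + 2 * A 2 + 2 * B 2" by (simp add: g_def distrib_left)
      then show ?case using aux[OF h1 h2 h3] AB[of 2] by simp
    qed
    have "\<forall>\<^sub>F x in at_left 1. dist (deriv f x / deriv neg_log (1 - x)) (- B 2) < \<eta>"
      by (rule tendstoD[OF d1 \<eta>])
    then have 2: "\<forall>\<^sub>F x in at_left 1. \<bar>deriv f x - (B 2 / (1 - x) - A 2 / x)\<bar> \<le> g x"
      using nbhd(2) small(2)
    proof eventually_elim
      case (elim x)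
      have "\<bar>- ((1 - x) * deriv f x) + B 2\<bar> < \<eta>" using elim by (simp add: deriv_neg_log dist_real_def mult.commute)
      then have "\<bar>(1 - x) * deriv f x - B 2\<bar> / (1 - x) \<le> \<eta> / (1 - x)" using elim by (intro divide_right_mono) auto
      moreover have "(1 - x) * deriv f x - B 2 = (1 - x) * (deriv f x - B 2 / (1 - x))"
        using elim by (simp add: right_diff_distrib)
      then have "\<bar>(1 - x) * deriv f x - B 2\<bar> / (1 - x) = \<bar>deriv f x - B 2 / (1 - x)\<bar>"
        using elim by (simp only: abs_mult) simp
      ultimately have h1: "\<bar>deriv f x - B 2 / (1 - x)\<bar> \<le> \<eta> / (1 - x)" by simp
      have h2: "A 2 / x \<le> 2 * A 2" using elim AB[of 2] divide_left_mono[of "1 / 2" x "A 2"] by simp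
      have h3: "A 2 / x \<ge> 0" "\<eta> / x \<ge> 0" using elim AB[of 2] \<eta> by auto
      have aux: "\<bar>p - (v - u)\<bar> \<le> e + e' + 2 * a + 2 * b"
        if "\<bar>p - v\<bar> \<le> e'" "u \<le> 2 * a" "0 \<le> u" "0 \<le> e" "0 < b" for p u v e e' a b :: real
        using that by linarith
      have "g x = \<eta> / x + \<eta> / (1 - x) + 2 * A 2 + 2 * B 2" by (simp add: g_def distrib_left)
      then show ?case using aux[OF h1 h2 h3] AB[of 2] by simp
    qed
    have "continuous_on {0<..<1} (\<lambda>x. \<bar>deriv f x - (B 2 / (1 - x) - A 2 / x)\<bar>)"
      by (intro continuous_intros dc) auto
    then obtain M where M: "M \<ge> 0" "\<And>x. x \<in> {0<..<1} \<Longrightarrow> \<bar>deriv f x - (B 2 / (1 - x) - A 2 / x)\<bar> \<le> g x + M"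
      using \<eta> AB[of 2] by (rule_tac bounded_by_ends[OF _ _ 1 2]) (auto simp: g_def)
    show ?thesis
      using M AB[of 2] by (intro exI[of _ "2 * (A 2 + B 2) + M"]) (auto simp: g_def add.assoc)
  qed
  show ?thesis
    by (rule that[of c K "A 2" "B 2"], unfold_locales) (use c K D fd AB[of 2] in auto)
qed

section \<open>Birkhoff sums of the roof and of its derivative\<close>

definition orb_avoids2 :: "real \<Rightarrow> nat \<Rightarrow> real \<Rightarrow> bool" where
  "orb_avoids2 \<alpha> n x \<longleftrightarrow> (\<forall>i<n. avoid_radius n \<le> orb \<alpha> x i \<and> orb \<alpha> x i \<le> 1 - avoid_radius n)"

lemma orb_uminus:
  assumes "orb \<alpha> x i > 0" shows "orb (- \<alpha>) (- x) i = 1 - orb \<alpha> x i"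
proof -
  have "orb (- \<alpha>) (- x) i = frac (- (x + real i * \<alpha>))" by (simp add: orb_def)
  moreover have "x + real i * \<alpha> \<notin> \<int>" using assms by (simp add: orb_def frac_gt_0_iff)
  ultimately show ?thesis by (simp only: frac_neg if_False orb_def)
qed

text \<open>The reflection \<open>x \<mapsto> -x\<close> conjugates the two rotations and exchanges the two ends of the circle.\<close>

lemma orb_avoids_uminus:
  assumes "orb_avoids2 \<alpha> n x" "ln (real n) \<ge> 1"
  shows "orb_avoids (- \<alpha>) n (- x)" "\<And>i. i < n \<Longrightarrow> orb (- \<alpha>) (- x) i = 1 - orb \<alpha> x i"
proof -
  show *: "orb (- \<alpha>) (- x) i = 1 - orb \<alpha> x i" if "i < n" for i
    using assms that avoid_radius_pos[OF assms(2)] by (intro orb_uminus) (auto simp: orb_avoids2_def intro: less_le_trans)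
  show "orb_avoids (- \<alpha>) n (- x)"
    using assms(1) * unfolding orb_avoids_def orb_avoids2_def by fastforce
qed

text \<open>The orbit sums of \<open>1 / x\<close> and, by reflection, of \<open>1 / (1 - x)\<close> are asymptotic to \<open>n log n\<close>, so that the sum of
  the derivatives is asymptotic to \<open>(B - A) n log n\<close>.\<close>

theorem (in log_roof) birkhoff_estimates:
  assumes "short_gaps \<alpha>"
  obtains c1 C1 where "c1 > 0" "C1 > 0" "\<forall>\<^sub>F n in sequentially. \<forall>x. orb_avoids2 \<alpha> n x \<longrightarrow>
    c1 * (real n * ln (real n)) \<le> \<bar>\<Sum>i<n. deriv f (orb \<alpha> x i)\<bar> \<and>
    (\<Sum>i<n. \<bar>deriv f (orb \<alpha> x i)\<bar>) \<le> C1 * (real n * ln (real n)) \<and>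
    (\<Sum>i<n. f (orb \<alpha> x i)) \<le> C1 * real n"
proof -
  define D where "D = \<bar>B - A\<bar>"
  have D: "D > 0" "D \<le> A + B" using AB by (auto simp: D_def)
  define \<eta> where "\<eta> = D / (8 * (A + B))"
  have \<eta>: "\<eta> > 0" "\<eta> \<le> 1" using D AB by (auto simp: \<eta>_def field_simps)
  obtain C where C: "C \<ge> 0" "\<And>x. x \<in> {0<..<1} \<Longrightarrow>
      \<bar>deriv f x - (B / (1 - x) - A / x)\<bar> \<le> D / 32 * (1 / x + 1 / (1 - x)) + C"
    using deriv_close[of "D / 32"] D by auto
  define C1 where "C1 = 2 * (A + B) + D + 10 * \<bar>K\<bar>"
  have Cl: "\<forall>\<^sub>F n in sequentially. C * real n \<le> D / 8 * (real n * ln (real n))"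
  proof -
    have "(\<lambda>n. C * real n / (real n * ln (real n))) \<longlonglongrightarrow> 0" by real_asymp
    then have "\<forall>\<^sub>F n in sequentially. C * real n / (real n * ln (real n)) < D / 8"
      by (rule order_tendstoD) (use D in auto)
    moreover have "\<forall>\<^sub>F n in sequentially. real n * ln (real n) > 0" by real_asymp
    ultimately show ?thesis
      by eventually_elim (simp only: pos_divide_less_eq less_imp_le)
  qed
  have l1: "\<forall>\<^sub>F n in sequentially. ln (real n) \<ge> 1" by real_asymp
  note sg' = short_gaps_uminus[OF assms]
  have "\<forall>\<^sub>F n in sequentially. \<forall>x. orb_avoids2 \<alpha> n x \<longrightarrow>
    D / 2 * (real n * ln (real n)) \<le> \<bar>\<Sum>i<n. deriv f (orb \<alpha> x i)\<bar> \<and>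
    (\<Sum>i<n. \<bar>deriv f (orb \<alpha> x i)\<bar>) \<le> C1 * (real n * ln (real n)) \<and>
    (\<Sum>i<n. f (orb \<alpha> x i)) \<le> C1 * real n"
    using sum_inverse_orb_asymp[OF assms \<eta>(1)] sum_inverse_orb_asymp[OF sg' \<eta>(1)]
      sum_powr_orb_le[OF assms] sum_powr_orb_le[OF sg'] Cl l1
  proof eventually_elim
    case (elim n)
    define W where "W = real n * ln (real n)"
    have W0: "W \<ge> 0" using elim(6) by (simp add: W_def)
    show ?case
    proof (intro allI impI)
      fix x assume av: "orb_avoids2 \<alpha> n x"
      define u where "u = orb \<alpha> x"
      have av1: "orb_avoids \<alpha> n x" using av by (simp add: orb_avoids_def orb_avoids2_def)
      note av2 = orb_avoids_uminus[OF av elim(6)]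
      have u01: "u i \<in> {0<..<1}" if "i < n" for i
        using av that avoid_radius_pos[OF elim(6)] unfolding u_def orb_avoids2_def by fastforce
      define U V where "U = (\<Sum>i<n. 1 / u i)" and "V = (\<Sum>i<n. 1 / (1 - u i))"
      have U: "\<bar>U - W\<bar> \<le> \<eta> * W" using elim(1) av1 by (simp add: U_def W_def u_def)
      have V: "\<bar>V - W\<bar> \<le> \<eta> * W"
      proof -
        have "V = (\<Sum>i<n. 1 / orb (- \<alpha>) (- x) i)" unfolding V_def by (intro sum.cong) (auto simp: av2(2) u_def)
        then show ?thesis using elim(2) av2(1) by (simp add: W_def)
      qed
      have UV: "U \<le> 2 * W" "V \<le> 2 * W" using U V mult_right_mono[OF \<eta>(2) W0] by linarith+
      have E: "(\<Sum>i<n. \<bar>deriv f (u i) - (B / (1 - u i) - A / u i)\<bar>) \<le> D / 4 * W"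
      proof -
        have "(\<Sum>i<n. \<bar>deriv f (u i) - (B / (1 - u i) - A / u i)\<bar>)
            \<le> (\<Sum>i<n. D / 32 * (1 / u i + 1 / (1 - u i)) + C)"
          by (intro sum_mono C u01) auto
        also have "\<dots> = D / 32 * (U + V) + C * real n"
          by (simp only: sum.distrib sum_distrib_left[symmetric] U_def V_def) simp
        also have "\<dots> \<le> D / 32 * (4 * W) + D / 8 * W"
          using UV D elim(5) by (intro add_mono mult_left_mono) (auto simp: W_def)
        finally show ?thesis by simp
      qed
      have "(\<Sum>i<n. deriv f (u i)) - (B * V - A * U) = (\<Sum>i<n. deriv f (u i) - (B / (1 - u i) - A / u i))"
        by (simp add: U_def V_def sum_subtractf sum_distrib_left)
      then have 1: "\<bar>(\<Sum>i<n. deriv f (u i)) - (B * V - A * U)\<bar> \<le> D / 4 * W"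
        using sum_abs[of "\<lambda>i. deriv f (u i) - (B / (1 - u i) - A / u i)" "{..<n}"] E by linarith
      have "\<bar>(B * V - A * U) - (B - A) * W\<bar> = \<bar>B * (V - W) - A * (U - W)\<bar>" by (simp add: algebra_simps)
      also have "\<dots> \<le> B * \<bar>V - W\<bar> + A * \<bar>U - W\<bar>"
        using AB by (intro order_trans[OF abs_triangle_ineq4]) (simp add: abs_mult)
      also have "\<dots> \<le> B * (\<eta> * W) + A * (\<eta> * W)" using U V AB by (intro add_mono mult_left_mono) auto
      also have "\<dots> = (\<eta> * (A + B)) * W" by (simp add: algebra_simps)
      also have "\<eta> * (A + B) = D / 8"
      proof -
        have "A + B \<noteq> 0" using AB by linarith
        then show ?thesis unfolding \<eta>_def by (simp only: times_divide_eq_left) (metis mult_divide_mult_cancel_right)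
      qed
      finally have 2: "\<bar>(B * V - A * U) - (B - A) * W\<bar> \<le> D / 8 * W" .
      have 3: "\<bar>(B - A) * W\<bar> = D * W" using W0 by (simp add: D_def abs_mult)
      have DW: "D * W \<ge> 0" using D W0 by simp
      have "D / 2 * W \<le> \<bar>\<Sum>i<n. deriv f (u i)\<bar>" using 1 2 3 DW by linarith
      moreover have "(\<Sum>i<n. \<bar>deriv f (u i)\<bar>) \<le> C1 * W"
      proof -
        have "(\<Sum>i<n. \<bar>deriv f (u i)\<bar>)
            \<le> (\<Sum>i<n. \<bar>deriv f (u i) - (B / (1 - u i) - A / u i)\<bar> + (B * (1 / (1 - u i)) + A * (1 / u i)))"
        proof (rule sum_mono)
          fix i assume "i \<in> {..<n}"
          then have "u i \<in> {0<..<1}" using u01 by simp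
          then have "B / (1 - u i) \<ge> 0" "A / u i \<ge> 0" using AB by auto
          then show "\<bar>deriv f (u i)\<bar> \<le> \<bar>deriv f (u i) - (B / (1 - u i) - A / u i)\<bar> + (B * (1 / (1 - u i)) + A * (1 / u i))"
            by (simp add: abs_if)
        qed
        also have "\<dots> = (\<Sum>i<n. \<bar>deriv f (u i) - (B / (1 - u i) - A / u i)\<bar>) + (B * V + A * U)"
          by (simp add: sum.distrib sum_distrib_left U_def V_def)
        also have "\<dots> \<le> D / 4 * W + (B * (2 * W) + A * (2 * W))"
          using E UV AB by (intro add_mono mult_left_mono) auto
        also have "\<dots> \<le> C1 * W"
        proof -
          have "\<bar>K\<bar> * W \<ge> 0" using W0 by simp
          then show ?thesis using DW unfolding C1_def by (simp add: algebra_simps)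
        qed
        finally show ?thesis .
      qed
      moreover have "(\<Sum>i<n. f (u i)) \<le> C1 * real n"
      proof -
        have "(\<Sum>i<n. f (u i)) \<le> (\<Sum>i<n. \<bar>K\<bar> * (u i powr (- 1 / 2) + (1 - u i) powr (- 1 / 2)))"
        proof (rule sum_mono)
          fix i assume "i \<in> {..<n}"
          then have "u i \<in> {0<..<1}" using u01 by simp
          then have "f (u i) \<le> K * (u i powr (- 1 / 2) + (1 - u i) powr (- 1 / 2))" by (rule f_le)
          also have "\<dots> \<le> \<bar>K\<bar> * (u i powr (- 1 / 2) + (1 - u i) powr (- 1 / 2))" by (intro mult_right_mono) auto
          finally show "f (u i) \<le> \<bar>K\<bar> * (u i powr (- 1 / 2) + (1 - u i) powr (- 1 / 2))" .
        qed
        also have "\<dots> = \<bar>K\<bar> * ((\<Sum>i<n. u i powr (- 1 / 2)) + (\<Sum>i<n. (1 - u i) powr (- 1 / 2)))"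
          by (simp only: sum.distrib sum_distrib_left[symmetric])
        also have "\<dots> \<le> \<bar>K\<bar> * (5 * real n + 5 * real n)"
        proof (intro mult_left_mono add_mono)
          show "(\<Sum>i<n. u i powr (- 1 / 2)) \<le> 5 * real n" using elim(3) av1 by (simp add: u_def)
          have "(\<Sum>i<n. (1 - u i) powr (- 1 / 2)) = (\<Sum>i<n. orb (- \<alpha>) (- x) i powr (- 1 / 2))"
            by (intro sum.cong) (auto simp: av2(2) u_def)
          then show "(\<Sum>i<n. (1 - u i) powr (- 1 / 2)) \<le> 5 * real n" using elim(4) av2(1) by simp
        qed auto
        also have "\<dots> \<le> C1 * real n" using D AB by (simp add: C1_def algebra_simps)
        finally show ?thesis .
      qed
      ultimately show "D / 2 * (real n * ln (real n)) \<le> \<bar>\<Sum>i<n. deriv f (orb \<alpha> x i)\<bar> \<and>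
        (\<Sum>i<n. \<bar>deriv f (orb \<alpha> x i)\<bar>) \<le> C1 * (real n * ln (real n)) \<and>
        (\<Sum>i<n. f (orb \<alpha> x i)) \<le> C1 * real n"
        by (simp add: W_def u_def)
    qed
  qed
  moreover have "D / 2 > 0" "C1 > 0" using D AB by (simp_all add: C1_def add_pos_nonneg)
  ultimately show ?thesis by (intro that[of "D / 2" C1])
qed

section \<open>The special flow\<close>

definition base_points :: "real \<Rightarrow> real set" where
  "base_points \<alpha> = {x. 0 \<le> x \<and> x < 1 \<and> (\<forall>n. rot \<alpha> n x \<noteq> 0)}"

definition bsum :: "real \<Rightarrow> (real \<Rightarrow> real) \<Rightarrow> real \<Rightarrow> nat \<Rightarrow> real" where
  "bsum \<alpha> f x n = (\<Sum>i<n. f (orb \<alpha> x i))"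

lemma rot_of_nat: "rot \<alpha> (int n) x = orb \<alpha> x n"
  by (simp add: rot_def orb_def)

lemma rot_rot: "rot \<alpha> m (rot \<alpha> n x) = rot \<alpha> (m + n) x"
  by (simp add: rot_def frac_frac_add algebra_simps)

lemma orb_orb: "orb \<alpha> (orb \<alpha> x m) i = orb \<alpha> x (m + i)"
  by (simp add: orb_def frac_frac_add algebra_simps)

lemma orb_0: "0 \<le> x \<Longrightarrow> x < 1 \<Longrightarrow> orb \<alpha> x 0 = x"
  by (simp add: orb_def frac_eq)

lemma base_pointsD:
  assumes "x \<in> base_points \<alpha>"
  shows "rot \<alpha> n x \<in> {0<..<1}" "orb \<alpha> x i \<in> {0<..<1}" "x \<in> {0<..<1}"
proof -
  have *: "rot \<alpha> n x \<in> {0<..<1}" for n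
    using assms frac_ge_0[of "x + of_int n * \<alpha>"] frac_lt_1[of "x + of_int n * \<alpha>"]
    by (simp add: base_points_def rot_def order_less_le)
  show "rot \<alpha> n x \<in> {0<..<1}" by (rule *)
  show "orb \<alpha> x i \<in> {0<..<1}" using *[of "int i"] by (simp only: rot_of_nat)
  have "rot \<alpha> 0 x = x" using assms by (simp add: rot_def base_points_def frac_eq)
  then show "x \<in> {0<..<1}" using *[of 0] by simp
qed

lemma rot_base_points: "x \<in> base_points \<alpha> \<Longrightarrow> rot \<alpha> n x \<in> base_points \<alpha>"
  by (auto simp: base_points_def rot_rot) (auto simp: rot_def frac_lt_1)

lemma orb_base_points: "x \<in> base_points \<alpha> \<Longrightarrow> orb \<alpha> x n \<in> base_points \<alpha>"
  using rot_base_points[of x \<alpha> "int n"] by (simp only: rot_of_nat)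

lemma bsum_0 [simp]: "bsum \<alpha> f x 0 = 0" by (simp add: bsum_def)

lemma bsum_Suc: "bsum \<alpha> f x (Suc n) = bsum \<alpha> f x n + f (orb \<alpha> x n)"
  by (simp add: bsum_def)

lemma bsum_add: "bsum \<alpha> f x (m + n) = bsum \<alpha> f x m + bsum \<alpha> f (orb \<alpha> x m) n"
  by (induction n) (simp_all add: bsum_Suc orb_orb)

lemma birkhoff_of_nat: "birkhoff \<alpha> f (int n) x = bsum \<alpha> f x n"
proof -
  have "(\<Sum>i\<in>{0..<int n}. f (rot \<alpha> i x)) = (\<Sum>i<n. f (orb \<alpha> x i))"
    by (rule sum.reindex_bij_witness[of _ int nat]) (auto simp: rot_of_nat[symmetric])
  then show ?thesis by (simp add: birkhoff_def bsum_def)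
qed

lemma birkhoff_step: "birkhoff \<alpha> f (n + 1) x = birkhoff \<alpha> f n x + f (rot \<alpha> n x)"
proof (cases "n \<ge> 0")
  case True
  have "{0..<n + 1} = insert n {0..<n}" using True by auto
  then show ?thesis using True by (simp add: birkhoff_def)
next
  case False
  have "{1..- n} = insert (- n) {1..- (n + 1)}" using False by auto
  then show ?thesis using False by (cases "n = - 1") (simp_all add: birkhoff_def)
qed

text \<open>For nonnegative times the flow only needs forward orbits.  The number of crossings as a least natural number
  is a measurable function of the point and the time, and it agrees with the unique integer in the definition of
  the flow (\<open>special_flow_eq\<close>).\<close>

definition flow_index :: "real \<Rightarrow> (real \<Rightarrow> real) \<Rightarrow> real \<Rightarrow> real \<Rightarrow> nat" where
  "flow_index \<alpha> f x h = (LEAST n. h < bsum \<alpha> f x (Suc n))"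

definition flow_map :: "real \<Rightarrow> (real \<Rightarrow> real) \<Rightarrow> real \<Rightarrow> real \<times> real \<Rightarrow> real \<times> real" where
  "flow_map \<alpha> f t z = (let N = flow_index \<alpha> f (fst z) (snd z + t)
     in (orb \<alpha> (fst z) N, snd z + t - bsum \<alpha> f (fst z) N))"

lemma flow_space_iff: "(x, s) \<in> flow_space \<alpha> f \<longleftrightarrow> x \<in> base_points \<alpha> \<and> 0 \<le> s \<and> s < f x"
  by (auto simp: flow_space_def base_points_def)

context log_roof
begin

lemma f_pos: "x \<in> {0<..<1} \<Longrightarrow> f x > 0"
  using f_ge c_pos by (meson less_le_trans)

lemma bsum_ge:
  assumes "x \<in> base_points \<alpha>" shows "bsum \<alpha> f x n \<ge> c * real n"
proof (induction n)
  case (Suc n)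
  then show ?case using f_ge[OF base_pointsD(2)[OF assms], of n] by (simp add: bsum_Suc distrib_left)
qed simp

lemma bsum_nonneg: "x \<in> base_points \<alpha> \<Longrightarrow> bsum \<alpha> f x n \<ge> 0"
  using bsum_ge[of x \<alpha> n] c_pos by (meson mult_nonneg_nonneg of_nat_0_le_iff order_less_imp_le order_trans)

lemma bsum_mono:
  assumes "x \<in> base_points \<alpha>" "m \<le> n" shows "bsum \<alpha> f x m + c * real (n - m) \<le> bsum \<alpha> f x n"
  using bsum_add[of \<alpha> f x m "n - m"] bsum_ge[OF orb_base_points[OF assms(1), of m], of "n - m"] assms(2) by simp

lemma flow_index_props:
  assumes "x \<in> base_points \<alpha>" "h \<ge> 0"
  defines "N \<equiv> flow_index \<alpha> f x h"
  shows "bsum \<alpha> f x N \<le> h" "h < bsum \<alpha> f x (Suc N)"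
proof -
  obtain n where "h < c * real n" using c_pos by (metis mult.commute reals_Archimedean3)
  then have "h < bsum \<alpha> f x n" using bsum_ge[OF assms(1), of n] by linarith
  then have "h < bsum \<alpha> f x (Suc n)" using bsum_mono[OF assms(1), of n "Suc n"] c_pos by simp
  then show N: "h < bsum \<alpha> f x (Suc N)" unfolding N_def flow_index_def by (rule LeastI)
  show "bsum \<alpha> f x N \<le> h"
  proof (cases N)
    case 0
    then show ?thesis using assms by simp
  next
    case (Suc m)
    then have "\<not> h < bsum \<alpha> f x (Suc m)"
      unfolding N_def flow_index_def by (metis lessI not_less_Least)
    then show ?thesis using Suc by simp
  qed
qed

lemma flow_index_unique:
  assumes "x \<in> base_points \<alpha>" "bsum \<alpha> f x n \<le> h" "h < bsum \<alpha> f x (Suc n)"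
  shows "flow_index \<alpha> f x h = n"
proof -
  have h: "h \<ge> 0" using bsum_nonneg[OF assms(1), of n] assms(2) by linarith
  note P = flow_index_props[OF assms(1) h]
  have mono: "bsum \<alpha> f x i \<le> bsum \<alpha> f x j" if "i \<le> j" for i j
    using bsum_mono[OF assms(1) that] c_pos by (smt (verit) mult_nonneg_nonneg of_nat_0_le_iff)
  show ?thesis
  proof (rule ccontr)
    assume "flow_index \<alpha> f x h \<noteq> n"
    then consider "Suc (flow_index \<alpha> f x h) \<le> n" | "Suc n \<le> flow_index \<alpha> f x h" by linarith
    then show False
    proof cases
      case 1 then show False using mono[OF 1] P assms by linarith
    next
      case 2 then show False using mono[OF 2] P assms by linarith
    qed
  qed
qed

lemma birkhoff_strict_mono:
  assumes "x \<in> base_points \<alpha>" "m < n" shows "birkhoff \<alpha> f m x < birkhoff \<alpha> f n x"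
proof -
  have "birkhoff \<alpha> f m x < birkhoff \<alpha> f (m + 1 + int k) x" for k
  proof (induction k)
    case 0
    then show ?case using f_pos[OF base_pointsD(1)[OF assms(1), of m]] by (simp add: birkhoff_step)
  next
    case (Suc k)
    then show ?case
      using f_pos[OF base_pointsD(1)[OF assms(1), of "m + 1 + int k"]] birkhoff_step[of \<alpha> f "m + 1 + int k" x]
      by (simp add: algebra_simps)
  qed
  from this[of "nat (n - m - 1)"] show ?thesis using assms(2) by simp
qed

lemma special_flow_eq:
  assumes "z \<in> flow_space \<alpha> f" "t \<ge> 0"
  shows "special_flow \<alpha> f t z = flow_map \<alpha> f t z"
proof -
  obtain x s where z: "z = (x, s)" by (cases z)
  have x: "x \<in> base_points \<alpha>" and s: "0 \<le> s" using assms(1) by (auto simp: z flow_space_iff)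
  define N where "N = flow_index \<alpha> f x (s + t)"
  have N: "bsum \<alpha> f x N \<le> s + t" "s + t < bsum \<alpha> f x (Suc N)"
    unfolding N_def using flow_index_props[OF x] s assms(2) by auto
  have "(THE N. birkhoff \<alpha> f N x \<le> s + t \<and> s + t < birkhoff \<alpha> f (N + 1) x) = int N"
  proof (rule the_equality)
    show "birkhoff \<alpha> f (int N) x \<le> s + t \<and> s + t < birkhoff \<alpha> f (int N + 1) x"
      using N birkhoff_of_nat[of \<alpha> f "Suc N" x] by (simp add: birkhoff_of_nat add.commute)
    fix M assume M: "birkhoff \<alpha> f M x \<le> s + t \<and> s + t < birkhoff \<alpha> f (M + 1) x"
    show "M = int N"
    proof (rule ccontr)
      assume "M \<noteq> int N"
      then consider "M + 1 \<le> int N" | "int N + 1 \<le> M" by linarith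
      then show False
      proof cases
        case 1
        then have "birkhoff \<alpha> f (M + 1) x \<le> birkhoff \<alpha> f (int N) x"
          using birkhoff_strict_mono[OF x, of "M + 1" "int N"] by (cases "M + 1 = int N") auto
        then show False using M N by (simp add: birkhoff_of_nat)
      next
        case 2
        then have "birkhoff \<alpha> f (int (Suc N)) x \<le> birkhoff \<alpha> f M x"
          using birkhoff_strict_mono[OF x, of "int (Suc N)" M] by (cases "M = int (Suc N)") auto
        then show False using M N unfolding birkhoff_of_nat by linarith
      qed
    qed
  qed
  then show ?thesis
    unfolding z special_flow_def flow_map_def prod.case Let_def
    by (simp add: N_def[symmetric] birkhoff_of_nat rot_of_nat)
qed

lemma flow_map_in_space:
  assumes "z \<in> flow_space \<alpha> f" "t \<ge> 0" shows "flow_map \<alpha> f t z \<in> flow_space \<alpha> f"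
proof -
  obtain x s where z: "z = (x, s)" by (cases z)
  have x: "x \<in> base_points \<alpha>" and s: "0 \<le> s" using assms(1) by (auto simp: z flow_space_iff)
  then show ?thesis
    using flow_index_props[OF x, of "s + t"] s assms(2) orb_base_points[OF x]
    unfolding z flow_map_def Let_def by (auto simp: flow_space_iff bsum_Suc)
qed

end

subsection \<open>Measurability\<close>

text \<open>Outside \<open>(0,1)\<close> the roof is arbitrary, possibly not measurable; there it is replaced by zero.\<close>

definition cut_roof :: "(real \<Rightarrow> real) \<Rightarrow> real \<Rightarrow> real" where
  "cut_roof f x = (if x \<in> {0<..<1} then f x else 0)"

lemma bsum_cut:
  assumes "x \<in> base_points \<alpha>" shows "bsum \<alpha> (cut_roof f) x = bsum \<alpha> f x"
  using base_pointsD(2)[OF assms] by (auto simp: bsum_def cut_roof_def fun_eq_iff intro!: sum.cong)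

lemma flow_map_cut:
  assumes "z \<in> flow_space \<alpha> f" shows "flow_map \<alpha> (cut_roof f) t z = flow_map \<alpha> f t z"
  using assms bsum_cut[of "fst z" \<alpha> f]
  by (cases z) (auto simp: flow_map_def flow_index_def flow_space_iff)

lemma frac_measurable [measurable]: "(frac :: real \<Rightarrow> real) \<in> borel_measurable borel"
  unfolding frac_def [abs_def] by measurable

lemma orb_measurable [measurable]: "(\<lambda>x. orb \<alpha> x i) \<in> borel_measurable borel"
  unfolding orb_def by measurable

lemma rot_measurable [measurable]: "(\<lambda>x. rot \<alpha> i x) \<in> borel_measurable borel"
  unfolding rot_def by measurable

lemma base_points_measurable [measurable]: "base_points \<alpha> \<in> sets borel"
proof -
  have "{x \<in> space borel. 0 \<le> x \<and> x < 1 \<and> (\<forall>n. rot \<alpha> n x \<noteq> 0)} \<in> sets borel" by measurable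
  then show ?thesis by (simp add: base_points_def)
qed

lemma base_points_emeasure: "emeasure lborel ({0..<1} - base_points \<alpha>) = 0"
proof -
  have "{0..<1} - base_points \<alpha> \<subseteq> (\<Union>n::int. range (\<lambda>m::int. of_int m - of_int n * \<alpha>))"
  proof
    fix x assume "x \<in> {0..<1} - base_points \<alpha>"
    then obtain n where "rot \<alpha> n x = 0" by (auto simp: base_points_def)
    then have "x = of_int \<lfloor>x + of_int n * \<alpha>\<rfloor> - of_int n * \<alpha>" by (simp add: rot_def frac_def)
    then show "x \<in> (\<Union>n::int. range (\<lambda>m::int. of_int m - of_int n * \<alpha>))" by blast
  qed
  then have "countable ({0..<1} - base_points \<alpha>)" by (rule countable_subset) auto
  then show ?thesis by (rule emeasure_lborel_countable)
qed

context log_roof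
begin

lemma cut_roof_measurable [measurable]: "cut_roof f \<in> borel_measurable borel"
proof -
  have "continuous_on {0<..<1} f"
    using f_deriv by (intro DERIV_continuous_on[where D = "deriv f"]) (blast intro: DERIV_subset)
  then have "(\<lambda>x. indicator {0<..<1} x *\<^sub>R f x) \<in> borel_measurable borel"
    by (intro borel_measurable_continuous_on_indicator) auto
  also have "(\<lambda>x. indicator {0<..<1} x *\<^sub>R f x) = cut_roof f"
    by (auto simp: cut_roof_def fun_eq_iff indicator_def)
  finally show ?thesis .
qed

lemma bsum_cut_measurable [measurable]: "(\<lambda>x. bsum \<alpha> (cut_roof f) x n) \<in> borel_measurable borel"
  unfolding bsum_def by measurable

lemma flow_map_measurable [measurable]:
  "(\<lambda>(z, t). flow_map \<alpha> (cut_roof f) t z) \<in> borel_measurable ((borel \<Otimes>\<^sub>M borel) \<Otimes>\<^sub>M borel)"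
proof -
  define I where "I = (\<lambda>(z :: real \<times> real, t :: real). flow_index \<alpha> (cut_roof f) (fst z) (snd z + t))"
  have [measurable]: "I \<in> (borel \<Otimes>\<^sub>M borel) \<Otimes>\<^sub>M borel \<rightarrow>\<^sub>M count_space UNIV"
    unfolding I_def flow_index_def by measurable
  have "(\<lambda>p. (orb \<alpha> (fst (fst p)) (I p), snd (fst p) + snd p - bsum \<alpha> (cut_roof f) (fst (fst p)) (I p)))
      \<in> (borel \<Otimes>\<^sub>M borel) \<Otimes>\<^sub>M borel \<rightarrow>\<^sub>M borel \<Otimes>\<^sub>M borel"
    by measurable
  then show ?thesis
    unfolding borel_prod by (simp add: I_def flow_map_def split_def Let_def)
qed

lemma flow_space_measurable [measurable]: "flow_space \<alpha> f \<in> sets (borel \<Otimes>\<^sub>M borel)"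
proof -
  have "flow_space \<alpha> f = {z \<in> space (borel \<Otimes>\<^sub>M borel). fst z \<in> base_points \<alpha> \<and> 0 \<le> snd z \<and> snd z < cut_roof f (fst z)}"
    using base_pointsD(3) by (auto simp: flow_space_iff cut_roof_def space_pair_measure)
  also have "\<dots> \<in> sets (borel \<Otimes>\<^sub>M borel)" by measurable
  finally show ?thesis .
qed

text \<open>The roof is dominated by the integrable function \<open>x powr (-1/2) + (1 - x) powr (-1/2)\<close>.\<close>

lemma flow_space_finite: "emeasure (lborel \<Otimes>\<^sub>M lborel) (flow_space \<alpha> f) < \<infinity>"
proof -
  have i1: "(\<lambda>x. x powr (- 1 / 2)) integrable_on {0..1::real}"
    by (rule integrable_on_powr_from_0) auto
  have i2: "(\<lambda>x. (1 - x) powr (- 1 / 2)) integrable_on {0..1::real}"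
    using integrable_affinity[OF i1[unfolded interval_cbox], of "-1" 1] by (simp add: image_affinity_atLeastAtMost_diff)
  define G where "G x = \<bar>K\<bar> * (x powr (- 1 / 2) + (1 - x) powr (- 1 / 2))" for x :: real
  have "G integrable_on {0..1}"
    unfolding G_def [abs_def] using integrable_cmul[OF integrable_add[OF i1 i2], of "\<bar>K\<bar>"] by simp
  then obtain J where J: "(G has_integral J) {0..1}" by (auto simp: integrable_on_def)
  have "emeasure (lborel \<Otimes>\<^sub>M lborel) (flow_space \<alpha> f)
      = (\<integral>\<^sup>+x. emeasure lborel (Pair x -` flow_space \<alpha> f) \<partial>lborel)"
    by (rule lborel.emeasure_pair_measure_alt) (simp add: sets_pair_measure_cong[of lborel borel lborel borel])
  also have "\<dots> \<le> (\<integral>\<^sup>+x. ennreal (G x) * indicator {0..1} x \<partial>lborel)"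
  proof (rule nn_integral_mono)
    fix x :: real
    show "emeasure lborel (Pair x -` flow_space \<alpha> f) \<le> ennreal (G x) * indicator {0..1} x"
    proof (cases "x \<in> base_points \<alpha>")
      case True
      have x: "x \<in> {0<..<1}" using True by (rule base_pointsD)
      have "f x \<le> K * (x powr (- 1 / 2) + (1 - x) powr (- 1 / 2))" by (rule f_le[OF x])
      also have "\<dots> \<le> G x" unfolding G_def by (intro mult_right_mono) auto
      finally have fG: "f x \<le> G x" .
      have "emeasure lborel (Pair x -` flow_space \<alpha> f) \<le> emeasure lborel {0..f x}"
        by (intro emeasure_mono) (auto simp: flow_space_iff)
      also have "\<dots> = ennreal (f x)" using f_pos[OF x] by simp
      also have "\<dots> \<le> ennreal (G x)" using fG by (rule ennreal_leI)
      finally show ?thesis using x by simp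
    qed (auto simp: flow_space_iff vimage_def)
  qed
  also have "\<dots> = ennreal J"
    by (rule nn_integral_has_integral_lebesgue'[OF _ J]) (auto simp: G_def)
  also have "\<dots> < \<infinity>" by simp
  finally show ?thesis .
qed

lemma flow_space_pos: "emeasure (lborel \<Otimes>\<^sub>M lborel) (flow_space \<alpha> f) > 0"
proof -
  have "emeasure lborel (base_points \<alpha>) = emeasure lborel {0..<1::real}"
  proof -
    have "emeasure lborel {0..<1::real} = emeasure lborel (base_points \<alpha> \<union> ({0..<1} - base_points \<alpha>))"
      by (intro arg_cong[of _ _ "emeasure lborel"]) (auto simp: base_points_def)
    also have "\<dots> = emeasure lborel (base_points \<alpha>)"
      by (intro emeasure_Un_null_set) (auto simp: null_sets_def base_points_emeasure)
    finally show ?thesis ..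
  qed
  then have b: "emeasure lborel (base_points \<alpha>) = 1" by simp
  have "0 < ennreal c" using c_pos by simp
  also have "ennreal c = emeasure (lborel \<Otimes>\<^sub>M lborel) (base_points \<alpha> \<times> {0..<c})"
    using c_pos by (subst lborel.emeasure_pair_measure_Times) (auto simp: b)
  also have "\<dots> \<le> emeasure (lborel \<Otimes>\<^sub>M lborel) (flow_space \<alpha> f)"
  proof (rule emeasure_mono)
    show "base_points \<alpha> \<times> {0..<c} \<subseteq> flow_space \<alpha> f"
      using f_ge[OF base_pointsD(3)] by (force simp: flow_space_iff)
    show "flow_space \<alpha> f \<in> sets (lborel \<Otimes>\<^sub>M lborel)"
      using flow_space_measurable by (simp add: sets_pair_measure_cong[of lborel borel lborel borel])
  qed
  finally show ?thesis .
qed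

end

subsection \<open>The invariant measure\<close>

context log_roof
begin

lemma space_flow_measure: "space (flow_measure \<alpha> f) = flow_space \<alpha> f"
  by (simp add: flow_measure_def space_scale_measure space_restrict_space space_pair_measure)

lemma flow_space_borel [measurable]: "flow_space \<alpha> f \<in> sets borel"
  using flow_space_measurable[of \<alpha>] unfolding borel_prod .

lemma sets_flow_measure: "Y \<in> sets (flow_measure \<alpha> f) \<longleftrightarrow> Y \<in> sets borel \<and> Y \<subseteq> flow_space \<alpha> f"
  unfolding flow_measure_def sets_scale_measure lborel_prod
  using flow_space_borel[of \<alpha>] by (subst sets_restrict_space_iff) auto

definition total_mass :: "real \<Rightarrow> real" where
  "total_mass \<alpha> = measure lborel (flow_space \<alpha> f)"

lemma emeasure_flow_space: "emeasure lborel (flow_space \<alpha> f) = ennreal (total_mass \<alpha>)"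
  and total_mass_pos: "total_mass \<alpha> > 0"
proof -
  have fin: "emeasure lborel (flow_space \<alpha> f) < \<infinity>" using flow_space_finite[of \<alpha>] by (simp add: lborel_prod)
  then show e: "emeasure lborel (flow_space \<alpha> f) = ennreal (total_mass \<alpha>)"
    unfolding total_mass_def by (intro emeasure_eq_ennreal_measure) simp
  show "total_mass \<alpha> > 0" using flow_space_pos[of \<alpha>] by (simp add: lborel_prod e)
qed

lemma emeasure_flow_measure:
  assumes "Y \<in> sets borel" "Y \<subseteq> flow_space \<alpha> f"
  shows "emeasure (flow_measure \<alpha> f) Y = ennreal (inverse (total_mass \<alpha>)) * emeasure lborel Y"
proof -
  have "emeasure (restrict_space lborel (flow_space \<alpha> f)) Y = emeasure lborel Y"
    using flow_space_borel[of \<alpha>] assms by (intro emeasure_restrict_space) auto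
  then show ?thesis
    using total_mass_pos[of \<alpha>] by (simp add: flow_measure_def lborel_prod emeasure_flow_space inverse_ennreal)
qed

lemma finite_lborel_subset:
  assumes "Y \<subseteq> flow_space \<alpha> f" shows "emeasure lborel Y \<noteq> \<infinity>"
proof -
  have "emeasure lborel Y \<le> emeasure lborel (flow_space \<alpha> f)"
    using assms flow_space_borel[of \<alpha>] by (intro emeasure_mono) auto
  then show ?thesis using emeasure_flow_space[of \<alpha>] by (auto simp: top_unique)
qed

lemma measure_flow_mono:
  assumes "Y \<subseteq> Z" "Z \<subseteq> flow_space \<alpha> f" "Y \<in> sets borel" "Z \<in> sets borel"
  shows "measure lborel Y \<le> measure lborel Z"
  using assms finite_lborel_subset[of Z \<alpha>]
  by (intro measure_mono_fmeasurable) (auto simp: fmeasurable_def less_top[symmetric])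

lemma measure_flow_measure:
  assumes "Y \<in> sets borel" "Y \<subseteq> flow_space \<alpha> f"
  shows "measure (flow_measure \<alpha> f) Y = measure lborel Y / total_mass \<alpha>"
  using emeasure_flow_measure[OF assms] total_mass_pos[of \<alpha>]
  by (simp add: measure_def enn2real_mult divide_inverse mult.commute)

end

subsection \<open>Rotation invariance and occupation times\<close>

lemma nn_integral_rotation:
  fixes g :: "real \<Rightarrow> ennreal"
  assumes [measurable]: "g \<in> borel_measurable borel"
  shows "(\<integral>\<^sup>+x. g (frac (x + a)) * indicator {0..<1} x \<partial>lborel) = (\<integral>\<^sup>+x. g x * indicator {0..<1} x \<partial>lborel)"
proof -
  define b where "b = frac a"
  have b: "0 \<le> b" "b < 1" by (auto simp: b_def frac_lt_1)
  have fr: "frac (x + a) = (if x < 1 - b then x + b else x + b - 1)" if "0 \<le> x" "x < 1" for x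
  proof -
    have "frac (x + a) = frac (b + x)" unfolding b_def frac_frac_add by (simp add: add.commute)
    also have "\<dots> = (if x < 1 - b then x + b else x + b - 1)"
      using that b by (auto simp: frac_unique_iff)
    finally show ?thesis .
  qed
  have "(\<integral>\<^sup>+x. g (frac (x + a)) * indicator {0..<1} x \<partial>lborel)
      = (\<integral>\<^sup>+x. g (b + 1 * x) * indicator {b..<1} (b + 1 * x) + g (b - 1 + 1 * x) * indicator {0..<b} (b - 1 + 1 * x) \<partial>lborel)"
    using b by (intro nn_integral_cong) (auto simp: fr indicator_def algebra_simps)
  also have "\<dots> = (\<integral>\<^sup>+x. g (b + 1 * x) * indicator {b..<1} (b + 1 * x) \<partial>lborel)
      + (\<integral>\<^sup>+x. g (b - 1 + 1 * x) * indicator {0..<b} (b - 1 + 1 * x) \<partial>lborel)"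
    by (rule nn_integral_add) measurable
  also have "(\<integral>\<^sup>+x. g (b + 1 * x) * indicator {b..<1} (b + 1 * x) \<partial>lborel) = (\<integral>\<^sup>+x. g x * indicator {b..<1} x \<partial>lborel)"
    using nn_integral_real_affine[of "\<lambda>x. g x * indicator {b..<1} x" 1 b] by simp
  also have "(\<integral>\<^sup>+x. g (b - 1 + 1 * x) * indicator {0..<b} (b - 1 + 1 * x) \<partial>lborel) = (\<integral>\<^sup>+x. g x * indicator {0..<b} x \<partial>lborel)"
    using nn_integral_real_affine[of "\<lambda>x. g x * indicator {0..<b} x" 1 "b - 1"] by simp
  also have "(\<integral>\<^sup>+x. g x * indicator {b..<1} x \<partial>lborel) + (\<integral>\<^sup>+x. g x * indicator {0..<b} x \<partial>lborel)
      = (\<integral>\<^sup>+x. g x * indicator {b..<1} x + g x * indicator {0..<b} x \<partial>lborel)"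
    by (rule nn_integral_add[symmetric]) measurable
  also have "\<dots> = (\<integral>\<^sup>+x. g x * indicator {0..<1} x \<partial>lborel)"
    using b by (intro nn_integral_cong) (auto simp: indicator_def)
  finally show ?thesis .
qed

lemma emeasure_rotation:
  fixes A :: "real set" and a :: real
  assumes "A \<in> sets borel" "A \<subseteq> {0..<1}"
  shows "emeasure lborel {x \<in> {0..<1}. frac (x + a) \<in> A} = emeasure lborel A"
proof -
  have [measurable]: "A \<in> sets borel" by fact
  have m: "{x \<in> {0..<1}. frac (x + a) \<in> A} \<in> sets borel"
  proof -
    have "(\<lambda>x. frac (x + a)) \<in> borel_measurable borel" by measurable
    then have "(\<lambda>x. frac (x + a)) -` A \<inter> space borel \<in> sets borel" using assms(1) by (rule measurable_sets)
    then have "{0..<1} \<inter> ((\<lambda>x. frac (x + a)) -` A \<inter> space borel) \<in> sets borel" by (intro sets.Int) auto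
    moreover have "{0..<1} \<inter> ((\<lambda>x. frac (x + a)) -` A \<inter> space borel) = {x \<in> {0..<1}. frac (x + a) \<in> A}" by auto
    ultimately show ?thesis by simp
  qed
  have "emeasure lborel {x \<in> {0..<1}. frac (x + a) \<in> A}
      = (\<integral>\<^sup>+x. indicator A (frac (x + a)) * indicator {0..<1} x \<partial>lborel)"
  proof -
    have "(\<integral>\<^sup>+x. indicator A (frac (x + a)) * indicator {0..<1} x \<partial>lborel)
        = (\<integral>\<^sup>+x. indicator {x \<in> {0..<1}. frac (x + a) \<in> A} x \<partial>lborel)"
      by (intro nn_integral_cong) (auto simp: indicator_def)
    also have "\<dots> = emeasure lborel {x \<in> {0..<1}. frac (x + a) \<in> A}"
      using m by (intro nn_integral_indicator) auto
    finally show ?thesis ..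
  qed
  also have "\<dots> = (\<integral>\<^sup>+x. indicator A x * indicator {0..<1} x \<partial>lborel)"
    by (rule nn_integral_rotation) measurable
  also have "\<dots> = (\<integral>\<^sup>+x. indicator A x \<partial>lborel)"
    using assms(2) by (intro nn_integral_cong) (auto simp: indicator_def)
  finally show ?thesis by simp
qed

definition section_length :: "real \<Rightarrow> (real \<Rightarrow> real) \<Rightarrow> (real \<times> real) set \<Rightarrow> real \<Rightarrow> ennreal" where
  "section_length \<alpha> f V x = emeasure lborel (Pair x -` (V \<inter> flow_space \<alpha> f))"

context log_roof
begin

lemma section_length_measurable [measurable]:
  assumes "V \<in> sets borel" shows "section_length \<alpha> f V \<in> borel_measurable borel"
proof -
  have "V \<inter> flow_space \<alpha> f \<in> sets (borel \<Otimes>\<^sub>M lborel)"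
  proof -
    have "sets (borel \<Otimes>\<^sub>M lborel) = sets (borel \<Otimes>\<^sub>M (borel :: real measure) :: (real \<times> real) measure)"
      by (rule sets_pair_measure_cong) auto
    also have "\<dots> = sets borel" by (simp only: borel_prod)
    finally show ?thesis using assms flow_space_borel[of \<alpha>] by blast
  qed
  from lborel.measurable_emeasure_Pair[OF this] show ?thesis
    unfolding section_length_def [abs_def] by simp
qed

lemma section_length_integral:
  assumes "V \<in> sets borel"
  shows "(\<integral>\<^sup>+x. section_length \<alpha> f V x * indicator {0..<1} x \<partial>lborel) = emeasure lborel (V \<inter> flow_space \<alpha> f)"
proof -
  have "V \<inter> flow_space \<alpha> f \<in> sets (lborel \<Otimes>\<^sub>M lborel)"
    unfolding lborel_prod using assms flow_space_borel[of \<alpha>] by auto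
  from lborel.emeasure_pair_measure_alt[OF this]
  have "emeasure lborel (V \<inter> flow_space \<alpha> f) = (\<integral>\<^sup>+x. section_length \<alpha> f V x \<partial>lborel)"
    by (simp add: lborel_prod section_length_def)
  also have "\<dots> = (\<integral>\<^sup>+x. section_length \<alpha> f V x * indicator {0..<1} x \<partial>lborel)"
  proof (rule nn_integral_cong)
    fix x
    show "section_length \<alpha> f V x = section_length \<alpha> f V x * indicator {0..<1} x"
    proof (cases "x \<in> {0..<1}")
      case False
      then have "Pair x -` (V \<inter> flow_space \<alpha> f) = {}" by (auto simp: flow_space_iff base_points_def)
      then show ?thesis using False by (simp add: section_length_def)
    qed simp
  qed
  finally show ?thesis ..
qed

text \<open>The first crossing may happen at once, and every further one takes at least the time \<open>c\<close>.\<close>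

definition crossings :: "real \<Rightarrow> nat" where "crossings r = nat \<lfloor>r / c\<rfloor> + 2"

lemma flow_index_less_crossings:
  assumes "(x, s) \<in> flow_space \<alpha> f" "0 \<le> t" "t \<le> r"
  shows "flow_index \<alpha> f x (s + t) < crossings r"
proof -
  have x: "x \<in> base_points \<alpha>" "0 \<le> s" "s < f x" using assms(1) by (auto simp: flow_space_iff)
  define N where "N = flow_index \<alpha> f x (s + t)"
  have N: "bsum \<alpha> f x N \<le> s + t" unfolding N_def using flow_index_props[OF x(1)] x assms(2) by auto
  show ?thesis
  proof (cases N)
    case 0
    then show ?thesis by (simp add: N_def crossings_def)
  next
    case (Suc m)
    have x01: "0 \<le> x" "x < 1" using x(1) by (auto simp: base_points_def)
    have "bsum \<alpha> f x N = f x + bsum \<alpha> f (orb \<alpha> x 1) m"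
      using bsum_add[of \<alpha> f x 1 m] orb_0[OF x01] by (simp add: Suc bsum_def)
    moreover have "bsum \<alpha> f (orb \<alpha> x 1) m \<ge> c * real m" by (rule bsum_ge[OF orb_base_points[OF x(1)]])
    ultimately have "c * real m \<le> r" using N x assms by linarith
    then have "real m \<le> r / c" using c_pos by (simp add: field_simps)
    then have "int m \<le> \<lfloor>r / c\<rfloor>" by linarith
    then show ?thesis using Suc by (simp add: N_def crossings_def)
  qed
qed

lemma emeasure_translate:
  assumes "Z \<in> sets borel" shows "emeasure lborel {t. a + t \<in> Z} = emeasure lborel (Z :: real set)"
proof -
  have "emeasure lborel Z = emeasure (distr lborel borel ((+) a)) Z" by (simp add: lborel_distr_plus)
  also have "\<dots> = emeasure lborel ((+) a -` Z \<inter> space lborel)" using assms by (intro emeasure_distr) auto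
  finally show ?thesis by (simp add: vimage_def)
qed

text \<open>Between two crossings an orbit moves vertically, so the time it spends in \<open>V\<close> is at most the length of
  the section of \<open>V\<close> over the current base point.\<close>

lemma occupation_time:
  assumes "(x, s) \<in> flow_space \<alpha> f" "V \<in> sets borel"
  shows "emeasure lborel {t \<in> {0..r}. flow_map \<alpha> f t (x, s) \<in> V} \<le> (\<Sum>i<crossings r. section_length \<alpha> f V (orb \<alpha> x i))"
proof -
  define Z where "Z i = Pair (orb \<alpha> x i) -` (V \<inter> flow_space \<alpha> f)" for i
  have Z: "Z i \<in> sets borel" for i
  proof -
    have "V \<inter> flow_space \<alpha> f \<in> sets (borel \<Otimes>\<^sub>M borel)"
      using assms(2) flow_space_borel[of \<alpha>] unfolding borel_prod by blast
    from sets_Pair1[OF this] show ?thesis by (simp add: Z_def)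
  qed
  have "{t \<in> {0..r}. flow_map \<alpha> f t (x, s) \<in> V} \<subseteq> (\<Union>i<crossings r. {t. (s - bsum \<alpha> f x i) + t \<in> Z i})"
  proof
    fix t assume "t \<in> {t \<in> {0..r}. flow_map \<alpha> f t (x, s) \<in> V}"
    then have t: "0 \<le> t" "t \<le> r" "flow_map \<alpha> f t (x, s) \<in> V" by auto
    have "flow_map \<alpha> f t (x, s) \<in> flow_space \<alpha> f" by (rule flow_map_in_space[OF assms(1) t(1)])
    then show "t \<in> (\<Union>i<crossings r. {t. (s - bsum \<alpha> f x i) + t \<in> Z i})"
      using t flow_index_less_crossings[OF assms(1) t(1,2)]
      by (intro UN_I[of "flow_index \<alpha> f x (s + t)"]) (auto simp: flow_map_def Let_def Z_def algebra_simps)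
  qed
  then have "emeasure lborel {t \<in> {0..r}. flow_map \<alpha> f t (x, s) \<in> V}
      \<le> emeasure lborel (\<Union>i<crossings r. {t. (s - bsum \<alpha> f x i) + t \<in> Z i})"
    using Z by (intro emeasure_mono) auto
  also have "\<dots> \<le> (\<Sum>i<crossings r. emeasure lborel {t. (s - bsum \<alpha> f x i) + t \<in> Z i})"
    using Z by (intro emeasure_subadditive_finite) auto
  also have "\<dots> = (\<Sum>i<crossings r. section_length \<alpha> f V (orb \<alpha> x i))"
    by (simp only: emeasure_translate[OF Z] mem_Collect_eq) (simp only: section_length_def Z_def)
  finally show ?thesis .
qed

text \<open>The rotation preserves Lebesgue measure, hence each of the \<open>n\<close> summands has the integral
  \<open>emeasure lborel (V \<inter> flow_space \<alpha> f)\<close>, and the Markov inequality applies.\<close>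

lemma occupation_markov:
  assumes [measurable]: "V \<in> sets borel" and "a > 0"
  shows "emeasure lborel {x \<in> {0..<1}. (\<Sum>i<n. section_length \<alpha> f V (orb \<alpha> x i)) \<ge> ennreal a}
    \<le> ennreal (real n / a) * emeasure lborel (V \<inter> flow_space \<alpha> f)"
proof -
  let ?u = "\<lambda>x. \<Sum>i<n. section_length \<alpha> f V (orb \<alpha> x i)"
  have "emeasure lborel ({x \<in> {0..<1}. 1 \<le> ennreal (1 / a) * ?u x})
      \<le> ennreal (1 / a) * (\<integral>\<^sup>+x. ?u x * indicator {0..<1} x \<partial>lborel)"
    by (rule nn_integral_Markov_inequality) measurable
  also have "(\<integral>\<^sup>+x. ?u x * indicator {0..<1} x \<partial>lborel)
      = (\<Sum>i<n. \<integral>\<^sup>+x. section_length \<alpha> f V (orb \<alpha> x i) * indicator {0..<1} x \<partial>lborel)"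
    unfolding sum_distrib_right by (rule nn_integral_sum) measurable
  also have "\<dots> = (\<Sum>i<n. emeasure lborel (V \<inter> flow_space \<alpha> f))"
    unfolding orb_def by (intro sum.cong refl) (simp add: nn_integral_rotation section_length_integral)
  also have "\<dots> = ennreal (real n) * emeasure lborel (V \<inter> flow_space \<alpha> f)"
    by (simp add: ennreal_of_nat_eq_real_of_nat)
  also have "ennreal (1 / a) * (ennreal (real n) * emeasure lborel (V \<inter> flow_space \<alpha> f))
      = ennreal (real n / a) * emeasure lborel (V \<inter> flow_space \<alpha> f)"
    using assms(2) by (simp add: mult.assoc[symmetric] ennreal_mult[symmetric])
  also have "{x \<in> {0..<1}. 1 \<le> ennreal (1 / a) * ?u x} = {x \<in> {0..<1}. ?u x \<ge> ennreal a}"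
  proof -
    have "1 \<le> ennreal (1 / a) * y \<longleftrightarrow> y \<ge> ennreal a" for y
    proof
      assume "1 \<le> ennreal (1 / a) * y"
      then have "ennreal a * 1 \<le> ennreal a * (ennreal (1 / a) * y)" by (intro mult_left_mono) auto
      then show "y \<ge> ennreal a" using assms(2) by (simp add: mult.assoc[symmetric] ennreal_mult[symmetric])
    next
      assume "y \<ge> ennreal a"
      then have "ennreal (1 / a) * ennreal a \<le> ennreal (1 / a) * y" by (intro mult_left_mono) auto
      then show "1 \<le> ennreal (1 / a) * y" using assms(2) by (simp add: ennreal_mult[symmetric])
    qed
    then show ?thesis by simp
  qed
  finally show ?thesis .
qed

end

section \<open>Names and covering numbers\<close>

lemma words_level_set:
  assumes "w \<in> words k r" shows "{t \<in> {0..r}. w t = i} \<in> sets borel"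
proof -
  have "w \<in> restrict_space borel {0..r} \<rightarrow>\<^sub>M count_space UNIV" using assms by (simp add: words_def)
  then have "w -` {i} \<inter> space (restrict_space borel {0..r}) \<in> sets (restrict_space borel {0..r})"
    by (rule measurable_sets) simp
  then have "w -` {i} \<inter> {0..r} \<in> sets borel" by (simp add: space_restrict_space sets_restrict_space_iff)
  moreover have "w -` {i} \<inter> {0..r} = {t \<in> {0..r}. w t = i}" by auto
  ultimately show ?thesis by simp
qed

lemma words_agree_set:
  assumes "w \<in> words k r" "w' \<in> words k r" shows "{t \<in> {0..r}. w t = w' t} \<in> sets borel"
proof -
  have "{t \<in> {0..r}. w t = w' t} = (\<Union>i\<in>{1..k}. {t \<in> {0..r}. w t = i} \<inter> {t \<in> {0..r}. w' t = i})"
  proof -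
    have "w t \<in> {1..k}" if "t \<in> {0..r}" for t using assms(1) that by (auto simp: words_def)
    then show ?thesis by fastforce
  qed
  also have "\<dots> \<in> sets borel"
    by (intro sets.finite_UN sets.Int words_level_set[OF assms(1)] words_level_set[OF assms(2)]) simp
  finally show ?thesis .
qed

lemma words_differ:
  assumes "w \<in> words k r" "w' \<in> words k r" "r > 0"
  shows "{t \<in> {0..r}. w t \<noteq> w' t} \<in> sets borel"
    "measure lborel {t \<in> {0..r}. w t \<noteq> w' t} = r * hamming r w w'"
proof -
  let ?A = "{t \<in> {0..r}. w t = w' t}"
  have A: "?A \<in> sets borel" by (rule words_agree_set[OF assms(1,2)])
  have e: "{t \<in> {0..r}. w t \<noteq> w' t} = {0..r} - ?A" by auto
  show "{t \<in> {0..r}. w t \<noteq> w' t} \<in> sets borel" unfolding e using A by auto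
  have "measure lborel ({0..r} - ?A) = measure lborel {0..r} - measure lborel ?A"
    using A assms(3) by (intro measure_Diff) auto
  then show "measure lborel {t \<in> {0..r}. w t \<noteq> w' t} = r * hamming r w w'"
    unfolding e hamming_def using assms(3) by simp
qed

lemma words_differ_triangle:
  assumes "w \<in> words k r" "u \<in> words k r" "v \<in> words k r" "r > 0"
    and "hamming r w u < \<epsilon>" "hamming r w v < \<epsilon>"
  shows "measure lborel {t \<in> {0..r}. u t \<noteq> v t} < 2 * \<epsilon> * r"
proof -
  have fin: "emeasure lborel Y \<noteq> \<infinity>" if "Y \<subseteq> {0..r}" for Y :: "real set"
  proof -
    have "emeasure lborel Y \<le> emeasure lborel {0..r}" using that by (intro emeasure_mono) auto
    then show ?thesis using assms(4) by (auto simp: top_unique)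
  qed
  have "measure lborel {t \<in> {0..r}. u t \<noteq> v t}
      \<le> measure lborel ({t \<in> {0..r}. w t \<noteq> u t} \<union> {t \<in> {0..r}. w t \<noteq> v t})"
  proof (rule measure_mono_fmeasurable)
    have "{t \<in> {0..r}. w t \<noteq> u t} \<union> {t \<in> {0..r}. w t \<noteq> v t} \<subseteq> {0..r}" by auto
    then have "emeasure lborel ({t \<in> {0..r}. w t \<noteq> u t} \<union> {t \<in> {0..r}. w t \<noteq> v t}) \<noteq> \<infinity>" by (rule fin)
    then show "{t \<in> {0..r}. w t \<noteq> u t} \<union> {t \<in> {0..r}. w t \<noteq> v t} \<in> fmeasurable lborel"
      using words_differ(1)[OF assms(1,2,4)] words_differ(1)[OF assms(1,3,4)]
      by (intro fmeasurableI sets.Un) (simp_all add: less_top)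
    show "{t \<in> {0..r}. u t \<noteq> v t} \<in> sets lborel" using words_differ(1)[OF assms(2,3,4)] by simp
  qed auto
  also have "\<dots> \<le> measure lborel {t \<in> {0..r}. w t \<noteq> u t} + measure lborel {t \<in> {0..r}. w t \<noteq> v t}"
    using assms words_differ(1)[OF assms(1,2)] words_differ(1)[OF assms(1,3)] by (intro measure_Un_le) auto
  also have "\<dots> = r * (hamming r w u + hamming r w v)"
    unfolding words_differ(2)[OF assms(1,2,4)] words_differ(2)[OF assms(1,3,4)] by (simp add: distrib_left)
  also have "\<dots> < r * (\<epsilon> + \<epsilon>)" using assms by (intro mult_strict_left_mono add_strict_mono)
  finally show ?thesis by (simp add: algebra_simps)
qed

definition atom :: "nat \<Rightarrow> (nat \<Rightarrow> 'a set) \<Rightarrow> 'a \<Rightarrow> nat" where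
  "atom k P z = (THE i. i \<in> {1..k} \<and> z \<in> P i)"

lemma atom_props:
  assumes "finite_partition M k P" "z \<in> space M"
  shows "atom k P z \<in> {1..k}" "z \<in> P (atom k P z)" "\<And>i. i \<in> {1..k} \<Longrightarrow> z \<in> P i \<Longrightarrow> atom k P z = i"
proof -
  have "disjoint_family_on P {1..k}" "(\<Union>i\<in>{1..k}. P i) = space M"
    using assms(1) by (auto simp: finite_partition_def)
  then have ex: "\<exists>!i. i \<in> {1..k} \<and> z \<in> P i"
    using assms(2) unfolding disjoint_family_on_def by blast
  from theI'[OF ex] show "atom k P z \<in> {1..k}" "z \<in> P (atom k P z)" by (auto simp: atom_def)
  show "atom k P z = i" if "i \<in> {1..k}" "z \<in> P i" for i
    unfolding atom_def using ex that by (intro the1_equality) auto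
qed

context log_roof
begin

abbreviation "fl \<alpha> \<equiv> special_flow \<alpha> f"
abbreviation "fm \<alpha> \<equiv> flow_measure \<alpha> f"

lemma flow_joint_measurable:
  assumes "V \<in> sets borel"
  shows "{p \<in> flow_space \<alpha> f \<times> {0..r}. flow_map \<alpha> f (snd p) (fst p) \<in> V} \<in> sets (borel \<Otimes>\<^sub>M lborel)"
proof -
  let ?g = "\<lambda>(z, t). flow_map \<alpha> (cut_roof f) t z"
  have b: "(borel \<Otimes>\<^sub>M borel) \<Otimes>\<^sub>M borel = (borel :: ((real \<times> real) \<times> real) measure)"
    by (simp only: borel_prod)
  have g: "?g \<in> borel_measurable borel" using flow_map_measurable[of \<alpha>] unfolding b .
  have "?g -` V \<inter> space borel \<in> sets borel" by (rule measurable_sets[OF g assms])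
  moreover have "flow_space \<alpha> f \<times> {0..r} \<in> sets (borel \<Otimes>\<^sub>M borel)"
    using flow_space_borel[of \<alpha>] by (intro pair_measureI) auto
  then have "flow_space \<alpha> f \<times> {0..r} \<in> sets borel" by (simp only: borel_prod)
  ultimately have "flow_space \<alpha> f \<times> {0..r} \<inter> (?g -` V \<inter> space borel) \<in> sets borel" by (rule sets.Int[rotated])
  also have "flow_space \<alpha> f \<times> {0..r} \<inter> (?g -` V \<inter> space borel)
      = {p \<in> flow_space \<alpha> f \<times> {0..r}. flow_map \<alpha> f (snd p) (fst p) \<in> V}"
    by (auto simp: flow_map_cut)
  also have "sets borel = sets (borel \<Otimes>\<^sub>M lborel :: ((real \<times> real) \<times> real) measure)"
  proof -
    have "sets (borel \<Otimes>\<^sub>M lborel) = sets (borel \<Otimes>\<^sub>M (borel :: real measure) :: ((real \<times> real) \<times> real) measure)"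
      by (rule sets_pair_measure_cong) auto
    then show ?thesis by (simp only: borel_prod)
  qed
  finally show ?thesis .
qed

lemma flow_time_set:
  assumes "V \<in> sets borel" "z \<in> flow_space \<alpha> f"
  shows "{t \<in> {0..r}. flow_map \<alpha> f t z \<in> V} \<in> sets borel"
proof -
  from sets_Pair1[OF flow_joint_measurable[OF assms(1)]]
  have "Pair z -` {p \<in> flow_space \<alpha> f \<times> {0..r}. flow_map \<alpha> f (snd p) (fst p) \<in> V} \<in> sets borel" by simp
  also have "Pair z -` {p \<in> flow_space \<alpha> f \<times> {0..r}. flow_map \<alpha> f (snd p) (fst p) \<in> V}
      = {t \<in> {0..r}. flow_map \<alpha> f t z \<in> V}"
    using assms(2) by auto
  finally show ?thesis .
qed

context
  fixes \<alpha> :: real and k :: nat and P :: "nat \<Rightarrow> (real \<times> real) set"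
  assumes part: "finite_partition (fm \<alpha>) k P"
begin

lemma name_eq:
  assumes "z \<in> flow_space \<alpha> f" "t \<in> {0..r}"
  shows "name (fl \<alpha>) k P r z t = atom k P (flow_map \<alpha> f t z)"
  using assms special_flow_eq[OF assms(1), of t] by (simp add: name_def atom_def)

lemma P_sets: "i \<in> {1..k} \<Longrightarrow> P i \<in> sets borel"
  using part sets_flow_measure[of "P i" \<alpha>] by (auto simp: finite_partition_def)

lemma name_eq_iff:
  assumes "z \<in> flow_space \<alpha> f" "t \<in> {0..r}"
  shows "name (fl \<alpha>) k P r z t = i \<longleftrightarrow> i \<in> {1..k} \<and> flow_map \<alpha> f t z \<in> P i"
proof -
  have "flow_map \<alpha> f t z \<in> space (fm \<alpha>)"
    using flow_map_in_space[OF assms(1), of t] assms(2) by (simp add: space_flow_measure)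
  from atom_props[OF part this] show ?thesis unfolding name_eq[OF assms] by blast
qed

lemma name_joint_measurable:
  assumes "i \<in> {1..k}"
  shows "{p \<in> flow_space \<alpha> f \<times> {0..r}. flow_map \<alpha> f (snd p) (fst p) \<in> P i} \<in> sets (borel \<Otimes>\<^sub>M lborel)"
  by (rule flow_joint_measurable[OF P_sets[OF assms]])

lemma name_level_set:
  assumes "z \<in> flow_space \<alpha> f"
  shows "{t \<in> {0..r}. name (fl \<alpha>) k P r z t = i} \<in> sets borel"
proof (cases "i \<in> {1..k}")
  case True
  have "{t \<in> {0..r}. flow_map \<alpha> f t z \<in> P i} \<in> sets borel" by (rule flow_time_set[OF P_sets[OF True] assms])
  also have "{t \<in> {0..r}. flow_map \<alpha> f t z \<in> P i} = {t \<in> {0..r}. name (fl \<alpha>) k P r z t = i}"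
    using True name_eq_iff[OF assms] by auto
  finally show ?thesis .
next
  case False
  then have "{t \<in> {0..r}. name (fl \<alpha>) k P r z t = i} = {}" using name_eq_iff[OF assms] by auto
  then show ?thesis by (simp only: sets.empty_sets)
qed

lemma name_in_words:
  assumes "z \<in> flow_space \<alpha> f" shows "name (fl \<alpha>) k P r z \<in> words k r"
proof -
  have "name (fl \<alpha>) k P r z \<in> {0..r} \<rightarrow>\<^sub>E {1..k}"
  proof (rule PiE_I)
    show "name (fl \<alpha>) k P r z t \<in> {1..k}" if "t \<in> {0..r}" for t
      using name_eq_iff[OF assms that, of "name (fl \<alpha>) k P r z t"] by simp
  qed (auto simp: name_def)
  moreover have "name (fl \<alpha>) k P r z \<in> restrict_space borel {0..r} \<rightarrow>\<^sub>M count_space UNIV"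
  proof (subst measurable_count_space_eq2_countable, safe)
    fix i
    have "name (fl \<alpha>) k P r z -` {i} \<inter> space (restrict_space borel {0..r}) = {t \<in> {0..r}. name (fl \<alpha>) k P r z t = i}"
      by (auto simp: space_restrict_space)
    then show "name (fl \<alpha>) k P r z -` {i} \<inter> space (restrict_space borel {0..r}) \<in> sets (restrict_space borel {0..r})"
      using name_level_set[OF assms] by (auto simp: sets_restrict_space_iff)
  qed auto
  ultimately show ?thesis by (simp add: words_def)
qed

text \<open>The time of agreement with a fixed word is the measure of a section of a jointly measurable set of points
  and times, so it depends measurably on the point.\<close>

lemma ball_preimage_measurable:
  assumes "w \<in> words k r"
  shows "{z \<in> flow_space \<alpha> f. name (fl \<alpha>) k P r z \<in> hamming_ball k r w \<epsilon>} \<in> sets borel"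
proof -
  define Q where "Q = (\<Union>i\<in>{1..k}. (UNIV \<times> {t \<in> {0..r}. w t = i}) \<inter>
     {p \<in> flow_space \<alpha> f \<times> {0..r}. flow_map \<alpha> f (snd p) (fst p) \<in> P i})"
  have "Q \<in> sets (borel \<Otimes>\<^sub>M lborel)"
    unfolding Q_def using words_level_set[OF assms] name_joint_measurable
    by (intro sets.finite_UN sets.Int pair_measureI) auto
  then have "(\<lambda>z. emeasure lborel (Pair z -` Q)) \<in> borel_measurable borel"
    by (rule lborel.measurable_emeasure_Pair)
  then have [measurable]: "(\<lambda>z. measure lborel (Pair z -` Q)) \<in> borel_measurable borel"
    unfolding measure_def by measurable
  have "(\<lambda>z. 1 / r * (r - measure lborel (Pair z -` Q))) -` {..<\<epsilon>} \<inter> space borel \<in> sets borel"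
    by (rule measurable_sets[where A = borel]) measurable
  then have "flow_space \<alpha> f \<inter> ((\<lambda>z. 1 / r * (r - measure lborel (Pair z -` Q))) -` {..<\<epsilon>} \<inter> space borel) \<in> sets borel"
    by (rule sets.Int[OF flow_space_borel])
  also have "flow_space \<alpha> f \<inter> ((\<lambda>z. 1 / r * (r - measure lborel (Pair z -` Q))) -` {..<\<epsilon>} \<inter> space borel)
      = {z \<in> flow_space \<alpha> f. name (fl \<alpha>) k P r z \<in> hamming_ball k r w \<epsilon>}"
  proof -
    have "measure lborel (Pair z -` Q) = measure lborel {t \<in> {0..r}. w t = name (fl \<alpha>) k P r z t}"
      if "z \<in> flow_space \<alpha> f" for z
    proof -
      have w: "w t \<in> {1..k}" if "t \<in> {0..r}" for t using assms that by (auto simp: words_def)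
      have "t \<in> Pair z -` Q \<longleftrightarrow> t \<in> {t \<in> {0..r}. w t = name (fl \<alpha>) k P r z t}" for t
      proof (cases "t \<in> {0..r}")
        case True
        have "t \<in> Pair z -` Q \<longleftrightarrow> (\<exists>i\<in>{1..k}. w t = i \<and> flow_map \<alpha> f t z \<in> P i)"
          using True that by (simp add: Q_def)
        also have "\<dots> \<longleftrightarrow> flow_map \<alpha> f t z \<in> P (w t)" using w[OF True] by blast
        also have "\<dots> \<longleftrightarrow> name (fl \<alpha>) k P r z t = w t"
          using name_eq_iff[OF that True, of "w t"] w[OF True] by simp
        finally show ?thesis using True by auto
      qed (auto simp: Q_def)
      then have "Pair z -` Q = {t \<in> {0..r}. w t = name (fl \<alpha>) k P r z t}" by blast
      then show ?thesis by simp
    qed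
    then show ?thesis using name_in_words by (auto simp: hamming_ball_def hamming_def)
  qed
  finally show ?thesis .
qed

lemma name_measurable: "name (fl \<alpha>) k P r \<in> fm \<alpha> \<rightarrow>\<^sub>M word_space k r"
  unfolding word_space_def
proof (rule measurable_measure_of)
  show "{hamming_ball k r w \<epsilon> |w \<epsilon>. w \<in> words k r \<and> \<epsilon> > 0} \<subseteq> Pow (words k r)"
    by (auto simp: hamming_ball_def)
  show "name (fl \<alpha>) k P r \<in> space (fm \<alpha>) \<rightarrow> words k r" using name_in_words by (auto simp: space_flow_measure)
  fix y assume "y \<in> {hamming_ball k r w \<epsilon> |w \<epsilon>. w \<in> words k r \<and> \<epsilon> > 0}"
  then obtain w \<epsilon> where y: "y = hamming_ball k r w \<epsilon>" "w \<in> words k r" by auto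
  have "name (fl \<alpha>) k P r -` y \<inter> space (fm \<alpha>)
      = {z \<in> flow_space \<alpha> f. name (fl \<alpha>) k P r z \<in> hamming_ball k r w \<epsilon>}"
    by (auto simp: y(1) space_flow_measure)
  then show "name (fl \<alpha>) k P r -` y \<inter> space (fm \<alpha>) \<in> sets (fm \<alpha>)"
    using ball_preimage_measurable[OF y(2), of \<epsilon>] by (auto simp: sets_flow_measure)
qed

lemma name_measure_balls:
  assumes "finite C" "C \<subseteq> words k r" "\<epsilon> > 0"
  defines "Y \<equiv> {z \<in> flow_space \<alpha> f. \<exists>w\<in>C. name (fl \<alpha>) k P r z \<in> hamming_ball k r w \<epsilon>}"
  shows "Y \<in> sets borel"
    "measure (name_measure (fm \<alpha>) (fl \<alpha>) k P r) (\<Union>w\<in>C. hamming_ball k r w \<epsilon>) = measure lborel Y / total_mass \<alpha>"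
proof -
  have e: "Y = (\<Union>w\<in>C. {z \<in> flow_space \<alpha> f. name (fl \<alpha>) k P r z \<in> hamming_ball k r w \<epsilon>})"
    by (auto simp: Y_def)
  show Y: "Y \<in> sets borel"
    unfolding e using assms(1,2) ball_preimage_measurable by (intro sets.finite_UN) auto
  have balls: "(\<Union>w\<in>C. hamming_ball k r w \<epsilon>) \<in> sets (word_space k r)"
    using assms unfolding word_space_def
    by (intro sets.finite_UN) (auto simp: hamming_ball_def intro!: sigma_sets.Basic)
  have "measure (name_measure (fm \<alpha>) (fl \<alpha>) k P r) (\<Union>w\<in>C. hamming_ball k r w \<epsilon>)
      = measure (fm \<alpha>) (name (fl \<alpha>) k P r -` (\<Union>w\<in>C. hamming_ball k r w \<epsilon>) \<inter> space (fm \<alpha>))"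
    unfolding name_measure_def by (rule measure_distr[OF name_measurable balls])
  also have "name (fl \<alpha>) k P r -` (\<Union>w\<in>C. hamming_ball k r w \<epsilon>) \<inter> space (fm \<alpha>) = Y"
    by (auto simp: Y_def space_flow_measure)
  also have "measure (fm \<alpha>) Y = measure lborel Y / total_mass \<alpha>"
    by (rule measure_flow_measure[OF Y]) (auto simp: Y_def)
  finally show "measure (name_measure (fm \<alpha>) (fl \<alpha>) k P r) (\<Union>w\<in>C. hamming_ball k r w \<epsilon>) = measure lborel Y / total_mass \<alpha>" .
qed

text \<open>The balls are centred at the names of the points of \<open>D\<close>.\<close>

lemma covering_number_le:
  assumes "r > 0" "\<epsilon> > 0" "finite D" "D \<subseteq> flow_space \<alpha> f" "Y \<in> sets borel" "Y \<subseteq> flow_space \<alpha> f"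
    and big: "measure lborel Y > (\<beta> - \<epsilon>) * total_mass \<alpha>"
    and close: "\<And>z. z \<in> Y \<Longrightarrow> \<exists>z0\<in>D. measure lborel {t \<in> {0..r}. atom k P (flow_map \<alpha> f t z0) \<noteq> atom k P (flow_map \<alpha> f t z)} < \<epsilon> * r"
  shows "covering_number (fm \<alpha>) (fl \<alpha>) k P \<epsilon> \<beta> r \<le> of_nat (card D)"
proof -
  let ?n = "name (fl \<alpha>) k P r"
  define C where "C = ?n ` D"
  have C: "finite C" "C \<subseteq> words k r" using assms(3,4) name_in_words by (auto simp: C_def)
  let ?Y = "{z \<in> flow_space \<alpha> f. \<exists>w\<in>C. ?n z \<in> hamming_ball k r w \<epsilon>}"
  have "Y \<subseteq> ?Y"
  proof
    fix z assume z: "z \<in> Y"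
    then have zF: "z \<in> flow_space \<alpha> f" using assms(6) by auto
    obtain z0 where z0: "z0 \<in> D"
      "measure lborel {t \<in> {0..r}. atom k P (flow_map \<alpha> f t z0) \<noteq> atom k P (flow_map \<alpha> f t z)} < \<epsilon> * r"
      using close[OF z] by blast
    have z0F: "z0 \<in> flow_space \<alpha> f" using z0 assms(4) by auto
    have "{t \<in> {0..r}. atom k P (flow_map \<alpha> f t z0) \<noteq> atom k P (flow_map \<alpha> f t z)} = {t \<in> {0..r}. ?n z0 t \<noteq> ?n z t}"
      using name_eq[OF zF] name_eq[OF z0F] by auto
    then have "r * hamming r (?n z0) (?n z) < \<epsilon> * r"
      using z0(2) words_differ(2)[OF name_in_words[OF z0F] name_in_words[OF zF] assms(1)] by simp
    then have "hamming r (?n z0) (?n z) < \<epsilon>" using assms(1) by (simp add: mult.commute)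
    then show "z \<in> ?Y" using zF z0(1) name_in_words[OF zF] by (auto simp: C_def hamming_ball_def)
  qed
  then have "measure lborel Y \<le> measure lborel ?Y"
    using name_measure_balls(1)[OF C assms(2)] assms(5) by (intro measure_flow_mono) auto
  then have "(\<beta> - \<epsilon>) * total_mass \<alpha> < measure lborel ?Y" using big by linarith
  then have "\<beta> - \<epsilon> < measure (name_measure (fm \<alpha>) (fl \<alpha>) k P r) (\<Union>w\<in>C. hamming_ball k r w \<epsilon>)"
    unfolding name_measure_balls(2)[OF C assms(2)] using total_mass_pos[of \<alpha>] by (simp add: less_divide_eq)
  then have "covering_number (fm \<alpha>) (fl \<alpha>) k P \<epsilon> \<beta> r \<le> of_nat (card C)"
    unfolding covering_number_def using C by (intro INF_lower) auto
  also have "\<dots> \<le> of_nat (card D)" unfolding C_def using assms(3) by (intro of_nat_mono card_image_le)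
  finally show ?thesis .
qed

text \<open>Two names in one ball of radius \<open>\<epsilon>\<close> differ during less than \<open>2 \<epsilon> r\<close>, hence one ball captures at most
  measure \<open>m\<close> of \<open>Y\<close>.  An admissible family captures a proportion above \<open>\<beta> - \<epsilon> > 3 \<beta> / 4\<close> of the whole
  space, of which at least \<open>\<beta> / 4\<close> lies in \<open>Y\<close>.\<close>

lemma covering_number_ge:
  assumes "r > 0" "\<epsilon> > 0" "m > 0" "Y \<in> sets borel" "Y \<subseteq> flow_space \<alpha> f"
    and big: "measure lborel Y \<ge> (1 - \<beta> / 2) * total_mass \<alpha>" and "\<epsilon> < \<beta> / 4"
    and close: "\<And>z. z \<in> Y \<Longrightarrow> \<exists>Z\<in>sets borel. emeasure lborel Z \<le> ennreal m \<and>
       (\<forall>z'\<in>Y. measure lborel {t \<in> {0..r}. atom k P (flow_map \<alpha> f t z) \<noteq> atom k P (flow_map \<alpha> f t z')} < 2 * \<epsilon> * r \<longrightarrow> z' \<in> Z)"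
  shows "covering_number (fm \<alpha>) (fl \<alpha>) k P \<epsilon> \<beta> r \<ge> ennreal (\<beta> / 4 * total_mass \<alpha> / m)"
  unfolding covering_number_def
proof (rule INF_greatest)
  let ?n = "name (fl \<alpha>) k P r"
  fix C assume "C \<in> {C. finite C \<and> C \<subseteq> words k r \<and>
     \<beta> - \<epsilon> < measure (name_measure (fm \<alpha>) (fl \<alpha>) k P r) (\<Union>w\<in>C. hamming_ball k r w \<epsilon>)}"
  then have C: "finite C" "C \<subseteq> words k r"
    and meas: "\<beta> - \<epsilon> < measure (name_measure (fm \<alpha>) (fl \<alpha>) k P r) (\<Union>w\<in>C. hamming_ball k r w \<epsilon>)" by auto
  let ?X = "{z \<in> flow_space \<alpha> f. \<exists>w\<in>C. ?n z \<in> hamming_ball k r w \<epsilon>}"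
  note X = name_measure_balls[OF C assms(2)]
  have mX: "measure lborel ?X > (\<beta> - \<epsilon>) * total_mass \<alpha>"
    using meas total_mass_pos[of \<alpha>] unfolding X(2) by (simp add: less_divide_eq)
  have "\<exists>Z. Z \<in> sets borel \<and> emeasure lborel Z \<le> ennreal m \<and> (\<forall>z\<in>Y. ?n z \<in> hamming_ball k r w \<epsilon> \<longrightarrow> z \<in> Z)"
    if w: "w \<in> C" for w
  proof (cases "\<exists>z\<in>Y. ?n z \<in> hamming_ball k r w \<epsilon>")
    case True
    then obtain z where z: "z \<in> Y" "?n z \<in> hamming_ball k r w \<epsilon>" by blast
    have zF: "z \<in> flow_space \<alpha> f" using z(1) assms(5) by auto
    obtain Z where Z: "Z \<in> sets borel" "emeasure lborel Z \<le> ennreal m"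
      "\<And>z'. z' \<in> Y \<Longrightarrow> measure lborel {t \<in> {0..r}. atom k P (flow_map \<alpha> f t z) \<noteq> atom k P (flow_map \<alpha> f t z')} < 2 * \<epsilon> * r \<Longrightarrow> z' \<in> Z"
      using close[OF z(1)] by blast
    have "z' \<in> Z" if z': "z' \<in> Y" "?n z' \<in> hamming_ball k r w \<epsilon>" for z'
    proof (rule Z(3)[OF z'(1)])
      have z'F: "z' \<in> flow_space \<alpha> f" using z'(1) assms(5) by auto
      have "measure lborel {t \<in> {0..r}. ?n z t \<noteq> ?n z' t} < 2 * \<epsilon> * r"
        using z(2) z'(2) w C(2) assms(1)
        by (intro words_differ_triangle[of w k] name_in_words zF z'F) (auto simp: hamming_ball_def)
      also have "{t \<in> {0..r}. ?n z t \<noteq> ?n z' t} = {t \<in> {0..r}. atom k P (flow_map \<alpha> f t z) \<noteq> atom k P (flow_map \<alpha> f t z')}"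
        using name_eq[OF zF] name_eq[OF z'F] by auto
      finally show "measure lborel {t \<in> {0..r}. atom k P (flow_map \<alpha> f t z) \<noteq> atom k P (flow_map \<alpha> f t z')} < 2 * \<epsilon> * r" .
    qed
    then show ?thesis using Z by blast
  next
    case False
    then show ?thesis by (intro exI[of _ "{}"]) auto
  qed
  then obtain Z where Z: "\<And>w. w \<in> C \<Longrightarrow> Z w \<in> sets borel" "\<And>w. w \<in> C \<Longrightarrow> emeasure lborel (Z w) \<le> ennreal m"
    "\<And>w z. w \<in> C \<Longrightarrow> z \<in> Y \<Longrightarrow> ?n z \<in> hamming_ball k r w \<epsilon> \<Longrightarrow> z \<in> Z w" by metis
  have "emeasure lborel (?X \<inter> Y) \<le> emeasure lborel (\<Union>w\<in>C. Z w)"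
    using Z(1,3) C by (intro emeasure_mono sets.finite_UN) auto
  also have "\<dots> \<le> (\<Sum>w\<in>C. emeasure lborel (Z w))"
    using Z(1) C by (intro emeasure_subadditive_finite) auto
  also have "\<dots> \<le> (\<Sum>w\<in>C. ennreal m)" by (intro sum_mono Z)
  also have "\<dots> = ennreal (real (card C) * m)"
    using assms(3) by (simp add: ennreal_mult ennreal_of_nat_eq_real_of_nat)
  finally have "emeasure lborel (?X \<inter> Y) \<le> ennreal (real (card C) * m)" .
  then have 1: "measure lborel (?X \<inter> Y) \<le> real (card C) * m"
    using assms(3) by (simp add: measure_def enn2real_leI)
  have "measure lborel ?X + measure lborel Y = measure lborel (?X \<union> Y) + measure lborel (?X \<inter> Y)"
    using X(1) assms(4) finite_lborel_subset[of ?X \<alpha>] finite_lborel_subset[OF assms(5)]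
    by (subst measure_Un3) (auto simp: fmeasurable_def less_top)
  moreover have "measure lborel (?X \<union> Y) \<le> total_mass \<alpha>"
    unfolding total_mass_def using X(1) assms(4,5) by (intro measure_flow_mono flow_space_borel) auto
  moreover have "\<epsilon> * total_mass \<alpha> \<le> \<beta> / 4 * total_mass \<alpha>"
    using assms(7) total_mass_pos[of \<alpha>] by (intro mult_right_mono) auto
  ultimately have "\<beta> / 4 * total_mass \<alpha> \<le> measure lborel (?X \<inter> Y)"
    using mX big by (simp add: algebra_simps)
  then have "\<beta> / 4 * total_mass \<alpha> \<le> real (card C) * m" using 1 by linarith
  then have "\<beta> / 4 * total_mass \<alpha> / m \<le> real (card C)" using assms(3) by (simp add: divide_le_eq)
  then show "ennreal (\<beta> / 4 * total_mass \<alpha> / m) \<le> of_nat (card C)"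
    by (simp add: ennreal_of_nat_eq_real_of_nat ennreal_leI)
qed

end

end

section \<open>Shearing and the good set\<close>

text \<open>The exponent lies strictly between that of \<open>avoid_radius\<close> and the exponent \<open>7 / 8\<close> of the second
  Diophantine condition.  The margin towards \<open>avoid_radius\<close> makes the Birkhoff estimates applicable to nearby points
  and to orbit segments of half the length.\<close>

definition deep_radius :: "nat \<Rightarrow> real" where
  "deep_radius n = 1 / (real n * ln (real n) powr (19 / 20))"

lemma deep_radius_pos: "ln (real n) \<ge> 1 \<Longrightarrow> deep_radius n > 0"
  unfolding deep_radius_def by (intro divide_pos_pos mult_pos_pos) (auto intro: Nat.gr0I)

lemma avoid_le_deep: "ln (real n) \<ge> 1 \<Longrightarrow> avoid_radius n \<le> deep_radius n"
  unfolding deep_radius_def avoid_radius_def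
  by (intro divide_left_mono mult_left_mono powr_mono mult_pos_pos) (auto intro: Nat.gr0I)

text \<open>The factor \<open>2\<close> leaves room for a shift of the base point by up to \<open>\<rho>\<close>.\<close>

definition deep :: "real \<Rightarrow> nat \<Rightarrow> real \<Rightarrow> real \<Rightarrow> bool" where
  "deep \<alpha> j \<rho> x \<longleftrightarrow> (\<forall>i<j. 2 * \<rho> \<le> orb \<alpha> x i \<and> orb \<alpha> x i \<le> 1 - 2 * \<rho>)"

abbreviation deep_orbit :: "real \<Rightarrow> nat \<Rightarrow> real \<Rightarrow> bool" where
  "deep_orbit \<alpha> n x \<equiv> deep \<alpha> n (deep_radius n) x"

lemma orb_shift:
  assumes "orb \<alpha> x i + e \<in> {0<..<1}" shows "orb \<alpha> (x + e) i = orb \<alpha> x i + e"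
proof -
  have "orb \<alpha> (x + e) i = frac (orb \<alpha> x i + e)"
    unfolding orb_def frac_frac_add by (simp add: algebra_simps)
  also have "\<dots> = orb \<alpha> x i + e" using assms by (simp add: frac_eq)
  finally show ?thesis .
qed

lemma deep_shift:
  assumes "deep \<alpha> j \<rho> x" "\<rho> > 0" "\<bar>e\<bar> \<le> \<rho>"
  shows "\<And>i. i < j \<Longrightarrow> orb \<alpha> (x + e) i = orb \<alpha> x i + e"
    and "avoid_radius j \<le> \<rho> \<Longrightarrow> orb_avoids2 \<alpha> j (x + e)"
proof -
  have b: "2 * \<rho> \<le> orb \<alpha> x i \<and> orb \<alpha> x i \<le> 1 - 2 * \<rho>" if "i < j" for i
    using assms(1) that by (simp add: deep_def)
  show *: "orb \<alpha> (x + e) i = orb \<alpha> x i + e" if "i < j" for i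
  proof (rule orb_shift)
    have "0 < orb \<alpha> x i + e \<and> orb \<alpha> x i + e < 1" using b[OF that] assms(2,3) by linarith
    then show "orb \<alpha> x i + e \<in> {0<..<1}" by simp
  qed
  show "orb_avoids2 \<alpha> j (x + e)" if "avoid_radius j \<le> \<rho>"
    unfolding orb_avoids2_def
  proof (intro allI impI)
    fix i assume i: "i < j"
    show "avoid_radius j \<le> orb \<alpha> (x + e) i \<and> orb \<alpha> (x + e) i \<le> 1 - avoid_radius j"
      unfolding *[OF i] using b[OF i] assms(3) that by linarith
  qed
qed

lemma near_singularity_measure:
  assumes "a \<ge> 0"
  shows "emeasure lborel {x \<in> {0..<1}. orb \<alpha> x i < a \<or> orb \<alpha> x i > 1 - a} \<le> ennreal (2 * a)"
    "{x \<in> {0..<1}. orb \<alpha> x i < a \<or> orb \<alpha> x i > 1 - a} \<in> sets borel"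
proof -
  let ?A = "{x \<in> {0..<1::real}. x < a \<or> x > 1 - a}"
  have A: "?A \<in> sets borel"
  proof -
    have "?A = {0..<1} \<inter> ({..<a} \<union> {1 - a<..})" by auto
    then show ?thesis by simp
  qed
  have e: "{x \<in> {0..<1}. orb \<alpha> x i < a \<or> orb \<alpha> x i > 1 - a} = {x \<in> {0..<1}. frac (x + real i * \<alpha>) \<in> ?A}"
    using orb_bounds by (auto simp: orb_def)
  have "emeasure lborel ?A \<le> emeasure lborel ({0..a} \<union> {1 - a..1})" by (intro emeasure_mono) auto
  also have "\<dots> \<le> emeasure lborel {0..a} + emeasure lborel {1 - a..1}" by (intro emeasure_subadditive) auto
  also have "\<dots> = ennreal (2 * a)" using assms by (simp flip: ennreal_plus)
  finally have "emeasure lborel ?A \<le> ennreal (2 * a)" .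
  then show "emeasure lborel {x \<in> {0..<1}. orb \<alpha> x i < a \<or> orb \<alpha> x i > 1 - a} \<le> ennreal (2 * a)"
    unfolding e by (subst emeasure_rotation[OF A]) auto
  have "{0..<1} \<inter> ((\<lambda>x. orb \<alpha> x i) -` ({..<a} \<union> {1 - a<..}) \<inter> space borel) \<in> sets borel"
    by (intro sets.Int[OF _ measurable_sets[OF orb_measurable]]) auto
  also have "{0..<1} \<inter> ((\<lambda>x. orb \<alpha> x i) -` ({..<a} \<union> {1 - a<..}) \<inter> space borel) = {x \<in> {0..<1}. orb \<alpha> x i < a \<or> orb \<alpha> x i > 1 - a}"
    by auto
  finally show "{x \<in> {0..<1}. orb \<alpha> x i < a \<or> orb \<alpha> x i > 1 - a} \<in> sets borel" .
qed

lemma near_singularity_measure_union: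
  assumes "\<And>i. w i \<ge> 0"
  shows "emeasure lborel {x \<in> {0..<1}. \<exists>i<n. orb \<alpha> x i < w i \<or> orb \<alpha> x i > 1 - w i} \<le> ennreal (\<Sum>i<n. 2 * w i)"
proof -
  have "{x \<in> {0..<1}. \<exists>i<n. orb \<alpha> x i < w i \<or> orb \<alpha> x i > 1 - w i} = (\<Union>i<n. {x \<in> {0..<1}. orb \<alpha> x i < w i \<or> orb \<alpha> x i > 1 - w i})"
    by auto
  moreover have "emeasure lborel (\<Union>i<n. {x \<in> {0..<1}. orb \<alpha> x i < w i \<or> orb \<alpha> x i > 1 - w i})
      \<le> (\<Sum>i<n. emeasure lborel {x \<in> {0..<1}. orb \<alpha> x i < w i \<or> orb \<alpha> x i > 1 - w i})"
  proof (rule emeasure_subadditive_finite)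
    show "(\<lambda>i. {x \<in> {0..<1}. orb \<alpha> x i < w i \<or> orb \<alpha> x i > 1 - w i}) ` {..<n} \<subseteq> sets lborel"
      unfolding sets_lborel using near_singularity_measure(2)[OF assms] by blast
  qed simp
  ultimately have "emeasure lborel {x \<in> {0..<1}. \<exists>i<n. orb \<alpha> x i < w i \<or> orb \<alpha> x i > 1 - w i}
      \<le> (\<Sum>i<n. emeasure lborel {x \<in> {0..<1}. orb \<alpha> x i < w i \<or> orb \<alpha> x i > 1 - w i})"
    by (simp only:)
  also have "\<dots> \<le> (\<Sum>i<n. ennreal (2 * w i))" by (intro sum_mono near_singularity_measure assms)
  also have "\<dots> = ennreal (\<Sum>i<n. 2 * w i)" by (rule sum_ennreal) (simp add: assms)
  finally show ?thesis .
qed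

context log_roof
begin

text \<open>The difference of the Birkhoff sums of two nearby points is controlled by the Birkhoff sum of the
  derivative at an intermediate point, because no singularity separates their orbits.\<close>

lemma bsum_mean_value:
  assumes "deep \<alpha> j \<rho> x" "\<rho> > 0" "\<bar>e\<bar> \<le> \<rho>"
  shows "\<exists>e'. \<bar>e'\<bar> \<le> \<rho> \<and> bsum \<alpha> f (x + e) j - bsum \<alpha> f x j = e * (\<Sum>i<j. deriv f (orb \<alpha> (x + e') i))"
proof -
  note r = assms(2)
  define g where "g u = (\<Sum>i<j. f (orb \<alpha> x i + u))" for u
  define g' where "g' u = (\<Sum>i<j. deriv f (orb \<alpha> x i + u))" for u
  have in01: "orb \<alpha> x i + u \<in> {0<..<1}" if "i < j" "\<bar>u\<bar> \<le> \<rho>" for i u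
  proof -
    have "2 * \<rho> \<le> orb \<alpha> x i \<and> orb \<alpha> x i \<le> 1 - 2 * \<rho>"
      using assms(1) that(1) by (simp add: deep_def)
    then have "0 < orb \<alpha> x i + u \<and> orb \<alpha> x i + u < 1" using that(2) r by linarith
    then show ?thesis by simp
  qed
  have gd: "(g has_real_derivative g' u) (at u)" if "\<bar>u\<bar> \<le> \<rho>" for u
    unfolding g_def [abs_def] g'_def
  proof (rule DERIV_sum)
    fix i assume "i \<in> {..<j}"
    then have "orb \<alpha> x i + u \<in> {0<..<1}" using in01 that by simp
    from f_deriv[OF this]
    have "((\<lambda>u. f (orb \<alpha> x i + u)) has_real_derivative deriv f (orb \<alpha> x i + u) * 1) (at u)"
      by (rule DERIV_chain2[where g = "\<lambda>u. orb \<alpha> x i + u"]) (auto intro!: derivative_eq_intros)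
    then show "((\<lambda>u. f (orb \<alpha> x i + u)) has_real_derivative deriv f (orb \<alpha> x i + u)) (at u)" by simp
  qed
  have gS: "g u = bsum \<alpha> f (x + u) j" "g' u = (\<Sum>i<j. deriv f (orb \<alpha> (x + u) i))" if "\<bar>u\<bar> \<le> \<rho>" for u
    using deep_shift(1)[OF assms(1,2) that] by (auto simp: g_def g'_def bsum_def)
  have "\<exists>e'. \<bar>e'\<bar> \<le> \<rho> \<and> g e - g 0 = e * g' e'"
  proof -
    consider "e = 0" | "e > 0" | "e < 0" by linarith
    then show ?thesis
    proof cases
      case 1
      then show ?thesis using r by (intro exI[of _ 0]) auto
    next
      case 2
      have "\<exists>z>0. z < e \<and> g e - g 0 = (e - 0) * g' z"
        using 2 assms(3) by (intro MVT2 gd) auto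
      then obtain z where z: "0 < z" "z < e" "g e - g 0 = (e - 0) * g' z" by blast
      show ?thesis using z assms(3) by (intro exI[of _ z]) (auto simp: algebra_simps)
    next
      case 3
      have "\<exists>z>e. z < 0 \<and> g 0 - g e = (0 - e) * g' z"
        using 3 assms(3) by (intro MVT2 gd) auto
      then obtain z where z: "e < z" "z < 0" "g 0 - g e = (0 - e) * g' z" by blast
      show ?thesis using z assms(3) by (intro exI[of _ z]) (auto simp: algebra_simps)
    qed
  qed
  then obtain e' where e': "\<bar>e'\<bar> \<le> \<rho>" "g e - g 0 = e * g' e'" by blast
  then show ?thesis using gS[OF assms(3)] gS[OF e'(1)] gS[of 0] r by (intro exI[of _ e']) auto
qed

lemma bsum_close:
  assumes est: "\<forall>x. orb_avoids2 \<alpha> n x \<longrightarrow> (\<Sum>i<n. \<bar>deriv f (orb \<alpha> x i)\<bar>) \<le> C1 * (real n * ln (real n))"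
    and "deep_orbit \<alpha> n x" "ln (real n) \<ge> 1" "\<bar>e\<bar> \<le> deep_radius n" "j \<le> n"
  shows "\<bar>bsum \<alpha> f (x + e) j - bsum \<alpha> f x j\<bar> \<le> \<bar>e\<bar> * (C1 * (real n * ln (real n)))"
proof -
  note r = deep_radius_pos[OF assms(3)]
  have "deep \<alpha> j (deep_radius n) x" using assms(2,5) by (auto simp: deep_def)
  then obtain e' where e': "\<bar>e'\<bar> \<le> deep_radius n"
    "bsum \<alpha> f (x + e) j - bsum \<alpha> f x j = e * (\<Sum>i<j. deriv f (orb \<alpha> (x + e') i))"
    using bsum_mean_value[OF _ r assms(4)] by blast
  have "\<bar>\<Sum>i<j. deriv f (orb \<alpha> (x + e') i)\<bar> \<le> (\<Sum>i<j. \<bar>deriv f (orb \<alpha> (x + e') i)\<bar>)" by (rule sum_abs)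
  also have "\<dots> \<le> (\<Sum>i<n. \<bar>deriv f (orb \<alpha> (x + e') i)\<bar>)" using assms(5) by (intro sum_mono2) auto
  also have "\<dots> \<le> C1 * (real n * ln (real n))"
    using est deep_shift(2)[OF assms(2) r e'(1) avoid_le_deep[OF assms(3)]] by blast
  finally show ?thesis unfolding e'(2) abs_mult by (intro mult_left_mono) auto
qed

lemma high_roof_borel: "{z \<in> flow_space \<alpha> f. f (fst z) > h} \<in> sets borel"
proof -
  have "(\<lambda>z. cut_roof f (fst z)) \<in> borel_measurable (borel \<Otimes>\<^sub>M (borel :: real measure))" by measurable
  then have "(\<lambda>z::real \<times> real. cut_roof f (fst z)) \<in> borel_measurable borel" by (simp only: borel_prod)
  then have "(\<lambda>z::real \<times> real. cut_roof f (fst z)) -` {h<..} \<inter> space borel \<in> sets borel" by (rule measurable_sets) simp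
  from sets.Int[OF flow_space_borel[of \<alpha>] this]
  have "flow_space \<alpha> f \<inter> ((\<lambda>z. cut_roof f (fst z)) -` {h<..} \<inter> space borel) \<in> sets borel" .
  also have "flow_space \<alpha> f \<inter> ((\<lambda>z. cut_roof f (fst z)) -` {h<..} \<inter> space borel) = {z \<in> flow_space \<alpha> f. f (fst z) > h}"
    using base_pointsD(3) by (auto simp: flow_space_iff cut_roof_def)
  finally show ?thesis .
qed

lemma roof_tail_small:
  assumes "\<eta> > 0"
  shows "\<exists>H>0. emeasure lborel {z \<in> flow_space \<alpha> f. f (fst z) > H} \<le> ennreal \<eta>"
proof -
  let ?A = "\<lambda>n::nat. {z \<in> flow_space \<alpha> f. f (fst z) > real n}"
  note m = high_roof_borel[of \<alpha>]
  have "(\<lambda>n. emeasure lborel (?A n)) \<longlonglongrightarrow> emeasure lborel (\<Inter>n. ?A n)"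
  proof (rule Lim_emeasure_decseq)
    show "range ?A \<subseteq> sets lborel" using m by auto
    show "decseq ?A" by (auto simp: decseq_def)
    show "emeasure lborel (?A n) \<noteq> \<infinity>" for n by (rule finite_lborel_subset) auto
  qed
  also have "(\<Inter>n. ?A n) = {}"
  proof -
    have False if "z \<in> (\<Inter>n. ?A n)" for z
    proof -
      obtain n where "f (fst z) < real n" using reals_Archimedean2 by blast
      then show False using that by (auto dest: spec[of _ n])
    qed
    then show ?thesis by blast
  qed
  finally have "(\<lambda>n. emeasure lborel (?A n)) \<longlonglongrightarrow> 0" by simp
  then have "\<forall>\<^sub>F n in sequentially. emeasure lborel (?A n) < ennreal \<eta>"
    by (rule order_tendstoD) (use assms in simp)
  then obtain N where "\<And>n. n \<ge> N \<Longrightarrow> emeasure lborel (?A n) < ennreal \<eta>" by (auto simp: eventually_sequentially)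
  from this[of "Suc N"] show ?thesis by (intro exI[of _ "real (Suc N)"]) (auto simp del: of_nat_Suc intro: less_imp_le)
qed

lemma emeasure_over_base:
  assumes "X \<in> sets borel" "X \<subseteq> {0..<1}" "H \<ge> 0"
  shows "emeasure lborel (X \<times> {0..H}) = ennreal H * emeasure lborel X"
proof -
  have "emeasure lborel (X \<times> {0..H}) = emeasure (lborel \<Otimes>\<^sub>M lborel) (X \<times> {0..H})" by (simp add: lborel_prod)
  also have "\<dots> = emeasure lborel X * emeasure lborel {0..H}"
    using assms by (intro lborel.emeasure_pair_measure_Times) auto
  finally show ?thesis using assms(3) by (simp add: mult.commute)
qed

text \<open>The conditions on the orbit are stated through the base point alone, so that the complement is estimated by an
  integral over the base.  By \<open>occupation_time\<close>, the sum of the section lengths bounds the time spent in \<open>V\<close> up to time \<open>r\<close>.\<close>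

definition good_set :: "real \<Rightarrow> real \<Rightarrow> (real \<times> real) set \<Rightarrow> real \<Rightarrow> real \<Rightarrow> (real \<times> real) set" where
  "good_set \<alpha> H V a r = {z \<in> flow_space \<alpha> f. f (fst z) \<le> H \<and>
     (\<Sum>i<crossings r. section_length \<alpha> f V (orb \<alpha> (fst z) i)) < ennreal a \<and> deep_orbit \<alpha> (crossings r) (fst z)}"

lemma good_set_measure:
  assumes V: "V \<in> sets borel" "emeasure lborel (V \<inter> flow_space \<alpha> f) \<le> ennreal v"
    and H: "H > 0" "emeasure lborel {z \<in> flow_space \<alpha> f. f (fst z) > H} \<le> ennreal h"
    and pos: "a > 0" "v \<ge> 0" "h \<ge> 0" "ln (real (crossings r)) \<ge> 1"
  defines "n \<equiv> crossings r"
  shows "good_set \<alpha> H V a r \<in> sets borel" "good_set \<alpha> H V a r \<subseteq> flow_space \<alpha> f"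
    "measure lborel (good_set \<alpha> H V a r) \<ge> total_mass \<alpha> - h - H * (real n / a * v + 4 * real n * deep_radius n)"
proof -
  let ?Y = "good_set \<alpha> H V a r"
  have r: "deep_radius n > 0" using pos(4) unfolding n_def by (rule deep_radius_pos)
  define B1 where "B1 = {x \<in> {0..<1}. (\<Sum>i<n. section_length \<alpha> f V (orb \<alpha> x i)) \<ge> ennreal a}"
  define B2 where "B2 = {x \<in> {0..<1}. \<exists>i<n. orb \<alpha> x i < 2 * deep_radius n \<or> orb \<alpha> x i > 1 - 2 * deep_radius n}"
  define T where "T = {z \<in> flow_space \<alpha> f. f (fst z) > H}"
  have T: "T \<in> sets borel" unfolding T_def by (rule high_roof_borel)
  have secm: "(\<lambda>x. section_length \<alpha> f V (orb \<alpha> x i)) \<in> borel_measurable borel" for i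
    by (rule measurable_compose[OF orb_measurable section_length_measurable[OF V(1)]])
  have B1: "B1 \<in> sets borel"
  proof -
    have "(\<lambda>x. \<Sum>i<n. section_length \<alpha> f V (orb \<alpha> x i)) -` {ennreal a..} \<inter> space borel \<in> sets borel"
      by (rule measurable_sets[where A = borel]) (intro borel_measurable_sum secm, simp)
    then have "{0..<1} \<inter> ((\<lambda>x. \<Sum>i<n. section_length \<alpha> f V (orb \<alpha> x i)) -` {ennreal a..} \<inter> space borel) \<in> sets borel"
      by (rule sets.Int[rotated]) simp
    moreover have "{0..<1} \<inter> ((\<lambda>x. \<Sum>i<n. section_length \<alpha> f V (orb \<alpha> x i)) -` {ennreal a..} \<inter> space borel) = B1"
      by (auto simp: B1_def)
    ultimately show ?thesis by simp
  qed
  have B2: "B2 \<in> sets borel"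
  proof -
    have "B2 = (\<Union>i<n. {0..<1} \<inter> ((\<lambda>x. orb \<alpha> x i) -` ({..<2 * deep_radius n} \<union> {1 - 2 * deep_radius n<..}) \<inter> space borel))"
      by (auto simp: B2_def)
    also have "\<dots> \<in> sets borel"
      by (intro sets.finite_UN sets.Int[OF _ measurable_sets[OF orb_measurable]]) auto
    finally show ?thesis .
  qed
  have e1: "emeasure lborel B1 \<le> ennreal (real n / a * v)"
  proof -
    have "emeasure lborel B1 \<le> ennreal (real n / a) * emeasure lborel (V \<inter> flow_space \<alpha> f)"
      unfolding B1_def by (rule occupation_markov[OF V(1) pos(1)])
    also have "\<dots> \<le> ennreal (real n / a) * ennreal v" by (intro mult_left_mono V) auto
    finally show ?thesis using pos by (simp add: ennreal_mult[symmetric])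
  qed
  have e2: "emeasure lborel B2 \<le> ennreal (4 * real n * deep_radius n)"
    using near_singularity_measure_union[of "\<lambda>_. 2 * deep_radius n" n \<alpha>] r unfolding B2_def by (simp add: mult_ac)
  have sub: "flow_space \<alpha> f - T - (B1 \<union> B2) \<times> UNIV = ?Y"
  proof (rule set_eqI)
    fix z
    show "z \<in> flow_space \<alpha> f - T - (B1 \<union> B2) \<times> UNIV \<longleftrightarrow> z \<in> ?Y"
    proof (cases "z \<in> flow_space \<alpha> f")
      case True
      then have "fst z \<in> {0..<1}" by (cases z) (simp add: flow_space_iff base_points_def)
      then have "fst z \<in> B1 \<union> B2 \<longleftrightarrow> \<not> ((\<Sum>i<n. section_length \<alpha> f V (orb \<alpha> (fst z) i)) < ennreal a \<and> deep_orbit \<alpha> n (fst z))"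
        unfolding B1_def B2_def deep_def by (simp only: mem_Collect_eq Un_iff not_less[symmetric]) blast
      then show ?thesis using True by (simp add: good_set_def T_def n_def mem_Times_iff not_less) (auto simp: not_le)
    qed (simp add: good_set_def)
  qed
  have BU: "(B1 \<union> B2) \<times> UNIV \<in> sets (borel :: (real \<times> real) measure)"
  proof -
    have "(B1 \<union> B2) \<times> UNIV \<in> sets (borel \<Otimes>\<^sub>M (borel :: real measure))" using B1 B2 by (intro pair_measureI) auto
    then show ?thesis by (simp only: borel_prod)
  qed
  show Y: "?Y \<in> sets borel" unfolding sub[symmetric] using T BU flow_space_borel[of \<alpha>] by (intro sets.Diff)
  show YF: "?Y \<subseteq> flow_space \<alpha> f" by (auto simp: good_set_def)
  have Bs: "B1 \<union> B2 \<in> sets borel" "B1 \<union> B2 \<subseteq> {0..<1}" 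
    by (rule sets.Un[OF B1 B2]) (unfold B1_def B2_def, blast)
  have cover: "flow_space \<alpha> f \<subseteq> ?Y \<union> (T \<union> (B1 \<union> B2) \<times> {0..H})"
  proof
    fix z assume z: "z \<in> flow_space \<alpha> f"
    obtain x s where xs: "z = (x, s)" by (cases z)
    show "z \<in> ?Y \<union> (T \<union> (B1 \<union> B2) \<times> {0..H})"
    proof (cases "z \<in> T \<or> x \<in> B1 \<union> B2")
      case True
      then show ?thesis using z by (auto simp: xs T_def flow_space_iff)
    next
      case False
      then show ?thesis using z unfolding sub[symmetric] by (auto simp: xs)
    qed
  qed
  have BH: "(B1 \<union> B2) \<times> {0..H} \<in> sets (borel :: (real \<times> real) measure)"
  proof -
    have "(B1 \<union> B2) \<times> {0..H} \<in> sets (borel \<Otimes>\<^sub>M (borel :: real measure))" using Bs by (intro pair_measureI) auto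
    then show ?thesis by (simp only: borel_prod)
  qed
  have "emeasure lborel (flow_space \<alpha> f) \<le> emeasure lborel (?Y \<union> (T \<union> (B1 \<union> B2) \<times> {0..H}))"
    using cover Y T BH by (intro emeasure_mono) auto
  also have "\<dots> \<le> emeasure lborel ?Y + (emeasure lborel T + emeasure lborel ((B1 \<union> B2) \<times> {0..H}))"
    using Y T BH by (intro order_trans[OF emeasure_subadditive] add_left_mono emeasure_subadditive) auto
  also have "emeasure lborel ((B1 \<union> B2) \<times> {0..H}) = ennreal H * emeasure lborel (B1 \<union> B2)"
    using Bs H by (intro emeasure_over_base) auto
  also have "emeasure lborel (B1 \<union> B2) \<le> emeasure lborel B1 + emeasure lborel B2"
    using B1 B2 by (intro emeasure_subadditive) auto
  also have "\<dots> \<le> ennreal (real n / a * v) + ennreal (4 * real n * deep_radius n)" by (intro add_mono e1 e2)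
  also have "\<dots> = ennreal (real n / a * v + 4 * real n * deep_radius n)"
    using pos r by (intro ennreal_plus[symmetric]) auto
  also have "emeasure lborel T \<le> ennreal h" unfolding T_def by (rule H(2))
  also have "emeasure lborel ?Y = ennreal (measure lborel ?Y)"
    using finite_lborel_subset[OF YF] by (intro emeasure_eq_ennreal_measure) auto
  finally have "ennreal (total_mass \<alpha>) \<le> ennreal (measure lborel ?Y) +
      (ennreal h + ennreal H * ennreal (real n / a * v + 4 * real n * deep_radius n))"
    by (simp add: emeasure_flow_space add_mono mult_left_mono)
  also have "\<dots> = ennreal (measure lborel ?Y + (h + H * (real n / a * v + 4 * real n * deep_radius n)))"
    using pos H r by (simp add: ennreal_mult[symmetric] ennreal_plus[symmetric] del: ennreal_plus)
  finally show "measure lborel ?Y \<ge> total_mass \<alpha> - h - H * (real n / a * v + 4 * real n * deep_radius n)"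
    using pos H r by (subst (asm) ennreal_le_iff) auto
qed

lemma good_set_occupation:
  assumes "z \<in> good_set \<alpha> H V a r" "V \<in> sets borel" "a > 0"
  shows "emeasure lborel {t \<in> {0..r}. flow_map \<alpha> f t z \<in> V} \<le> ennreal a"
proof -
  obtain x s where z: "z = (x, s)" by (cases z)
  have "emeasure lborel {t \<in> {0..r}. flow_map \<alpha> f t (x, s) \<in> V} \<le> (\<Sum>i<crossings r. section_length \<alpha> f V (orb \<alpha> x i))"
    using assms by (intro occupation_time) (auto simp: good_set_def z)
  also have "\<dots> \<le> ennreal a" using assms(1) by (auto simp: good_set_def z)
  finally show ?thesis by (simp add: z)
qed

lemma crossings_at_top: "filterlim crossings at_top at_top"
proof -
  have "filterlim (\<lambda>r. r / c) at_top at_top" using c_pos by real_asymp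
  then have "filterlim (\<lambda>r. nat \<lfloor>r / c\<rfloor>) at_top at_top"
    by (intro filterlim_compose[OF filterlim_nat_sequentially] filterlim_compose[OF filterlim_floor_sequentially])
  then show ?thesis unfolding crossings_def [abs_def]
    by (rule filterlim_at_top_mono) auto
qed

lemma crossings_eventually:
  assumes "\<forall>\<^sub>F n in sequentially. Q n" shows "\<forall>\<^sub>F r in at_top. Q (crossings r)"
  using assms crossings_at_top by (rule eventually_compose_filterlim)

lemma crossings_le: "r \<ge> 0 \<Longrightarrow> real (crossings r) \<le> r / c + 2"
  using c_pos by (simp add: crossings_def)

end

section \<open>The upper bound\<close>

context log_roof
begin

text \<open>By inner regularity the atoms contain compact sets with almost the full mass, and disjoint compact sets have
  positive distance.  The points of height zero form a null set and are removed first; on the remaining compact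
  sets the distance to the floor and to the roof attains a positive minimum, as the roof is continuous.\<close>

lemma inner_compacts:
  assumes part: "finite_partition (fm \<alpha>) k P" and "\<eta> > 0"
  obtains KK \<delta> where "compact KK" "KK \<subseteq> flow_space \<alpha> f" "emeasure lborel (- KK \<inter> flow_space \<alpha> f) \<le> ennreal \<eta>"
    "\<delta> > 0" "\<And>x s. (x, s) \<in> KK \<Longrightarrow> \<delta> \<le> s \<and> s \<le> f x - \<delta>"
    "\<And>z z'. z \<in> KK \<Longrightarrow> z' \<in> KK \<Longrightarrow> dist z z' < \<delta> \<Longrightarrow> atom k P z = atom k P z'"
proof -
  let ?F = "flow_space \<alpha> f"
  define \<mu> where "\<mu> = density lborel (indicator ?F :: real \<times> real \<Rightarrow> ennreal)"
  have em: "emeasure \<mu> Y = emeasure lborel (Y \<inter> ?F)" if "Y \<in> sets borel" for Y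
    unfolding \<mu>_def using that flow_space_borel[of \<alpha>]
    by (subst emeasure_restricted) (auto simp: Int_commute)
  have sets\<mu>: "sets \<mu> = sets borel" by (simp add: \<mu>_def)
  have fin: "emeasure \<mu> (space \<mu>) \<noteq> \<infinity>"
    using em[of UNIV] emeasure_flow_space[of \<alpha>] by (simp add: \<mu>_def)
  have kpos: "k > 0"
  proof (rule Nat.gr0I)
    assume "k = 0"
    then have "flow_space \<alpha> f = {}" using part by (auto simp: finite_partition_def space_flow_measure)
    then show False using emeasure_flow_space[of \<alpha>] total_mass_pos[of \<alpha>] by simp
  qed
  \<comment> \<open>Removing the floor makes every compact subset of an atom stay above a positive height.\<close>
  define Q where "Q i = {z \<in> P i. 0 < snd z}" for i
  have Qb: "Q i \<in> sets borel" "Q i \<subseteq> ?F" if "i \<in> {1..k}" for i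
  proof -
    have P: "P i \<in> sets borel" "P i \<subseteq> ?F"
      using part that sets_flow_measure[of "P i" \<alpha>] by (auto simp: finite_partition_def)
    have "open {z :: real \<times> real. 0 < snd z}" by (intro open_Collect_less continuous_intros)
    then have "P i \<inter> {z. 0 < snd z} \<in> sets borel" using P by (intro sets.Int) auto
    also have "P i \<inter> {z. 0 < snd z} = Q i" by (auto simp: Q_def)
    finally show "Q i \<in> sets borel" .
    show "Q i \<subseteq> ?F" using P by (auto simp: Q_def)
  qed
  have "\<exists>Kc. compact Kc \<and> Kc \<subseteq> Q i \<and> emeasure lborel (Q i - Kc) \<le> ennreal (\<eta> / real k)" if i: "i \<in> {1..k}" for i
  proof -
    have fQ: "emeasure \<mu> (Q i) \<noteq> \<infinity>"
    proof -
      have "emeasure \<mu> (Q i) \<le> emeasure \<mu> (space \<mu>)" by (rule emeasure_space)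
      then show ?thesis using fin by (auto simp: top_unique)
    qed
    have "\<exists>Kc \<in> {Kc. Kc \<subseteq> Q i \<and> compact Kc}. emeasure \<mu> (Q i) - ennreal (\<eta> / real k) \<le> emeasure \<mu> Kc"
    proof (cases "emeasure \<mu> (Q i) \<le> ennreal (\<eta> / real k)")
      case True
      then have "emeasure \<mu> (Q i) - ennreal (\<eta> / real k) \<le> emeasure \<mu> {}"
        using fQ by (subst ennreal_minus_le_iff) auto
      then show ?thesis by (intro bexI[of _ "{}"]) auto
    next
      case False
      have "emeasure \<mu> (Q i) - ennreal (\<eta> / real k) < emeasure \<mu> (Q i)"
        using False fQ assms(2) kpos by (intro ennreal_between) (auto simp: not_le less_top intro: le_less_trans[OF zero_le])
      also have "emeasure \<mu> (Q i) = (SUP Kc\<in>{Kc. Kc \<subseteq> Q i \<and> compact Kc}. emeasure \<mu> Kc)"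
        by (rule inner_regular[OF sets\<mu> fin Qb(1)[OF i]])
      finally show ?thesis unfolding less_SUP_iff by (blast intro: less_imp_le)
    qed
    then obtain Kc where Kc: "Kc \<subseteq> Q i" "compact Kc" "emeasure \<mu> (Q i) - ennreal (\<eta> / real k) \<le> emeasure \<mu> Kc" by blast
    have Kb: "Kc \<in> sets borel" by (intro borel_closed compact_imp_closed Kc(2))
    have e: "emeasure \<mu> (Q i) = emeasure lborel (Q i)" "emeasure \<mu> Kc = emeasure lborel Kc"
      using em[OF Qb(1)[OF i]] em[OF Kb] Qb(2)[OF i] Kc(1) by (auto simp: Int_absorb2)
    have fK: "emeasure lborel Kc \<noteq> \<infinity>" using Qb(2)[OF i] Kc(1) by (intro finite_lborel_subset) auto
    have "emeasure lborel (Q i - Kc) = emeasure lborel (Q i) - emeasure lborel Kc"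
      using Kc Kb Qb[OF i] fK by (intro emeasure_Diff) auto
    also have "\<dots> \<le> ennreal (\<eta> / real k)"
    proof -
      have "emeasure lborel (Q i) \<le> emeasure lborel Kc + ennreal (\<eta> / real k)"
        using Kc(3) unfolding e by (simp add: ennreal_minus_le_iff add.commute)
      then show ?thesis using fK by (subst ennreal_minus_le_iff) auto
    qed
    finally show ?thesis using Kc by blast
  qed
  then obtain Kc where Kc: "\<And>i. i \<in> {1..k} \<Longrightarrow> compact (Kc i)" "\<And>i. i \<in> {1..k} \<Longrightarrow> Kc i \<subseteq> Q i"
    "\<And>i. i \<in> {1..k} \<Longrightarrow> emeasure lborel (Q i - Kc i) \<le> ennreal (\<eta> / real k)" by metis
  define KK where "KK = (\<Union>i\<in>{1..k}. Kc i)"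
  have KKc: "compact KK" unfolding KK_def using Kc(1) by (intro compact_UN) auto
  have KKF: "KK \<subseteq> ?F" unfolding KK_def using Kc(2) Qb(2) by blast
  have mass: "emeasure lborel (- KK \<inter> ?F) \<le> ennreal \<eta>"
  proof -
    have zero: "emeasure lborel (UNIV \<times> {0::real} :: (real \<times> real) set) = 0"
    proof -
      have "emeasure (lborel \<Otimes>\<^sub>M lborel) (UNIV \<times> {0} :: (real \<times> real) set) = emeasure lborel (UNIV :: real set) * emeasure lborel {0::real}"
        by (rule lborel.emeasure_pair_measure_Times) auto
      then show ?thesis by (simp add: lborel_prod)
    qed
    have zb: "(UNIV \<times> {0::real} :: (real \<times> real) set) \<in> sets borel"
      by (intro borel_closed closed_Times) auto
    have Kb: "Kc i \<in> sets borel" if "i \<in> {1..k}" for i by (intro borel_closed compact_imp_closed Kc(1)[OF that])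
    have "- KK \<inter> ?F \<subseteq> (\<Union>i\<in>{1..k}. Q i - Kc i) \<union> (UNIV \<times> {0})"
    proof
      fix z assume z: "z \<in> - KK \<inter> ?F"
      have "z \<in> (\<Union>i\<in>{1..k}. P i)" using z part by (simp add: finite_partition_def space_flow_measure)
      then obtain i where i: "i \<in> {1..k}" "z \<in> P i" by blast
      have "snd z \<ge> 0" using z by (cases z) (auto simp: flow_space_iff)
      then show "z \<in> (\<Union>i\<in>{1..k}. Q i - Kc i) \<union> (UNIV \<times> {0})"
        using i z by (cases "snd z = 0") (auto simp: Q_def KK_def mem_Times_iff)
    qed
    then have "emeasure lborel (- KK \<inter> ?F) \<le> emeasure lborel ((\<Union>i\<in>{1..k}. Q i - Kc i) \<union> (UNIV \<times> {0}))"
      using Qb(1) Kb zb by (intro emeasure_mono) auto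
    also have "\<dots> \<le> emeasure lborel (\<Union>i\<in>{1..k}. Q i - Kc i) + emeasure lborel (UNIV \<times> {0::real} :: (real \<times> real) set)"
      using Qb(1) Kb zb by (intro emeasure_subadditive) auto
    also have "\<dots> \<le> (\<Sum>i\<in>{1..k}. emeasure lborel (Q i - Kc i))"
      unfolding zero add_0_right using Qb(1) Kb by (intro emeasure_subadditive_finite) auto
    also have "\<dots> \<le> (\<Sum>i\<in>{1..k}. ennreal (\<eta> / real k))" by (intro sum_mono Kc(3))
    also have "\<dots> = ennreal \<eta>"
      using kpos assms(2) by (simp add: ennreal_of_nat_eq_real_of_nat ennreal_mult[symmetric])
    finally show ?thesis .
  qed
  have "\<exists>d>0. \<forall>i\<in>{1..k}. \<forall>j\<in>{1..k}. i \<noteq> j \<longrightarrow> (\<forall>z\<in>Kc i. \<forall>z'\<in>Kc j. d \<le> dist z z')"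
  proof -
    have "\<exists>d>0. i \<noteq> j \<longrightarrow> (\<forall>z\<in>Kc i. \<forall>z'\<in>Kc j. d \<le> dist z z')" if ij: "i \<in> {1..k}" "j \<in> {1..k}" for i j
    proof (cases "i = j")
      case False
      have "P i \<inter> P j = {}" using part ij False by (auto simp: finite_partition_def disjoint_family_on_def)
      then have "Kc i \<inter> Kc j = {}" using Kc(2)[OF ij(1)] Kc(2)[OF ij(2)] by (auto simp: Q_def)
      from separate_compact_closed[OF Kc(1)[OF ij(1)] compact_imp_closed[OF Kc(1)[OF ij(2)]] this]
      show ?thesis by blast
    qed (auto intro: exI[of _ 1])
    then obtain d where d: "\<And>i j. i \<in> {1..k} \<Longrightarrow> j \<in> {1..k} \<Longrightarrow> d i j > 0 \<and> (i \<noteq> j \<longrightarrow> (\<forall>z\<in>Kc i. \<forall>z'\<in>Kc j. d i j \<le> dist z z'))"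
      by metis
    define D where "D = (\<lambda>(i, j). d i j) ` ({1..k} \<times> {1..k})"
    have D: "finite D" "D \<noteq> {}" "\<And>u. u \<in> D \<Longrightarrow> u > 0" using kpos d by (auto simp: D_def)
    have "Min D \<le> d i j" if "i \<in> {1..k}" "j \<in> {1..k}" for i j
      using D(1) that by (intro Min_le) (auto simp: D_def)
    moreover have "Min D > 0" using D by simp
    ultimately show ?thesis using d by (intro exI[of _ "Min D"]) (meson order_trans)
  qed
  then obtain d where d: "d > 0" "\<And>i j z z'. i \<in> {1..k} \<Longrightarrow> j \<in> {1..k} \<Longrightarrow> i \<noteq> j \<Longrightarrow> z \<in> Kc i \<Longrightarrow> z' \<in> Kc j \<Longrightarrow> d \<le> dist z z'"
    by blast
  define h where "h z = min (snd z) (f (fst z) - snd z)" for z :: "real \<times> real"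
  have hc: "continuous_on KK h"
  proof -
    have fc: "continuous_on {0<..<1} f"
      using f_deriv by (intro DERIV_continuous_on[where D = "deriv f"]) (blast intro: DERIV_subset)
    have "continuous_on KK (\<lambda>z. f (fst z))"
    proof (rule continuous_on_compose2[OF fc])
      show "continuous_on KK fst" by (intro continuous_intros)
      show "fst ` KK \<subseteq> {0<..<1}" using KKF base_pointsD(3) by (force simp: flow_space_iff)
    qed
    then show ?thesis unfolding h_def by (intro continuous_intros)
  qed
  have hpos: "h z > 0" if zK: "z \<in> KK" for z
  proof -
    obtain i where "i \<in> {1..k}" "z \<in> Kc i" using zK unfolding KK_def by blast
    then have "z \<in> Q i" using Kc(2) by blast
    then have "snd z > 0" by (simp add: Q_def)
    moreover have "z \<in> ?F" using zK KKF by auto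
    ultimately show ?thesis by (cases z) (auto simp: h_def flow_space_iff)
  qed
  obtain e where e: "e > 0" "\<And>z. z \<in> KK \<Longrightarrow> e \<le> h z"
  proof (cases "KK = {}")
    case False
    then obtain z0 where "z0 \<in> KK" "\<And>z. z \<in> KK \<Longrightarrow> h z0 \<le> h z"
      using continuous_attains_inf[OF KKc False hc] by blast
    then show ?thesis using that[of "h z0"] hpos by blast
  qed (use that[of 1] in auto)
  have at: "atom k P z = i" if "i \<in> {1..k}" "z \<in> Kc i" for i z
  proof (rule atom_props(3)[OF part _ that(1)])
    show "z \<in> P i" using that Kc(2) by (auto simp: Q_def)
    show "z \<in> space (fm \<alpha>)" using that Kc(2)[OF that(1)] Qb(2)[OF that(1)] by (auto simp: space_flow_measure)
  qed
  show ?thesis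
  proof (rule that[OF KKc KKF mass, of "min d e"])
    show "min d e > 0" using d e by simp
    show "min d e \<le> s \<and> s \<le> f x - min d e" if "(x, s) \<in> KK" for x s
      using e(2)[OF that] by (auto simp: h_def)
    show "atom k P z = atom k P z'" if z: "z \<in> KK" "z' \<in> KK" "dist z z' < min d e" for z z'
    proof -
      obtain i j where ij: "i \<in> {1..k}" "z \<in> Kc i" "j \<in> {1..k}" "z' \<in> Kc j" using z by (auto simp: KK_def)
      then have "i = j" using d(2)[of i j z z'] z(3) by fastforce
      then show ?thesis using at ij by metis
    qed
  qed
qed

text \<open>As long as the first point is not near the floor or the roof, the difference of the Birkhoff sums is too
  small for the two points to have made different numbers of crossings.\<close>

lemma flow_stays_close:
  assumes z: "(x, s) \<in> flow_space \<alpha> f" "(x + e, s') \<in> flow_space \<alpha> f" and t: "t \<in> {0..r}"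
    and deep: "deep_orbit \<alpha> (crossings r) x" "ln (real (crossings r)) \<ge> 1" "\<bar>e\<bar> \<le> deep_radius (crossings r)"
    and close: "\<bar>s - s'\<bar> \<le> d" "\<bar>e\<bar> \<le> d"
      "\<And>j. j \<le> crossings r \<Longrightarrow> \<bar>bsum \<alpha> f (x + e) j - bsum \<alpha> f x j\<bar> \<le> d"
    and inner: "4 * d \<le> snd (flow_map \<alpha> f t (x, s))"
      "snd (flow_map \<alpha> f t (x, s)) \<le> f (fst (flow_map \<alpha> f t (x, s))) - 4 * d" and "d > 0"
  shows "dist (flow_map \<alpha> f t (x, s)) (flow_map \<alpha> f t (x + e, s')) \<le> 3 * d"
proof -
  define N where "N = flow_index \<alpha> f x (s + t)"
  have bx: "x \<in> base_points \<alpha>" "x + e \<in> base_points \<alpha>" "s \<ge> 0" using z by (auto simp: flow_space_iff)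
  have N: "N < crossings r" unfolding N_def using t by (intro flow_index_less_crossings[OF z(1)]) auto
  have fm: "flow_map \<alpha> f t (x, s) = (orb \<alpha> x N, s + t - bsum \<alpha> f x N)"
    by (simp add: flow_map_def N_def Let_def)
  have in1: "bsum \<alpha> f x N + 4 * d \<le> s + t" "s + t + 4 * d \<le> bsum \<alpha> f x (Suc N)"
    using inner by (simp_all add: fm bsum_Suc)
  have c1: "\<bar>bsum \<alpha> f (x + e) N - bsum \<alpha> f x N\<bar> \<le> d" "\<bar>bsum \<alpha> f (x + e) (Suc N) - bsum \<alpha> f x (Suc N)\<bar> \<le> d"
    using close(3)[of N] close(3)[of "Suc N"] N by auto
  have N': "flow_index \<alpha> f (x + e) (s' + t) = N"
    by (rule flow_index_unique[OF bx(2)]) (use in1 c1 close(1) \<open>d > 0\<close> in linarith)+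
  have fm': "flow_map \<alpha> f t (x + e, s') = (orb \<alpha> (x + e) N, s' + t - bsum \<alpha> f (x + e) N)"
    by (simp add: flow_map_def N' Let_def)
  have "orb \<alpha> (x + e) N = orb \<alpha> x N + e" by (rule deep_shift(1)[OF deep(1) deep_radius_pos[OF deep(2)] deep(3) N])
  then have "dist (fst (flow_map \<alpha> f t (x, s))) (fst (flow_map \<alpha> f t (x + e, s'))) \<le> d"
    using close(2) by (simp add: fm fm' dist_real_def)
  moreover have "dist (snd (flow_map \<alpha> f t (x, s))) (snd (flow_map \<alpha> f t (x + e, s'))) \<le> 2 * d"
    using close(1) c1(1) by (simp add: fm fm' dist_real_def)
  moreover have "dist u v \<le> dist (fst u) (fst v) + dist (snd u) (snd v)" for u v :: "real \<times> real"
    unfolding dist_prod_def by (rule sqrt_sum_squares_le_sum) auto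
  ultimately show ?thesis by (smt (verit))
qed

text \<open>The good set is cut into boxes whose width \<open>\<delta> / (C1 n log n)\<close> keeps the shear at most \<open>\<delta>\<close> for all of the
  \<open>n\<close> crossings up to time \<open>r\<close>.  Two points of one box have equal symbols whenever both
  orbits are in the compact part \<open>KK\<close>, which fails for a proportion of time below \<open>\<epsilon>\<close>.\<close>

theorem covering_number_upper:
  assumes part: "finite_partition (fm \<alpha>) k P" and sg: "short_gaps \<alpha>" and "\<epsilon> > 0" "\<beta> \<le> 1"
  shows "\<exists>C>0. \<forall>\<^sub>F r in at_top. covering_number (fm \<alpha>) (fl \<alpha>) k P \<epsilon> \<beta> r \<le> ennreal (C * ((r / c + 2) * ln (r / c + 2) + 1))"
proof -
  define m0 where "m0 = total_mass \<alpha>"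
  have m0: "m0 > 0" unfolding m0_def by (rule total_mass_pos)
  obtain H where H: "H > 0" "emeasure lborel {z \<in> flow_space \<alpha> f. f (fst z) > H} \<le> ennreal (\<epsilon> * m0 / 4)"
    using roof_tail_small[of "\<epsilon> * m0 / 4" \<alpha>] m0 assms(3) by auto
  \<comment> \<open>Chosen such that, by the Markov inequality, few base points have orbits spending more than the time \<open>\<epsilon> r / 4\<close> outside \<open>KK\<close>.\<close>
  define \<eta> where "\<eta> = \<epsilon>\<^sup>2 * c * m0 / (64 * H)"
  have \<eta>: "\<eta> > 0" using assms(3) c_pos m0 H by (simp add: \<eta>_def)
  obtain KK \<delta>0 where KK: "compact KK" "KK \<subseteq> flow_space \<alpha> f" "emeasure lborel (- KK \<inter> flow_space \<alpha> f) \<le> ennreal \<eta>"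
    and \<delta>0: "\<delta>0 > 0" "\<And>x s. (x, s) \<in> KK \<Longrightarrow> \<delta>0 \<le> s \<and> s \<le> f x - \<delta>0"
    "\<And>z z'. z \<in> KK \<Longrightarrow> z' \<in> KK \<Longrightarrow> dist z z' < \<delta>0 \<Longrightarrow> atom k P z = atom k P z'"
    using inner_compacts[OF part \<eta>] by blast
  define \<delta> where "\<delta> = \<delta>0 / 4"
  have \<delta>: "\<delta> > 0" "\<delta>0 = 4 * \<delta>" using \<delta>0 by (auto simp: \<delta>_def)
  obtain c1 C1 where C1: "C1 > 0" and est0: "\<forall>\<^sub>F n in sequentially. \<forall>x. orb_avoids2 \<alpha> n x \<longrightarrow>
    c1 * (real n * ln (real n)) \<le> \<bar>\<Sum>i<n. deriv f (orb \<alpha> x i)\<bar> \<and>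
    (\<Sum>i<n. \<bar>deriv f (orb \<alpha> x i)\<bar>) \<le> C1 * (real n * ln (real n)) \<and>
    (\<Sum>i<n. f (orb \<alpha> x i)) \<le> C1 * real n"
    using birkhoff_estimates[OF sg] by blast
  have est1: "\<forall>\<^sub>F n in sequentially. \<forall>x. orb_avoids2 \<alpha> n x \<longrightarrow>
      (\<Sum>i<n. \<bar>deriv f (orb \<alpha> x i)\<bar>) \<le> C1 * (real n * ln (real n))"
    using est0 by eventually_elim blast
  have l1: "\<forall>\<^sub>F n in sequentially. ln (real n) \<ge> 1" by real_asymp
  have l2: "\<forall>\<^sub>F n in sequentially. \<delta> / (C1 * (real n * ln (real n))) \<le> deep_radius n"
  proof -
    have "filterlim (\<lambda>n. ln (real n) powr (1 / 20)) at_top sequentially" by real_asymp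
    then have "\<forall>\<^sub>F n in sequentially. \<delta> / C1 \<le> ln (real n) powr (1 / 20)" by (simp add: filterlim_at_top)
    then show ?thesis using l1
    proof eventually_elim
      case (elim n)
      define L where "L = ln (real n)"
      have L: "L \<ge> 1" "\<delta> / C1 \<le> L powr (1 / 20)" using elim by (auto simp: L_def)
      have n0: "real n > 0" using elim(2) by (cases n) auto
      have "\<delta> / (C1 * (real n * L)) = \<delta> / C1 / (real n * L)" by simp
      also have "\<dots> \<le> L powr (1 / 20) / (real n * L)" using L n0 by (intro divide_right_mono) auto
      also have "\<dots> = 1 / (real n * L powr (19 / 20))"
      proof -
        have "L powr (1 / 20) * L powr (19 / 20) = L" using L by (simp add: powr_add[symmetric])
        then show ?thesis using L n0 by (simp add: field_simps)
      qed
      finally show ?case by (simp add: deep_radius_def L_def)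
    qed
  qed
  have l3: "\<forall>\<^sub>F n in sequentially. \<delta> / (C1 * (real n * ln (real n))) \<le> \<delta>"
  proof -
    have "filterlim (\<lambda>n. real n * ln (real n)) at_top sequentially" by real_asymp
    then have "\<forall>\<^sub>F n in sequentially. 1 / C1 \<le> real n * ln (real n)" by (simp add: filterlim_at_top)
    then show ?thesis
    proof eventually_elim
      case (elim n)
      have "1 \<le> C1 * (real n * ln (real n))" using elim C1 by (simp add: field_simps)
      then have "\<delta> / (C1 * (real n * ln (real n))) \<le> \<delta> / 1" using \<delta> by (intro divide_left_mono) auto
      then show ?case by simp
    qed
  qed
  have l4: "\<forall>\<^sub>F n in sequentially. H * (4 * real n * deep_radius n) < \<epsilon> * m0 / 8"
  proof -
    have "(\<lambda>n. H * (4 * real n * deep_radius n)) \<longlonglongrightarrow> 0" unfolding deep_radius_def by real_asymp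
    then show ?thesis by (rule order_tendstoD) (use m0 assms(3) in simp)
  qed
  have l5: "\<forall>\<^sub>F r in at_top. r / c + 2 \<le> 2 * r / c \<and> r > 0"
    using eventually_ge_at_top[of "2 * c"] by eventually_elim (use c_pos in \<open>simp add: field_simps\<close>)
  define C where "C = (C1 / \<delta> + 1) * (H / \<delta> + 1)"
  have Cpos: "C > 0" using C1 \<delta> H by (simp add: C_def add_pos_pos)
  have "\<forall>\<^sub>F r in at_top. covering_number (fm \<alpha>) (fl \<alpha>) k P \<epsilon> \<beta> r \<le> ennreal (C * ((r / c + 2) * ln (r / c + 2) + 1))"
    using crossings_eventually[OF est1] crossings_eventually[OF l1] crossings_eventually[OF l2]
      crossings_eventually[OF l3] crossings_eventually[OF l4] l5
  proof eventually_elim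
    case (elim r)
    define n where "n = crossings r"
    note est = elim(1)[folded n_def] and ln1 = elim(2)[folded n_def] and ell1 = elim(3)[folded n_def]
      and ell2 = elim(4)[folded n_def] and sm = elim(5)[folded n_def]
    have r0: "r > 0" using elim(6) by simp
    have nr: "real n \<le> 2 * r / c" using crossings_le[of r] elim(6) by (simp add: n_def)
    have n0: "real n > 0" using ln1 by (cases n) auto
    define W where "W = C1 * (real n * ln (real n))"
    have W: "W > 0" unfolding W_def using C1 n0 ln1 by (intro mult_pos_pos) linarith+
    define l where "l = \<delta> / W"
    have l: "l > 0" "l \<le> deep_radius n" "l \<le> \<delta>" "l * W = \<delta>"
    proof -
      show "l > 0" "l * W = \<delta>" using W \<delta> by (auto simp: l_def)
      show "l \<le> deep_radius n" "l \<le> \<delta>" unfolding l_def W_def by (rule ell1, rule ell2)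
    qed
    define a where "a = \<epsilon> * r / 4"
    have a: "a > 0" using assms(3) r0 by (simp add: a_def)
    define Y where "Y = good_set \<alpha> H (- KK) a r"
    have Vb: "- KK \<in> sets borel" using KK(1) by (intro borel_comp borel_compact)
    note GS = good_set_measure[OF Vb KK(3) H a less_imp_le[OF \<eta>] _ ln1[unfolded n_def], folded n_def]
    have Yb: "Y \<in> sets borel" "Y \<subseteq> flow_space \<alpha> f" unfolding Y_def using GS(1,2) m0 assms(3) by auto
    have "H * (real n / a * \<eta>) \<le> \<epsilon> * m0 / 8"
    proof -
      have "real n / a * \<eta> \<le> (2 * r / c) / a * \<eta>"
        using nr a \<eta> by (intro mult_right_mono divide_right_mono) auto
      also have "\<dots> = \<epsilon> * m0 / (8 * H)"
        using r0 c_pos assms(3) H by (simp add: a_def \<eta>_def field_simps power2_eq_square)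
      finally have "H * (real n / a * \<eta>) \<le> H * (\<epsilon> * m0 / (8 * H))" using H by (intro mult_left_mono) auto
      then show ?thesis using H by simp
    qed
    moreover have "\<epsilon> * m0 / 4 \<ge> 0" using m0 assms(3) by simp
    from GS(3)[OF this] have "m0 - \<epsilon> * m0 / 4 - (H * (real n / a * \<eta>) + H * (4 * real n * deep_radius n)) \<le> measure lborel Y"
      unfolding Y_def m0_def[symmetric] distrib_left .
    ultimately have "m0 - \<epsilon> * m0 / 4 - (\<epsilon> * m0 / 8 + \<epsilon> * m0 / 8) < measure lborel Y"
      using sm by linarith
    then have big: "measure lborel Y > (1 - \<epsilon>) * m0"
      using m0 mult_pos_pos[OF assms(3) m0] by (simp add: algebra_simps)
    define cell where "cell z = (\<lfloor>fst z / l\<rfloor>, \<lfloor>snd z / \<delta>\<rfloor>)" for z :: "real \<times> real"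
    have cell: "cell ` Y \<subseteq> {0..\<lfloor>1 / l\<rfloor>} \<times> {0..\<lfloor>H / \<delta>\<rfloor>}"
    proof
      fix w assume "w \<in> cell ` Y"
      then obtain x s where xs: "(x, s) \<in> Y" "w = cell (x, s)" by auto
      have F: "(x, s) \<in> flow_space \<alpha> f" "f x \<le> H" using xs(1) by (auto simp: Y_def good_set_def)
      then have "0 \<le> x" "x \<le> 1" "0 \<le> s" "s \<le> H" by (auto simp: flow_space_iff base_points_def)
      then show "w \<in> {0..\<lfloor>1 / l\<rfloor>} \<times> {0..\<lfloor>H / \<delta>\<rfloor>}"
        unfolding xs(2) cell_def using l \<delta> by (auto intro!: floor_mono divide_right_mono)
    qed
    have fin: "finite (cell ` Y)" by (rule finite_subset[OF cell]) auto
    define rep where "rep w = (SOME z. z \<in> Y \<and> cell z = w)" for w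
    have rep: "rep (cell z) \<in> Y" "cell (rep (cell z)) = cell z" if "z \<in> Y" for z
      using someI[of "\<lambda>z'. z' \<in> Y \<and> cell z' = cell z" z] that by (auto simp: rep_def)
    define D where "D = rep ` cell ` Y"
    have D: "finite D" "D \<subseteq> flow_space \<alpha> f" using fin rep Yb by (auto simp: D_def)
    have cardD: "real (card D) \<le> (1 / l + 1) * (H / \<delta> + 1)"
    proof -
      have "card D \<le> card (cell ` Y)" unfolding D_def by (rule card_image_le[OF fin])
      also have "\<dots> \<le> card ({0..\<lfloor>1 / l\<rfloor>} \<times> {0..\<lfloor>H / \<delta>\<rfloor>})" by (rule card_mono[OF _ cell]) auto
      finally have "real (card D) \<le> real (nat (\<lfloor>1 / l\<rfloor> + 1)) * real (nat (\<lfloor>H / \<delta>\<rfloor> + 1))"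
        by (simp add: card_cartesian_product flip: of_nat_mult)
      also have "\<dots> \<le> (1 / l + 1) * (H / \<delta> + 1)"
      proof (rule mult_mono)
        have "1 / l \<ge> 0" "H / \<delta> \<ge> 0" using l \<delta> H by auto
        then show "real (nat (\<lfloor>1 / l\<rfloor> + 1)) \<le> 1 / l + 1" "real (nat (\<lfloor>H / \<delta>\<rfloor> + 1)) \<le> H / \<delta> + 1" "0 \<le> 1 / l + 1"
          by (auto simp: of_nat_nat)
      qed auto
      finally show ?thesis .
    qed
    have "covering_number (fm \<alpha>) (fl \<alpha>) k P \<epsilon> \<beta> r \<le> of_nat (card D)"
    proof (rule covering_number_le[OF part r0 assms(3) D Yb])
      have "(\<beta> - \<epsilon>) * m0 \<le> (1 - \<epsilon>) * m0" using assms(4) m0 by (intro mult_right_mono) auto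
      then show "(\<beta> - \<epsilon>) * total_mass \<alpha> < measure lborel Y" using big unfolding m0_def by linarith
      fix z assume z: "z \<in> Y"
      define z0 where "z0 = rep (cell z)"
      have z0: "z0 \<in> Y" "cell z0 = cell z" using rep[OF z] by (auto simp: z0_def)
      obtain x s where xs: "z0 = (x, s)" by (cases z0)
      obtain x' s' where xs': "z = (x', s')" by (cases z)
      have zF: "(x, s) \<in> flow_space \<alpha> f" "(x', s') \<in> flow_space \<alpha> f" using z z0 Yb(2) xs xs' by auto
      have same: "\<bar>u - v\<bar> < m" if "\<lfloor>u / m\<rfloor> = \<lfloor>v / m\<rfloor>" "m > 0" for u v m :: real
      proof -
        have "\<bar>u / m - v / m\<bar> < 1" using that(1) by linarith
        then have "\<bar>u - v\<bar> / m < 1" using that(2) by (simp add: diff_divide_distrib[symmetric])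
        then show ?thesis using that(2) by simp
      qed
      have xx: "\<bar>x - x'\<bar> < l" "\<bar>s - s'\<bar> < \<delta>"
        using z0(2) l(1) \<delta>(1) by (auto simp: xs xs' cell_def intro!: same)
      define e where "e = x' - x"
      have e: "x' = x + e" "\<bar>e\<bar> \<le> l" using xx by (auto simp: e_def)
      have deep: "deep_orbit \<alpha> n x" using z0(1) by (auto simp: Y_def good_set_def xs n_def)
      have cl: "\<bar>bsum \<alpha> f (x + e) j - bsum \<alpha> f x j\<bar> \<le> \<delta>" if "j \<le> n" for j
      proof -
        have "\<bar>bsum \<alpha> f (x + e) j - bsum \<alpha> f x j\<bar> \<le> \<bar>e\<bar> * W"
          unfolding W_def using bsum_close[OF est deep ln1 _ that] e l by simp
        also have "\<dots> \<le> l * W" using e W by (intro mult_right_mono) auto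
        finally show ?thesis using l by simp
      qed
      let ?V = "\<lambda>z. {t \<in> {0..r}. flow_map \<alpha> f t z \<in> - KK}"
      have occ: "emeasure lborel (?V z0) \<le> ennreal a" "emeasure lborel (?V z) \<le> ennreal a"
        using good_set_occupation[OF _ Vb a] z z0 by (auto simp: Y_def)
      have sub: "{t \<in> {0..r}. atom k P (flow_map \<alpha> f t z0) \<noteq> atom k P (flow_map \<alpha> f t z)} \<subseteq> ?V z0 \<union> ?V z"
      proof (rule subsetI, rule ccontr)
        fix t assume t: "t \<in> {t \<in> {0..r}. atom k P (flow_map \<alpha> f t z0) \<noteq> atom k P (flow_map \<alpha> f t z)}" "t \<notin> ?V z0 \<union> ?V z"
        then have in0: "flow_map \<alpha> f t z0 \<in> KK" "flow_map \<alpha> f t z \<in> KK" "t \<in> {0..r}" by auto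
        obtain u v where uv: "flow_map \<alpha> f t (x, s) = (u, v)" by (cases "flow_map \<alpha> f t (x, s)")
        have "4 * \<delta> \<le> v \<and> v \<le> f u - 4 * \<delta>" using \<delta>0(2)[of u v] in0(1) uv xs \<delta>(2) by simp
        then have "dist (flow_map \<alpha> f t (x, s)) (flow_map \<alpha> f t (x + e, s')) \<le> 3 * \<delta>"
          using zF e xx l \<delta> cl deep ln1 in0(3) uv unfolding n_def
          by (intro flow_stays_close[where r = r]) auto
        then have "dist (flow_map \<alpha> f t z0) (flow_map \<alpha> f t z) < \<delta>0" using \<delta> by (simp add: xs xs' e(1))
        then show False using \<delta>0(3)[OF in0(1,2)] t(1) by simp
      qed
      have Vm: "?V w \<in> sets borel" if "w \<in> flow_space \<alpha> f" for w
        by (rule flow_time_set[OF Vb that])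
      have "emeasure lborel {t \<in> {0..r}. atom k P (flow_map \<alpha> f t z0) \<noteq> atom k P (flow_map \<alpha> f t z)}
          \<le> emeasure lborel (?V z0 \<union> ?V z)"
        using sub Vm zF xs xs' by (intro emeasure_mono) auto
      also have "\<dots> \<le> emeasure lborel (?V z0) + emeasure lborel (?V z)"
        using Vm zF xs xs' by (intro emeasure_subadditive) auto
      also have "\<dots> \<le> ennreal a + ennreal a" by (intro add_mono occ)
      also have "\<dots> = ennreal (\<epsilon> * r / 2)" using a by (simp add: ennreal_plus[symmetric] a_def del: ennreal_plus)
      finally have "measure lborel {t \<in> {0..r}. atom k P (flow_map \<alpha> f t z0) \<noteq> atom k P (flow_map \<alpha> f t z)} \<le> \<epsilon> * r / 2"
        unfolding measure_def using assms(3) r0 by (intro enn2real_leI) auto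
      also have "\<dots> < \<epsilon> * r" using assms(3) r0 by simp
      finally show "\<exists>z0\<in>D. measure lborel {t \<in> {0..r}. atom k P (flow_map \<alpha> f t z0) \<noteq> atom k P (flow_map \<alpha> f t z)} < \<epsilon> * r"
        using z unfolding z0_def D_def by blast
    qed
    also have "of_nat (card D) \<le> ennreal (C * ((r / c + 2) * ln (r / c + 2) + 1))"
    proof -
      have "real (card D) \<le> (1 / l + 1) * (H / \<delta> + 1)" by (rule cardD)
      also have "\<dots> \<le> ((C1 / \<delta> + 1) * ((r / c + 2) * ln (r / c + 2) + 1)) * (H / \<delta> + 1)"
      proof (rule mult_right_mono)
        define q where "q = (r / c + 2) * ln (r / c + 2)"
        have nle: "real n \<le> r / c + 2" unfolding n_def using r0 by (intro crossings_le) auto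
        then have "ln (real n) \<le> ln (r / c + 2)" using n0 by (subst ln_le_cancel_iff) auto
        then have q: "real n * ln (real n) \<le> q" unfolding q_def using nle n0 ln1 by (intro mult_mono) auto
        have "1 / l = C1 / \<delta> * (real n * ln (real n))" using \<delta> W by (simp add: l_def W_def)
        also have "\<dots> \<le> C1 / \<delta> * q" using q C1 \<delta> by (intro mult_left_mono) auto
        finally have "1 / l + 1 \<le> C1 / \<delta> * q + 1" by simp
        also have "\<dots> \<le> (C1 / \<delta> + 1) * (q + 1)"
        proof -
          have "q \<ge> 0" using q n0 ln1 by (meson mult_nonneg_nonneg less_imp_le order_trans zero_le_one)
          moreover have "C1 / \<delta> \<ge> 0" using C1 \<delta> by simp
          ultimately show ?thesis by (simp add: distrib_left distrib_right)
        qed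
        finally show "1 / l + 1 \<le> (C1 / \<delta> + 1) * ((r / c + 2) * ln (r / c + 2) + 1)" by (simp add: q_def)
      qed (use H \<delta> in auto)
      also have "\<dots> = C * ((r / c + 2) * ln (r / c + 2) + 1)" by (simp add: C_def mult_ac)
      finally show ?thesis by (simp add: ennreal_of_nat_eq_real_of_nat ennreal_leI)
    qed
    finally show ?case .
  qed
  then show ?thesis using Cpos by blast
qed

end

section \<open>Points whose orbit is close to the singularity in both time directions\<close>

text \<open>If the orbit of \<open>y\<close> comes close to the singularity within \<open>n\<close> steps in the future and within \<open>n\<close> steps in the
  past, then a multiple \<open>m \<alpha>\<close> with \<open>m < 2 n\<close> is extremely close to an integer, which requires a large ratio of
  consecutive denominators around \<open>4 n\<close>.  The indices \<open>k\<close> with such a ratio are sparse by the second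
  Diophantine condition, and for each of them the points with a close visit form a set of measure at most
  \<open>(log q\<^sub>k) powr (- 7 / 8)\<close>.\<close>

text \<open>An upper bound for \<open>2 * deep_radius n\<close>, uniform in all \<open>n > i\<close> whose multiple \<open>4 n\<close> is at least \<open>q\<^sub>k\<close>.\<close>

definition visit_radius :: "real \<Rightarrow> nat \<Rightarrow> nat \<Rightarrow> real" where
  "visit_radius \<alpha> k i = 2 / (max (real i + 1) (real (cden \<alpha> k) / 4) * ln (real (cden \<alpha> k) / 4) powr (19 / 20))"

definition visit_set :: "real \<Rightarrow> nat \<Rightarrow> real set" where
  "visit_set \<alpha> k = {x \<in> {0..<1}. \<exists>i<cden \<alpha> (Suc k). orb \<alpha> x i < visit_radius \<alpha> k i \<or> orb \<alpha> x i > 1 - visit_radius \<alpha> k i}"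

lemma visit_set_borel: "visit_set \<alpha> k \<in> sets borel"
proof -
  have "visit_set \<alpha> k = (\<Union>i<cden \<alpha> (Suc k). {0..<1} \<inter> ((\<lambda>x. orb \<alpha> x i) -` ({..<visit_radius \<alpha> k i} \<union> {1 - visit_radius \<alpha> k i<..}) \<inter> space borel))"
    by (auto simp: visit_set_def)
  also have "\<dots> \<in> sets borel"
    by (intro sets.finite_UN sets.Int[OF _ measurable_sets[OF orb_measurable]]) auto
  finally show ?thesis .
qed

lemma sum_inverse_max_le:
  fixes p q :: nat
  assumes "1 \<le> q" "q \<le> p"
  shows "(\<Sum>i<p. 1 / max (real i + 1) (real q / 4)) \<le> 4 + ln (real p / real q)"
proof -
  have "(\<Sum>i<p. 1 / max (real i + 1) (real q / 4)) = (\<Sum>i<q. 1 / max (real i + 1) (real q / 4)) + (\<Sum>i\<in>{q..<p}. 1 / max (real i + 1) (real q / 4))"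
    using assms by (subst sum.union_disjoint[symmetric]) (auto intro!: sum.cong)
  also have "(\<Sum>i<q. 1 / max (real i + 1) (real q / 4)) \<le> (\<Sum>i<q. 4 / real q)"
  proof (rule sum_mono)
    fix i
    have "1 / max (real i + 1) (real q / 4) \<le> 1 / (real q / 4)" using assms by (intro divide_left_mono) auto
    then show "1 / max (real i + 1) (real q / 4) \<le> 4 / real q" by simp
  qed
  also have "\<dots> = 4" using assms by simp
  also have "(\<Sum>i\<in>{q..<p}. 1 / max (real i + 1) (real q / 4)) \<le> (\<Sum>i\<in>{q..<p}. inverse (real (Suc i)))"
  proof (rule sum_mono)
    fix i assume "i \<in> {q..<p}"
    have "1 / max (real i + 1) (real q / 4) \<le> 1 / (real i + 1)" by (intro divide_left_mono) (auto simp: max_def)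
    then show "1 / max (real i + 1) (real q / 4) \<le> inverse (real (Suc i))" by (simp add: inverse_eq_divide add.commute)
  qed
  also have "\<dots> = harm p - harm q"
    using sum.union_disjoint[of "{..<q}" "{q..<p}" "\<lambda>i. inverse (real (Suc i))"] ivl_disj_un_one(2)[OF assms(2)]
    by (simp add: harm_altdef ivl_disj_int_one)
  also have "\<dots> \<le> ln (real p) - ln (real q)"
    using euler_mascheroni_sequence_decreasing[of q p] assms by simp
  also have "\<dots> = ln (real p / real q)" using assms by (simp add: ln_div)
  finally show ?thesis by simp
qed

text \<open>The radii sum up to a constant plus a harmonic sum between \<open>q\<^sub>k\<close> and \<open>q\<^sub>k\<^sub>+\<^sub>1\<close>, of order \<open>log log q\<^sub>k\<close> by the first Diophantine
  condition, divided by \<open>(log q\<^sub>k) powr (19 / 20)\<close>.\<close>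

lemma visit_set_measure:
  assumes "\<alpha> \<in> dioph_D"
  shows "\<forall>\<^sub>F k in sequentially. emeasure lborel (visit_set \<alpha> k) \<le> ennreal (ln (real (cden \<alpha> k)) powr (- 7 / 8))"
proof -
  have irr: "\<alpha> \<notin> \<rat>" using assms by (simp add: dioph_D_def)
  have "\<forall>\<^sub>F L::real in at_top. 4 / (L - ln 4) powr (19 / 20) * (4 + 201 / 200 * ln L) \<le> L powr (- 7 / 8)" "\<forall>\<^sub>F L in at_top. L \<ge> (2::real)"
    by real_asymp+
  then have 1: "\<forall>\<^sub>F k in sequentially. 4 / (ln (real (cden \<alpha> k)) - ln 4) powr (19 / 20) * (4 + 201 / 200 * ln (ln (real (cden \<alpha> k))))
      \<le> ln (real (cden \<alpha> k)) powr (- 7 / 8)"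
    and 2: "\<forall>\<^sub>F k in sequentially. ln (real (cden \<alpha> k)) \<ge> 2"
    using ln_cden_at_top[OF irr] by (auto simp: filterlim_iff)
  show ?thesis using 1 2 cden_ratio_bound[OF assms]
  proof eventually_elim
    case (elim k)
    define q p L where "q = cden \<alpha> k" and "p = cden \<alpha> (Suc k)" and "L = ln (real q)"
    have q1: "q \<ge> 1" "q \<le> p" unfolding q_def p_def using cden_ge_1[OF irr] cden_mono[OF irr, of k "Suc k"] by auto
    have L2: "L \<ge> 2" using elim by (simp add: L_def q_def)
    have lq: "ln (real q / 4) = L - ln 4" using q1 by (simp add: L_def ln_div)
    define w where "w = visit_radius \<alpha> k"
    have w0: "w i \<ge> 0" for i by (simp add: w_def visit_radius_def)
    have "emeasure lborel (visit_set \<alpha> k) \<le> ennreal (\<Sum>i<p. 2 * w i)"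
      unfolding visit_set_def p_def[symmetric] w_def[symmetric] by (rule near_singularity_measure_union[OF w0])
    also have "(\<Sum>i<p. 2 * w i) = 4 / ln (real q / 4) powr (19 / 20) * (\<Sum>i<p. 1 / max (real i + 1) (real q / 4))"
      unfolding sum_distrib_left by (intro sum.cong refl) (simp add: w_def visit_radius_def q_def)
    also have "\<dots> \<le> 4 / (L - ln 4) powr (19 / 20) * (4 + 201 / 200 * ln L)"
      unfolding lq
    proof (rule mult_left_mono)
      have "real p / real q \<le> L powr (201 / 200)"
        using elim(3) q1 by (simp add: p_def q_def L_def field_simps)
      then have "ln (real p / real q) \<le> ln (L powr (201 / 200))" using q1 L2 by (subst ln_le_cancel_iff) auto
      also have "\<dots> = 201 / 200 * ln L" using L2 by (simp add: ln_powr)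
      finally show "(\<Sum>i<p. 1 / max (real i + 1) (real q / 4)) \<le> 4 + 201 / 200 * ln L"
        using sum_inverse_max_le[OF q1] by linarith
    qed simp
    also have "\<dots> \<le> L powr (- 7 / 8)" using elim(1) by (simp add: L_def q_def)
    finally show ?case by (simp add: L_def q_def ennreal_leI)
  qed
qed

lemma orb_rot_neg:
  "orb \<alpha> (rot \<alpha> (- int m) y) i = frac (y + (real i - real m) * \<alpha>)"
  by (simp add: orb_def rot_def frac_frac_add algebra_simps)

lemma not_deep_orbitE:
  assumes "\<not> deep_orbit \<alpha> n y"
  obtains i where "i < n" "orb \<alpha> y i < 2 * deep_radius n \<or> orb \<alpha> y i > 1 - 2 * deep_radius n"
  using assms by (auto simp: deep_def not_le)

lemma frac_near_integer:
  assumes "frac u < a \<or> frac u > 1 - a" "a > 0"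
  obtains m :: int where "\<bar>u - of_int m\<bar> < a"
proof (cases "frac u < a")
  case True
  then show ?thesis using frac_ge_0[of u] by (intro that[of "\<lfloor>u\<rfloor>"]) (simp add: frac_def)
next
  case False
  then show ?thesis using assms frac_lt_1[of u] by (intro that[of "\<lfloor>u\<rfloor> + 1"]) (simp add: frac_def)
qed

lemma two_sided_visit:
  assumes "\<alpha> \<in> dioph_D"
  shows "\<forall>\<^sub>F n in sequentially. \<forall>y\<in>{0..<1}. \<not> deep_orbit \<alpha> n y \<and> \<not> deep_orbit \<alpha> n (rot \<alpha> (- int n) y) \<longrightarrow>
    (\<exists>k\<ge>k0. k \<notin> K_set \<alpha> \<and> y \<in> visit_set \<alpha> k)"
proof -
  have irr: "\<alpha> \<notin> \<rat>" using assms by (simp add: dioph_D_def)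
  have "\<forall>\<^sub>F L::real in at_top. (L - ln 4) powr (19 / 20) / 32 > L powr (7 / 8)" "\<forall>\<^sub>F L in at_top. L > 1 + ln (4::real)"
    by real_asymp+
  then have "\<forall>\<^sub>F k in sequentially. (ln (real (cden \<alpha> k)) - ln 4) powr (19 / 20) / 32 > ln (real (cden \<alpha> k)) powr (7 / 8)"
    "\<forall>\<^sub>F k in sequentially. ln (real (cden \<alpha> k)) > 1 + ln 4"
    using ln_cden_at_top[OF irr] by (auto simp: filterlim_iff)
  then have "\<forall>\<^sub>F k in sequentially. (ln (real (cden \<alpha> k)) - ln 4) powr (19 / 20) / 32 > ln (real (cden \<alpha> k)) powr (7 / 8)
      \<and> ln (real (cden \<alpha> k)) > 1 + ln 4" by eventually_elim simp
  then obtain k1 where k1: "\<And>k. k \<ge> k1 \<Longrightarrow> (ln (real (cden \<alpha> k)) - ln 4) powr (19 / 20) / 32 > ln (real (cden \<alpha> k)) powr (7 / 8)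
      \<and> ln (real (cden \<alpha> k)) > 1 + ln 4" by (auto simp: eventually_sequentially)
  have "filterlim (\<lambda>n::nat. 4 * n) at_top sequentially"
    by (rule filterlim_subseq) (auto simp: strict_mono_def)
  then have gap: "\<forall>\<^sub>F n in sequentially. \<exists>k\<ge>max k0 k1. cden \<alpha> k \<le> 4 * n \<and> 4 * n < cden \<alpha> (Suc k) \<and>
      real (cden \<alpha> (Suc k)) \<le> real (cden \<alpha> k) * ln (real (4 * n)) powr (201 / 200)"
    using cden_gap[OF assms, of "max k0 k1"] unfolding filterlim_iff by blast
  have l1: "\<forall>\<^sub>F n in sequentially. ln (real n) \<ge> 1" by real_asymp
  show ?thesis using gap l1
  proof eventually_elim
    case (elim n)
    obtain k where k: "k \<ge> k0" "k \<ge> k1" "cden \<alpha> k \<le> 4 * n" "4 * n < cden \<alpha> (Suc k)" using elim(1) by auto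
    define q p L where "q = cden \<alpha> k" and "p = cden \<alpha> (Suc k)" and "L = ln (real q)"
    have q1: "q \<ge> 1" unfolding q_def by (rule cden_ge_1[OF irr])
    have lq: "ln (real q / 4) = L - ln 4" using q1 by (simp add: L_def ln_div)
    have L: "(L - ln 4) powr (19 / 20) / 32 > L powr (7 / 8)" "L - ln 4 > 1"
      using k1[OF k(2)] by (auto simp: L_def q_def)
    have n0: "real n > 0" using elim(2) by (cases n) auto
    have qn: "real q / 4 \<le> real n" using k(3) by (simp add: q_def)
    have lnn: "L - ln 4 \<le> ln (real n)" unfolding lq[symmetric] using qn q1 n0 by (subst ln_le_cancel_iff) auto
    have r0: "deep_radius n > 0" using elim(2) by (rule deep_radius_pos)
    show ?case
    proof (intro ballI impI)
      fix y :: real assume y: "y \<in> {0..<1}" and nd: "\<not> deep_orbit \<alpha> n y \<and> \<not> deep_orbit \<alpha> n (rot \<alpha> (- int n) y)"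
      obtain i where i: "i < n" "orb \<alpha> y i < 2 * deep_radius n \<or> orb \<alpha> y i > 1 - 2 * deep_radius n"
        using nd not_deep_orbitE by blast
      obtain j where j: "j < n" "orb \<alpha> (rot \<alpha> (- int n) y) j < 2 * deep_radius n \<or> orb \<alpha> (rot \<alpha> (- int n) y) j > 1 - 2 * deep_radius n"
        using nd not_deep_orbitE by blast
      obtain a :: int where a: "\<bar>y + real i * \<alpha> - of_int a\<bar> < 2 * deep_radius n"
        using frac_near_integer[of "y + real i * \<alpha>" "2 * deep_radius n"] i(2) r0 by (auto simp: orb_def)
      obtain b :: int where b: "\<bar>y + (real j - real n) * \<alpha> - of_int b\<bar> < 2 * deep_radius n"
        using frac_near_integer[of "y + (real j - real n) * \<alpha>" "2 * deep_radius n"] j(2) r0 by (auto simp: orb_rot_neg)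
      \<comment> \<open>The number of steps between the two visits.\<close>
      define m where "m = i + n - j"
      have m: "0 < m" "2 * m \<le> p" using i(1) j(1) k(4) by (auto simp: m_def p_def)
      have "real m * \<alpha> - of_int (a - b) = (y + real i * \<alpha> - of_int a) - (y + (real j - real n) * \<alpha> - of_int b)"
        using j(1) by (simp add: m_def algebra_simps of_nat_diff)
      then have "\<bar>real m * \<alpha> - of_int (a - b)\<bar> < 4 * deep_radius n" using a b by linarith
      moreover have "\<bar>real m * \<alpha> - of_int (a - b)\<bar> \<ge> 1 / (2 * real p)"
        using good_denom_separation[OF good_denom_cden[OF irr, of k] m(1)] m(2) unfolding p_def by blast
      ultimately have "1 / (2 * real p) < 4 * deep_radius n" by linarith
      then have "1 / (2 * real p) < 4 / (real n * ln (real n) powr (19 / 20))" by (simp add: deep_radius_def)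
      moreover have "real n * ln (real n) powr (19 / 20) > 0"
        using n0 elim(2) by (intro mult_pos_pos) auto
      moreover have p0: "real p > 0" using m by simp
      ultimately have "real n * ln (real n) powr (19 / 20) < 8 * real p" by (simp add: field_simps)
      moreover have "(real q / 4) * (L - ln 4) powr (19 / 20) \<le> real n * ln (real n) powr (19 / 20)"
        using qn lnn L(2) by (intro mult_mono powr_mono2) auto
      ultimately have "real q * ((L - ln 4) powr (19 / 20) / 32) < real p" by simp
      moreover have "real q * L powr (7 / 8) \<le> real q * ((L - ln 4) powr (19 / 20) / 32)"
        using L(1) by (intro mult_left_mono) auto
      ultimately have "real q * L powr (7 / 8) < real p" by linarith
      then have kK: "k \<notin> K_set \<alpha>"
        by (simp add: K_set_def q_def p_def L_def of_cden[OF irr])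
      have "2 * deep_radius n \<le> visit_radius \<alpha> k i"
      proof -
        have "max (real i + 1) (real q / 4) * (L - ln 4) powr (19 / 20) \<le> real n * ln (real n) powr (19 / 20)"
          using i(1) qn lnn L(2) by (intro mult_mono powr_mono2) auto
        moreover have "max (real i + 1) (real q / 4) * (L - ln 4) powr (19 / 20) > 0"
          using L(2) by (intro mult_pos_pos) (auto simp: less_max_iff_disj)
        ultimately have "2 / (real n * ln (real n) powr (19 / 20)) \<le> 2 / (max (real i + 1) (real q / 4) * (L - ln 4) powr (19 / 20))"
          using mult_pos_pos[of "real n * ln (real n) powr (19 / 20)" "max (real i + 1) (real q / 4) * (L - ln 4) powr (19 / 20)"]
          by (intro divide_left_mono) linarith+
        then show ?thesis unfolding visit_radius_def q_def[symmetric] lq by (simp add: deep_radius_def)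
      qed
      then have "y \<in> visit_set \<alpha> k"
        using y i k(4) unfolding visit_set_def by (intro CollectI conjI exI[of _ i]) auto
      then show "\<exists>k\<ge>k0. k \<notin> K_set \<alpha> \<and> y \<in> visit_set \<alpha> k" using kK k(1) by blast
    qed
  qed
qed

context log_roof
begin

text \<open>The measures of the sets \<open>visit_set \<alpha> k\<close> with \<open>k\<close> outside \<open>K_set \<alpha>\<close> are summable by the second Diophantine
  condition; \<open>X\<close> is the union of a tail.\<close>

lemma bad_base_set:
  assumes D: "\<alpha> \<in> dioph_D" and E: "\<alpha> \<in> dioph_E" and "\<eta> > 0"
  obtains X where "X \<in> sets borel" "X \<subseteq> {0..<1}" "emeasure lborel ((X \<times> UNIV) \<inter> flow_space \<alpha> f) \<le> ennreal \<eta>"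
    "\<forall>\<^sub>F n in sequentially. \<forall>y\<in>{0..<1} - X. deep_orbit \<alpha> n y \<or> deep_orbit \<alpha> n (rot \<alpha> (- int n) y)"
proof -
  have irr: "\<alpha> \<notin> \<rat>" using D by (simp add: dioph_D_def)
  define S where "S = {i. i \<ge> 2 \<and> i \<notin> K_set \<alpha>}"
  define g where "g k = (if k \<in> S then ln (real (cden \<alpha> k)) powr (- 7 / 8) else 0)" for k
  define Z where "Z k = (if k \<in> S then visit_set \<alpha> k else {})" for k
  have "(\<lambda>i. ln (real (cden \<alpha> i)) powr (- 7 / 8)) summable_on S"
    using E by (simp add: dioph_E_def S_def of_cden[OF irr])
  then have "g summable_on UNIV"
    by (rule summable_on_cong_neutral[THEN iffD1, rotated -1]) (auto simp: g_def)
  then have gs: "summable g" by (subst (asm) summable_on_UNIV_nonneg_real_iff) (auto simp: g_def)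
  have Zb: "Z k \<in> sets lborel" for k using visit_set_borel[of \<alpha> k] by (auto simp: Z_def)
  have Z01: "Z k \<subseteq> {0..<1}" for k by (auto simp: Z_def visit_set_def)
  have Zfin: "emeasure lborel (Z k) < \<infinity>" for k
  proof -
    have "emeasure lborel (Z k) \<le> emeasure lborel {0..<1::real}" using Z01 by (intro emeasure_mono) auto
    then show ?thesis by (simp add: order_le_less_trans)
  qed
  have "\<forall>\<^sub>F k in sequentially. norm (measure lborel (Z k)) \<le> g k"
    using visit_set_measure[OF D]
  proof eventually_elim
    case (elim k)
    then show ?case by (auto simp: Z_def g_def measure_def intro!: enn2real_leI)
  qed
  then have "summable (\<lambda>k. measure lborel (Z k))" by (rule summable_comparison_test_ev[OF _ gs])
  then have null: "limsup Z \<in> null_sets lborel" by (rule borel_cantelli_limsup1[OF Zb Zfin])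
  define U where "U k0 = (\<Union>k\<in>{k0..}. Z k)" for k0
  have Ub: "U k0 \<in> sets borel" "U k0 \<subseteq> {0..<1}" for k0
    using Zb Z01 by (auto simp: U_def intro!: sets.countable_UN')
  have prod: "X \<times> UNIV \<in> sets (borel :: (real \<times> real) measure)" if "X \<in> sets borel" for X :: "real set"
  proof -
    have "X \<times> UNIV \<in> sets (borel \<Otimes>\<^sub>M (borel :: real measure))" using that by (intro pair_measureI) auto
    then show ?thesis by (simp only: borel_prod)
  qed
  define W where "W k0 = (U k0 \<times> UNIV) \<inter> flow_space \<alpha> f" for k0
  have Wb: "W k0 \<in> sets borel" for k0 unfolding W_def by (rule sets.Int[OF prod[OF Ub(1)] flow_space_borel])
  have "(\<lambda>k0. emeasure lborel (W k0)) \<longlonglongrightarrow> emeasure lborel (\<Inter>k0. W k0)"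
  proof (rule Lim_emeasure_decseq)
    show "range W \<subseteq> sets lborel" using Wb by auto
    show "decseq W" unfolding decseq_def W_def U_def by fastforce
    show "emeasure lborel (W k0) \<noteq> \<infinity>" for k0 by (rule finite_lborel_subset) (auto simp: W_def)
  qed
  also have "emeasure lborel (\<Inter>k0. W k0) = 0"
  proof -
    have lb: "limsup Z \<in> sets borel" "emeasure lborel (limsup Z) = 0" using null by auto
    have "(\<Inter>k0. W k0) \<subseteq> limsup Z \<times> UNIV" by (auto simp: limsup_INF_SUP W_def U_def)
    then have "emeasure lborel (\<Inter>k0. W k0) \<le> emeasure lborel (limsup Z \<times> (UNIV :: real set))"
      using prod[OF lb(1)] by (intro emeasure_mono) auto
    also have "\<dots> = emeasure (lborel \<Otimes>\<^sub>M lborel) (limsup Z \<times> (UNIV :: real set))" by (simp add: lborel_prod)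
    also have "\<dots> = emeasure lborel (limsup Z) * emeasure lborel (UNIV :: real set)"
      using lb by (intro lborel.emeasure_pair_measure_Times) auto
    finally show ?thesis using lb by simp
  qed
  finally have "\<forall>\<^sub>F k0 in sequentially. emeasure lborel (W k0) < ennreal \<eta>"
    by (rule order_tendstoD) (use assms in simp)
  then obtain k0 where k0: "emeasure lborel (W k0) < ennreal \<eta>" "k0 \<ge> 2"
    using eventually_conj[OF _ eventually_ge_at_top[of 2]] by (metis (no_types, lifting) eventually_sequentially order_refl)
  show ?thesis
  proof (rule that[OF Ub, of k0])
    show "emeasure lborel ((U k0 \<times> UNIV) \<inter> flow_space \<alpha> f) \<le> ennreal \<eta>"
      using k0(1) by (simp add: W_def less_imp_le)
    show "\<forall>\<^sub>F n in sequentially. \<forall>y\<in>{0..<1} - U k0. deep_orbit \<alpha> n y \<or> deep_orbit \<alpha> n (rot \<alpha> (- int n) y)"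
      using two_sided_visit[OF D, of k0]
    proof eventually_elim
      case (elim n)
      show ?case
      proof (intro ballI)
        fix y assume y: "y \<in> {0..<1} - U k0"
        show "deep_orbit \<alpha> n y \<or> deep_orbit \<alpha> n (rot \<alpha> (- int n) y)"
        proof (rule ccontr)
          assume "\<not> (deep_orbit \<alpha> n y \<or> deep_orbit \<alpha> n (rot \<alpha> (- int n) y))"
          then obtain k where "k \<ge> k0" "k \<notin> K_set \<alpha>" "y \<in> visit_set \<alpha> k" using elim y by blast
          then have "y \<in> U k0" using k0(2) by (auto simp: U_def Z_def S_def)
          then show False using y by simp
        qed
      qed
    qed
  qed
qed

end

section \<open>Separation of names\<close>

text \<open>If every point of \<open>S\<close> lies in an interval in which \<open>U\<close> has density at least \<open>\<kappa>\<close>, then \<open>U\<close> is not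
  much smaller than \<open>\<kappa> S\<close>: a disjoint subfamily of the intervals, enlarged five times, still covers \<open>S\<close>.\<close>

lemma vitali_fraction:
  fixes S U :: "real set"
  assumes U: "U \<in> sets borel" and "\<kappa> \<ge> 0"
    and cov: "\<And>t. t \<in> S \<Longrightarrow> \<exists>a \<rho>. t \<in> cball a \<rho> \<and> 0 < \<rho> \<and> \<rho> \<le> L \<and> ennreal (\<kappa> * (2 * \<rho>)) \<le> emeasure lborel (U \<inter> cball a \<rho>)"
    and "S \<in> sets borel"
  shows "ennreal \<kappa> * emeasure lborel S \<le> 5 * emeasure lborel U"
proof -
  obtain a \<rho> where a: "\<And>t. t \<in> S \<Longrightarrow> t \<in> cball (a t) (\<rho> t) \<and> 0 < \<rho> t \<and> \<rho> t \<le> L \<and> ennreal (\<kappa> * (2 * \<rho> t)) \<le> emeasure lborel (U \<inter> cball (a t) (\<rho> t))"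
    using cov by metis
  obtain C where C: "countable C" "C \<subseteq> S"
    "pairwise (\<lambda>i j. disjnt (cball (a i) (\<rho> i)) (cball (a j) (\<rho> j))) C"
    "S \<subseteq> (\<Union>i\<in>C. cball (a i) (5 * \<rho> i))"
    by (rule Vitali_covering_lemma_cballs[where S = S and K = S and a = a and r = \<rho> and B = L]) (use a in auto)
  have \<rho>0: "\<rho> i > 0" if "i \<in> C" for i using a C(2) that by blast
  define I where "I = to_nat_on C ` C"
  define g where "g = from_nat_into C"
  have g: "g n \<in> C" "to_nat_on C (g n) = n" if "n \<in> I" for n
    using that C(1) by (auto simp: I_def g_def)
  define A where "A n = (if n \<in> I then cball (a (g n)) (5 * \<rho> (g n)) else {})" for n
  define W where "W n = (if n \<in> I then U \<inter> cball (a (g n)) (\<rho> (g n)) else {})" for n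
  have cb: "emeasure lborel (cball u v) = ennreal (2 * v)" if "v \<ge> 0" for u v :: real
    using that by (simp add: cball_eq_atLeastAtMost)
  have SA: "S \<subseteq> (\<Union>n. A n)"
  proof
    fix t assume "t \<in> S"
    then obtain i where i: "i \<in> C" "t \<in> cball (a i) (5 * \<rho> i)" using C(4) by blast
    have "to_nat_on C i \<in> I" "g (to_nat_on C i) = i" using i(1) C(1) by (auto simp: I_def g_def)
    then show "t \<in> (\<Union>n. A n)" using i(2) by (intro UN_I[of "to_nat_on C i"]) (auto simp: A_def)
  qed
  have "emeasure lborel S \<le> emeasure lborel (\<Union>n. A n)" using SA by (intro emeasure_mono) (auto simp: A_def)
  also have "\<dots> \<le> (\<Sum>n. emeasure lborel (A n))" by (intro emeasure_subadditive_countably) (auto simp: A_def)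
  finally have "ennreal \<kappa> * emeasure lborel S \<le> ennreal \<kappa> * (\<Sum>n. emeasure lborel (A n))" by (intro mult_left_mono) auto
  also have "\<dots> = (\<Sum>n. ennreal \<kappa> * emeasure lborel (A n))" by (simp add: ennreal_suminf_cmult)
  also have "\<dots> \<le> (\<Sum>n. 5 * emeasure lborel (W n))"
  proof (intro suminf_le summableI)
    fix n
    show "ennreal \<kappa> * emeasure lborel (A n) \<le> 5 * emeasure lborel (W n)"
    proof (cases "n \<in> I")
      case True
      note gn = g(1)[OF True]
      have "ennreal \<kappa> * emeasure lborel (A n) = ennreal (5 * (\<kappa> * (2 * \<rho> (g n))))"
        using True \<rho>0[OF gn] assms(2) by (simp add: A_def cb ennreal_mult[symmetric] mult_ac)
      also have "\<dots> = 5 * ennreal (\<kappa> * (2 * \<rho> (g n)))"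
        using \<rho>0[OF gn] assms(2) by (subst ennreal_mult) auto
      also have "\<dots> \<le> 5 * emeasure lborel (W n)"
        using a gn C(2) True by (intro mult_left_mono) (auto simp: W_def)
      finally show ?thesis .
    qed (simp add: A_def)
  qed
  also have "\<dots> = 5 * (\<Sum>n. emeasure lborel (W n))" by (simp add: ennreal_suminf_cmult)
  also have "(\<Sum>n. emeasure lborel (W n)) = emeasure lborel (\<Union>n. W n)"
  proof (rule suminf_emeasure)
    show "range W \<subseteq> sets lborel" using U by (auto simp: W_def)
    show "disjoint_family W"
      unfolding disjoint_family_on_def
    proof (intro ballI impI)
      fix m n :: nat assume "m \<noteq> n"
      show "W m \<inter> W n = {}"
      proof (cases "m \<in> I \<and> n \<in> I")
        case True
        then have "g m \<noteq> g n" using g(2) \<open>m \<noteq> n\<close> by metis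
        then have "disjnt (cball (a (g m)) (\<rho> (g m))) (cball (a (g n)) (\<rho> (g n)))"
          using C(3) g(1) True by (auto simp: pairwise_def)
        then show ?thesis by (auto simp: W_def disjnt_def)
      qed (auto simp: W_def)
    qed
  qed
  also have "5 * emeasure lborel (\<Union>n. W n) \<le> 5 * emeasure lborel U"
    using U by (intro mult_left_mono emeasure_mono) (auto simp: W_def)
  finally show ?thesis .
qed

lemma birkhoff_0 [simp]: "birkhoff \<alpha> f 0 x = 0"
  by (simp add: birkhoff_def)

lemma birkhoff_cocycle:
  assumes "x \<in> base_points \<alpha>"
  shows "birkhoff \<alpha> f (m + n) x = birkhoff \<alpha> f m x + birkhoff \<alpha> f n (rot \<alpha> m x)"
proof (induction n rule: int_induct[where k = 0])
  case base
  then show ?case by simp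
next
  case (step1 i)
  have "birkhoff \<alpha> f (m + (i + 1)) x = birkhoff \<alpha> f (m + i) x + f (rot \<alpha> (m + i) x)"
    using birkhoff_step[of \<alpha> f "m + i" x] by (simp add: add.assoc)
  then show ?case using step1 birkhoff_step[of \<alpha> f i "rot \<alpha> m x"] by (simp add: rot_rot add.commute)
next
  case (step2 i)
  have "birkhoff \<alpha> f (m + i) x = birkhoff \<alpha> f (m + (i - 1)) x + f (rot \<alpha> (m + (i - 1)) x)"
    using birkhoff_step[of \<alpha> f "m + (i - 1)" x] by (simp add: algebra_simps)
  moreover have "birkhoff \<alpha> f i (rot \<alpha> m x) = birkhoff \<alpha> f (i - 1) (rot \<alpha> m x) + f (rot \<alpha> (m + (i - 1)) x)"
    using birkhoff_step[of \<alpha> f "i - 1" "rot \<alpha> m x"] by (simp add: rot_rot add.commute)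
  ultimately show ?case using step2 by linarith
qed

lemma birkhoff_backward:
  assumes "x \<in> base_points \<alpha>"
  shows "birkhoff \<alpha> f (- int n) x = - bsum \<alpha> f (rot \<alpha> (- int n) x) n"
  using birkhoff_cocycle[OF assms, of f "- int n" "int n"] by (simp add: birkhoff_of_nat)

lemma rot_diff_index:
  assumes "x \<in> base_points \<alpha>" shows "rot \<alpha> (- int j) (orb \<alpha> x (i + j)) = orb \<alpha> x i"
proof -
  have "rot \<alpha> (- int j) (orb \<alpha> x (i + j)) = rot \<alpha> (- int j + int (i + j)) x"
    unfolding rot_of_nat[symmetric] rot_rot ..
  also have "- int j + int (i + j) = int i" by simp
  finally show ?thesis by (simp only: rot_of_nat)
qed

lemma orb_rot: "orb \<alpha> (rot \<alpha> m x) i = rot \<alpha> (m + int i) x"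
  by (simp add: orb_def rot_def frac_frac_add algebra_simps)

lemma eventually_half:
  assumes "\<forall>\<^sub>F j in sequentially. Q j" shows "\<forall>\<^sub>F n::nat in sequentially. \<forall>j. n \<le> 2 * j \<longrightarrow> Q j"
proof -
  obtain N where N: "\<And>j. j \<ge> N \<Longrightarrow> Q j" using assms by (auto simp: eventually_sequentially)
  show ?thesis by (intro eventually_sequentiallyI[of "2 * N"]) (auto intro!: N)
qed

context log_roof
begin

lemma birkhoff_gap:
  assumes "x \<in> base_points \<alpha>" shows "\<bar>birkhoff \<alpha> f m x - birkhoff \<alpha> f n x\<bar> \<ge> c * \<bar>real_of_int (m - n)\<bar>"
proof -
  have *: "birkhoff \<alpha> f (n + int i) x - birkhoff \<alpha> f n x \<ge> c * real i" for n i
    using birkhoff_cocycle[OF assms, of f n "int i"] bsum_ge[OF rot_base_points[OF assms, of n], of i]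
    by (simp add: birkhoff_of_nat)
  show ?thesis using *[where n = n and i = "nat (m - n)"] *[where n = m and i = "nat (n - m)"] by (cases "n \<le> m") auto
qed

text \<open>If the second orbit has made
  as many crossings as the first, the heights differ by the shear up to \<open>\<delta>\<close>; any other number of crossings changes the
  difference by at least \<open>c\<close>, whereas the shear is at most \<open>c - 2 \<delta>\<close>.\<close>

lemma sheared_heights_differ:
  assumes z: "(x, s) \<in> flow_space \<alpha> f" "(x', s') \<in> flow_space \<alpha> f" and t: "t0 \<ge> 0" "t \<ge> 0"
  defines "y \<equiv> fst (flow_map \<alpha> f t0 (x, s))" and "y' \<equiv> fst (flow_map \<alpha> f t0 (x', s'))"
    and "j \<equiv> int (flow_index \<alpha> f x (s + t)) - int (flow_index \<alpha> f x (s + t0))"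
  assumes close: "\<bar>snd (flow_map \<alpha> f t0 (x, s)) - snd (flow_map \<alpha> f t0 (x', s'))\<bar> < \<delta>"
    and shear: "2 * \<delta> \<le> \<bar>birkhoff \<alpha> f j y' - birkhoff \<alpha> f j y\<bar>" "\<bar>birkhoff \<alpha> f j y' - birkhoff \<alpha> f j y\<bar> \<le> c - 2 * \<delta>"
  shows "\<not> \<bar>snd (flow_map \<alpha> f t (x, s)) - snd (flow_map \<alpha> f t (x', s'))\<bar> < \<delta>"
proof -
  have b: "x \<in> base_points \<alpha>" "x' \<in> base_points \<alpha>" using z by (auto simp: flow_space_iff)
  define M M' N N' where "M = flow_index \<alpha> f x (s + t0)" and "M' = flow_index \<alpha> f x' (s' + t0)"
    and "N = flow_index \<alpha> f x (s + t)" and "N' = flow_index \<alpha> f x' (s' + t)"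
  define j' where "j' = int N' - int M'"
  have y: "y = rot \<alpha> (int M) x" "y' = rot \<alpha> (int M') x'"
    by (simp_all add: y_def y'_def flow_map_def Let_def M_def M'_def rot_of_nat)
  have by': "y' \<in> base_points \<alpha>" unfolding y by (rule rot_base_points[OF b(2)])
  have S: "bsum \<alpha> f x N = bsum \<alpha> f x M + birkhoff \<alpha> f j y" "bsum \<alpha> f x' N' = bsum \<alpha> f x' M' + birkhoff \<alpha> f j' y'"
    using birkhoff_cocycle[OF b(1), of f "int M" j] birkhoff_cocycle[OF b(2), of f "int M'" j']
    by (simp_all add: j_def j'_def N_def[symmetric] M_def[symmetric] y birkhoff_of_nat)
  have sn: "snd (flow_map \<alpha> f t0 (x, s)) = s + t0 - bsum \<alpha> f x M" "snd (flow_map \<alpha> f t0 (x', s')) = s' + t0 - bsum \<alpha> f x' M'"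
    "snd (flow_map \<alpha> f t (x, s)) = s + t - bsum \<alpha> f x N" "snd (flow_map \<alpha> f t (x', s')) = s' + t - bsum \<alpha> f x' N'"
    by (simp_all add: flow_map_def Let_def M_def M'_def N_def N'_def)
  show ?thesis
  proof (cases "j' = j")
    case True
    then show ?thesis using close shear(1) S(1) S(2)[unfolded True] unfolding sn by linarith
  next
    case False
    then have "\<bar>j' - j\<bar> \<ge> 1" by linarith
    then have "\<bar>real_of_int (j' - j)\<bar> \<ge> 1" by linarith
    then have "c * 1 \<le> c * \<bar>real_of_int (j' - j)\<bar>" using c_pos by (intro mult_left_mono) auto
    then have "\<bar>birkhoff \<alpha> f j' y' - birkhoff \<alpha> f j y'\<bar> \<ge> c" using birkhoff_gap[OF by', of j' j] by linarith
    then show ?thesis using close shear(2) S unfolding sn by linarith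
  qed
qed

text \<open>At the scale \<open>n\<close> the offset \<open>e\<close> is magnified to a time difference between \<open>2 \<delta>\<close> and \<open>c - 2 \<delta>\<close> by any
  number \<open>j\<close> of crossings with \<open>n / 2 \<le> j \<le> n\<close>, as long as the orbit avoids the singularity.\<close>

definition split_scale :: "real \<Rightarrow> real \<Rightarrow> real \<Rightarrow> real \<Rightarrow> nat \<Rightarrow> real \<Rightarrow> bool" where
  "split_scale \<alpha> \<delta> c1 C1 n e \<longleftrightarrow> n \<ge> 2 \<and> ln (real n) \<ge> 1 \<and> \<bar>e\<bar> \<le> deep_radius n \<and>
    (\<forall>j. n \<le> 2 * j \<longrightarrow> j \<le> n \<longrightarrow> avoid_radius j \<le> deep_radius n \<and>
       2 * \<delta> \<le> \<bar>e\<bar> * (c1 * (real j * ln (real j))) \<and> \<bar>e\<bar> * (C1 * (real j * ln (real j))) \<le> c - 2 * \<delta> \<and>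
       (\<forall>x. orb_avoids2 \<alpha> j x \<longrightarrow> c1 * (real j * ln (real j)) \<le> \<bar>\<Sum>i<j. deriv f (orb \<alpha> x i)\<bar> \<and>
         (\<Sum>i<j. \<bar>deriv f (orb \<alpha> x i)\<bar>) \<le> C1 * (real j * ln (real j)) \<and> (\<Sum>i<j. f (orb \<alpha> x i)) \<le> C1 * real j))"

lemma split_scale_shear:
  assumes "split_scale \<alpha> \<delta> c1 C1 n e" "deep \<alpha> j (deep_radius n) p" "n \<le> 2 * j" "j \<le> n"
  shows "2 * \<delta> \<le> \<bar>bsum \<alpha> f (p + e) j - bsum \<alpha> f p j\<bar>" "\<bar>bsum \<alpha> f (p + e) j - bsum \<alpha> f p j\<bar> \<le> c - 2 * \<delta>"
proof -
  have n: "ln (real n) \<ge> 1" "\<bar>e\<bar> \<le> deep_radius n" using assms(1) by (auto simp: split_scale_def)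
  note r = deep_radius_pos[OF n(1)]
  have J: "avoid_radius j \<le> deep_radius n" "2 * \<delta> \<le> \<bar>e\<bar> * (c1 * (real j * ln (real j)))"
    "\<bar>e\<bar> * (C1 * (real j * ln (real j))) \<le> c - 2 * \<delta>"
    and est: "\<And>x. orb_avoids2 \<alpha> j x \<Longrightarrow> c1 * (real j * ln (real j)) \<le> \<bar>\<Sum>i<j. deriv f (orb \<alpha> x i)\<bar> \<and>
         (\<Sum>i<j. \<bar>deriv f (orb \<alpha> x i)\<bar>) \<le> C1 * (real j * ln (real j))"
    using assms(1,3,4) unfolding split_scale_def by blast+
  obtain e' where e': "\<bar>e'\<bar> \<le> deep_radius n"
    "bsum \<alpha> f (p + e) j - bsum \<alpha> f p j = e * (\<Sum>i<j. deriv f (orb \<alpha> (p + e') i))"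
    using bsum_mean_value[OF assms(2) r n(2)] by blast
  note E = est[OF deep_shift(2)[OF assms(2) r e'(1) J(1)]]
  have "\<bar>\<Sum>i<j. deriv f (orb \<alpha> (p + e') i)\<bar> \<le> (\<Sum>i<j. \<bar>deriv f (orb \<alpha> (p + e') i)\<bar>)" by (rule sum_abs)
  then have up: "\<bar>\<Sum>i<j. deriv f (orb \<alpha> (p + e') i)\<bar> \<le> C1 * (real j * ln (real j))" using E by linarith
  show "2 * \<delta> \<le> \<bar>bsum \<alpha> f (p + e) j - bsum \<alpha> f p j\<bar>"
    unfolding e'(2) abs_mult using J(2) E by (meson abs_ge_zero mult_left_mono order_trans)
  show "\<bar>bsum \<alpha> f (p + e) j - bsum \<alpha> f p j\<bar> \<le> c - 2 * \<delta>"
    unfolding e'(2) abs_mult using J(3) up by (meson abs_ge_zero mult_left_mono order_trans)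
qed

lemma split_scale_bsum:
  assumes "split_scale \<alpha> \<delta> c1 C1 n e" "deep_orbit \<alpha> n p" shows "bsum \<alpha> f p n \<le> C1 * real n"
proof -
  have n: "ln (real n) \<ge> 1" using assms(1) by (auto simp: split_scale_def)
  have "orb_avoids2 \<alpha> n (p + 0)" using deep_radius_pos[OF n] avoid_le_deep[OF n] by (intro deep_shift(2)[OF assms(2)]) auto
  then show ?thesis using assms(1) unfolding split_scale_def bsum_def by auto
qed

text \<open>Around a time at which two orbits are close with offset \<open>e\<close>, there is an interval of length
  comparable to \<open>n\<close> in a definite fraction of which their heights differ.  It extends into the
  future or into the past, whichever direction is free of close visits to the singularity.\<close>

lemma separation_window:
  assumes z: "(x, s) \<in> flow_space \<alpha> f" "(x', s') \<in> flow_space \<alpha> f"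
    and t0: "W \<le> t0" "t0 \<le> r - W" and sc: "split_scale \<alpha> \<delta> c1 C1 n e" and \<delta>: "\<delta> > 0" "C1 > 0"
  defines "y \<equiv> fst (flow_map \<alpha> f t0 (x, s))" and "y' \<equiv> fst (flow_map \<alpha> f t0 (x', s'))"
    and "u \<equiv> snd (flow_map \<alpha> f t0 (x, s))" and "u' \<equiv> snd (flow_map \<alpha> f t0 (x', s'))"
  assumes close: "\<bar>u - u'\<bar> < \<delta>" "y' = y + e" "u < C1 * real n" "2 * (C1 * real n) \<le> W"
    and dir: "deep_orbit \<alpha> n y \<or> deep_orbit \<alpha> n (rot \<alpha> (- int n) y)"
  shows "\<exists>a b. a \<le> t0 \<and> t0 \<le> b \<and> a < b \<and> 0 \<le> a \<and> b \<le> r \<and> b - a \<le> 2 * (C1 * real n) \<and>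
     (\<exists>a' b'. a \<le> a' \<and> b' \<le> b \<and> c * real n / 4 \<le> b' - a' \<and>
        (\<forall>t\<in>{a'..<b'}. \<not> \<bar>snd (flow_map \<alpha> f t (x, s)) - snd (flow_map \<alpha> f t (x', s'))\<bar> < \<delta>))"
proof -
  have bx: "x \<in> base_points \<alpha>" "x' \<in> base_points \<alpha>" "s \<ge> 0" using z by (auto simp: flow_space_iff)
  have n2: "n \<ge> 2" "ln (real n) \<ge> 1" "\<bar>e\<bar> \<le> deep_radius n" using sc by (auto simp: split_scale_def)
  have Cn: "C1 * real n > 0" using \<delta> n2 by simp
  have W0: "W > 0" using close(4) Cn by linarith
  have t00: "t0 \<ge> 0" using t0 W0 by linarith
  define N where "N = flow_index \<alpha> f x (s + t0)"
  have N: "bsum \<alpha> f x N \<le> s + t0" "s + t0 < bsum \<alpha> f x (Suc N)"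
    unfolding N_def using flow_index_props[OF bx(1)] bx(3) t00 by auto
  have y: "y = orb \<alpha> x N" "u = s + t0 - bsum \<alpha> f x N" by (simp_all add: y_def u_def flow_map_def Let_def N_def)
  have u0: "u \<ge> 0" using N y by linarith
  have by1: "y \<in> base_points \<alpha>" unfolding y by (rule orb_base_points[OF bx(1)])
  have y'b: "y' \<in> base_points \<alpha>"
    unfolding y'_def using flow_map_in_space[OF z(2) t00] by (cases "flow_map \<alpha> f t0 (x', s')") (auto simp: flow_space_iff)
  \<comment> \<open>The heights differ between the crossings number \<open>m\<close> and \<open>n\<close>, counted from \<open>t0\<close>.\<close>
  define m where "m = (n + 1) div 2"
  have m: "n \<le> 2 * m" "1 \<le> m" "m \<le> n" "n \<le> 4 * (n - m)" using n2 by (auto simp: m_def)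
  have rm: "real n \<le> 4 * real (n - m)" using m(4) by linarith
  have cn: "c * real n / 4 \<le> c * real (n - m)" using rm c_pos mult_left_mono[of "real n / 4" "real (n - m)" c] by simp
  have idx: "flow_index \<alpha> f x (s + t) = k" if "bsum \<alpha> f x k - s \<le> t" "t < bsum \<alpha> f x (Suc k) - s" for k t
    by (rule flow_index_unique[OF bx(1)]) (use that in linarith)+
  have differ: "\<not> \<bar>snd (flow_map \<alpha> f t (x, s)) - snd (flow_map \<alpha> f t (x', s'))\<bar> < \<delta>"
    if t: "t \<ge> 0" and sh: "2 * \<delta> \<le> \<bar>birkhoff \<alpha> f (int (flow_index \<alpha> f x (s + t)) - int N) y' - birkhoff \<alpha> f (int (flow_index \<alpha> f x (s + t)) - int N) y\<bar>"
      "\<bar>birkhoff \<alpha> f (int (flow_index \<alpha> f x (s + t)) - int N) y' - birkhoff \<alpha> f (int (flow_index \<alpha> f x (s + t)) - int N) y\<bar> \<le> c - 2 * \<delta>" for t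
    using sheared_heights_differ[OF z t00 t close(1)[unfolded u_def u'_def]] sh unfolding y_def y'_def N_def by blast
  have mono: "bsum \<alpha> f x i \<le> bsum \<alpha> f x k" if "i \<le> k" for i k
    using bsum_mono[OF bx(1) that] c_pos mult_nonneg_nonneg[of c "real (k - i)"] by linarith
  from dir show ?thesis
  proof
    \<comment> \<open>The window is the time of the next \<open>n\<close> crossings.\<close>
    assume fwd: "deep_orbit \<alpha> n y"
    define b where "b = bsum \<alpha> f x (N + n) - s"
    define a' where "a' = bsum \<alpha> f x (N + m) - s"
    have bl: "bsum \<alpha> f y n \<le> C1 * real n" by (rule split_scale_bsum[OF sc fwd])
    have be: "bsum \<alpha> f x (N + n) = bsum \<alpha> f x N + bsum \<alpha> f y n" unfolding y by (rule bsum_add)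
    have "Suc N \<le> N + m" using m by simp
    from mono[OF this] have t0a': "t0 < a'" using N(2) by (simp add: a'_def)
    have len: "c * real (n - m) \<le> b - a'" using bsum_mono[OF bx(1), of "N + m" "N + n"] m by (simp add: b_def a'_def)
    have ca: "a' \<le> b" using mono[of "N + m" "N + n"] m by (simp add: a'_def b_def)
    have "b - t0 \<le> C1 * real n" using be bl y(2) u0 by (simp add: b_def)
    moreover have "\<forall>t\<in>{a'..<b}. \<not> \<bar>snd (flow_map \<alpha> f t (x, s)) - snd (flow_map \<alpha> f t (x', s'))\<bar> < \<delta>"
    proof
      fix t assume t: "t \<in> {a'..<b}"
      have t1: "t \<ge> 0" using t t0a' t00 by simp
      define k where "k = flow_index \<alpha> f x (s + t)"
      have k: "bsum \<alpha> f x k \<le> s + t" "s + t < bsum \<alpha> f x (Suc k)"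
        unfolding k_def using flow_index_props[OF bx(1)] bx(3) t1 by auto
      have k1: "k < N + n"
      proof (rule ccontr)
        assume "\<not> k < N + n"
        then have "N + n \<le> k" by simp
        from mono[OF this] show False using k t by (simp add: b_def)
      qed
      have k2: "N + m \<le> k"
      proof (rule ccontr)
        assume "\<not> N + m \<le> k"
        then have "Suc k \<le> N + m" by simp
        from mono[OF this] show False using k t by (simp add: a'_def)
      qed
      define j where "j = k - N"
      have j: "n \<le> 2 * j" "j \<le> n" "int k - int N = int j" using k1 k2 m by (auto simp: j_def)
      have dj: "deep \<alpha> j (deep_radius n) y" using fwd j(2) by (auto simp: deep_def)
      show "\<not> \<bar>snd (flow_map \<alpha> f t (x, s)) - snd (flow_map \<alpha> f t (x', s'))\<bar> < \<delta>"
        using split_scale_shear[OF sc dj j(1,2)] j(3)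
        by (intro differ[OF t1]) (simp_all add: k_def[symmetric] birkhoff_of_nat close(2))
    qed
    ultimately show ?thesis
      using t0a' ca len cn Cn close(4) t0 t00
      by (intro exI[of _ t0] exI[of _ b] conjI exI[of _ a']) linarith+
  next
    \<comment> \<open>The window is the time of the previous \<open>n\<close> crossings; it starts after time \<open>0\<close> because \<open>t0 \<ge> W\<close>.\<close>
    assume bwd: "deep_orbit \<alpha> n (rot \<alpha> (- int n) y)"
    define p where "p = rot \<alpha> (- int n) y"
    have bl: "bsum \<alpha> f p n \<le> C1 * real n" unfolding p_def by (rule split_scale_bsum[OF sc bwd])
    have Nn: "n \<le> N"
    proof (rule ccontr)
      assume "\<not> n \<le> N"
      then have l: "N \<le> n" by simp
      have "birkhoff \<alpha> f (- int n) y \<le> birkhoff \<alpha> f (- int N) y"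
        using birkhoff_strict_mono[OF by1, of "- int n" "- int N"] l by (cases "n = N") auto
      then have "bsum \<alpha> f (rot \<alpha> (- int N) y) N \<le> bsum \<alpha> f p n" by (simp add: birkhoff_backward[OF by1] p_def)
      moreover have "rot \<alpha> (- int N) y = x"
        using rot_diff_index[OF bx(1), of N 0] orb_0[of x] bx(1) unfolding y by (simp add: base_points_def)
      ultimately have "t0 < W" using bl y(2) close(3,4) bx(3) by simp
      then show False using t0 by simp
    qed
    have pn: "orb \<alpha> x (N - n) = p" unfolding p_def y using rot_diff_index[OF bx(1), of n "N - n"] Nn by simp
    define a where "a = bsum \<alpha> f x (N - n) - s"
    define b' where "b' = bsum \<alpha> f x (N - m + 1) - s"
    have ae: "bsum \<alpha> f x N = bsum \<alpha> f x (N - n) + bsum \<alpha> f p n"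
      using bsum_add[of \<alpha> f x "N - n" n] Nn by (simp add: pn)
    have len: "c * real (n - m) \<le> b' - a"
    proof -
      have "c * real (n - m) \<le> c * real (N - m + 1 - (N - n))" using c_pos Nn m by (intro mult_left_mono) auto
      moreover have "N - n \<le> N - m + 1" using m by simp
      note bsum_mono[OF bx(1) this]
      ultimately show ?thesis unfolding a_def b'_def by linarith
    qed
    have "N - m + 1 \<le> N" using m Nn by simp
    from mono[OF this] have b't: "b' \<le> t0" using y(2) u0 unfolding b'_def by linarith
    have t0a: "t0 - a = bsum \<alpha> f p n + u" using ae y(2) by (simp add: a_def)
    have a0: "a \<ge> 0" using t0a bl close(3,4) t0 by linarith
    have pa: "bsum \<alpha> f p n > 0"
    proof -
      have "p \<in> base_points \<alpha>" unfolding p_def by (rule rot_base_points[OF by1])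
      then have "c * real n \<le> bsum \<alpha> f p n" by (rule bsum_ge)
      moreover have "c * real n > 0" using c_pos n2 by simp
      ultimately show ?thesis by linarith
    qed
    have "\<forall>t\<in>{a..<b'}. \<not> \<bar>snd (flow_map \<alpha> f t (x, s)) - snd (flow_map \<alpha> f t (x', s'))\<bar> < \<delta>"
    proof
      fix t assume t: "t \<in> {a..<b'}"
      have t1: "t \<ge> 0" using t a0 by simp
      define k where "k = flow_index \<alpha> f x (s + t)"
      have k: "bsum \<alpha> f x k \<le> s + t" "s + t < bsum \<alpha> f x (Suc k)"
        unfolding k_def using flow_index_props[OF bx(1)] bx(3) t1 by auto
      have k1: "k < N - m + 1"
      proof (rule ccontr)
        assume "\<not> k < N - m + 1"
        then have "N - m + 1 \<le> k" by simp
        from mono[OF this] show False using k t by (simp add: b'_def)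
      qed
      have k2: "N - n \<le> k"
      proof (rule ccontr)
        assume "\<not> N - n \<le> k"
        then have "Suc k \<le> N - n" by simp
        from mono[OF this] show False using k t by (simp add: a_def)
      qed
      define j where "j = N - k"
      have j: "n \<le> 2 * j" "j \<le> n" "int k - int N = - int j" using k1 k2 m Nn by (auto simp: j_def)
      define q where "q = rot \<alpha> (- int j) y"
      have dj: "deep \<alpha> j (deep_radius n) q"
        unfolding deep_def
      proof (intro allI impI)
        fix i assume i: "i < j"
        have "orb \<alpha> q i = orb \<alpha> (rot \<alpha> (- int n) y) (n - j + i)"
          using i j(2) by (simp add: q_def orb_rot of_nat_diff algebra_simps)
        then show "2 * deep_radius n \<le> orb \<alpha> q i \<and> orb \<alpha> q i \<le> 1 - 2 * deep_radius n"
          using bwd i j(2) by (simp add: deep_def)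
      qed
      have q': "rot \<alpha> (- int j) y' = q + e"
      proof -
        have q0: "orb \<alpha> q 0 = q" unfolding q_def by (intro orb_0) (auto simp: rot_def frac_lt_1)
        have "0 < j" using j(1) n2 by simp
        then have "2 * deep_radius n \<le> orb \<alpha> q 0 \<and> orb \<alpha> q 0 \<le> 1 - 2 * deep_radius n"
          using dj unfolding deep_def by blast
        then have q01: "0 < q + e" "q + e < 1" using n2(3) deep_radius_pos[OF n2(2)] unfolding q0 by linarith+
        have "rot \<alpha> (- int j) y' = frac (frac (y - real j * \<alpha>) + e)"
          unfolding frac_frac_add by (simp add: rot_def close(2) algebra_simps)
        also have "\<dots> = frac (q + e)" by (simp add: q_def rot_def)
        also have "\<dots> = q + e" using q01 by (simp add: frac_eq)
        finally show ?thesis .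
      qed
      have "birkhoff \<alpha> f (- int j) y' - birkhoff \<alpha> f (- int j) y = - (bsum \<alpha> f (q + e) j - bsum \<alpha> f q j)"
        by (simp add: birkhoff_backward[OF y'b] birkhoff_backward[OF by1] q' q_def[symmetric])
      then have "\<bar>birkhoff \<alpha> f (- int j) y' - birkhoff \<alpha> f (- int j) y\<bar> = \<bar>bsum \<alpha> f (q + e) j - bsum \<alpha> f q j\<bar>" by linarith
      then show "\<not> \<bar>snd (flow_map \<alpha> f t (x, s)) - snd (flow_map \<alpha> f t (x', s'))\<bar> < \<delta>"
        using split_scale_shear[OF sc dj j(1,2)] j(3)
        by (intro differ[OF t1]) (simp_all only: k_def[symmetric])
    qed
    then show ?thesis
      using b't len cn Cn t0a bl close(3,4) a0 t0 pa u0
      by (intro exI[of _ a] exI[of _ t0] conjI exI[of _ b']) linarith+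
  qed
qed

text \<open>If two orbits are close at some time with a tiny offset of the base coordinates, then the base points
  differ, up to this offset, by a bounded number of rotations: the heights at time zero bound the
  difference of the numbers of crossings.\<close>

lemma tiny_offset_location:
  assumes z: "(x, s) \<in> flow_space \<alpha> f" "(x', s') \<in> flow_space \<alpha> f" "f x \<le> H" "f x' \<le> H"
    and t0: "0 \<le> t0" "t0 \<le> r"
    and deep: "deep_orbit \<alpha> (crossings r) x" "ln (real (crossings r)) \<ge> 1" "d \<le> deep_radius (crossings r)"
    and shear: "\<And>e j. \<bar>e\<bar> \<le> d \<Longrightarrow> j \<le> crossings r \<Longrightarrow> \<bar>bsum \<alpha> f (x + e) j - bsum \<alpha> f x j\<bar> \<le> l"
    and close: "\<bar>snd (flow_map \<alpha> f t0 (x, s)) - snd (flow_map \<alpha> f t0 (x', s'))\<bar> < \<delta>"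
      "\<bar>fst (flow_map \<alpha> f t0 (x', s')) - fst (flow_map \<alpha> f t0 (x, s))\<bar> \<le> d"
  shows "\<exists>m::int. c * \<bar>real_of_int m\<bar> \<le> H + \<delta> + l \<and> \<bar>frac (x' - of_int m * \<alpha>) - x\<bar> \<le> d"
proof -
  have bx: "x \<in> base_points \<alpha>" "x' \<in> base_points \<alpha>" "0 \<le> s" "s < f x" "0 \<le> s'" "s' < f x'" using z by (auto simp: flow_space_iff)
  define N N' where "N = flow_index \<alpha> f x (s + t0)" and "N' = flow_index \<alpha> f x' (s' + t0)"
  have Nn: "N < crossings r" unfolding N_def using t0 by (intro flow_index_less_crossings[OF z(1)]) auto
  have fm: "flow_map \<alpha> f t0 (x, s) = (orb \<alpha> x N, s + t0 - bsum \<alpha> f x N)"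
    "flow_map \<alpha> f t0 (x', s') = (orb \<alpha> x' N', s' + t0 - bsum \<alpha> f x' N')"
    by (simp_all add: flow_map_def Let_def N_def N'_def)
  define e where "e = orb \<alpha> x' N' - orb \<alpha> x N"
  have e: "\<bar>e\<bar> \<le> d" "\<bar>e\<bar> \<le> deep_radius (crossings r)" using close(2) deep(3) by (auto simp: e_def fm)
  note r0 = deep_radius_pos[OF deep(2)]
  have x01: "0 < x + e" "x + e < 1"
  proof -
    have "orb \<alpha> x 0 = x" using bx(1) by (intro orb_0) (auto simp: base_points_def)
    moreover have "2 * deep_radius (crossings r) \<le> orb \<alpha> x 0 \<and> orb \<alpha> x 0 \<le> 1 - 2 * deep_radius (crossings r)"
      using deep(1) Nn unfolding deep_def by (metis gr_zeroI not_less_zero)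
    ultimately show "0 < x + e" "x + e < 1" using e(2) r0 by linarith+
  qed
  have same: "orb \<alpha> (x + e) N = orb \<alpha> x' N'"
    unfolding deep_shift(1)[OF deep(1) r0 e(2) Nn] by (simp add: e_def)
  define m where "m = int N' - int N"
  have xe: "rot \<alpha> m x' = x + e"
  proof -
    have "rot \<alpha> m x' = rot \<alpha> (- int N) (orb \<alpha> x' N')" unfolding rot_of_nat[symmetric] rot_rot by (simp add: m_def)
    also have "\<dots> = rot \<alpha> (- int N) (orb \<alpha> (x + e) N)" by (simp only: same)
    also have "\<dots> = rot \<alpha> 0 (x + e)" unfolding rot_of_nat[symmetric] rot_rot by simp
    also have "\<dots> = x + e" using x01 by (simp add: rot_def frac_eq)
    finally show ?thesis .
  qed
  have "bsum \<alpha> f x' N' = birkhoff \<alpha> f m x' + bsum \<alpha> f (x + e) N"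
    using birkhoff_cocycle[OF bx(2), of f m "int N"] by (simp add: m_def birkhoff_of_nat[symmetric] xe[unfolded m_def])
  moreover have "\<bar>bsum \<alpha> f (x + e) N - bsum \<alpha> f x N\<bar> \<le> l" using shear[OF e(1)] Nn by simp
  moreover have "\<bar>bsum \<alpha> f x N - bsum \<alpha> f x' N'\<bar> \<le> H + \<delta>" using close(1) bx z(3,4) unfolding fm by simp
  ultimately have "\<bar>birkhoff \<alpha> f m x' - birkhoff \<alpha> f 0 x'\<bar> \<le> H + \<delta> + l" by simp
  then have "c * \<bar>real_of_int (- m)\<bar> \<le> H + \<delta> + l" using birkhoff_gap[OF bx(2), of m 0] by simp
  moreover have "\<bar>frac (x' - of_int (- m) * \<alpha>) - x\<bar> \<le> d"
    using xe e(1) by (simp add: rot_def)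
  ultimately show ?thesis by blast
qed

text \<open>A union of rotated intervals, each of length \<open>2 d\<close>, times the interval of heights.\<close>

lemma location_set_measure:
  assumes x: "0 \<le> x" "x < 1" and "d \<ge> 0" "R \<ge> 0" "H \<ge> 0"
  shows "\<exists>Z\<in>sets borel. emeasure lborel Z \<le> ennreal ((2 * R + 1) * (2 * d) * H) \<and>
     (\<forall>x' s'. 0 \<le> x' \<and> x' < 1 \<and> 0 \<le> s' \<and> s' \<le> H \<and> (\<exists>m::int. \<bar>real_of_int m\<bar> \<le> R \<and> \<bar>frac (x' - of_int m * \<alpha>) - x\<bar> \<le> d) \<longrightarrow> (x', s') \<in> Z)"
proof -
  define I where "I = {m::int. \<bar>real_of_int m\<bar> \<le> R}"
  have I: "I = {- \<lfloor>R\<rfloor>..\<lfloor>R\<rfloor>}" unfolding I_def by (auto simp: le_floor_iff abs_le_iff) linarith+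
  then have fI: "finite I" by simp
  have cI: "real (card I) \<le> 2 * R + 1" using assms(4) unfolding I by (simp add: of_nat_nat)
  define Y where "Y = {x - d..x + d} \<inter> {0..<1}"
  have Y: "Y \<in> sets borel" "Y \<subseteq> {0..<1}" by (auto simp: Y_def)
  define T where "T m = {w \<in> {0..<1}. frac (w + (- of_int m * \<alpha>)) \<in> Y}" for m :: int
  have T: "T m \<in> sets borel" for m
  proof -
    have "(\<lambda>w::real. frac (w + (- of_int m * \<alpha>))) \<in> borel_measurable borel" by measurable
    then have "(\<lambda>w::real. frac (w + (- of_int m * \<alpha>))) -` Y \<inter> space borel \<in> sets borel" by (rule measurable_sets[OF _ Y(1)])
    then have "{0..<1} \<inter> ((\<lambda>w::real. frac (w + (- of_int m * \<alpha>))) -` Y \<inter> space borel) \<in> sets borel" by (rule sets.Int[rotated]) simp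
    also have "{0..<1} \<inter> ((\<lambda>w::real. frac (w + (- of_int m * \<alpha>))) -` Y \<inter> space borel) = T m" by (auto simp: T_def)
    finally show ?thesis .
  qed
  have eT: "emeasure lborel (T m) \<le> ennreal (2 * d)" for m
  proof -
    have "emeasure lborel (T m) = emeasure lborel Y" unfolding T_def by (rule emeasure_rotation[OF Y])
    also have "\<dots> \<le> emeasure lborel {x - d..x + d}" by (intro emeasure_mono) (auto simp: Y_def)
    finally show ?thesis using assms(3) by simp
  qed
  define Z where "Z = (\<Union>m\<in>I. T m) \<times> {0..H}"
  have U: "(\<Union>m\<in>I. T m) \<in> sets borel" "(\<Union>m\<in>I. T m) \<subseteq> {0..<1}" using fI T by (auto simp: T_def)
  have "emeasure lborel Z = ennreal H * emeasure lborel (\<Union>m\<in>I. T m)"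
    unfolding Z_def by (rule emeasure_over_base[OF U assms(5)])
  also have "\<dots> \<le> ennreal H * (\<Sum>m\<in>I. ennreal (2 * d))"
  proof (rule mult_left_mono)
    have "emeasure lborel (\<Union>m\<in>I. T m) \<le> (\<Sum>m\<in>I. emeasure lborel (T m))"
      by (rule emeasure_subadditive_finite[OF fI]) (use T in auto)
    also have "\<dots> \<le> (\<Sum>m\<in>I. ennreal (2 * d))" by (intro sum_mono eT)
    finally show "emeasure lborel (\<Union>m\<in>I. T m) \<le> (\<Sum>m\<in>I. ennreal (2 * d))" .
  qed simp
  also have "\<dots> = ennreal (H * (real (card I) * (2 * d)))"
    using assms by (simp add: ennreal_of_nat_eq_real_of_nat ennreal_mult[symmetric])
  also have "\<dots> \<le> ennreal ((2 * R + 1) * (2 * d) * H)"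
  proof (rule ennreal_leI)
    have "H * (real (card I) * (2 * d)) \<le> H * ((2 * R + 1) * (2 * d))" using cI assms by (intro mult_left_mono mult_right_mono) auto
    then show "H * (real (card I) * (2 * d)) \<le> (2 * R + 1) * (2 * d) * H" by (simp add: mult_ac)
  qed
  finally have eZ: "emeasure lborel Z \<le> ennreal ((2 * R + 1) * (2 * d) * H)" .
  have "Z \<in> sets (borel \<Otimes>\<^sub>M (borel :: real measure))" unfolding Z_def using U by (intro pair_measureI) auto
  then have bZ: "Z \<in> sets borel" by (simp only: borel_prod)
  have "(x', s') \<in> Z" if "0 \<le> x'" "x' < 1" "0 \<le> s'" "s' \<le> H" "\<bar>real_of_int m\<bar> \<le> R" "\<bar>frac (x' - of_int m * \<alpha>) - x\<bar> \<le> d" for x' s' and m :: int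
  proof -
    have "frac (x' - of_int m * \<alpha>) \<in> Y" using that(6) frac_lt_1[of "x' - of_int m * \<alpha>"] by (auto simp: Y_def abs_le_iff)
    then have "x' \<in> T m" using that by (simp add: T_def)
    then show ?thesis using that by (auto simp: Z_def I_def)
  qed
  then show ?thesis using eZ bZ by (intro bexI[of _ Z]) auto
qed

end

section \<open>The lower bound\<close>

text \<open>The boxes of width \<open>1 / G\<close> and height \<open>\<delta>\<close> below the level \<open>H\<close> are numbered row by row from \<open>2\<close> on; everything
  above the level is a single atom.\<close>

definition grid_part :: "nat \<Rightarrow> real \<Rightarrow> real \<Rightarrow> real \<times> real \<Rightarrow> nat" where
  "grid_part G \<delta> H z = (if snd z \<ge> H then 1 else 2 + nat \<lfloor>real G * fst z\<rfloor> + G * nat \<lfloor>snd z / \<delta>\<rfloor>)"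

lemma grid_part_measurable: "{z. grid_part G \<delta> H z = i} \<in> sets borel"
proof -
  have "grid_part G \<delta> H \<in> (borel \<Otimes>\<^sub>M borel) \<rightarrow>\<^sub>M count_space UNIV"
    unfolding grid_part_def [abs_def] by measurable
  then have "grid_part G \<delta> H \<in> borel \<rightarrow>\<^sub>M count_space UNIV" by (simp only: borel_prod)
  then have "grid_part G \<delta> H -` {i} \<inter> space borel \<in> sets borel" by (rule measurable_sets) simp
  then show ?thesis by (simp add: vimage_def)
qed

lemma grid_part_close:
  assumes "0 \<le> fst z" "fst z < 1" "0 \<le> snd z" "0 \<le> fst z'" "fst z' < 1" "0 \<le> snd z'" "G \<ge> 1" "\<delta> > 0"
    and eq: "grid_part G \<delta> H z = grid_part G \<delta> H z'" and low: "snd z < H"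
  shows "\<bar>fst z - fst z'\<bar> < 1 / real G" "\<bar>snd z - snd z'\<bar> < \<delta>"
proof -
  have "snd z' < H" using eq low by (auto simp: grid_part_def split: if_splits)
  then have e: "nat \<lfloor>real G * fst z\<rfloor> + G * nat \<lfloor>snd z / \<delta>\<rfloor> = nat \<lfloor>real G * fst z'\<rfloor> + G * nat \<lfloor>snd z' / \<delta>\<rfloor>"
    using eq low by (simp add: grid_part_def)
  have lt: "nat \<lfloor>real G * u\<rfloor> < G" if "0 \<le> u" "u < 1" for u
  proof -
    have "real G * u < real G * 1" using that assms(7) by (intro mult_strict_left_mono) auto
    then have "\<lfloor>real G * u\<rfloor> < int G" by (simp add: floor_less_iff)
    then show ?thesis using assms(7) by linarith
  qed
  have a: "nat \<lfloor>real G * fst z\<rfloor> = nat \<lfloor>real G * fst z'\<rfloor>"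
    using arg_cong[OF e, of "\<lambda>n. n mod G"] lt[of "fst z"] lt[of "fst z'"] assms by simp
  then have b: "nat \<lfloor>snd z / \<delta>\<rfloor> = nat \<lfloor>snd z' / \<delta>\<rfloor>" using e assms(7) by simp
  have "\<lfloor>real G * fst z\<rfloor> \<ge> 0" "\<lfloor>real G * fst z'\<rfloor> \<ge> 0" "\<lfloor>snd z / \<delta>\<rfloor> \<ge> 0" "\<lfloor>snd z' / \<delta>\<rfloor> \<ge> 0" using assms by auto
  then have f: "\<lfloor>real G * fst z\<rfloor> = \<lfloor>real G * fst z'\<rfloor>" "\<lfloor>snd z / \<delta>\<rfloor> = \<lfloor>snd z' / \<delta>\<rfloor>" using a b by linarith+
  have "\<bar>real G * fst z - real G * fst z'\<bar> < 1" using f(1) by linarith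
  then have "real G * \<bar>fst z - fst z'\<bar> < 1" by (simp add: abs_mult flip: right_diff_distrib)
  then show "\<bar>fst z - fst z'\<bar> < 1 / real G" using assms(7) by (simp add: less_divide_eq mult.commute)
  have "\<bar>snd z / \<delta> - snd z' / \<delta>\<bar> < 1" using f(2) by linarith
  then have "\<bar>snd z - snd z'\<bar> / \<delta> < 1" using assms(8) by (simp flip: diff_divide_distrib)
  then show "\<bar>snd z - snd z'\<bar> < \<delta>" using assms(8) by simp
qed

lemma eventually_from_1:
  assumes "\<forall>\<^sub>F n in sequentially. Q n" shows "\<exists>n0\<ge>1. \<forall>n\<ge>n0. Q n"
proof -
  obtain N where "\<And>n. n \<ge> N \<Longrightarrow> Q n" using assms by (auto simp: eventually_sequentially)
  then show ?thesis by (intro exI[of _ "max N 1"]) auto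
qed

context log_roof
begin

lemma grid_partition:
  fixes \<alpha> \<delta> H :: real and G :: nat
  assumes "G \<ge> 1" "\<delta> > 0"
  defines "P \<equiv> (\<lambda>i. {z \<in> flow_space \<alpha> f. grid_part G \<delta> H z = i})"
    and "k \<equiv> 2 + G + G * nat \<lfloor>H / \<delta>\<rfloor>"
  shows "finite_partition (fm \<alpha>) k P" "\<And>z. z \<in> flow_space \<alpha> f \<Longrightarrow> atom k P z = grid_part G \<delta> H z"
proof -
  have range: "grid_part G \<delta> H z \<in> {1..k}" if "z \<in> flow_space \<alpha> f" for z
  proof (cases "snd z \<ge> H")
    case False
    have z: "0 \<le> fst z" "fst z < 1" "0 \<le> snd z" using that by (cases z; simp add: flow_space_iff base_points_def)+
    have "real G * fst z \<le> real G * 1" using z assms(1) by (intro mult_left_mono) auto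
    then have "nat \<lfloor>real G * fst z\<rfloor> \<le> G" by linarith
    moreover have "nat \<lfloor>snd z / \<delta>\<rfloor> \<le> nat \<lfloor>H / \<delta>\<rfloor>"
      using False assms(2) by (intro nat_mono floor_mono divide_right_mono) auto
    then have "G * nat \<lfloor>snd z / \<delta>\<rfloor> \<le> G * nat \<lfloor>H / \<delta>\<rfloor>" by (rule mult_le_mono2)
    ultimately have "2 + nat \<lfloor>real G * fst z\<rfloor> + G * nat \<lfloor>snd z / \<delta>\<rfloor> \<le> k" unfolding k_def by linarith
    then show ?thesis using False by (simp add: grid_part_def)
  qed (simp add: grid_part_def k_def)
  have Pb: "P i \<in> sets (fm \<alpha>)" for i
  proof -
    have "flow_space \<alpha> f \<inter> {z. grid_part G \<delta> H z = i} \<in> sets borel"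
      by (rule sets.Int[OF flow_space_borel grid_part_measurable])
    also have "flow_space \<alpha> f \<inter> {z. grid_part G \<delta> H z = i} = P i" by (auto simp: P_def)
    finally show ?thesis by (auto simp: sets_flow_measure P_def)
  qed
  show part: "finite_partition (fm \<alpha>) k P"
    unfolding finite_partition_def
  proof (intro conjI)
    show "P ` {1..k} \<subseteq> sets (fm \<alpha>)" using Pb by auto
    show "disjoint_family_on P {1..k}" by (auto simp: disjoint_family_on_def P_def)
    show "(\<Union>i\<in>{1..k}. P i) = space (fm \<alpha>)" using range by (auto simp: P_def space_flow_measure)
  qed
  show "atom k P z = grid_part G \<delta> H z" if "z \<in> flow_space \<alpha> f" for z
    using that range[OF that] by (intro atom_props(3)[OF part]) (auto simp: space_flow_measure P_def)
qed

text \<open>For every small offset there is a scale at which it is magnified by the shear to a definite size.\<close>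

lemma scale_choice:
  fixes e a2 :: real and n0 :: nat
  assumes "e \<noteq> 0" "n0 \<ge> 1" "\<bar>e\<bar> * (real (Suc n0) * ln (real (Suc n0))) \<le> a2"
  obtains n where "n \<ge> n0" "\<bar>e\<bar> * (real n * ln (real n)) \<le> a2" "a2 < \<bar>e\<bar> * (real (Suc n) * ln (real (Suc n)))"
proof -
  define g where "g n = real n * ln (real n)" for n :: nat
  have mono: "g i \<le> g j" if "1 \<le> i" "i \<le> j" for i j
    unfolding g_def using that by (intro mult_mono) auto
  have "filterlim g at_top sequentially" unfolding g_def [abs_def] by real_asymp
  then have "\<forall>\<^sub>F n in sequentially. a2 / \<bar>e\<bar> + 1 \<le> g n" by (simp add: filterlim_at_top)
  then obtain m0 where "a2 / \<bar>e\<bar> + 1 \<le> g m0" by (auto simp: eventually_sequentially)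
  then have "a2 / \<bar>e\<bar> < g m0" by linarith
  then have ex: "a2 < \<bar>e\<bar> * g m0" using assms(1) by (simp add: divide_less_eq mult.commute)
  define m where "m = (LEAST m. a2 < \<bar>e\<bar> * g m \<and> m \<ge> 1)"
  have "m0 \<ge> 1 \<or> a2 < \<bar>e\<bar> * g 1" using ex by (cases m0) (auto simp: g_def)
  then have "\<exists>m. a2 < \<bar>e\<bar> * g m \<and> m \<ge> 1" using ex by auto
  then have m: "a2 < \<bar>e\<bar> * g m" "m \<ge> 1" unfolding m_def by (metis (mono_tags, lifting) LeastI)+
  have least: "\<not> a2 < \<bar>e\<bar> * g i" if "i < m" "i \<ge> 1" for i using not_less_Least[of i] that unfolding m_def by blast
  have "m > Suc n0"
  proof (rule ccontr)
    assume "\<not> m > Suc n0"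
    then have "g m \<le> g (Suc n0)" using m by (intro mono) auto
    then have "\<bar>e\<bar> * g m \<le> \<bar>e\<bar> * g (Suc n0)" by (intro mult_left_mono) auto
    then show False using m assms(3) by (simp add: g_def)
  qed
  then show ?thesis using that[of "m - 1"] m least[of "m - 1"] assms(2) by (simp add: g_def not_less)
qed

text \<open>Let \<open>d = 1 / (r (log r) powr t)\<close>.  If two good points have names that differ during less than \<open>2 \<epsilon> r\<close>, then at some time their
  heights are \<open>\<delta>\<close>-close and their offset in the base is at most \<open>d\<close>: otherwise every time of coincidence lies in
  a separation window whose length is a small multiple of \<open>r\<close>, and the Vitali lemma gives more times of difference than
  there are.  So the points with a name close to a given one lie in a set of measure \<open>O(d (log r) powr (1 - t))\<close>, and
  the number of balls is at least of the inverse order.\<close>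

theorem covering_number_lower:
  assumes D: "\<alpha> \<in> dioph_D" and E: "\<alpha> \<in> dioph_E" and \<beta>: "0 < \<beta>" and t: "19 / 20 < t" "t < 1"
  shows "\<exists>k P \<epsilon>0. \<epsilon>0 > 0 \<and> finite_partition (fm \<alpha>) k P \<and> (\<forall>\<epsilon>. 0 < \<epsilon> \<and> \<epsilon> < \<epsilon>0 \<longrightarrow>
    (\<exists>C>0. \<forall>\<^sub>F r in at_top. ennreal (C * (r * ln r powr (2 * t - 1))) \<le> covering_number (fm \<alpha>) (fl \<alpha>) k P \<epsilon> \<beta> r))"
proof -
  note sg = short_gaps_dioph[OF D]
  define m0 where "m0 = total_mass \<alpha>"
  have m0: "m0 > 0" unfolding m0_def by (rule total_mass_pos)
  obtain c1 C1 where C1: "c1 > 0" "C1 > 0" and est0: "\<forall>\<^sub>F n in sequentially. \<forall>x. orb_avoids2 \<alpha> n x \<longrightarrow>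
    c1 * (real n * ln (real n)) \<le> \<bar>\<Sum>i<n. deriv f (orb \<alpha> x i)\<bar> \<and>
    (\<Sum>i<n. \<bar>deriv f (orb \<alpha> x i)\<bar>) \<le> C1 * (real n * ln (real n)) \<and>
    (\<Sum>i<n. f (orb \<alpha> x i)) \<le> C1 * real n"
    using birkhoff_estimates[OF sg] by blast
  \<comment> \<open>The approximate value of \<open>\<bar>e\<bar> n log n\<close> at the chosen scale: times \<open>C1\<close> it is at most \<open>c / 2\<close>, and times \<open>c1 / 4\<close> at least \<open>2 \<delta>\<close>.\<close>
  define a2 where "a2 = c / (2 * C1)"
  define \<delta> where "\<delta> = min (c / 4) (c1 * a2 / 8)"
  \<comment> \<open>Lower bound for the fraction of a window during which the heights differ.\<close>
  define \<kappa> where "\<kappa> = min 1 (c / (8 * C1))"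
  \<comment> \<open>Fraction of time allowed for differing symbols and for visits to \<open>V\<close>.\<close>
  define \<theta> where "\<theta> = \<kappa> / 24"
  have a2: "a2 > 0" using c_pos C1 by (simp add: a2_def)
  have \<delta>: "\<delta> > 0" "\<delta> \<le> c / 4" "2 * \<delta> \<le> c1 * a2 / 4" using c_pos C1 a2 by (auto simp: \<delta>_def)
  have \<kappa>: "\<kappa> > 0" "\<kappa> \<le> 1" "\<kappa> \<le> c / (8 * C1)" using c_pos C1 by (auto simp: \<kappa>_def)
  have \<theta>: "\<theta> > 0" using \<kappa> by (simp add: \<theta>_def)
  obtain H where H: "H > 0" "emeasure lborel {z \<in> flow_space \<alpha> f. f (fst z) > H} \<le> ennreal (\<beta> * m0 / 8)"
    using roof_tail_small[of "\<beta> * m0 / 8" \<alpha>] m0 \<beta> by auto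
  define v where "v = \<beta> * m0 * c * \<theta> / (32 * H)"
  have v: "v > 0" using \<beta> m0 c_pos \<theta> H by (simp add: v_def)
  obtain H' where H': "H' > 0" "emeasure lborel {z \<in> flow_space \<alpha> f. f (fst z) > H'} \<le> ennreal (v / 2)"
    using roof_tail_small[of "v / 2" \<alpha>] v by auto
  obtain X where X: "X \<in> sets borel" "X \<subseteq> {0..<1}" "emeasure lborel ((X \<times> UNIV) \<inter> flow_space \<alpha> f) \<le> ennreal (v / 2)"
    and dir: "\<forall>\<^sub>F n in sequentially. \<forall>y\<in>{0..<1} - X. deep_orbit \<alpha> n y \<or> deep_orbit \<alpha> n (rot \<alpha> (- int n) y)"
    using bad_base_set[OF D E, of "v / 2"] v by auto
  \<comment> \<open>Where coincidence of symbols is not informative, or where no direction is free of close visits.\<close>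
  define V where "V = {z :: real \<times> real. snd z \<ge> H'} \<union> X \<times> UNIV"
  have XU: "X \<times> (UNIV :: real set) \<in> sets borel"
  proof -
    have "X \<times> UNIV \<in> sets (borel \<Otimes>\<^sub>M (borel :: real measure))" using X by (intro pair_measureI) auto
    then show ?thesis by (simp only: borel_prod)
  qed
  have hs: "{z :: real \<times> real. snd z \<ge> H'} \<in> sets borel" by (intro borel_closed closed_Collect_le continuous_intros)
  have Vb: "V \<in> sets borel" unfolding V_def by (rule sets.Un[OF hs XU])
  have Vm: "emeasure lborel (V \<inter> flow_space \<alpha> f) \<le> ennreal v"
  proof -
    have "emeasure lborel (V \<inter> flow_space \<alpha> f)
        \<le> emeasure lborel ({z \<in> flow_space \<alpha> f. f (fst z) > H'} \<union> (X \<times> UNIV) \<inter> flow_space \<alpha> f)"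
      using high_roof_borel[of \<alpha> H'] sets.Int[OF XU flow_space_borel[of \<alpha>]]
      by (intro emeasure_mono) (auto simp: V_def flow_space_iff)
    also have "\<dots> \<le> emeasure lborel {z \<in> flow_space \<alpha> f. f (fst z) > H'} + emeasure lborel ((X \<times> UNIV) \<inter> flow_space \<alpha> f)"
      using high_roof_borel[of \<alpha> H'] sets.Int[OF XU flow_space_borel[of \<alpha>]] by (intro emeasure_subadditive) auto
    also have "\<dots> \<le> ennreal (v / 2) + ennreal (v / 2)" by (intro add_mono H' X)
    also have "\<dots> = ennreal v" using v by (simp flip: ennreal_plus)
    finally show ?thesis .
  qed
  \<comment> \<open>Conditions on the scale \<open>n\<close>, valid for all \<open>n \<ge> n0\<close>.\<close>
  have e1: "\<forall>\<^sub>F n in sequentially. \<forall>j. n \<le> 2 * j \<longrightarrow> (\<forall>x. orb_avoids2 \<alpha> j x \<longrightarrow>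
    c1 * (real j * ln (real j)) \<le> \<bar>\<Sum>i<j. deriv f (orb \<alpha> x i)\<bar> \<and>
    (\<Sum>i<j. \<bar>deriv f (orb \<alpha> x i)\<bar>) \<le> C1 * (real j * ln (real j)) \<and>
    (\<Sum>i<j. f (orb \<alpha> x i)) \<le> C1 * real j)"
    by (rule eventually_half[OF est0])
  have e2: "\<forall>\<^sub>F n in sequentially. \<forall>j. n \<le> 2 * j \<longrightarrow> avoid_radius j \<le> deep_radius n
      \<and> real (Suc n) * ln (real (Suc n)) / 4 \<le> real j * ln (real j)"
  proof -
    have "\<forall>\<^sub>F n in sequentially. real n * ln (real n) powr (19 / 20) \<le> real n / 2 * ln (real n / 2) powr (97 / 100)"
      "\<forall>\<^sub>F n in sequentially. real (Suc n) * ln (real (Suc n)) / 4 \<le> real n / 2 * ln (real n / 2)"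
      "\<forall>\<^sub>F n in sequentially. ln (real n / 2) \<ge> 1" "\<forall>\<^sub>F n in sequentially. ln (real n) \<ge> 1"
      by real_asymp+
    then show ?thesis
    proof eventually_elim
      case (elim n)
      have n0: "real n > 0" using elim(4) by (cases n) auto
      show ?case
      proof (intro allI impI conjI)
        fix j assume "n \<le> 2 * j"
        then have j: "real n / 2 \<le> real j" by linarith
        then have l: "ln (real n / 2) \<le> ln (real j)" using n0 by (subst ln_le_cancel_iff) auto
        have "real n / 2 * ln (real n / 2) powr (97 / 100) \<le> real j * ln (real j) powr (97 / 100)"
          using j l elim(3) by (intro mult_mono powr_mono2) auto
        then have "real n * ln (real n) powr (19 / 20) \<le> real j * ln (real j) powr (97 / 100)" using elim(1) by linarith
        moreover have "real n * ln (real n) powr (19 / 20) > 0" using n0 elim(4) by (intro mult_pos_pos) auto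
        ultimately show "avoid_radius j \<le> deep_radius n"
          unfolding avoid_radius_def deep_radius_def using mult_pos_pos by (intro divide_left_mono) auto
        have "real n / 2 * ln (real n / 2) \<le> real j * ln (real j)"
          using j l elim(3) by (intro mult_mono) auto
        then show "real (Suc n) * ln (real (Suc n)) / 4 \<le> real j * ln (real j)" using elim(2) by linarith
      qed
    qed
  qed
  have e3: "\<forall>\<^sub>F n in sequentially. a2 / (real n * ln (real n)) \<le> deep_radius n"
  proof -
    have "filterlim (\<lambda>n. ln (real n) powr (1 / 20)) at_top sequentially" by real_asymp
    then have "\<forall>\<^sub>F n in sequentially. a2 \<le> ln (real n) powr (1 / 20)" by (simp add: filterlim_at_top)
    moreover have "\<forall>\<^sub>F n in sequentially. ln (real n) \<ge> 1" by real_asymp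
    ultimately show ?thesis
    proof eventually_elim
      case (elim n)
      define L where "L = ln (real n)"
      have L: "L \<ge> 1" "a2 \<le> L powr (1 / 20)" using elim by (auto simp: L_def)
      have n0: "real n > 0" using elim(2) by (cases n) auto
      have "a2 / (real n * L) \<le> L powr (1 / 20) / (real n * L)" using L n0 by (intro divide_right_mono) auto
      also have "\<dots> = 1 / (real n * L powr (19 / 20))"
      proof -
        have "L powr (1 / 20) * L powr (19 / 20) = L" using L by (simp add: powr_add[symmetric])
        then show ?thesis using L n0 by (simp add: field_simps)
      qed
      finally show ?case by (simp add: deep_radius_def L_def)
    qed
  qed
  have e4: "\<forall>\<^sub>F n in sequentially. ln (real n) \<ge> 1 \<and> n \<ge> 2 \<and> H' < C1 * real n"
  proof -
    have "filterlim (\<lambda>n. C1 * real n) at_top sequentially" using C1 by real_asymp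
    then have "\<forall>\<^sub>F n in sequentially. H' + 1 \<le> C1 * real n" by (simp add: filterlim_at_top)
    moreover have "\<forall>\<^sub>F n in sequentially. ln (real n) \<ge> 1" by real_asymp
    ultimately show ?thesis using eventually_ge_at_top[of 2] by eventually_elim auto
  qed
  obtain n0 where n0: "n0 \<ge> 1" and scale0: "\<forall>n\<ge>n0.
      (\<forall>j. n \<le> 2 * j \<longrightarrow> (\<forall>x. orb_avoids2 \<alpha> j x \<longrightarrow>
        c1 * (real j * ln (real j)) \<le> \<bar>\<Sum>i<j. deriv f (orb \<alpha> x i)\<bar> \<and>
        (\<Sum>i<j. \<bar>deriv f (orb \<alpha> x i)\<bar>) \<le> C1 * (real j * ln (real j)) \<and>
        (\<Sum>i<j. f (orb \<alpha> x i)) \<le> C1 * real j)) \<and>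
      (\<forall>j. n \<le> 2 * j \<longrightarrow> avoid_radius j \<le> deep_radius n \<and> real (Suc n) * ln (real (Suc n)) / 4 \<le> real j * ln (real j)) \<and>
      a2 / (real n * ln (real n)) \<le> deep_radius n \<and> (ln (real n) \<ge> 1 \<and> n \<ge> 2 \<and> H' < C1 * real n) \<and>
      (\<forall>y\<in>{0..<1} - X. deep_orbit \<alpha> n y \<or> deep_orbit \<alpha> n (rot \<alpha> (- int n) y))"
    using eventually_from_1[OF eventually_conj[OF e1 eventually_conj[OF e2 eventually_conj[OF e3 eventually_conj[OF e4 dir]]]]]
    by (elim exE conjE) (rule that; assumption)
  note scale = scale0[THEN spec, THEN mp]
  \<comment> \<open>Offsets up to \<open>d0\<close> have their scale beyond \<open>n0\<close>; the grid is chosen that fine.\<close>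
  define d0 where "d0 = a2 / (real (Suc n0) * ln (real (Suc n0)))"
  have gn0: "real (Suc n0) * ln (real (Suc n0)) > 0" using n0 by (intro mult_pos_pos) (auto intro!: ln_gt_zero)
  have d0: "d0 > 0" using a2 gn0 by (simp add: d0_def)
  have split: "\<exists>n\<ge>n0. \<bar>e\<bar> * (real n * ln (real n)) \<le> a2 \<and> split_scale \<alpha> \<delta> c1 C1 n e" if e: "e \<noteq> 0" "\<bar>e\<bar> \<le> d0" for e
  proof -
    have "\<bar>e\<bar> * (real (Suc n0) * ln (real (Suc n0))) \<le> a2" using e(2) gn0 by (simp only: d0_def pos_le_divide_eq)
    then obtain n where n: "n \<ge> n0" "\<bar>e\<bar> * (real n * ln (real n)) \<le> a2" "a2 < \<bar>e\<bar> * (real (Suc n) * ln (real (Suc n)))"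
      using scale_choice[OF e(1) n0] by blast
    note sc = scale[OF n(1)]
    have ln1: "ln (real n) \<ge> 1" "n \<ge> 2" using sc by blast+
    have g0: "real n * ln (real n) > 0" using ln1 by (intro mult_pos_pos) auto
    have "\<bar>e\<bar> \<le> a2 / (real n * ln (real n))" using n(2) g0 by (simp only: pos_le_divide_eq)
    then have ed: "\<bar>e\<bar> \<le> deep_radius n" using sc by linarith
    have "2 * \<delta> \<le> \<bar>e\<bar> * (c1 * (real j * ln (real j)))" if j: "n \<le> 2 * j" for j
    proof -
      have "c1 * a2 / 4 \<le> c1 * (\<bar>e\<bar> * (real (Suc n) * ln (real (Suc n)))) / 4"
        using n(3) C1 by (intro divide_right_mono mult_left_mono) auto
      also have "\<dots> = c1 * \<bar>e\<bar> * (real (Suc n) * ln (real (Suc n)) / 4)" by simp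
      also have "\<dots> \<le> c1 * \<bar>e\<bar> * (real j * ln (real j))" using sc j C1 by (intro mult_left_mono) auto
      finally show ?thesis using \<delta>(3) by (simp add: mult_ac)
    qed
    moreover have "\<bar>e\<bar> * (C1 * (real j * ln (real j))) \<le> c - 2 * \<delta>" if j: "n \<le> 2 * j" "j \<le> n" for j
    proof -
      have "j \<ge> 1" using j ln1 by linarith
      then have "real j * ln (real j) \<le> real n * ln (real n)" using j by (intro mult_mono) auto
      then have "C1 * (\<bar>e\<bar> * (real j * ln (real j))) \<le> C1 * (\<bar>e\<bar> * (real n * ln (real n)))" using C1 by (intro mult_left_mono) auto
      also have "\<dots> \<le> C1 * a2" using n(2) C1 by (intro mult_left_mono) auto
      also have "\<dots> = c / 2" using C1 by (simp add: a2_def)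
      also have "\<dots> \<le> c - 2 * \<delta>" using \<delta>(2) by simp
      finally show ?thesis by (simp add: mult_ac)
    qed
    ultimately have "split_scale \<alpha> \<delta> c1 C1 n e" unfolding split_scale_def using sc ed ln1 by blast
    then show ?thesis using n by blast
  qed
  define G where "G = nat \<lceil>1 / d0\<rceil> + 1"
  have G: "G \<ge> 1" "1 / real G \<le> d0"
  proof -
    show G1: "G \<ge> 1" by (simp add: G_def)
    have "1 / d0 \<le> real G" unfolding G_def using d0 by linarith
    then have "1 \<le> d0 * real G" using d0 by (simp add: divide_le_eq mult.commute)
    then show "1 / real G \<le> d0" using G1 by (simp add: divide_le_eq)
  qed
  define P where "P = (\<lambda>i. {z \<in> flow_space \<alpha> f. grid_part G \<delta> H' z = i})"
  define k where "k = 2 + G + G * nat \<lfloor>H' / \<delta>\<rfloor>"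
  have part: "finite_partition (fm \<alpha>) k P" and atom: "\<And>z. z \<in> flow_space \<alpha> f \<Longrightarrow> atom k P z = grid_part G \<delta> H' z"
    unfolding P_def k_def by (rule grid_partition[OF G(1) \<delta>(1)])+
  define \<epsilon>0 where "\<epsilon>0 = min (\<beta> / 4) (\<theta> / 4)"
  define Bc where "Bc = 2 * (H + \<delta> + 4 * C1 / c) / c + 1"
  have Bc: "Bc > 0" using H \<delta> C1 c_pos by (simp add: Bc_def add_nonneg_pos)
  define C where "C = \<beta> * m0 / (8 * Bc * H)"
  have C: "C > 0" using \<beta> m0 Bc H by (simp add: C_def)
  \<comment> \<open>Conditions on the time \<open>r\<close>.\<close>
  have lnt: "filterlim (\<lambda>r. ln r powr (t - 19 / 20)) at_top at_top"
    by (rule filterlim_compose[OF _ ln_at_top]) (use t in \<open>real_asymp\<close>)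
  have lnt1: "((\<lambda>r. ln r powr (t - 1)) \<longlongrightarrow> 0) at_top"
    by (rule tendsto_neg_powr[OF _ ln_at_top]) (use t in simp)
  define \<omega> where "\<omega> = 1 / (16 * C1)"
  have \<omega>: "\<omega> > 0" using C1 by (simp add: \<omega>_def)
  have r1: "\<forall>\<^sub>F r in at_top. ln r \<ge> 1 \<and> r / c + 2 \<le> 2 * r / c \<and> r > 0 \<and> ln (2 * r / c) \<le> 2 * ln r \<and> ln (\<omega> * r) \<ge> ln r / 2"
  proof -
    have "\<forall>\<^sub>F r in at_top. ln r \<ge> (1 :: real)" by real_asymp
    moreover have "\<forall>\<^sub>F r in at_top. ln r \<ge> - ln (c / 2)" "\<forall>\<^sub>F r in at_top. ln r / 2 \<ge> - ln \<omega>" by real_asymp+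
    moreover have "\<forall>\<^sub>F r in at_top. r \<ge> 2 * c + 1" by (rule eventually_ge_at_top)
    ultimately show ?thesis
    proof eventually_elim
      case (elim r)
      have r: "r > 0" using elim(4) c_pos by linarith
      have "ln (2 * r / c) = ln r - ln (c / 2)" using ln_div[of r "c / 2"] r c_pos by (simp add: mult.commute)
      moreover have "ln (\<omega> * r) = ln \<omega> + ln r" using r \<omega> by (simp add: ln_mult)
      ultimately show ?case using elim r c_pos by (auto simp: field_simps)
    qed
  qed
  have r2: "\<forall>\<^sub>F r in at_top. a2 * ln r powr (t - 1) < \<omega> / 2"
    by (rule order_tendstoD(2)[OF tendsto_mult_right_zero[OF lnt1]]) (use \<omega> in simp)
  have r3: "\<forall>\<^sub>F r in at_top. 4 / c \<le> ln r powr (t - 19 / 20)" using lnt by (simp add: filterlim_at_top)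
  have r4: "\<forall>\<^sub>F n in sequentially. H * (4 * real n * deep_radius n) < \<beta> * m0 / 8"
  proof -
    have "(\<lambda>n. H * (4 * real n * deep_radius n)) \<longlonglongrightarrow> 0" unfolding deep_radius_def by real_asymp
    then show ?thesis by (rule order_tendstoD) (use m0 \<beta> in simp)
  qed
  have r5: "\<forall>\<^sub>F n in sequentially. \<forall>x. orb_avoids2 \<alpha> n x \<longrightarrow> (\<Sum>i<n. \<bar>deriv f (orb \<alpha> x i)\<bar>) \<le> C1 * (real n * ln (real n))"
    using est0 by eventually_elim blast
  have r6: "\<forall>\<^sub>F n in sequentially. ln (real n) \<ge> 1" by real_asymp
  have main: "\<forall>\<^sub>F r in at_top. ennreal (C * (r * ln r powr (2 * t - 1))) \<le> covering_number (fm \<alpha>) (fl \<alpha>) k P \<epsilon> \<beta> r"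
    if \<epsilon>: "0 < \<epsilon>" "\<epsilon> < \<epsilon>0" for \<epsilon>
    using r1 r2 r3 crossings_eventually[OF r4] crossings_eventually[OF r5] crossings_eventually[OF r6]
  proof eventually_elim
    case (elim r)
    define n where "n = crossings r"
    define L where "L = ln r"
    note sm = elim(4)[folded n_def] and est = elim(5)[folded n_def] and ln1 = elim(6)[folded n_def]
    have L1: "L \<ge> 1" and r0: "r > 0" using elim(1) by (auto simp: L_def)
    have nr: "real n \<le> 2 * r / c" using crossings_le[of r] elim(1) by (simp add: n_def)
    have n0': "real n > 0" using ln1 by (cases n) auto
    have lnn: "ln (real n) \<le> 2 * L"
    proof -
      have "ln (real n) \<le> ln (2 * r / c)" using nr n0' by (subst ln_le_cancel_iff) auto
      then show ?thesis using elim(1) by (simp add: L_def)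
    qed
    \<comment> \<open>The scale of an offset above \<open>d\<close> is below \<open>\<omega> r\<close>, because \<open>t < 1\<close>.\<close>
    define d where "d = 1 / (r * L powr t)"
    have d: "d > 0" using r0 L1 by (simp add: d_def)
    have dd: "d \<le> deep_radius n"
    proof -
      have "real n * ln (real n) powr (19 / 20) \<le> (2 * r / c) * (2 * L) powr (19 / 20)"
        using nr lnn n0' ln1 r0 c_pos by (intro mult_mono powr_mono2) auto
      also have "\<dots> \<le> (2 * r / c) * (2 * L powr (19 / 20))"
      proof (rule mult_left_mono)
        have "(2::real) powr (19 / 20) \<le> 2 powr 1" by (intro powr_mono) auto
        then show "(2 * L) powr (19 / 20) \<le> 2 * L powr (19 / 20)" using L1 by (simp add: powr_mult mult_right_mono)
      qed (use r0 c_pos in simp)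
      also have "\<dots> = r * (4 / c * L powr (19 / 20))" by simp
      also have "\<dots> \<le> r * (L powr (t - 19 / 20) * L powr (19 / 20))"
        using elim(3) r0 by (intro mult_left_mono mult_right_mono) (auto simp: L_def)
      also have "\<dots> = r * L powr t" using L1 by (simp add: powr_add[symmetric])
      finally have "real n * ln (real n) powr (19 / 20) \<le> r * L powr t" .
      moreover have "real n * ln (real n) powr (19 / 20) > 0" using n0' ln1 by (intro mult_pos_pos) auto
      ultimately show ?thesis unfolding d_def deep_radius_def using r0 L1
        by (intro divide_left_mono mult_pos_pos) (use n0' in auto)
    qed
    have short: "real i \<le> \<omega> * r" if "real i * ln (real i) \<le> a2 * (r * L powr t)" for i :: nat
    proof (rule ccontr)
      assume "\<not> real i \<le> \<omega> * r"
      then have i: "\<omega> * r < real i" by simp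
      have "0 < \<omega> * r" using \<omega> r0 by simp
      then have "ln (\<omega> * r) \<le> ln (real i)" using i by (subst ln_le_cancel_iff) linarith+
      then have "L / 2 \<le> ln (real i)" using elim(1) by (simp add: L_def)
      then have "\<omega> * r * (L / 2) \<le> real i * ln (real i)" using i \<omega> r0 L1 by (intro mult_mono) auto
      moreover have "a2 * (r * L powr t) < \<omega> * r * (L / 2)"
      proof -
        have "L powr t = L powr (t - 1) * L" using L1 powr_add[of L "t - 1" 1] by simp
        then have "a2 * (r * L powr t) = (a2 * L powr (t - 1)) * (r * L)" by simp
        also have "\<dots> < \<omega> / 2 * (r * L)" using elim(2) mult_pos_pos[OF r0, of L] L1 by (intro mult_strict_right_mono) (auto simp: L_def)
        finally show ?thesis by simp
      qed
      ultimately show False using that by linarith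
    qed
    define a where "a = \<theta> / 2 * r"
    have a: "a > 0" using \<theta> r0 by (simp add: a_def)
    define Y where "Y = good_set \<alpha> H V a r"
    have bm: "\<beta> * m0 / 8 \<ge> 0" using \<beta> m0 by simp
    note GS = good_set_measure[OF Vb Vm H a less_imp_le[OF v] bm elim(6), folded n_def Y_def]
    have occ: "H * (real n / a * v) \<le> \<beta> * m0 / 8"
    proof -
      have "real n / a * v \<le> (2 * r / c) / a * v" using nr a v by (intro mult_right_mono divide_right_mono) auto
      also have "\<dots> = \<beta> * m0 / (8 * H)" using r0 c_pos \<theta> H by (simp add: a_def v_def field_simps)
      finally have "H * (real n / a * v) \<le> H * (\<beta> * m0 / (8 * H))" using H by (intro mult_left_mono) auto
      then show ?thesis using H by simp
    qed
    have "m0 \<le> measure lborel Y + (H * (real n / a * v) + (\<beta> * m0 / 8 + H * (4 * real n * deep_radius n)))"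
      using GS(3) unfolding m0_def by (simp add: algebra_simps)
    then have "m0 - \<beta> * m0 / 2 \<le> measure lborel Y" using occ sm bm by linarith
    then have big: "measure lborel Y \<ge> (1 - \<beta> / 2) * total_mass \<alpha>" by (simp add: m0_def left_diff_distrib)
    define l where "l = d * (C1 * (real n * ln (real n)))"
    define R where "R = (H + \<delta> + l) / c"
    define mass where "mass = (2 * R + 1) * (2 * d) * H"
    have l0: "l \<ge> 0" using d C1 ln1 by (simp add: l_def)
    have R0: "R \<ge> 0" using H \<delta> l0 c_pos by (simp add: R_def)
    have mass0: "mass > 0" using R0 d H by (simp add: mass_def add_nonneg_pos)
    have "ennreal (\<beta> / 4 * total_mass \<alpha> / mass) \<le> covering_number (fm \<alpha>) (fl \<alpha>) k P \<epsilon> \<beta> r"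
    proof (rule covering_number_ge[OF part r0 \<epsilon>(1) mass0 GS(1,2) big])
      show "\<epsilon> < \<beta> / 4" using \<epsilon> by (simp add: \<epsilon>0_def)
      fix z assume z: "z \<in> Y"
      obtain x s where xs: "z = (x, s)" by (cases z)
      have zF: "(x, s) \<in> flow_space \<alpha> f" "f x \<le> H" "deep_orbit \<alpha> n x"
        using z GS(2) by (auto simp: xs Y_def good_set_def n_def)
      have bx: "x \<in> base_points \<alpha>" "0 \<le> x" "x < 1" using zF(1) by (auto simp: flow_space_iff base_points_def)
      obtain Z where Z: "Z \<in> sets borel" "emeasure lborel Z \<le> ennreal mass"
        "\<And>x' s'. 0 \<le> x' \<and> x' < 1 \<and> 0 \<le> s' \<and> s' \<le> H \<and> (\<exists>m::int. \<bar>real_of_int m\<bar> \<le> R \<and> \<bar>frac (x' - of_int m * \<alpha>) - x\<bar> \<le> d) \<Longrightarrow> (x', s') \<in> Z"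
        using location_set_measure[OF bx(2,3) less_imp_le[OF d] R0 less_imp_le[OF H(1)], of \<alpha>] unfolding mass_def by blast
      have "z' \<in> Z" if z': "z' \<in> Y" and names: "measure lborel {t \<in> {0..r}. atom k P (flow_map \<alpha> f t z) \<noteq> atom k P (flow_map \<alpha> f t z')} < 2 * \<epsilon> * r" for z'
      proof -
        obtain x' s' where xs': "z' = (x', s')" by (cases z')
        have z'F: "(x', s') \<in> flow_space \<alpha> f" "f x' \<le> H" using z' GS(2) by (auto simp: xs' Y_def good_set_def)
        have bx': "x' \<in> base_points \<alpha>" "0 \<le> x'" "x' < 1" "0 \<le> s'" "s' \<le> H" using z'F by (auto simp: flow_space_iff base_points_def)
        let ?T = "\<lambda>t. flow_map \<alpha> f t (x, s)" and ?T' = "\<lambda>t. flow_map \<alpha> f t (x', s')"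
        have matched: "\<bar>fst (?T t) - fst (?T' t)\<bar> < 1 / real G" "\<bar>snd (?T t) - snd (?T' t)\<bar> < \<delta>"
          if t: "t \<ge> 0" "atom k P (?T t) = atom k P (?T' t)" "?T t \<notin> V" for t
        proof -
          have F: "?T t \<in> flow_space \<alpha> f" "?T' t \<in> flow_space \<alpha> f" using flow_map_in_space[OF zF(1) t(1)] flow_map_in_space[OF z'F(1) t(1)] .
          have b: "0 \<le> fst w \<and> fst w < 1 \<and> 0 \<le> snd w" if "w \<in> flow_space \<alpha> f" for w
            using that by (cases w) (auto simp: flow_space_iff base_points_def)
          have "snd (?T t) < H'" using t(3) by (auto simp: V_def)
          then show "\<bar>fst (?T t) - fst (?T' t)\<bar> < 1 / real G" "\<bar>snd (?T t) - snd (?T' t)\<bar> < \<delta>"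
            using grid_part_close[of "?T t" "?T' t" G \<delta> H'] b[OF F(1)] b[OF F(2)] G(1) \<delta>(1) t(2) atom[OF F(1)] atom[OF F(2)] by auto
        qed
        have "\<exists>t0. 0 \<le> t0 \<and> t0 \<le> r \<and> \<bar>snd (?T t0) - snd (?T' t0)\<bar> < \<delta> \<and> \<bar>fst (?T' t0) - fst (?T t0)\<bar> \<le> d"
        proof (rule ccontr)
          assume none: "\<not> ?thesis"
          define U where "U = {t \<in> {0..r}. atom k P (?T t) \<noteq> atom k P (?T' t)} \<union> {t \<in> {0..r}. ?T t \<in> V}"
          have Ue: "{t \<in> {0..r}. atom k P (?T t) \<noteq> atom k P (?T' t)}
              = {t \<in> {0..r}. name (fl \<alpha>) k P r (x, s) t \<noteq> name (fl \<alpha>) k P r (x', s') t}"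
            using name_eq[OF part zF(1)] name_eq[OF part z'F(1)] by auto
          have U1: "{t \<in> {0..r}. atom k P (?T t) \<noteq> atom k P (?T' t)} \<in> sets borel"
            unfolding Ue by (rule words_differ(1)[OF name_in_words[OF part zF(1)] name_in_words[OF part z'F(1)] r0])
          have U2: "{t \<in> {0..r}. ?T t \<in> V} \<in> sets borel" by (rule flow_time_set[OF Vb zF(1)])
          have Ub: "U \<in> sets borel" unfolding U_def by (rule sets.Un[OF U1 U2])
          have eU: "emeasure lborel U \<le> ennreal (\<theta> * r)"
          proof -
            have "emeasure lborel {t \<in> {0..r}. atom k P (?T t) \<noteq> atom k P (?T' t)} \<le> emeasure lborel {0..r}"
              by (intro emeasure_mono) auto
            then have "emeasure lborel {t \<in> {0..r}. atom k P (?T t) \<noteq> atom k P (?T' t)} \<noteq> \<infinity>" using r0 by (auto simp: top_unique)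
            then have "emeasure lborel {t \<in> {0..r}. atom k P (?T t) \<noteq> atom k P (?T' t)}
                = ennreal (measure lborel {t \<in> {0..r}. atom k P (?T t) \<noteq> atom k P (?T' t)})"
              by (intro emeasure_eq_ennreal_measure) auto
            also have "\<dots> \<le> ennreal (2 * \<epsilon> * r)" using names by (intro ennreal_leI) (simp add: xs xs')
            also have "\<dots> \<le> ennreal (\<theta> / 2 * r)"
              using \<epsilon> r0 by (intro ennreal_leI mult_right_mono) (auto simp: \<epsilon>0_def)
            finally have 1: "emeasure lborel {t \<in> {0..r}. atom k P (?T t) \<noteq> atom k P (?T' t)} \<le> ennreal (\<theta> / 2 * r)" .
            have 2: "emeasure lborel {t \<in> {0..r}. ?T t \<in> V} \<le> ennreal (\<theta> / 2 * r)"
              using good_set_occupation[OF z[unfolded Y_def] Vb a] by (simp add: xs a_def)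
            have "emeasure lborel U \<le> emeasure lborel {t \<in> {0..r}. atom k P (?T t) \<noteq> atom k P (?T' t)} + emeasure lborel {t \<in> {0..r}. ?T t \<in> V}"
              unfolding U_def by (rule emeasure_subadditive) (use U1 U2 in simp_all)
            also have "\<dots> \<le> ennreal (\<theta> / 2 * r) + ennreal (\<theta> / 2 * r)" by (intro add_mono 1 2)
            also have "\<dots> = ennreal (\<theta> * r)" using \<theta> r0 by (simp flip: ennreal_plus)
            finally show ?thesis .
          qed
          \<comment> \<open>Times in the middle half of \<open>{0..r}\<close>, so that windows on either side fit.\<close>
          define W where "W = r / 4"
          define S where "S = {W..r - W} - U"
          have Sb: "S \<in> sets borel" unfolding S_def using Ub by (intro sets.Diff) auto
          have eS: "ennreal (r / 2) \<le> emeasure lborel S + ennreal (\<theta> * r)"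
          proof -
            have "ennreal (r / 2) = emeasure lborel {W..r - W}" using r0 by (simp add: W_def)
            also have "\<dots> \<le> emeasure lborel (S \<union> U)" using Sb Ub by (intro emeasure_mono) (auto simp: S_def)
            also have "\<dots> \<le> emeasure lborel S + emeasure lborel U" using Sb Ub by (intro emeasure_subadditive) auto
            also have "\<dots> \<le> emeasure lborel S + ennreal (\<theta> * r)" by (intro add_left_mono eU)
            finally show ?thesis .
          qed
          have "ennreal \<kappa> * emeasure lborel S \<le> 5 * emeasure lborel U"
          proof (rule vitali_fraction[OF Ub less_imp_le[OF \<kappa>(1)] _ Sb])
            fix t0 assume "t0 \<in> S"
            then have t0: "W \<le> t0" "t0 \<le> r - W" "t0 \<notin> U" by (auto simp: S_def)
            have t0r: "0 \<le> t0" "t0 \<le> r" using t0 r0 by (auto simp: W_def)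
            have nU: "atom k P (?T t0) = atom k P (?T' t0)" "?T t0 \<notin> V" using t0(3) t0r by (auto simp: U_def)
            note M = matched[OF t0r(1) nU]
            define e where "e = fst (?T' t0) - fst (?T t0)"
            have e: "\<bar>e\<bar> > d" "e \<noteq> 0" "\<bar>e\<bar> \<le> d0"
            proof -
              show 1: "\<bar>e\<bar> > d" using none M(2) t0r unfolding e_def by force
              show "e \<noteq> 0" using 1 d by auto
              show "\<bar>e\<bar> \<le> d0" using M(1) G(2) unfolding e_def by linarith
            qed
            obtain i where i: "i \<ge> n0" "\<bar>e\<bar> * (real i * ln (real i)) \<le> a2" "split_scale \<alpha> \<delta> c1 C1 i e"
              using split[OF e(2,3)] by blast
            have sci: "ln (real i) \<ge> 1" "i \<ge> 2" "H' < C1 * real i" using scale[OF i(1)] by blast+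
            have "real i * ln (real i) \<le> a2 * (r * L powr t)"
            proof -
              have "d * (real i * ln (real i)) \<le> \<bar>e\<bar> * (real i * ln (real i))" using e(1) sci by (intro mult_right_mono) auto
              then have "d * (real i * ln (real i)) \<le> a2" using i(2) by linarith
              then show ?thesis using r0 L1 by (simp add: d_def field_simps)
            qed
            then have "real i \<le> \<omega> * r" by (rule short)
            then have "C1 * real i \<le> C1 * (\<omega> * r)" using C1 by (intro mult_left_mono) auto
            then have iW: "2 * (C1 * real i) \<le> W" using C1 r0 by (simp add: \<omega>_def W_def)
            have y01: "fst (?T t0) \<in> {0..<1} - X"
            proof -
              have "?T t0 \<in> flow_space \<alpha> f" by (rule flow_map_in_space[OF zF(1) t0r(1)])
              then have "fst (?T t0) \<in> {0..<1}" by (cases "?T t0") (auto simp: flow_space_iff base_points_def)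
              moreover have "fst (?T t0) \<notin> X" using nU(2) by (auto simp: V_def mem_Times_iff)
              ultimately show ?thesis by simp
            qed
            have dr: "deep_orbit \<alpha> i (fst (?T t0)) \<or> deep_orbit \<alpha> i (rot \<alpha> (- int i) (fst (?T t0)))"
              using scale[OF i(1)] y01 by blast
            have "snd (?T t0) < C1 * real i" using nU(2) sci(3) by (auto simp: V_def)
            then obtain a1 b1 a' b' where win: "a1 \<le> t0" "t0 \<le> b1" "a1 < b1" "0 \<le> a1" "b1 \<le> r" "b1 - a1 \<le> 2 * (C1 * real i)"
                "a1 \<le> a'" "b' \<le> b1" "c * real i / 4 \<le> b' - a'"
                "\<forall>t\<in>{a'..<b'}. \<not> \<bar>snd (?T t) - snd (?T' t)\<bar> < \<delta>"
              using separation_window[OF zF(1) z'F(1) t0(1,2) i(3) \<delta>(1) C1(2) M(2) _ _ iW dr] unfolding e_def by auto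
            have cb: "cball ((a1 + b1) / 2) ((b1 - a1) / 2) = {a1..b1}"
              unfolding cball_eq_atLeastAtMost by (simp add: field_simps)
            have "{a'..<b'} \<subseteq> U \<inter> {a1..b1}"
            proof
              fix t assume t: "t \<in> {a'..<b'}"
              then have t': "0 \<le> t" "t \<le> r" "t \<in> {a1..b1}" using win by auto
              have "t \<in> U"
              proof (rule ccontr)
                assume "t \<notin> U"
                then have "atom k P (?T t) = atom k P (?T' t)" "?T t \<notin> V" using t' by (auto simp: U_def)
                from matched(2)[OF t'(1) this] show False using win(10) t by blast
              qed
              then show "t \<in> U \<inter> {a1..b1}" using t' by blast
            qed
            then have "emeasure lborel {a'..<b'} \<le> emeasure lborel (U \<inter> {a1..b1})" using Ub by (intro emeasure_mono) auto
            moreover have "a' \<le> b'" using win(9) c_pos by (smt (verit) divide_nonneg_nonneg mult_nonneg_nonneg of_nat_0_le_iff)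
            ultimately have "ennreal (b' - a') \<le> emeasure lborel (U \<inter> {a1..b1})" by simp
            moreover have "\<kappa> * (2 * ((b1 - a1) / 2)) \<le> b' - a'"
            proof -
              have "\<kappa> * (b1 - a1) \<le> c / (8 * C1) * (2 * (C1 * real i))" using \<kappa> win by (intro mult_mono) auto
              also have "\<dots> = c * real i / 4" using C1 by simp
              finally have "\<kappa> * (b1 - a1) \<le> c * real i / 4" .
              moreover have "\<kappa> * (2 * ((b1 - a1) / 2)) = \<kappa> * (b1 - a1)" by simp
              ultimately show ?thesis using win(9) by linarith
            qed
            then have "ennreal (\<kappa> * (2 * ((b1 - a1) / 2))) \<le> ennreal (b' - a')" by (rule ennreal_leI)
            ultimately have "ennreal (\<kappa> * (2 * ((b1 - a1) / 2))) \<le> emeasure lborel (U \<inter> {a1..b1})" by (rule order_trans[rotated])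
            then show "\<exists>a \<rho>. t0 \<in> cball a \<rho> \<and> 0 < \<rho> \<and> \<rho> \<le> r \<and> ennreal (\<kappa> * (2 * \<rho>)) \<le> emeasure lborel (U \<inter> cball a \<rho>)"
              using win by (intro exI[of _ "(a1 + b1) / 2"] exI[of _ "(b1 - a1) / 2"]) (auto simp: cb)
          qed
          also have "\<dots> \<le> 5 * ennreal (\<theta> * r)" by (intro mult_left_mono eU) auto
          finally have kS: "ennreal \<kappa> * emeasure lborel S \<le> 5 * ennreal (\<theta> * r)" .
          have "ennreal (\<kappa> * (r / 2)) = ennreal \<kappa> * ennreal (r / 2)" using \<kappa> r0 by (intro ennreal_mult) auto
          also have "\<dots> \<le> ennreal \<kappa> * (emeasure lborel S + ennreal (\<theta> * r))" by (intro mult_left_mono eS) auto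
          also have "\<dots> = ennreal \<kappa> * emeasure lborel S + ennreal \<kappa> * ennreal (\<theta> * r)" by (rule distrib_left)
          also have "\<dots> \<le> 5 * ennreal (\<theta> * r) + ennreal \<kappa> * ennreal (\<theta> * r)" by (intro add_right_mono kS)
          also have "\<dots> = ennreal (5 * (\<theta> * r) + \<kappa> * (\<theta> * r))"
            using \<kappa> \<theta> r0 by (simp add: ennreal_plus ennreal_mult)
          finally have "ennreal (\<kappa> * (r / 2)) \<le> ennreal (5 * (\<theta> * r) + \<kappa> * (\<theta> * r))" .
          then have "\<kappa> * (r / 2) \<le> 5 * (\<theta> * r) + \<kappa> * (\<theta> * r)"
            by (rule ennreal_le_iff[THEN iffD1, rotated]) (use \<kappa> \<theta> r0 in \<open>intro add_nonneg_nonneg mult_nonneg_nonneg; simp\<close>)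
          also have "\<dots> \<le> 5 * (\<theta> * r) + 1 * (\<theta> * r)" using \<kappa> \<theta> r0 by (intro add_left_mono mult_right_mono) auto
          also have "\<dots> = \<kappa> * r / 4" by (simp add: \<theta>_def)
          finally show False using mult_pos_pos[OF \<kappa>(1) r0] by simp
        qed
        then obtain t0 where t0: "0 \<le> t0" "t0 \<le> r" "\<bar>snd (?T t0) - snd (?T' t0)\<bar> < \<delta>" "\<bar>fst (?T' t0) - fst (?T t0)\<bar> \<le> d" by blast
        have "\<exists>m::int. c * \<bar>real_of_int m\<bar> \<le> H + \<delta> + l \<and> \<bar>frac (x' - of_int m * \<alpha>) - x\<bar> \<le> d"
        proof (rule tiny_offset_location[OF zF(1) z'F(1) zF(2) z'F(2) t0(1,2) zF(3)[unfolded n_def] elim(6) dd[unfolded n_def] _ t0(3,4)])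
          fix e :: real and j assume e: "\<bar>e\<bar> \<le> d" "j \<le> crossings r"
          have "\<bar>bsum \<alpha> f (x + e) j - bsum \<alpha> f x j\<bar> \<le> \<bar>e\<bar> * (C1 * (real n * ln (real n)))"
            by (rule bsum_close[OF est zF(3) ln1 order_trans[OF e(1) dd] e(2)[folded n_def]])
          also have "\<dots> \<le> l" unfolding l_def using e C1 ln1 by (intro mult_right_mono) auto
          finally show "\<bar>bsum \<alpha> f (x + e) j - bsum \<alpha> f x j\<bar> \<le> l" .
        qed
        then obtain m :: int where m: "c * \<bar>real_of_int m\<bar> \<le> H + \<delta> + l" "\<bar>frac (x' - of_int m * \<alpha>) - x\<bar> \<le> d" by blast
        have "\<bar>real_of_int m\<bar> \<le> R" using m(1) c_pos by (simp add: R_def le_divide_eq mult.commute)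
        then show "z' \<in> Z" unfolding xs' using bx' m(2) by (intro Z(3)) blast
      qed
      then show "\<exists>Z\<in>sets borel. emeasure lborel Z \<le> ennreal mass \<and> (\<forall>z'\<in>Y. measure lborel {t \<in> {0..r}. atom k P (flow_map \<alpha> f t z) \<noteq> atom k P (flow_map \<alpha> f t z')} < 2 * \<epsilon> * r \<longrightarrow> z' \<in> Z)"
        using Z(1,2) by blast
    qed
    moreover have "C * (r * ln r powr (2 * t - 1)) \<le> \<beta> / 4 * total_mass \<alpha> / mass"
    proof -
      define q where "q = L powr (1 - t)"
      have q1: "q \<ge> 1" unfolding q_def using L1 t by (intro ge_one_powr_ge_zero) auto
      have lq: "l \<le> 4 * C1 / c * q"
      proof -
        have "l \<le> d * (C1 * ((2 * r / c) * (2 * L)))"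
          unfolding l_def using nr lnn d C1 n0' ln1 r0 c_pos by (intro mult_left_mono mult_mono) auto
        also have "\<dots> = 4 * C1 / c * (L / L powr t)" using r0 L1 by (simp add: d_def field_simps)
        also have "L / L powr t = q" using L1 by (simp add: q_def powr_diff)
        finally show ?thesis .
      qed
      have "2 * R + 1 \<le> Bc * q"
      proof -
        have "(H + \<delta>) * 1 \<le> (H + \<delta>) * q" using q1 H \<delta> by (intro mult_left_mono) auto
        then have "H + \<delta> + l \<le> (H + \<delta> + 4 * C1 / c) * q" using lq by (simp add: distrib_right)
        then have "2 * ((H + \<delta> + l) / c) \<le> 2 * ((H + \<delta> + 4 * C1 / c) * q / c)"
          using c_pos by (intro mult_left_mono divide_right_mono) auto
        then have "2 * R + 1 \<le> 2 * ((H + \<delta> + 4 * C1 / c) * q / c) + q" using q1 by (simp add: R_def)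
        also have "\<dots> = Bc * q" by (simp add: Bc_def distrib_right)
        finally show ?thesis .
      qed
      then have "mass \<le> Bc * q * (2 * d) * H" unfolding mass_def using d H by (intro mult_right_mono) auto
      then have "\<beta> / 4 * m0 / (Bc * q * (2 * d) * H) \<le> \<beta> / 4 * m0 / mass"
        using mass0 \<beta> m0 Bc q1 d H by (intro divide_left_mono mult_pos_pos) auto
      moreover have "\<beta> / 4 * m0 / (Bc * q * (2 * d) * H) = C * (r * ln r powr (2 * t - 1))"
      proof -
        have "L powr (2 * t - 1) = L powr t / q"
          unfolding q_def using L1 by (simp add: powr_diff[symmetric])
        then have "C * (r * ln r powr (2 * t - 1)) = C * (r * L powr t / q)" by (simp add: L_def)
        also have "\<dots> = \<beta> / 4 * m0 / (Bc * q * (2 * d) * H)"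
          using r0 L1 q1 Bc H by (simp add: C_def d_def field_simps)
        finally show ?thesis ..
      qed
      ultimately show ?thesis unfolding m0_def by simp
    qed
    ultimately show ?case by (meson ennreal_leI order_trans)
  qed
  have "\<epsilon>0 > 0" using \<beta> \<theta> by (simp add: \<epsilon>0_def)
  then show ?thesis using part main C by blast
qed

end

section \<open>Slow entropy\<close>

lemma tendsto_at_right_SUP:
  fixes F :: "real \<Rightarrow> ennreal"
  assumes "\<And>x y. 0 < x \<Longrightarrow> x \<le> y \<Longrightarrow> F y \<le> F x"
  shows "(F \<longlongrightarrow> (SUP x\<in>{0<..}. F x)) (at_right 0)"
proof (rule order_tendstoI)
  fix a assume "a < (SUP x\<in>{0<..}. F x)"
  then obtain x where x: "x > 0" "a < F x" by (auto simp: less_SUP_iff)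
  then have "a < F y" if "0 < y" "y < x" for y using assms[of y x] that by (auto intro: less_le_trans)
  then show "\<forall>\<^sub>F y in at_right 0. a < F y"
    using x(1) by (auto simp: eventually_at_right_field)
next
  fix a assume a: "(SUP x\<in>{0<..}. F x) < a"
  have "F y < a" if "0 < y" for y
    using that by (intro le_less_trans[OF SUP_upper a]) auto
  then show "\<forall>\<^sub>F y in at_right 0. F y < a"
    by (auto simp: eventually_at_right_field intro: exI[of _ 1])
qed

context log_roof
begin

abbreviation "nlog_scale \<equiv> (\<lambda>n t. real n * ln (real n) powr t)"

lemma covering_number_antimono:
  assumes part: "finite_partition (fm \<alpha>) k P" and "0 < \<epsilon>" "\<epsilon> \<le> \<epsilon>'"
  shows "covering_number (fm \<alpha>) (fl \<alpha>) k P \<epsilon>' \<beta> r \<le> covering_number (fm \<alpha>) (fl \<alpha>) k P \<epsilon> \<beta> r"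
  unfolding covering_number_def
proof (rule INF_superset_mono)
  show "{C. finite C \<and> C \<subseteq> words k r \<and> \<beta> - \<epsilon> < measure (name_measure (fm \<alpha>) (fl \<alpha>) k P r) (\<Union>w\<in>C. hamming_ball k r w \<epsilon>)}
    \<subseteq> {C. finite C \<and> C \<subseteq> words k r \<and> \<beta> - \<epsilon>' < measure (name_measure (fm \<alpha>) (fl \<alpha>) k P r) (\<Union>w\<in>C. hamming_ball k r w \<epsilon>')}"
  proof safe
    fix C assume C: "finite C" "C \<subseteq> words k r"
      and m: "\<beta> - \<epsilon> < measure (name_measure (fm \<alpha>) (fl \<alpha>) k P r) (\<Union>w\<in>C. hamming_ball k r w \<epsilon>)"
    have \<epsilon>': "0 < \<epsilon>'" using assms by linarith
    note M = name_measure_balls[OF part C assms(2)] and M' = name_measure_balls[OF part C \<epsilon>']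
    have "measure lborel {z \<in> flow_space \<alpha> f. \<exists>w\<in>C. name (fl \<alpha>) k P r z \<in> hamming_ball k r w \<epsilon>}
        \<le> measure lborel {z \<in> flow_space \<alpha> f. \<exists>w\<in>C. name (fl \<alpha>) k P r z \<in> hamming_ball k r w \<epsilon>'}"
    proof (rule measure_flow_mono[OF _ _ M(1) M'(1)])
      show "{z \<in> flow_space \<alpha> f. \<exists>w\<in>C. name (fl \<alpha>) k P r z \<in> hamming_ball k r w \<epsilon>}
          \<subseteq> {z \<in> flow_space \<alpha> f. \<exists>w\<in>C. name (fl \<alpha>) k P r z \<in> hamming_ball k r w \<epsilon>'}"
        using assms(3) by (force simp: hamming_ball_def)
    qed auto
    then have "measure (name_measure (fm \<alpha>) (fl \<alpha>) k P r) (\<Union>w\<in>C. hamming_ball k r w \<epsilon>)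
        \<le> measure (name_measure (fm \<alpha>) (fl \<alpha>) k P r) (\<Union>w\<in>C. hamming_ball k r w \<epsilon>')"
      unfolding M(2) M'(2) using total_mass_pos[of \<alpha>] by (intro divide_right_mono) auto
    then show "\<beta> - \<epsilon>' < measure (name_measure (fm \<alpha>) (fl \<alpha>) k P r) (\<Union>w\<in>C. hamming_ball k r w \<epsilon>')"
      using m assms(3) by linarith
  qed
qed simp

text \<open>A smaller \<open>\<epsilon>\<close> requires more balls, so the limit is a supremum.\<close>

lemma partition_entropy_SUP:
  assumes part: "finite_partition (fm \<alpha>) k P"
  shows "partition_entropy a \<beta> (fm \<alpha>) (fl \<alpha>) k P = (SUP \<epsilon>\<in>{0<..}. partition_entropy_eps a (fm \<alpha>) (fl \<alpha>) k P \<epsilon> \<beta>)"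
  unfolding partition_entropy_def
proof (rule tendsto_Lim[OF trivial_limit_at_right_real tendsto_at_right_SUP])
  fix x y :: real assume xy: "0 < x" "x \<le> y"
  have "Liminf at_top (\<lambda>r. covering_number (fm \<alpha>) (fl \<alpha>) k P y \<beta> r / ennreal (a (nat \<lfloor>r\<rfloor>) t))
      \<le> Liminf at_top (\<lambda>r. covering_number (fm \<alpha>) (fl \<alpha>) k P x \<beta> r / ennreal (a (nat \<lfloor>r\<rfloor>) t))" for t
    by (intro Liminf_mono always_eventually allI divide_right_mono_ennreal covering_number_antimono[OF part xy])
  then show "partition_entropy_eps a (fm \<alpha>) (fl \<alpha>) k P y \<beta> \<le> partition_entropy_eps a (fm \<alpha>) (fl \<alpha>) k P x \<beta>"
    unfolding partition_entropy_eps_def by (intro Sup_subset_mono image_mono) (auto intro: less_le_trans)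
qed

lemma partition_entropy_le_1:
  assumes part: "finite_partition (fm \<alpha>) k P" and sg: "short_gaps \<alpha>" and "\<beta> \<le> 1"
  shows "partition_entropy nlog_scale \<beta> (fm \<alpha>) (fl \<alpha>) k P \<le> 1"
  unfolding partition_entropy_SUP[OF part] partition_entropy_eps_def
proof (rule SUP_least, rule Sup_least)
  fix \<epsilon> :: real and x
  assume \<epsilon>: "\<epsilon> \<in> {0<..}" and x: "x \<in> ennreal ` {t. 0 < t \<and>
    0 < Liminf at_top (\<lambda>r. covering_number (fm \<alpha>) (fl \<alpha>) k P \<epsilon> \<beta> r / ennreal (real (nat \<lfloor>r\<rfloor>) * ln (real (nat \<lfloor>r\<rfloor>)) powr t))}"
  then obtain t where t: "x = ennreal t" "t > 0"
    "0 < Liminf at_top (\<lambda>r. covering_number (fm \<alpha>) (fl \<alpha>) k P \<epsilon> \<beta> r / ennreal (real (nat \<lfloor>r\<rfloor>) * ln (real (nat \<lfloor>r\<rfloor>)) powr t))" by auto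
  have "t \<le> 1"
  proof (rule ccontr)
    assume "\<not> t \<le> 1"
    then have t1: "t > 1" by simp
    obtain C where C: "C > 0" "\<forall>\<^sub>F r in at_top. covering_number (fm \<alpha>) (fl \<alpha>) k P \<epsilon> \<beta> r \<le> ennreal (C * ((r / c + 2) * ln (r / c + 2) + 1))"
      using covering_number_upper[OF part sg _ assms(3), of \<epsilon>] \<epsilon> by auto
    define h where "h r = C * ((r / c + 2) * ln (r / c + 2) + 1) / ((r - 1) * ln (r - 1)) * ln (r - 1) powr (- (t - 1))" for r
    have "(h \<longlongrightarrow> C * inverse c * 0) at_top"
      unfolding h_def
    proof (rule tendsto_mult)
      show "((\<lambda>r. C * ((r / c + 2) * ln (r / c + 2) + 1) / ((r - 1) * ln (r - 1))) \<longlongrightarrow> C * inverse c) at_top"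
        using c_pos by real_asymp
      have "filterlim (\<lambda>r::real. ln (r - 1)) at_top at_top" by real_asymp
      then show "((\<lambda>r. ln (r - 1) powr (- (t - 1))) \<longlongrightarrow> 0) at_top"
        by (rule tendsto_neg_powr[rotated]) (use t1 in simp)
    qed
    then have h0: "((\<lambda>r. ennreal (h r)) \<longlongrightarrow> 0) at_top" using tendsto_ennrealI[of h 0] by simp
    have "\<forall>\<^sub>F r in at_top. covering_number (fm \<alpha>) (fl \<alpha>) k P \<epsilon> \<beta> r / ennreal (real (nat \<lfloor>r\<rfloor>) * ln (real (nat \<lfloor>r\<rfloor>)) powr t) \<le> ennreal (h r)"
      using C(2) eventually_ge_at_top[of 4]
    proof eventually_elim
      case (elim r)
      define q where "q = C * ((r / c + 2) * ln (r / c + 2) + 1)"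
      define N where "N = real (nat \<lfloor>r\<rfloor>)"
      have N: "r - 1 \<le> N" using elim(2) unfolding N_def by linarith
      have l: "0 < ln (r - 1)" "ln (r - 1) \<le> ln N" using N elim(2) by (auto intro!: ln_gt_zero)
      have den: "(r - 1) * ln (r - 1) powr t \<le> N * ln N powr t"
        using N l elim(2) t(2) by (intro mult_mono powr_mono2) auto
      have den0: "(r - 1) * ln (r - 1) powr t > 0" using l elim(2) by (intro mult_pos_pos) auto
      have "ln (r / c + 2) \<ge> 0" using elim(2) c_pos by (intro ln_ge_zero) (simp add: add_increasing)
      then have q0: "q \<ge> 0" unfolding q_def using C(1) c_pos elim(2) by (intro mult_nonneg_nonneg add_nonneg_nonneg) auto
      have "covering_number (fm \<alpha>) (fl \<alpha>) k P \<epsilon> \<beta> r / ennreal (N * ln N powr t) \<le> ennreal q / ennreal (N * ln N powr t)"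
        using elim(1) unfolding q_def by (rule divide_right_mono_ennreal)
      also have "\<dots> = ennreal (q / (N * ln N powr t))" using q0 den den0 by (intro divide_ennreal) auto
      also have "\<dots> \<le> ennreal (q / ((r - 1) * ln (r - 1) powr t))"
        by (intro ennreal_leI divide_left_mono[OF den q0] mult_pos_pos[OF less_le_trans[OF den0 den] den0])
      also have "q / ((r - 1) * ln (r - 1) powr t) = h r"
      proof -
        have "ln (r - 1) powr t = ln (r - 1) * ln (r - 1) powr (t - 1)" using l powr_add[of "ln (r - 1)" 1 "t - 1"] by simp
        then show ?thesis unfolding h_def q_def[symmetric] powr_minus by (simp add: divide_inverse mult_ac)
      qed
      finally show ?case by (simp add: N_def)
    qed
    then have lim: "((\<lambda>r. covering_number (fm \<alpha>) (fl \<alpha>) k P \<epsilon> \<beta> r / ennreal (real (nat \<lfloor>r\<rfloor>) * ln (real (nat \<lfloor>r\<rfloor>)) powr t)) \<longlongrightarrow> 0) at_top"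
      by (rule tendsto_sandwich[OF always_eventually[OF allI[OF zero_le]] _ tendsto_const h0])
    show False using t(3) unfolding lim_imp_Liminf[OF trivial_limit_at_top_linorder lim] by simp
  qed
  then show "x \<le> 1" unfolding t(1) by (simp add: ennreal_le_1)
qed

text \<open>The exponent \<open>s\<close> of the lower bound for the covering number is chosen with \<open>2 s - 1 = t\<close>.\<close>

lemma slow_entropy_ge:
  assumes D: "\<alpha> \<in> dioph_D" and E: "\<alpha> \<in> dioph_E" and \<beta>: "0 < \<beta>" and t: "9 / 10 < t" "t < 1"
  shows "slow_entropy nlog_scale \<beta> (fm \<alpha>) (fl \<alpha>) \<ge> ennreal t"
proof -
  define s where "s = (1 + t) / 2"
  have s: "19 / 20 < s" "s < 1" "2 * s - 1 = t" using t by (auto simp: s_def field_simps)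
  obtain k P \<epsilon>0 where \<epsilon>0: "\<epsilon>0 > 0" and part: "finite_partition (fm \<alpha>) k P" and low: "\<And>\<epsilon>. 0 < \<epsilon> \<Longrightarrow> \<epsilon> < \<epsilon>0 \<Longrightarrow>
    \<exists>C>0. \<forall>\<^sub>F r in at_top. ennreal (C * (r * ln r powr (2 * s - 1))) \<le> covering_number (fm \<alpha>) (fl \<alpha>) k P \<epsilon> \<beta> r"
    using covering_number_lower[OF D E \<beta> s(1,2)] by blast
  obtain C where C: "C > 0" "\<forall>\<^sub>F r in at_top. ennreal (C * (r * ln r powr t)) \<le> covering_number (fm \<alpha>) (fl \<alpha>) k P (\<epsilon>0 / 2) \<beta> r"
    using low[of "\<epsilon>0 / 2"] \<epsilon>0 s(3) by auto
  have "\<forall>\<^sub>F r in at_top. ennreal C \<le> covering_number (fm \<alpha>) (fl \<alpha>) k P (\<epsilon>0 / 2) \<beta> r / ennreal (real (nat \<lfloor>r\<rfloor>) * ln (real (nat \<lfloor>r\<rfloor>)) powr t)"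
    using C(2) eventually_ge_at_top[of 4]
  proof eventually_elim
    case (elim r)
    define N where "N = real (nat \<lfloor>r\<rfloor>)"
    have N: "3 \<le> N" "N \<le> r" using elim(2) unfolding N_def by linarith+
    have l: "0 < ln N" "ln N \<le> ln r" using N by (auto intro!: ln_gt_zero)
    have den0: "N * ln N powr t > 0" using l N by (intro mult_pos_pos) auto
    have "N * ln N powr t \<le> r * ln r powr t" using N l t by (intro mult_mono powr_mono2) auto
    then have "C * (N * ln N powr t) \<le> C * (r * ln r powr t)" using C by (intro mult_left_mono) auto
    then have "ennreal (C * (N * ln N powr t)) \<le> covering_number (fm \<alpha>) (fl \<alpha>) k P (\<epsilon>0 / 2) \<beta> r"
      using elim(1) by (meson ennreal_leI order_trans)
    then have "ennreal (C * (N * ln N powr t)) / ennreal (N * ln N powr t)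
        \<le> covering_number (fm \<alpha>) (fl \<alpha>) k P (\<epsilon>0 / 2) \<beta> r / ennreal (N * ln N powr t)" by (rule divide_right_mono_ennreal)
    moreover have "ennreal (C * (N * ln N powr t)) / ennreal (N * ln N powr t) = ennreal C"
      using C den0 by (subst divide_ennreal) auto
    ultimately show ?case by (simp add: N_def)
  qed
  then have low: "ennreal C \<le> Liminf at_top (\<lambda>r. covering_number (fm \<alpha>) (fl \<alpha>) k P (\<epsilon>0 / 2) \<beta> r / ennreal (real (nat \<lfloor>r\<rfloor>) * ln (real (nat \<lfloor>r\<rfloor>)) powr t))"
    by (rule Liminf_bounded)
  have "0 < Liminf at_top (\<lambda>r. covering_number (fm \<alpha>) (fl \<alpha>) k P (\<epsilon>0 / 2) \<beta> r / ennreal (real (nat \<lfloor>r\<rfloor>) * ln (real (nat \<lfloor>r\<rfloor>)) powr t))"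
    using C(1) by (intro less_le_trans[OF _ low]) simp
  then have "ennreal t \<le> partition_entropy_eps nlog_scale (fm \<alpha>) (fl \<alpha>) k P (\<epsilon>0 / 2) \<beta>"
    unfolding partition_entropy_eps_def using t by (intro Sup_upper) auto
  also have "\<dots> \<le> partition_entropy nlog_scale \<beta> (fm \<alpha>) (fl \<alpha>) k P"
    unfolding partition_entropy_SUP[OF part] using \<epsilon>0 by (intro SUP_upper) auto
  also have "\<dots> \<le> slow_entropy nlog_scale \<beta> (fm \<alpha>) (fl \<alpha>)"
    unfolding slow_entropy_def using part by (intro SUP_upper2[of "(k, P)"]) auto
  finally show ?thesis .
qed

lemma slow_entropy_eq_1:
  assumes D: "\<alpha> \<in> dioph_D" and E: "\<alpha> \<in> dioph_E" and \<beta>: "0 < \<beta>" "\<beta> \<le> 1"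
  shows "slow_entropy nlog_scale \<beta> (fm \<alpha>) (fl \<alpha>) = 1"
proof (rule antisym)
  show "slow_entropy nlog_scale \<beta> (fm \<alpha>) (fl \<alpha>) \<le> 1"
    unfolding slow_entropy_def
    using partition_entropy_le_1[OF _ short_gaps_dioph[OF D] \<beta>(2)] by (intro SUP_least) auto
  show "1 \<le> slow_entropy nlog_scale \<beta> (fm \<alpha>) (fl \<alpha>)"
  proof (rule ccontr)
    assume "\<not> ?thesis"
    then have less: "slow_entropy nlog_scale \<beta> (fm \<alpha>) (fl \<alpha>) < 1" by simp
    then obtain y where y: "0 \<le> y" "slow_entropy nlog_scale \<beta> (fm \<alpha>) (fl \<alpha>) = ennreal y"
      by (cases "slow_entropy nlog_scale \<beta> (fm \<alpha>) (fl \<alpha>)") (auto simp: top_unique)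
    have "y < 1" using less y by (simp add: ennreal_less_one_iff)
    define t where "t = max (19 / 20) ((1 + y) / 2)"
    have t: "9 / 10 < t" "t < 1" "y < t" using \<open>y < 1\<close> by (auto simp: t_def less_max_iff_disj field_simps)
    have "ennreal t \<le> ennreal y" using slow_entropy_ge[OF D E \<beta>(1) t(1,2)] y by simp
    then show False using t y by simp
  qed
qed

end

theorem theorem1p1:
  fixes \<alpha> \<beta> :: real and f :: "real \<Rightarrow> real"
  assumes "0 < \<beta>" and "\<beta> \<le> 1"
    and "\<alpha> \<in> dioph_D \<inter> dioph_E"
    and "arnold_roof f"
  shows "slow_entropy (\<lambda>n t. real n * ln (real n) powr t) \<beta>
           (flow_measure \<alpha> f) (special_flow \<alpha> f) = 1"
proof -
  obtain c K A B where "log_roof f c K A B" using arnold_roof_log_roof[OF assms(4)] by blast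
  then interpret log_roof f c K A B .
  show ?thesis using slow_entropy_eq_1 assms by blast
qed

end
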